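(* Let $d\ge1$. Let $V_0:[0,+\infty)\to[0,+\infty)$ be continuous with $V_0^{-1}(0)=\{0\}$ and $\liminf_{x\to+\infty}V_0(x)>0$. Assume that $V_0$ is flat at $0$, i.e. $V_0(x)=\mathcal{O}(|x|^n)$ near $0$ for all $n\in\mathbb{N}$, and that, for every $n\in\mathbb{N}$, the function $x\mapsto|x|^{-n}V_0(x)$ is strictly increasing for small positive $x$ (the size of the neighborhood of $0$ may depend on $n$). Let $\theta:\mathbb{S}^{d-1}\to(0,+\infty)$ be continuous and define $V:\mathbb{R}^d\to[0,+\infty)$ by $$V(x)=V_0\big(|x|\,\theta(\widehat{x})\big),\qquad \widehat{x}=\frac{x}{|x|}\in\mathbb{S}^{d-1}.$$ Let $P=-h^2\Delta+V$ on $L^2(\mathbb{R}^d)$, let $$\Omega=\{x\in\mathbb{R}^d:\ |x|<1/\theta(\widehat{x})\},$$ and, for $h>0$ small enough, let $\delta=\delta(h)\in(0,+\infty)$ be the unique solution of $\delta^2V_0(\delta)=h^2$. Then, for all $k\in\mathbb{N}^*=\{1,2,\dots\}$, in the limit $h\to0$, $$\lambda_k(P)\sim\frac{h^2}{\delta^2}\,\lambda_k(-\Delta^D_\Omega),$$ i.e. the ratio of the two sides tends to $1$ as $h\to0$, where $-\Delta_\Omega^D$ is the Dirichlet Laplacian on $\Omega$.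
   Context: The set $\mathbb{N}$ contains $0$. By convention $V(0)=V_0(0)=0$ and $0\in\Omega$, so $\Omega$ is a star-shaped bounded open set. For $d=1$, $\mathbb{S}^0=\{-1,+1\}$. The operator $P=-h^2\Delta+V$ is the non-negative self-adjoint operator on $L^2(\mathbb{R}^d)$ associated with the quadratic form $u\mapsto h^2\|\nabla u\|^2+\|V^{1/2}u\|^2$ on $\{u\in H^1(\mathbb{R}^d): V^{1/2}u\in L^2(\mathbb{R}^d)\}$; it depends on the semiclassical parameter $h>0$. For a non-negative self-adjoint operator $T$, $\lambda_k(T)$ denotes its $k$-th eigenvalue (in increasing order, counted with multiplicity), or the bottom of its essential spectrum if $T$ has fewer than $k$ eigenvalues below it (equivalently, the $k$-th max-min value of $T$). The Dirichlet Laplacian $-\Delta^D_\Omega$ is the self-adjoint operator on $L^2(\Omega)$ associated with the form $u\mapsto\|\nabla u\|^2$ on $H^1_0(\Omega)$. Under the stated hypotheses $\delta(h)$ exists and is unique for all sufficiently small $h>0$. *)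

theory Defs
  imports "HOL-Analysis.Analysis" "HOL-Library.Landau_Symbols"
begin

text \<open>Elements of the complex Hilbert space of square-integrable functions are represented by
  functions, and equality in that space is equality almost everywhere.  For \<open>S\<close> a subset of
  the Euclidean space, the values outside \<open>S\<close> are irrelevant in \<open>L2 (lebesgue_on S)\<close>.\<close>

definition L2 :: "'a measure \<Rightarrow> ('a \<Rightarrow> complex) set" where
  "L2 M = {u \<in> borel_measurable M. integrable M (\<lambda>x. (norm (u x))\<^sup>2)}"

definition l2_inner :: "'a measure \<Rightarrow> ('a \<Rightarrow> complex) \<Rightarrow> ('a \<Rightarrow> complex) \<Rightarrow> complex" where
  "l2_inner M u v = (LINT x|M. u x * cnj (v x))"

definition l2_norm :: "'a measure \<Rightarrow> ('a \<Rightarrow> complex) \<Rightarrow> real" where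
  "l2_norm M u = sqrt (LINT x|M. (norm (u x))\<^sup>2)"

definition partial :: "'a::euclidean_space \<Rightarrow> ('a \<Rightarrow> complex) \<Rightarrow> 'a \<Rightarrow> complex" where
  "partial i f x = frechet_derivative f (at x) i"

primrec Ck_fun :: "nat \<Rightarrow> ('a::euclidean_space \<Rightarrow> complex) \<Rightarrow> bool" where
  "Ck_fun 0 f \<longleftrightarrow> continuous_on UNIV f"
| "Ck_fun (Suc k) f \<longleftrightarrow> f differentiable_on UNIV \<and> (\<forall>i\<in>Basis. Ck_fun k (partial i f))"

definition test_functions :: "'a::euclidean_space set \<Rightarrow> ('a \<Rightarrow> complex) set" where
  "test_functions S = {\<phi>. (\<forall>k. Ck_fun k \<phi>) \<and>
     compact (closure {x. \<phi> x \<noteq> 0}) \<and> closure {x. \<phi> x \<noteq> 0} \<subseteq> S}"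

definition is_weak_partial ::
  "'a::euclidean_space set \<Rightarrow> 'a \<Rightarrow> ('a \<Rightarrow> complex) \<Rightarrow> ('a \<Rightarrow> complex) \<Rightarrow> bool" where
  "is_weak_partial S i u g \<longleftrightarrow> (\<forall>\<phi>\<in>test_functions S.
     (LINT x|lebesgue_on S. u x * partial i \<phi> x) = - (LINT x|lebesgue_on S. g x * \<phi> x))"

definition H1 :: "'a::euclidean_space set \<Rightarrow> ('a \<Rightarrow> complex) set" where
  "H1 S = {u \<in> L2 (lebesgue_on S). \<forall>i\<in>Basis. \<exists>g\<in>L2 (lebesgue_on S). is_weak_partial S i u g}"

text \<open>For \<open>S\<close> open, \<open>u \<in> H1 S\<close> and \<open>i \<in> Basis\<close>, this is determined up to a null set.\<close>

definition weak_partial ::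
  "'a::euclidean_space set \<Rightarrow> 'a \<Rightarrow> ('a \<Rightarrow> complex) \<Rightarrow> 'a \<Rightarrow> complex" where
  "weak_partial S i u = (SOME g. g \<in> L2 (lebesgue_on S) \<and> is_weak_partial S i u g)"

definition grad_form ::
  "'a::euclidean_space set \<Rightarrow> ('a \<Rightarrow> complex) \<Rightarrow> ('a \<Rightarrow> complex) \<Rightarrow> complex" where
  "grad_form S u v =
     (\<Sum>i\<in>Basis. l2_inner (lebesgue_on S) (weak_partial S i u) (weak_partial S i v))"

definition H1_norm :: "'a::euclidean_space set \<Rightarrow> ('a \<Rightarrow> complex) \<Rightarrow> real" where
  "H1_norm S u = sqrt ((l2_norm (lebesgue_on S) u)\<^sup>2 +
     (\<Sum>i\<in>Basis. (l2_norm (lebesgue_on S) (weak_partial S i u))\<^sup>2))"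

definition H10 :: "'a::euclidean_space set \<Rightarrow> ('a \<Rightarrow> complex) set" where
  "H10 S = {u \<in> H1 S. \<forall>\<epsilon>>0. \<exists>\<phi>\<in>test_functions S. H1_norm S (\<lambda>x. u x - \<phi> x) < \<epsilon>}"

text \<open>An operator on the space \<open>L2 M\<close> is given by its graph, a set of pairs closed under
  almost-everywhere equality in both components.\<close>

type_synonym 'a l2_op = "(('a \<Rightarrow> complex) \<times> ('a \<Rightarrow> complex)) set"

text \<open>The operator associated with the form domain \<open>Q\<close> and the sesquilinear form \<open>q\<close>
  (the polarization of the quadratic form \<open>\<lambda>u. q u u\<close>), as in the first representation theorem.\<close>

definition form_operator :: "'a measure \<Rightarrow> ('a \<Rightarrow> complex) set \<Rightarrow>
    (('a \<Rightarrow> complex) \<Rightarrow> ('a \<Rightarrow> complex) \<Rightarrow> complex) \<Rightarrow> 'a l2_op" where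
  "form_operator M Q q = {(u, f). u \<in> Q \<and> f \<in> L2 M \<and> (\<forall>v\<in>Q. q u v = l2_inner M f v)}"

text \<open>Resolvent set: \<open>T - z\<close> is onto and has a bounded inverse (the second condition contains
  injectivity).\<close>

definition op_resolvent_set :: "'a measure \<Rightarrow> 'a l2_op \<Rightarrow> complex set" where
  "op_resolvent_set M T = {z.
     (\<forall>f\<in>L2 M. \<exists>u. (u, \<lambda>x. f x + z * u x) \<in> T) \<and>
     (\<exists>C. \<forall>(u, f)\<in>T. l2_norm M u \<le> C * l2_norm M (\<lambda>x. f x - z * u x))}"

definition op_spectrum :: "'a measure \<Rightarrow> 'a l2_op \<Rightarrow> complex set" where
  "op_spectrum M T = - op_resolvent_set M T"

definition op_eigenspace :: "'a l2_op \<Rightarrow> complex \<Rightarrow> ('a \<Rightarrow> complex) set" where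
  "op_eigenspace T z = {u. (u, \<lambda>x. z * u x) \<in> T}"

text \<open>The dimension of the eigenspace modulo almost-everywhere equality; it is \<open>0\<close> exactly
  when \<open>z\<close> is not an eigenvalue.\<close>

definition op_multiplicity :: "'a measure \<Rightarrow> 'a l2_op \<Rightarrow> complex \<Rightarrow> enat" where
  "op_multiplicity M T z = Sup {enat n | n. \<exists>e :: nat \<Rightarrow> 'a \<Rightarrow> complex.
     (\<forall>i<n. e i \<in> op_eigenspace T z) \<and>
     (\<forall>c. (AE x in M. (\<Sum>i<n. c i * e i x) = 0) \<longrightarrow> (\<forall>i<n. c i = 0))}"

text \<open>The discrete spectrum consists of the isolated points of the spectrum that are eigenvalues
  of finite multiplicity.\<close>

definition op_discrete_spectrum :: "'a measure \<Rightarrow> 'a l2_op \<Rightarrow> complex set" where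
  "op_discrete_spectrum M T = {z \<in> op_spectrum M T. \<not> z islimpt op_spectrum M T \<and>
     0 < op_multiplicity M T z \<and> op_multiplicity M T z < \<infinity>}"

definition op_essential_spectrum :: "'a measure \<Rightarrow> 'a l2_op \<Rightarrow> complex set" where
  "op_essential_spectrum M T = op_spectrum M T - op_discrete_spectrum M T"

text \<open>For a self-adjoint operator the spectrum is real.  The value is \<open>\<infinity>\<close> if the essential
  spectrum is empty.\<close>

definition bottom_ess :: "'a measure \<Rightarrow> 'a l2_op \<Rightarrow> ereal" where
  "bottom_ess M T = (INF z\<in>op_essential_spectrum M T. ereal (Re z))"

text \<open>The number of eigenvalues in \<open>A\<close>, counted with multiplicity; the supremum over finite
  subsets is the (possibly infinite) sum of the multiplicities.\<close>

definition eigenvalue_count :: "'a measure \<Rightarrow> 'a l2_op \<Rightarrow> real set \<Rightarrow> enat" where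
  "eigenvalue_count M T A =
     (SUP F\<in>{F. finite F \<and> F \<subseteq> A}. \<Sum>\<mu>\<in>F. op_multiplicity M T (complex_of_real \<mu>))"

text \<open>For \<open>k \<ge> 1\<close> and \<open>T\<close> self-adjoint and non-negative: the \<open>k\<close>-th eigenvalue in increasing
  order, counted with multiplicity, if there are at least \<open>k\<close> eigenvalues below the essential
  spectrum, and the bottom of the essential spectrum otherwise.\<close>

definition lambda_k :: "'a measure \<Rightarrow> 'a l2_op \<Rightarrow> nat \<Rightarrow> ereal" where
  "lambda_k M T k =
     (if enat k \<le> eigenvalue_count M T {t. ereal t < bottom_ess M T}
      then ereal (LEAST t. enat k \<le> eigenvalue_count M T {..t})
      else bottom_ess M T)"

definition schroedinger_domain :: "('a::euclidean_space \<Rightarrow> real) \<Rightarrow> ('a \<Rightarrow> complex) set" where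
  "schroedinger_domain V =
     {u \<in> H1 UNIV. (\<lambda>x. complex_of_real (sqrt (V x)) * u x) \<in> L2 lebesgue}"

definition schroedinger_form :: "real \<Rightarrow> ('a::euclidean_space \<Rightarrow> real) \<Rightarrow>
    ('a \<Rightarrow> complex) \<Rightarrow> ('a \<Rightarrow> complex) \<Rightarrow> complex" where
  "schroedinger_form h V u v = complex_of_real (h\<^sup>2) * grad_form UNIV u v +
     l2_inner lebesgue (\<lambda>x. complex_of_real (sqrt (V x)) * u x)
                       (\<lambda>x. complex_of_real (sqrt (V x)) * v x)"

definition schroedinger_op :: "real \<Rightarrow> ('a::euclidean_space \<Rightarrow> real) \<Rightarrow> 'a l2_op" where
  "schroedinger_op h V =
     form_operator lebesgue (schroedinger_domain V) (schroedinger_form h V)"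

definition dirichlet_laplacian :: "'a::euclidean_space set \<Rightarrow> 'a l2_op" where
  "dirichlet_laplacian S = form_operator (lebesgue_on S) (H10 S) (grad_form S)"

text \<open>Here \<open>sgn x\<close> is \<open>x / |x|\<close>, and \<open>sgn 0 = 0\<close>, so \<open>potential V0 \<theta> 0 = V0 0\<close>
  whatever the value of \<open>\<theta>\<close> off the unit sphere.\<close>

definition potential :: "(real \<Rightarrow> real) \<Rightarrow> ('a::euclidean_space \<Rightarrow> real) \<Rightarrow> 'a \<Rightarrow> real" where
  "potential V0 \<theta> x = V0 (norm x * \<theta> (sgn x))"

definition star_domain :: "('a::euclidean_space \<Rightarrow> real) \<Rightarrow> 'a set" where
  "star_domain \<theta> = {x. x = 0 \<or> norm x < 1 / \<theta> (sgn x)}"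

definition delta :: "(real \<Rightarrow> real) \<Rightarrow> real \<Rightarrow> real" where
  "delta V0 h = (THE d. 0 < d \<and> d\<^sup>2 * V0 d = h\<^sup>2)"

end

theory Submission
  imports Defs "HOL-Library.Function_Algebras" "HOL-Library.Diagonal_Subsequence"
    "HOL-Computational_Algebra.Polynomial"
begin

text \<open>Put \<open>r x = |x| \<theta> (x/|x|)\<close>, so that \<open>V x = V0 (r x)\<close> and \<open>\<Omega> = {r < 1}\<close>.  The dilation by \<open>\<delta>\<close> turns
  \<open>P\<close> into \<open>V0 \<delta> = h^2/\<delta>^2\<close> times \<open>-\<Delta> + W\<close> with \<open>W x = V0 (\<delta> r x) / V0 \<delta>\<close>
  (\<open>dilated_eigenvalue\<close>).  As \<open>V0 x / x^n\<close> increases near \<open>0\<close> for every \<open>n\<close>, for small \<open>\<delta>\<close> one has \<open>W <= r^n\<close> where \<open>r < 1\<close> and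
  \<open>W >= r^n\<close> where \<open>r > 1\<close> and \<open>\<delta> r\<close> is small; hence, as \<open>h \<rightarrow> 0\<close>, \<open>W\<close> tends to \<open>0\<close> inside \<open>\<Omega>\<close> and to
  infinity outside its closure (\<open>rescaled_small\<close>, \<open>rescaled_large\<close>), and the eigenvalues of \<open>-\<Delta> + W\<close> tend to
  those of the Dirichlet Laplacian (\<open>eigenvalue_convergence\<close>).

  For this limit an eigenvalue is described variationally: it is the least \<open>t\<close> for which some \<open>k\<close>-dimensional space
  of trial functions has all its Rayleigh quotients at most \<open>t\<close> (\<open>lambda_k_least_trial\<close>).  The upper bound
  (\<open>upper_bound\<close>) takes Dirichlet eigenfunctions approximated by test functions, on whose supports \<open>W\<close> is uniformly small.
  The lower bound (\<open>limit_trial\<close>) takes orthonormal trial functions of \<open>-\<Delta> + W\<close> along a sequence: they have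
  bounded gradient energy and, as \<open>W\<close> is large far out, no mass escapes, so by a local Rellich inequality
  (\<open>local_rellich\<close>) a subsequence converges in \<open>L2\<close>.  The limits have no more energy and vanish outside \<open>{r <= 1}\<close>.
  Shrinking them slightly towards \<open>0\<close> and mollifying shows that they are in \<open>H10 \<Omega>\<close>
  (\<open>test_approximation\<close>); here the star shape of \<open>\<Omega>\<close> enters.

  The variational description of an eigenvalue defined by spectra is obtained for forms that are bounded below by \<open>c\<close> up
  to finitely many functionals (\<open>finite_rank_bound\<close>).  Minimising repeatedly below \<open>c\<close> yields finitely many orthonormal
  eigenvectors and a form bounded below by \<open>c\<close> on their orthogonal complement (\<open>eigenbasis_below\<close>);
  there the resolvent is constructed explicitly (\<open>resolvent_below\<close>).  For both operators the
  finite-rank bound is again the local Rellich inequality.  Weak compactness is avoided: a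
  minimiser of the norm over nested convex sets replaces weak limits (\<open>mazur\<close>).\<close>

text \<open>Short names that keep these facts apart from those with the same base name about the gauge integral.\<close>

lemmas Lintegral_mono = Bochner_Integration.integral_mono
lemmas Lintegrable_add = Bochner_Integration.integrable_add
lemmas Lintegral_cong = Bochner_Integration.integral_cong
lemmas Lintegral_add = Bochner_Integration.integral_add
lemmas Lintegrable_bound = Bochner_Integration.integrable_bound
lemmas Lintegral_diff = Bochner_Integration.integral_diff
lemmas Lintegrable_sum = Bochner_Integration.integrable_sum
lemmas Lintegral_sum = Bochner_Integration.integral_sum
lemmas Lintegrable_diff = Bochner_Integration.integrable_diff
lemmas Lintegral_cnj = Bochner_Integration.integral_cnj
lemmas Lintegrable_cong = Bochner_Integration.integrable_cong

abbreviation (input) converges (infix "\<leadsto>" 60) where "X \<leadsto> L \<equiv> X \<longlonglongrightarrow> L"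

abbreviation cplx where "cplx \<equiv> complex_of_real"

section \<open>Semi-inner products\<close>

text \<open>Only semi-definiteness is asked for: a function that vanishes almost everywhere has norm zero without being the zero function.\<close>

locale semi_ip = vector_space scale
  for scale :: "complex => 'v::ab_group_add => 'v" (infixr "\<odot>" 75) +
  fixes Q :: "'v set" and ip :: "'v => 'v => complex"
  assumes sub: "subspace Q"
    and ip_add: "!!u v w. u \<in> Q ==> v \<in> Q ==> w \<in> Q ==> ip (u + v) w = ip u w + ip v w"
    and ip_scale: "!!u w c. u \<in> Q ==> w \<in> Q ==> ip (c \<odot> u) w = c * ip u w"
    and ip_sym: "!!u v. u \<in> Q ==> v \<in> Q ==> ip v u = cnj (ip u v)"
    and ip_pos: "!!u. u \<in> Q ==> 0 <= Re (ip u u)"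
begin

abbreviation sq :: "'v => real" where "sq u \<equiv> Re (ip u u)"

lemma closed:
  "0 \<in> Q" "u \<in> Q ==> v \<in> Q ==> u + v \<in> Q" "u \<in> Q ==> v \<in> Q ==> u - v \<in> Q"
  "u \<in> Q ==> c \<odot> u \<in> Q" "u \<in> Q ==> - u \<in> Q"
  using sub by (auto intro: subspace_0 subspace_add subspace_diff subspace_scale subspace_neg)

lemma closed_sum: "(!!i. i \<in> A ==> f i \<in> Q) ==> (\<Sum>i\<in>A. f i) \<in> Q"
  using sub by (rule subspace_sum)

lemma ip_add2: "u \<in> Q ==> v \<in> Q ==> w \<in> Q ==> ip w (u + v) = ip w u + ip w v"
  using ip_sym[of "u + v" w] ip_sym[of u w] ip_sym[of v w] ip_add[of u v w] by (simp add: closed)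

lemma ip_scale2: "u \<in> Q ==> w \<in> Q ==> ip w (c \<odot> u) = cnj c * ip w u"
  using ip_sym[of "c \<odot> u" w] ip_sym[of u w] ip_scale[of u w c] by (simp add: closed)

lemma ip_zero: "w \<in> Q ==> ip 0 w = 0" "w \<in> Q ==> ip w 0 = 0"
  using ip_add[of 0 0 w] ip_add2[of 0 0 w] by (auto simp: closed)

lemma ip_diff: "u \<in> Q ==> v \<in> Q ==> w \<in> Q ==> ip (u - v) w = ip u w - ip v w"
  using ip_add[of "u - v" v w] by (simp add: closed)

lemma ip_diff2: "u \<in> Q ==> v \<in> Q ==> w \<in> Q ==> ip w (u - v) = ip w u - ip w v"
  using ip_add2[of "u - v" v w] by (simp add: closed)

lemma ip_sum: "(!!i. i \<in> A ==> f i \<in> Q) ==> w \<in> Q ==> ip (\<Sum>i\<in>A. f i) w = (\<Sum>i\<in>A. ip (f i) w)"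
  by (induction A rule: infinite_finite_induct) (auto simp: ip_zero ip_add closed closed_sum)

lemma ip_sum2: "(!!i. i \<in> A ==> f i \<in> Q) ==> w \<in> Q ==> ip w (\<Sum>i\<in>A. f i) = (\<Sum>i\<in>A. ip w (f i))"
  by (induction A rule: infinite_finite_induct) (auto simp: ip_zero ip_add2 closed closed_sum)

lemma ip_self: "u \<in> Q ==> ip u u = cplx (sq u)"
  using ip_sym[of u u] by (auto simp: complex_eq_iff)

lemma sq_add: "u \<in> Q ==> v \<in> Q ==> sq (u + v) = sq u + sq v + 2 * Re (ip u v)"
  using ip_sym[of u v] by (simp add: ip_add ip_add2 closed)

lemma sq_diff: "u \<in> Q ==> v \<in> Q ==> sq (u - v) = sq u + sq v - 2 * Re (ip u v)"
  using ip_sym[of u v] by (simp add: ip_diff ip_diff2 closed)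

lemma sq_diff_commute: "u \<in> Q ==> v \<in> Q ==> sq (u - v) = sq (v - u)"
  using ip_sym[of u v] by (simp add: sq_diff)

lemma sq_scale: "u \<in> Q ==> sq (c \<odot> u) = (cmod c)^2 * sq u"
proof -
  assume u: "u \<in> Q"
  have "ip (c \<odot> u) (c \<odot> u) = (c * cnj c) * ip u u"
    using u by (simp add: ip_scale ip_scale2 closed)
  also have "\<dots> = cplx ((cmod c)^2) * cplx (sq u)"
    using ip_self[OF u] complex_norm_square by metis
  finally show ?thesis by simp
qed

lemma parallelogram: "u \<in> Q ==> v \<in> Q ==> sq (u - v) + sq (u + v) = 2 * sq u + 2 * sq v"
  by (simp add: sq_add sq_diff)

lemma sq_add_le: "u \<in> Q ==> v \<in> Q ==> sq (u + v) <= 2 * sq u + 2 * sq v"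
  using parallelogram[of u v] ip_pos[of "u - v"] by (simp add: closed)

lemma Cauchy_Schwarz_sq:
  assumes u: "u \<in> Q" and v: "v \<in> Q"
  shows "(cmod (ip u v))^2 <= sq u * sq v"
proof -
  define t where "t = ip u v"
  have pos: "0 <= sq u - 2 * r * (cmod t)^2 + r^2 * (cmod t)^2 * sq v" for r :: real
  proof -
    have "cnj (cplx r * t) * t = cplx (r * (cmod t)^2)"
      using complex_norm_square[of t] by (simp add: mult.assoc mult.commute[of "cnj t"])
    hence "Re (ip u ((cplx r * t) \<odot> v)) = r * (cmod t)^2"
      using u v by (simp add: ip_scale2 t_def[symmetric] del: complex_cnj_mult)
    moreover have "sq ((cplx r * t) \<odot> v) = r^2 * (cmod t)^2 * sq v"
      using v by (simp add: sq_scale norm_mult power_mult_distrib)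
    ultimately have "sq (u - (cplx r * t) \<odot> v) = sq u + r^2 * (cmod t)^2 * sq v - 2 * (r * (cmod t)^2)"
      using u v by (simp add: sq_diff closed)
    with ip_pos[of "u - (cplx r * t) \<odot> v"] u v show ?thesis by (simp add: closed)
  qed
  show ?thesis
  proof (cases "sq v = 0")
    case True
    have "(cmod t)^2 = 0"
    proof (rule ccontr)
      assume "(cmod t)^2 \<noteq> 0"
      then have "0 < (cmod t)^2" by simp
      with pos[of "(sq u + 1) / (2 * (cmod t)^2)"] True show False by (simp add: field_simps)
    qed
    with True show ?thesis by (simp add: t_def)
  next
    case False
    with ip_pos[OF v] have "0 < sq v" by simp
    with pos[of "1 / sq v"] show ?thesis by (simp add: t_def field_simps power2_eq_square)
  qed
qed

lemma Cauchy_Schwarz: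
  assumes "u \<in> Q" "v \<in> Q" shows "cmod (ip u v) <= sqrt (sq u) * sqrt (sq v)"
  using real_le_rsqrt[OF Cauchy_Schwarz_sq[OF assms]] by (simp add: real_sqrt_mult)

lemma triangle:
  assumes "u \<in> Q" "v \<in> Q" shows "sqrt (sq (u + v)) <= sqrt (sq u) + sqrt (sq v)"
proof -
  have "sq (u + v) <= sq u + sq v + 2 * (sqrt (sq u) * sqrt (sq v))"
    using sq_add[OF assms] Cauchy_Schwarz[OF assms] complex_Re_le_cmod[of "ip u v"] by linarith
  also have "\<dots> = (sqrt (sq u) + sqrt (sq v))^2"
    using assms by (simp add: power2_sum ip_pos)
  finally show ?thesis using assms by (intro real_le_lsqrt) (auto simp: ip_pos closed)
qed

lemma triangle_sum:
  "(!!i. i \<in> A ==> f i \<in> Q) ==> sqrt (sq (\<Sum>i\<in>A. f i)) <= (\<Sum>i\<in>A. sqrt (sq (f i)))"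
proof (induction A rule: infinite_finite_induct)
  case (insert x F)
  then show ?case using triangle[of "f x" "sum f F"] by (simp add: closed_sum)
qed (auto simp: ip_zero closed)

lemma ip_null: "u \<in> Q ==> v \<in> Q ==> sq u = 0 ==> ip u v = 0"
  using Cauchy_Schwarz_sq[of u v] by simp

lemma tendsto_ip:
  assumes "!!n. w n \<in> Q" "u \<in> Q" "v \<in> Q" "(%n. sq (w n - u)) \<leadsto> 0"
  shows "(%n. ip (w n) v) \<leadsto> ip u v"
proof -
  have "(%n. sqrt (sq (w n - u)) * sqrt (sq v)) \<leadsto> sqrt 0 * sqrt (sq v)"
    by (intro tendsto_intros assms)
  hence "(%n. sqrt (sq (w n - u)) * sqrt (sq v)) \<leadsto> 0" by simp
  hence "(%n. ip (w n) v - ip u v) \<leadsto> 0"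
  proof (rule Lim_null_comparison[rotated])
    show "\<forall>\<^sub>F n in sequentially. norm (ip (w n) v - ip u v) <= sqrt (sq (w n - u)) * sqrt (sq v)"
      using assms(1-3) Cauchy_Schwarz[of "w _ - u" v] by (intro always_eventually allI) (simp add: ip_diff[symmetric] closed)
  qed
  thus ?thesis by (rule LIM_zero_cancel)
qed

lemma tendsto_sq:
  assumes "!!n. w n \<in> Q" "u \<in> Q" "(%n. sq (w n - u)) \<leadsto> 0"
  shows "(%n. sq (w n)) \<leadsto> sq u"
proof -
  have "(%n. sq (w n - u) + 2 * Re (ip (w n) u) - sq u) \<leadsto> 0 + 2 * Re (ip u u) - sq u"
    by (intro tendsto_intros tendsto_ip assms)
  moreover have "sq (w n - u) + 2 * Re (ip (w n) u) - sq u = sq (w n)" for n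
    using assms by (simp add: sq_diff)
  ultimately show ?thesis by simp
qed

text \<open>Increments that decay geometrically make a sequence Cauchy; this is how the Neumann iteration below converges.\<close>

lemma geometric_Cauchy:
  assumes w: "!!n. w n \<in> Q" and d: "!!n. sqrt (sq (w (Suc n) - w n)) <= K * r ^ n"
    and r: "0 <= r" "r < 1" and K: "0 <= K"
  shows "\<forall>e>0. \<exists>N. \<forall>m\<ge>N. \<forall>n\<ge>N. sq (w m - w n) < e"
proof -
  have tele: "sqrt (sq (w (n + j) - w n)) <= K * r ^ n / (1 - r) * (1 - r ^ j)" for n j
  proof (induction j)
    case 0 show ?case by (simp add: ip_zero closed)
  next
    case (Suc j)
    have "sqrt (sq (w (n + Suc j) - w n)) <= sqrt (sq (w (Suc (n + j)) - w (n + j))) + sqrt (sq (w (n + j) - w n))"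
      using triangle[of "w (Suc (n + j)) - w (n + j)" "w (n + j) - w n"] w by (simp add: closed)
    also have "\<dots> <= K * r ^ (n + j) + K * r ^ n / (1 - r) * (1 - r ^ j)"
      using d[of "n + j"] Suc by linarith
    also have "\<dots> = K * r ^ n / (1 - r) * (1 - r ^ Suc j)"
      using r by (simp add: power_add field_simps)
    finally show ?case .
  qed
  have bound: "sq (w m - w n) <= (K * r ^ n / (1 - r))^2" if "n <= m" for m n
  proof -
    have "sqrt (sq (w m - w n)) <= K * r ^ n / (1 - r) * (1 - r ^ (m - n))"
      using tele[of n "m - n"] that by simp
    also have "\<dots> <= K * r ^ n / (1 - r) * 1" using r K by (intro mult_left_mono) auto
    finally show ?thesis by (intro sqrt_le_D) simp
  qed
  show ?thesis
  proof (intro allI impI)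
    fix e :: real assume e: "0 < e"
    have "(%n. (K * r ^ n / (1 - r))^2) \<leadsto> (K * 0 / (1 - r))^2"
      using r by (intro tendsto_intros LIMSEQ_realpow_zero) auto
    hence "\<forall>\<^sub>F n in sequentially. (K * r ^ n / (1 - r))^2 < e"
      using e order_tendstoD(2)[of _ "(K * 0 / (1 - r))^2" sequentially e] by simp
    then obtain N where N: "!!n. n \<ge> N ==> (K * r ^ n / (1 - r))^2 < e"
      by (auto simp: eventually_sequentially)
    have "sq (w m - w n) < e" if "m \<ge> N" "n \<ge> N" for m n
    proof (cases "n <= m")
      case True thus ?thesis using bound[of n m] N[of n] that by linarith
    next
      case False thus ?thesis using bound[of m n] N[of m] that sq_diff_commute[of "w m" "w n"] w by simp
    qed
    thus "\<exists>N. \<forall>m\<ge>N. \<forall>n\<ge>N. sq (w m - w n) < e" by blast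
  qed
qed

lemma ip_orthonormal_sum:
  fixes n :: nat
  assumes e: "!!i. i < n ==> e i \<in> Q" and o: "!!i j. i < n ==> j < n ==> ip (e i) (e j) = (if i = j then 1 else 0)"
    and j: "j < n"
  shows "ip (\<Sum>i<n. c i \<odot> e i) (e j) = c j"
proof -
  have "ip (\<Sum>i<n. c i \<odot> e i) (e j) = (\<Sum>i<n. c i * ip (e i) (e j))"
    using e j by (subst ip_sum) (auto simp: closed ip_scale)
  also have "\<dots> = (\<Sum>i<n. if j = i then c i else 0)"
    using o j by (intro sum.cong) auto
  finally show ?thesis using j by (simp add: sum.delta')
qed

lemma sq_orthonormal_sum:
  fixes n :: nat
  assumes e: "!!i. i < n ==> e i \<in> Q" and o: "!!i j. i < n ==> j < n ==> ip (e i) (e j) = (if i = j then 1 else 0)"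
  shows "sq (\<Sum>i<n. c i \<odot> e i) = (\<Sum>i<n. (cmod (c i))^2)"
proof -
  let ?u = "\<Sum>i<n. c i \<odot> e i"
  have u: "?u \<in> Q" using e by (intro closed_sum closed) auto
  have "ip ?u ?u = (\<Sum>j<n. cnj (c j) * ip ?u (e j))"
    using e u by (subst ip_sum2) (auto simp: closed ip_scale2)
  also have "\<dots> = (\<Sum>j<n. cnj (c j) * c j)"
    using ip_orthonormal_sum[OF e o] by (intro sum.cong) auto
  also have "\<dots> = (\<Sum>j<n. cplx ((cmod (c j))^2))"
    by (intro sum.cong refl) (metis complex_norm_square mult.commute)
  finally show ?thesis by simp
qed

end

section \<open>Linear systems and diagonal subsequences\<close>

text \<open>More unknowns than equations; the induction eliminates one equation by means of a pivot.\<close>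

lemma homogeneous_system_nontrivial:
  fixes A :: "'i => nat => complex"
  assumes "finite I" "N < card I"
  shows "\<exists>a. (\<exists>i\<in>I. a i \<noteq> 0) & (\<forall>j<N. (\<Sum>i\<in>I. a i * A i j) = 0)"
  using assms
proof (induction N arbitrary: I A)
  case 0
  then obtain i where "i \<in> I" by fastforce
  then show ?case by (intro exI[of _ "%_. 1"]) auto
next
  case (Suc N)
  show ?case
  proof (cases "\<forall>i\<in>I. A i N = 0")
    case True
    from Suc.IH[of I A] Suc.prems obtain a
      where "\<exists>i\<in>I. a i \<noteq> 0" "\<forall>j<N. (\<Sum>i\<in>I. a i * A i j) = 0" by auto
    with True show ?thesis by (intro exI[of _ a]) (auto simp: less_Suc_eq)
  next
    case False
    then obtain p where p: "p \<in> I" "A p N \<noteq> 0" by auto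
    let ?J = "I - {p}"
    from Suc.IH[of ?J "%i j. A i j - A i N / A p N * A p j"] Suc.prems p
    have "\<exists>a. (\<exists>i\<in>?J. a i \<noteq> 0) & (\<forall>j<N. (\<Sum>i\<in>?J. a i * (A i j - A i N / A p N * A p j)) = 0)"
      by (simp add: less_diff_conv)
    then obtain a where a: "\<exists>i\<in>?J. a i \<noteq> 0"
        "\<forall>j<N. (\<Sum>i\<in>?J. a i * (A i j - A i N / A p N * A p j)) = 0" by blast
    define b where "b = a(p := - (\<Sum>i\<in>?J. a i * A i N) / A p N)"
    have split: "(\<Sum>i\<in>I. b i * A i j) = (\<Sum>i\<in>?J. a i * A i j) + b p * A p j" for j
    proof -
      have "(\<Sum>i\<in>I. b i * A i j) = b p * A p j + (\<Sum>i\<in>?J. b i * A i j)"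
        using Suc.prems p by (intro sum.remove) auto
      also have "(\<Sum>i\<in>?J. b i * A i j) = (\<Sum>i\<in>?J. a i * A i j)"
        by (intro sum.cong) (auto simp: b_def)
      finally show ?thesis by simp
    qed
    have "(\<Sum>i\<in>I. b i * A i j) = 0" if "j < Suc N" for j
    proof (cases "j = N")
      case True thus ?thesis unfolding split by (simp add: b_def p)
    next
      case False
      hence "(\<Sum>i\<in>?J. a i * (A i j - A i N / A p N * A p j)) = 0" using a that by auto
      moreover have "(\<Sum>i\<in>?J. a i * (A i j - A i N / A p N * A p j))
          = (\<Sum>i\<in>?J. a i * A i j) - (\<Sum>i\<in>?J. a i * A i N) / A p N * A p j"
        by (simp add: sum_subtractf sum_distrib_right sum_divide_distrib right_diff_distrib mult.assoc)
      ultimately show ?thesis unfolding split by (simp add: b_def)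
    qed
    moreover have "\<exists>i\<in>I. b i \<noteq> 0" using a by (auto simp: b_def)
    ultimately show ?thesis by blast
  qed
qed

lemma bounded_diagonal_subseq:
  fixes g :: "nat => nat => complex"
  assumes "!!n j. cmod (g n j) <= B j"
  shows "\<exists>r. strict_mono r & (\<forall>j. convergent (%n. g (r n) j))"
proof -
  interpret subseqs "%j s. convergent (%n. g (s n) j)"
  proof
    fix j and s :: "nat => nat" assume "strict_mono s"
    have "bounded (range (%n. g (s n) j))"
      using assms by (auto simp: bounded_iff)
    then obtain l r where "strict_mono r" "((%n. g (s n) j) \<circ> r) \<leadsto> l"
      using bounded_imp_convergent_subsequence by blast
    thus "\<exists>r'. strict_mono r' & convergent (%n. g ((s \<circ> r') n) j)"
      by (auto simp: o_def convergent_def)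
  qed
  have "convergent (%n. g (diagseq n) j)" for j
  proof -
    have "convergent (%n. g ((diagseq \<circ> (+) (Suc j)) n) j)"
    proof (rule diagseq_holds)
      fix j s r assume "strict_mono (r :: nat => nat)" "convergent (%n. g (s n) j)"
      thus "convergent (%n. g ((s \<circ> r) n) j)"
        using convergent_subseq_convergent[of "%n. g (s n) j" r] by (simp add: o_def)
    qed
    then obtain l where "(%n. g (diagseq (Suc j + n)) j) \<leadsto> l"
      by (auto simp: o_def convergent_def)
    hence "(%n. g (diagseq (n + Suc j)) j) \<leadsto> l" by (simp add: add.commute)
    hence "(%n. g (diagseq n) j) \<leadsto> l" by (rule LIMSEQ_offset)
    thus ?thesis by (auto simp: convergent_def)
  qed
  thus ?thesis using subseq_diagseq by blast
qed

section \<open>Closed forms\<close>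

locale hform = H: semi_ip scale H ip + Q: semi_ip scale Q q
  for scale :: "complex => 'v::ab_group_add => 'v" (infixr "\<odot>" 75) and H ip Q q +
  assumes QH: "Q \<subseteq> H"
    and complete: "!!w. (!!n. w n \<in> Q) ==>
      (\<forall>e>0. \<exists>N. \<forall>m\<ge>N. \<forall>n\<ge>N. Re (q (w m - w n) (w m - w n)) + Re (ip (w m - w n) (w m - w n)) < e) ==>
      \<exists>u\<in>Q. (%n. Re (q (w n - u) (w n - u)) + Re (ip (w n - u) (w n - u))) \<leadsto> 0"
begin

definition a where "a u v = q u v + ip u v"

lemma QinH: "u \<in> Q ==> u \<in> H" using QH by auto

sublocale A: semi_ip scale Q a
proof unfold_locales
  fix u v assume "u \<in> Q" "v \<in> Q"
  thus "a v u = cnj (a u v)"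
    using Q.ip_sym[of u v] H.ip_sym[of u v] QinH by (simp add: a_def)
qed (auto simp: Q.sub a_def Q.ip_add H.ip_add QinH Q.ip_scale H.ip_scale distrib_left Q.ip_pos H.ip_pos)

lemma A_sq: "A.sq u = Q.sq u + H.sq u" by (simp add: a_def)

lemma sq_le: assumes "u \<in> Q" shows "Q.sq u <= A.sq u" "H.sq u <= A.sq u"
  using assms Q.ip_pos H.ip_pos QinH by (auto simp: a_def)

lemma complete_A:
  assumes "!!n. w n \<in> Q" "\<forall>e>0. \<exists>N. \<forall>m\<ge>N. \<forall>n\<ge>N. A.sq (w m - w n) < e"
  shows "\<exists>u\<in>Q. (%n. A.sq (w n - u)) \<leadsto> 0"
  using complete[of w] assms unfolding A_sq by auto

lemma A_tendsto:
  assumes "!!n. w n \<in> Q" "u \<in> Q" "(%n. A.sq (w n - u)) \<leadsto> 0"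
  shows "(%n. H.sq (w n - u)) \<leadsto> 0" "(%n. Q.sq (w n - u)) \<leadsto> 0"
proof -
  show "(%n. H.sq (w n - u)) \<leadsto> 0"
    by (rule tendsto_sandwich[OF _ _ tendsto_const assms(3)])
       (use assms H.ip_pos QinH Q.closed sq_le in \<open>auto intro!: always_eventually\<close>)
  show "(%n. Q.sq (w n - u)) \<leadsto> 0"
    by (rule tendsto_sandwich[OF _ _ tendsto_const assms(3)])
       (use assms Q.ip_pos Q.closed sq_le in \<open>auto intro!: always_eventually\<close>)
qed

lemma A_limits:
  assumes "!!n. w n \<in> Q" "u \<in> Q" "(%n. A.sq (w n - u)) \<leadsto> 0"
  shows "v \<in> H ==> (%n. ip (w n) v) \<leadsto> ip u v" "v \<in> Q ==> (%n. q (w n) v) \<leadsto> q u v"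
    "(%n. H.sq (w n)) \<leadsto> H.sq u" "(%n. Q.sq (w n)) \<leadsto> Q.sq u"
  using A_tendsto[OF assms] assms QinH
  by (auto intro!: H.tendsto_ip Q.tendsto_ip H.tendsto_sq Q.tendsto_sq)

text \<open>Midpoints suffice, because only the parallelogram identity is ever applied.\<close>

definition midconvex :: "'v set => bool" where
  "midconvex X \<longleftrightarrow> (\<forall>u\<in>X. \<forall>v\<in>X. (1/2) \<odot> (u + v) \<in> X)"

text \<open>Almost-minimisers of the norm over a decreasing sequence of convex sets: the minima increase and are bounded by \<open>B\<close>, so
  by the parallelogram identity the almost-minimisers are Cauchy.\<close>

lemma nested_minimizers:
  assumes X: "!!N. X N \<subseteq> Q" "!!N. X (Suc N) \<subseteq> X N" "!!N. midconvex (X N)"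
    and B: "!!N. \<exists>x\<in>X N. A.sq x <= B"
  shows "\<exists>v u. (\<forall>N. v N \<in> X N) & u \<in> Q & (%N. A.sq (v N - u)) \<leadsto> 0 &
    (\<forall>N. \<forall>x\<in>X N. A.sq (v N) <= A.sq x + 1 / real (Suc N))"
proof -
  define s where "s N = Inf (A.sq ` X N)" for N
  have mono: "X n \<subseteq> X m" if "m <= n" for m n using X(2) that by (rule lift_Suc_antimono_le)
  have bdd: "bdd_below (A.sq ` X N)" for N using A.ip_pos X(1) by (intro bdd_belowI[of _ 0]) auto
  have ne: "A.sq ` X N \<noteq> {}" for N using B[of N] by auto
  have sle: "s N <= A.sq x" if "x \<in> X N" for N x
    unfolding s_def using that bdd by (intro cInf_lower) auto
  have inc: "incseq s" unfolding s_def using mono bdd ne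
    by (auto simp: incseq_def intro!: cInf_superset_mono image_mono)
  have "s N <= B" for N using B[of N] sle by force
  with inc obtain L where L: "s \<leadsto> L" using incseq_convergent[of s B] by blast
  have "\<exists>x\<in>X N. A.sq x < s N + 1 / real (Suc N)" for N
    using cInf_lessD[OF ne, of N "s N + 1 / real (Suc N)"] by (auto simp: s_def)
  then obtain v where v: "!!N. v N \<in> X N" "!!N. A.sq (v N) < s N + 1 / real (Suc N)" by metis
  have vQ: "v N \<in> Q" for N using v X by auto
  have est: "A.sq (v m - v n) <= 2 * (s n - s m) + 2 / real (Suc m) + 2 / real (Suc n)" if "m <= n" for m n
  proof -
    have "(1/2) \<odot> (v m + v n) \<in> X m"
      using X(3)[of m] v(1)[of m] v(1)[of n] mono[OF that] by (auto simp: midconvex_def)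
    from sle[OF this] have "s m <= A.sq (v m + v n) / 4"
      using vQ by (simp add: A.sq_scale A.closed power2_eq_square)
    with A.parallelogram[of "v m" "v n"] vQ v(2)[of m] v(2)[of n] show ?thesis by simp
  qed
  have "\<exists>N. \<forall>m\<ge>N. \<forall>n\<ge>N. A.sq (v m - v n) < e" if e: "e > 0" for e
  proof -
    have "(%n. 2 * (L - s n) + 2 / real (Suc n) + 2 / real (Suc n)) \<leadsto> 2 * (L - L) + 0 + 0"
      by (intro tendsto_intros L lim_const_over_n[THEN LIMSEQ_Suc])
    with e have "\<forall>\<^sub>F n in sequentially. 2 * (L - s n) + 2 / real (Suc n) + 2 / real (Suc n) < e"
      by (intro order_tendstoD(2)[where y = "2 * (L - L) + 0 + 0"]) auto
    then obtain N where N: "!!n. n \<ge> N ==> 2 * (L - s n) + 2 / real (Suc n) + 2 / real (Suc n) < e"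
      by (auto simp: eventually_sequentially)
    have *: "A.sq (v m - v n) < e" if "N <= m" "m <= n" for m n
    proof -
      have "2 / real (Suc n) <= 2 / real (Suc m)" using that by (intro divide_left_mono) auto
      moreover have "s n <= L" using inc L by (rule incseq_le)
      ultimately show ?thesis using est[OF that(2)] N[OF that(1)] by argo
    qed
    have "A.sq (v m - v n) < e" if "N <= m" "N <= n" for m n
      using *[of m n] *[of n m] that A.sq_diff_commute[of "v m" "v n"] vQ by (cases "m <= n") auto
    thus ?thesis by blast
  qed
  with complete_A[of v] vQ obtain u where u: "u \<in> Q" "(%n. A.sq (v n - u)) \<leadsto> 0" by blast
  moreover have "A.sq (v N) <= A.sq x + 1 / real (Suc N)" if "x \<in> X N" for N x
    using sle[OF that] v(2)[of N] by linarith
  ultimately show ?thesis using v(1) by blast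
qed

text \<open>Mazur's theorem together with weak compactness.  The sets of \<open>nested_minimizers\<close> are the convex hulls of the tails of \<open>w\<close>;
  a functional that converges along \<open>w\<close> is nearly constant on the tails, and so takes the limit value at \<open>u\<close>.\<close>

theorem mazur:
  assumes X: "X \<subseteq> Q" "midconvex X" and w: "!!n. w n \<in> X" "!!n. A.sq (w n) <= B"
  shows "\<exists>u\<in>Q. \<exists>v. (\<forall>N. v N \<in> X) & (%N. A.sq (v N - u)) \<leadsto> 0 &
    (\<forall>\<phi>\<in>H. \<forall>L. (%n. ip (w n) \<phi>) \<leadsto> L --> ip u \<phi> = L)"
proof -
  define Y where "Y N = \<Inter>{C. C \<subseteq> X & midconvex C & (\<forall>n\<ge>N. w n \<in> C)}" for N
  have sub: "Y N \<subseteq> C" if "C \<subseteq> X" "midconvex C" "\<forall>n\<ge>N. w n \<in> C" for N C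
    using that unfolding Y_def by blast
  have YX: "Y N \<subseteq> X" for N using sub[of X N] X w by auto
  have wY: "w N \<in> Y N" for N unfolding Y_def by auto
  have "Y (Suc N) \<subseteq> Y N" for N unfolding Y_def by (rule Inter_anti_mono) auto
  moreover have "midconvex (Y N)" for N unfolding Y_def midconvex_def by blast
  moreover have "\<exists>x\<in>Y N. A.sq x <= B" for N using wY w by blast
  ultimately obtain v u where v: "!!N. v N \<in> Y N" and u: "u \<in> Q" "(%N. A.sq (v N - u)) \<leadsto> 0"
    using nested_minimizers[of Y B] YX X by blast
  have vX: "v N \<in> X" for N using v YX by auto
  have "ip u \<phi> = L" if \<phi>: "\<phi> \<in> H" and L: "(%n. ip (w n) \<phi>) \<leadsto> L" for \<phi> L
  proof -
    have "(%n. ip (v n) \<phi>) \<leadsto> L"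
    proof (rule LIMSEQ_I)
      fix r :: real assume r: "0 < r"
      obtain N0 where N0: "!!n. n \<ge> N0 ==> norm (ip (w n) \<phi> - L) < r" using LIMSEQ_D[OF L r] by auto
      define C where "C = {x\<in>X. norm (ip x \<phi> - L) < r}"
      have "midconvex C" unfolding midconvex_def
      proof (intro ballI)
        fix x y assume xy: "x \<in> C" "y \<in> C"
        hence Hx: "x \<in> H" "y \<in> H" using X QinH by (auto simp: C_def)
        have "ip ((1/2) \<odot> (x + y)) \<phi> - L = (1/2) * (ip x \<phi> - L) + (1/2) * (ip y \<phi> - L)"
          using Hx \<phi> by (simp add: H.ip_scale H.ip_add H.closed field_simps)
        also have "norm \<dots> <= norm ((1/2) * (ip x \<phi> - L)) + norm ((1/2) * (ip y \<phi> - L))"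
          by (rule norm_triangle_ineq)
        also have "\<dots> < r" using xy by (simp add: C_def norm_mult)
        finally show "(1/2) \<odot> (x + y) \<in> C" using xy X(2) by (auto simp: C_def midconvex_def)
      qed
      hence "Y N \<subseteq> C" if "N \<ge> N0" for N using that N0 w by (intro sub) (auto simp: C_def)
      hence "norm (ip (v N) \<phi> - L) < r" if "N \<ge> N0" for N using v[of N] that by (auto simp: C_def)
      thus "\<exists>no. \<forall>n\<ge>no. norm (ip (v n) \<phi> - L) < r" by blast
    qed
    moreover have "(%n. ip (v n) \<phi>) \<leadsto> ip u \<phi>"
      using A_limits(1)[of v u \<phi>] vX X u \<phi> by auto
    ultimately show ?thesis using LIMSEQ_unique by blast
  qed
  thus ?thesis using u vX by blast
qed

text \<open>A point of least form norm on the affine hyperplane \<open>ip u f = 1\<close> is orthogonal to the directions of the hyperplane.\<close>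

theorem riesz:
  assumes f: "f \<in> H"
  shows "\<exists>u\<in>Q. \<forall>v\<in>Q. a u v = ip f v"
proof (cases "\<forall>v\<in>Q. ip v f = 0")
  case True
  hence "ip f v = 0" if "v \<in> Q" for v using H.ip_sym[of v f] that f QinH by simp
  thus ?thesis using A.closed(1) A.ip_zero by (intro bexI[of _ 0]) auto
next
  case False
  then obtain z where z: "z \<in> Q" "ip z f \<noteq> 0" by auto
  define X where "X = {u\<in>Q. ip u f = 1}"
  have "(1 / ip z f) \<odot> z \<in> X" using z f QinH by (auto simp: X_def Q.closed H.ip_scale)
  moreover have "midconvex X" using f QinH
    by (auto simp: midconvex_def X_def Q.closed H.ip_scale H.ip_add H.closed)
  ultimately have "\<exists>v u. (\<forall>N. v N \<in> X) & u \<in> Q & (%N. A.sq (v N - u)) \<leadsto> 0 &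
      (\<forall>N. \<forall>x\<in>X. A.sq (v N) <= A.sq x + 1 / real (Suc N))"
    by (intro nested_minimizers[of "%_. X" "A.sq ((1 / ip z f) \<odot> z)"]) (auto simp: X_def)
  then obtain v u where v: "\<forall>N. v N \<in> X" and u: "u \<in> Q" and lim: "(%N. A.sq (v N - u)) \<leadsto> 0"
      and le: "\<forall>N. \<forall>x\<in>X. A.sq (v N) <= A.sq x + 1 / real (Suc N)" by blast
  have vQ: "v N \<in> Q" for N using v by (auto simp: X_def)
  have "(%N. ip (v N) f) \<leadsto> ip u f" using A_limits(1)[OF _ u lim] vQ f by auto
  moreover have "(%N. ip (v N) f) = (%_. 1)" using v by (auto simp: X_def)
  ultimately have uf: "ip u f = 1" by (metis LIMSEQ_unique tendsto_const)
  have min: "A.sq u <= A.sq x" if x: "x \<in> X" for x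
  proof (rule LIMSEQ_le)
    show "(%N. A.sq (v N)) \<leadsto> A.sq u" using A.tendsto_sq[OF _ u lim] vQ by auto
    show "(%N. A.sq x + 1 / real (Suc N)) \<leadsto> A.sq x"
      using tendsto_add[OF tendsto_const[of "A.sq x"] lim_const_over_n[THEN LIMSEQ_Suc, of 1]] by simp
    show "\<exists>N. \<forall>n\<ge>N. A.sq (v n) <= A.sq x + 1 / real (Suc n)" using le x by auto
  qed
  have orth: "a u k = 0" if k: "k \<in> Q" "ip k f = 0" for k
  proof -
    have *: "A.sq u <= A.sq (u - c \<odot> k)" for c
      using k u uf f QinH by (intro min) (auto simp: X_def Q.closed H.ip_diff H.ip_scale H.closed)
    define t where "t = a u k"
    have "0 <= - 2 * r * (cmod t)^2 + r^2 * (cmod t)^2 * A.sq k" for r :: real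
    proof -
      have "cnj (cplx r * t) * t = cplx (r * (cmod t)^2)"
        using complex_norm_square[of t] by (simp add: mult.assoc mult.commute[of "cnj t"])
      hence "Re (a u ((cplx r * t) \<odot> k)) = r * (cmod t)^2"
        using u k by (simp add: A.ip_scale2 t_def[symmetric] del: complex_cnj_mult)
      moreover have "A.sq ((cplx r * t) \<odot> k) = r^2 * (cmod t)^2 * A.sq k"
        using k by (simp add: A.sq_scale norm_mult power_mult_distrib)
      ultimately show ?thesis using *[of "cplx r * t"] u k by (simp add: A.sq_diff A.closed)
    qed
    note * = this
    define r where "r = 1 / (A.sq k + 1)"
    have r: "0 < r" "r * A.sq k < 1" using A.ip_pos[OF k(1)] by (auto simp: r_def field_simps)
    have "0 <= (cmod t)^2 * (r * (r * A.sq k - 2))"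
      using *[of r] by (simp add: algebra_simps power2_eq_square)
    moreover have "r * (r * A.sq k - 2) < 0" using r by (intro mult_pos_neg) auto
    ultimately have "(cmod t)^2 <= 0" using r by (auto simp: zero_le_mult_iff)
    thus ?thesis by (simp add: t_def)
  qed
  have upos: "A.sq u \<noteq> 0"
  proof
    assume "A.sq u = 0"
    hence "H.sq u = 0" using sq_le(2)[OF u] H.ip_pos[OF QinH[OF u]] by linarith
    hence "ip u f = 0" using H.ip_null[OF QinH[OF u] f] by simp
    thus False using uf by simp
  qed
  show ?thesis
  proof (intro bexI[of _ "cplx (1 / A.sq u) \<odot> u"] ballI)
    fix x assume x: "x \<in> Q"
    have "a u (x - ip x f \<odot> u) = 0"
      using x u f uf QinH by (intro orth) (auto simp: Q.closed H.ip_diff H.ip_scale H.closed)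
    hence "a u x = cnj (ip x f) * cplx (A.sq u)"
      using x u by (simp add: A.ip_diff2 A.ip_scale2 A.closed flip: A.ip_self)
    thus "a (cplx (1 / A.sq u) \<odot> u) x = ip f x"
      using x u upos H.ip_sym[OF QinH[OF x] f] by (simp add: A.ip_scale)
  qed (use u in \<open>auto simp: Q.closed\<close>)
qed

end

section \<open>The spectrum of a form below a finite-rank perturbation\<close>

context hform
begin

text \<open>Solvability at \<open>z0\<close> extends to a disc about \<open>z0\<close> by a Neumann series, whose radius is the distance to the half-plane \<open>Re z >= c\<close>.\<close>

lemma solve_step:
  assumes c: "!!u. u \<in> Q ==> c * H.sq u <= Q.sq u"
    and z0: "Re z0 < c" "\<forall>f\<in>H. \<exists>u\<in>Q. \<forall>v\<in>Q. q u v - z0 * ip u v = ip f v"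
    and z: "cmod (z - z0) < c - Re z0"
  shows "\<forall>f\<in>H. \<exists>u\<in>Q. \<forall>v\<in>Q. q u v - z * ip u v = ip f v"
proof
  fix f assume f: "f \<in> H"
  from z0(2) obtain G where G: "!!g. g \<in> H ==> G g \<in> Q"
      "!!g v. g \<in> H ==> v \<in> Q ==> q (G g) v - z0 * ip (G g) v = ip g v" by metis
  define k where "k = z - z0"
  define w where "w = rec_nat 0 (%_ x. G (f + k \<odot> x))"
  have w0: "w 0 = 0" and wS: "!!n. w (Suc n) = G (f + k \<odot> w n)" by (auto simp: w_def)
  have wQ: "w n \<in> Q" for n by (induction n) (auto simp: w0 wS Q.closed f QinH H.closed intro!: G)
  note wH = QinH[OF wQ]
  define d where "d n = w (Suc n) - w n" for n
  have dQ: "d n \<in> Q" for n by (simp add: d_def wQ Q.closed)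
  note dH = QinH[OF dQ]
  have dq: "q (d (Suc n)) v - z0 * ip (d (Suc n)) v = k * ip (d n) v" if v: "v \<in> Q" for n v
  proof -
    have *: "q (w (Suc n)) v - z0 * ip (w (Suc n)) v = ip f v + k * ip (w n) v" for n
      using G(2)[of "f + k \<odot> w n" v] v f QinH by (simp add: wS wH H.closed H.ip_add H.ip_scale)
    show ?thesis using *[of n] *[of "Suc n"] v QinH
      by (simp add: d_def Q.ip_diff H.ip_diff wQ wH algebra_simps)
  qed
  define \<rho> where "\<rho> = cmod k / (c - Re z0)"
  have \<rho>: "0 <= \<rho>" "\<rho> < 1" using z z0(1) by (auto simp: \<rho>_def k_def)
  have est: "Q.sq (d (Suc n)) - Re z0 * H.sq (d (Suc n)) <= cmod k * (sqrt (H.sq (d n)) * sqrt (H.sq (d (Suc n))))" for n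
  proof -
    have "Re (q (d (Suc n)) (d (Suc n)) - z0 * ip (d (Suc n)) (d (Suc n))) = Re (k * ip (d n) (d (Suc n)))"
      using dq[OF dQ] by simp
    moreover have "Re (z0 * ip (d (Suc n)) (d (Suc n))) = Re z0 * H.sq (d (Suc n))"
      by (subst H.ip_self[OF dH]) simp
    moreover have "Re (k * ip (d n) (d (Suc n))) <= cmod k * cmod (ip (d n) (d (Suc n)))"
      using complex_Re_le_cmod[of "k * ip (d n) (d (Suc n))"] by (simp add: norm_mult)
    moreover have "cmod k * cmod (ip (d n) (d (Suc n))) <= cmod k * (sqrt (H.sq (d n)) * sqrt (H.sq (d (Suc n))))"
      by (intro mult_left_mono H.Cauchy_Schwarz dH) auto
    ultimately show ?thesis by (simp only: minus_complex.simps)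
  qed
  have contr: "sqrt (H.sq (d (Suc n))) <= \<rho> * sqrt (H.sq (d n))" for n
  proof (cases "H.sq (d (Suc n)) = 0")
    case True thus ?thesis using \<rho> H.ip_pos[OF dH] by simp
  next
    case False
    define y where "y = sqrt (H.sq (d (Suc n)))"
    have y: "0 < y" "H.sq (d (Suc n)) = y * y" using False H.ip_pos[OF dH, of "Suc n"] by (auto simp: y_def)
    have "(c - Re z0) * (y * y) <= cmod k * (sqrt (H.sq (d n)) * y)"
      using est[of n] c[OF dQ, of "Suc n"] unfolding y(2)[symmetric] y_def[symmetric]
      by (simp add: left_diff_distrib)
    hence "((c - Re z0) * y) * y <= (cmod k * sqrt (H.sq (d n))) * y" by (simp add: mult.assoc)
    hence "(c - Re z0) * y <= cmod k * sqrt (H.sq (d n))" using y(1) by (simp only: mult_le_cancel_right_pos)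
    thus ?thesis using z0(1) by (simp add: \<rho>_def y_def[symmetric] field_simps)
  qed
  define D where "D = sqrt (H.sq (d 0))"
  have D: "0 <= D" by (simp add: D_def H.ip_pos dH)
  have Hd: "sqrt (H.sq (d n)) <= D * \<rho> ^ n" for n
  proof (induction n)
    case (Suc n)
    have "\<rho> * sqrt (H.sq (d n)) <= \<rho> * (D * \<rho> ^ n)" using Suc \<rho> by (intro mult_left_mono) auto
    thus ?case using contr[of n] by (simp add: mult_ac)
  qed (simp add: D_def)
  define K where "K = \<bar>Re z0\<bar> + 1 + cmod k"
  have K: "K > 0" by (simp add: K_def add_pos_nonneg)
  have Ad: "sqrt (A.sq (d (Suc n))) <= sqrt K * D * \<rho> ^ n" for n
  proof -
    have 1: "sqrt (H.sq (d (Suc n))) <= D * \<rho> ^ n"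
    proof -
      have "D * \<rho> ^ Suc n <= D * \<rho> ^ n * 1" using D \<rho> by (simp add: mult_left_le_one_le mult_left_mono)
      thus ?thesis using Hd[of "Suc n"] by simp
    qed
    have nn: "0 <= H.sq (d m)" for m using H.ip_pos[OF dH] .
    have 2: "H.sq (d (Suc n)) <= (D * \<rho> ^ n)^2"
      using power_mono[OF 1, of 2] nn by simp
    have "sqrt (H.sq (d n)) * sqrt (H.sq (d (Suc n))) <= (D * \<rho> ^ n) * (D * \<rho> ^ n)"
      using 1 Hd[of n] nn D \<rho> by (intro mult_mono) auto
    hence 3: "cmod k * (sqrt (H.sq (d n)) * sqrt (H.sq (d (Suc n)))) <= cmod k * (D * \<rho> ^ n)^2"
      by (intro mult_left_mono) (auto simp: power2_eq_square)
    have "(Re z0 + 1) * H.sq (d (Suc n)) <= (\<bar>Re z0\<bar> + 1) * (D * \<rho> ^ n)^2"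
      using 2 nn by (intro mult_mono) auto
    hence "A.sq (d (Suc n)) <= K * (D * \<rho> ^ n)^2"
      using est[of n] 3 by (simp add: A_sq K_def algebra_simps)
    hence "sqrt (A.sq (d (Suc n))) <= sqrt (K * (D * \<rho> ^ n)^2)" by (rule real_sqrt_le_mono)
    also have "\<dots> = sqrt K * D * \<rho> ^ n" using D \<rho> by (simp add: real_sqrt_mult)
    finally show ?thesis .
  qed
  have "\<forall>e>0. \<exists>N. \<forall>m\<ge>N. \<forall>n\<ge>N. A.sq (w (Suc m) - w (Suc n)) < e"
    using Ad D K \<rho> by (intro A.geometric_Cauchy[where w = "%n. w (Suc n)" and K = "sqrt K * D" and r = \<rho>])
      (auto simp: wQ d_def)
  from complete_A[OF _ this] wQ obtain u where u: "u \<in> Q" "(%n. A.sq (w (Suc n) - u)) \<leadsto> 0" by auto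
  have u': "(%n. A.sq (w n - u)) \<leadsto> 0" using LIMSEQ_imp_Suc[OF u(2)] .
  show "\<exists>u\<in>Q. \<forall>v\<in>Q. q u v - z * ip u v = ip f v"
  proof (intro bexI[OF _ u(1)] ballI)
    fix v assume v: "v \<in> Q"
    have "q (w (Suc n)) v - z0 * ip (w (Suc n)) v = ip f v + k * ip (w n) v" for n
      using G(2)[of "f + k \<odot> w n" v] v f QinH by (simp add: wS wH H.closed H.ip_add H.ip_scale)
    moreover have "(%n. q (w (Suc n)) v - z0 * ip (w (Suc n)) v) \<leadsto> q u v - z0 * ip u v"
      by (intro tendsto_intros A_limits[OF _ u] wQ v QinH)
    moreover have "(%n. ip f v + k * ip (w n) v) \<leadsto> ip f v + k * ip u v"
      by (intro tendsto_intros A_limits[OF _ u(1) u'] wQ v QinH)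
    ultimately have "q u v - z0 * ip u v = ip f v + k * ip u v" using LIMSEQ_unique by auto
    thus "q u v - z * ip u v = ip f v" by (simp add: k_def algebra_simps)
  qed
qed

text \<open>Riesz' theorem solves the equation at \<open>z = -1\<close>; from there \<open>solve_step\<close> goes along a segment, on which its radius stays bounded below.\<close>

theorem coercive_solvable:
  assumes c: "!!u. u \<in> Q ==> c * H.sq u <= Q.sq u" and c0: "-1 < c" and z: "Re z < c"
  shows "\<forall>f\<in>H. \<exists>u\<in>Q. \<forall>v\<in>Q. q u v - z * ip u v = ip f v"
proof -
  define \<epsilon> where "\<epsilon> = c - max (- 1) (Re z)"
  have \<epsilon>: "0 < \<epsilon>" using c0 z by (simp add: \<epsilon>_def)
  obtain m where m: "real m > cmod (z + 1) / \<epsilon>" using reals_Archimedean2 by blast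
  have m0: "0 < real m" using m \<epsilon> by (meson divide_nonneg_pos le_less_trans norm_ge_zero)
  define y where "y j = -1 + cplx (real j / real m) * (z + 1)" for j
  have "\<forall>f\<in>H. \<exists>u\<in>Q. \<forall>v\<in>Q. q u v - y j * ip u v = ip f v" if "j <= m" for j
    using that
  proof (induction j)
    case 0
    show ?case using riesz by (simp add: y_def a_def)
  next
    case (Suc j)
    have "Re (y j) = (1 - real j / real m) * (-1) + real j / real m * Re z"
      by (simp add: y_def algebra_simps add_divide_distrib)
    also have "\<dots> <= (1 - real j / real m) * max (-1) (Re z) + real j / real m * max (-1) (Re z)"
      using Suc.prems m0 by (intro add_mono mult_left_mono) auto
    also have "\<dots> = max (-1) (Re z)" by (simp add: algebra_simps)
    finally have re: "\<epsilon> <= c - Re (y j)" by (simp add: \<epsilon>_def)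
    have "y (Suc j) - y j = cplx (1 / real m) * (z + 1)"
      by (simp add: y_def add_divide_distrib algebra_simps)
    hence "cmod (y (Suc j) - y j) = cmod (z + 1) / real m" by (simp add: norm_mult norm_divide)
    also have "\<dots> < \<epsilon>" using m m0 \<epsilon> by (simp add: field_simps)
    finally have "cmod (y (Suc j) - y j) < c - Re (y j)" using re by simp
    with Suc re \<epsilon> show ?case by (intro solve_step[OF c, of "y j" "y (Suc j)"]) auto
  qed
  from this[of m] show ?thesis using m0 by (simp add: y_def)
qed

lemma coercive_bound:
  assumes c: "c * H.sq u <= Q.sq u" and z: "Re z < c" and u: "u \<in> Q" "f \<in> H"
    and eq: "q u u - z * ip u u = ip f u"
  shows "(c - Re z) * sqrt (H.sq u) <= sqrt (H.sq f)"
proof (cases "H.sq u = 0")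
  case True thus ?thesis using u H.ip_pos by simp
next
  case False
  define y where "y = sqrt (H.sq u)"
  have y: "0 < y" "H.sq u = y * y" using False H.ip_pos[OF QinH[OF u(1)]] by (auto simp: y_def)
  have "Re (z * ip u u) = Re z * H.sq u" by (subst H.ip_self) (auto simp: u QinH)
  hence "Re (q u u - z * ip u u) = Q.sq u - Re z * H.sq u" by (simp only: minus_complex.simps)
  moreover have "Re (q u u - z * ip u u) <= sqrt (H.sq f) * y"
    unfolding eq y_def using H.Cauchy_Schwarz[of f u] complex_Re_le_cmod[of "ip f u"] u QinH by fastforce
  ultimately have "Q.sq u - Re z * H.sq u <= sqrt (H.sq f) * y" by linarith
  hence "((c - Re z) * y) * y <= sqrt (H.sq f) * y"
    using c y(2) by (simp add: algebra_simps)
  hence "(c - Re z) * y <= sqrt (H.sq f)" using y(1) by (simp only: mult_le_cancel_right_pos)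
  thus ?thesis by (simp add: y_def)
qed

text \<open>Orthogonality is taken in \<open>H\<close>; the complement is again a closed form domain.\<close>

definition orthc :: "nat => (nat => 'v) => 'v set" where
  "orthc n e = {u\<in>Q. \<forall>j<n. ip u (e j) = 0}"

text \<open>Besides the eigenvector equation this records that each \<open>l i\<close> is the minimum of the form on the complement of the earlier vectors, which orders the eigenvalues.\<close>

definition eigfam :: "nat => (nat => 'v) => (nat => real) => bool" where
  "eigfam n e l \<longleftrightarrow> (\<forall>i<n. e i \<in> Q) &
     (\<forall>i<n. \<forall>j<n. ip (e i) (e j) = (if i = j then 1 else 0)) &
     (\<forall>i<n. \<forall>v\<in>Q. q (e i) v = cplx (l i) * ip (e i) v) &
     (\<forall>j<n. \<forall>i\<le>j. l i <= l j) &
     (\<forall>i<n. \<forall>u\<in>orthc i e. l i * H.sq u <= Q.sq u)"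

lemma orthc_subspace: "\<forall>i<n. e i \<in> Q ==> H.subspace (orthc n e)"
  unfolding H.subspace_def orthc_def using QinH
  by (auto simp: Q.closed H.ip_zero H.ip_add H.ip_scale)

lemma orthc_hform:
  assumes e: "\<forall>i<n. e i \<in> Q" shows "hform scale H ip (orthc n e) q"
proof unfold_locales
  show "H.subspace (orthc n e)" by (rule orthc_subspace[OF e])
  fix w :: "nat => 'v" assume w: "!!k. w k \<in> orthc n e"
    and C: "\<forall>\<epsilon>>0. \<exists>N. \<forall>k\<ge>N. \<forall>m\<ge>N. Q.sq (w k - w m) + H.sq (w k - w m) < \<epsilon>"
  have wQ: "w k \<in> Q" for k using w by (auto simp: orthc_def)
  obtain u where u: "u \<in> Q" "(%n. A.sq (w n - u)) \<leadsto> 0"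
    using complete[OF wQ C] by (auto simp: A_sq)
  have "ip u (e j) = 0" if "j < n" for j
  proof -
    have "(%k. ip (w k) (e j)) \<leadsto> ip u (e j)"
      using e that QinH by (intro A_limits(1)[OF wQ u]) auto
    moreover have "(%k. ip (w k) (e j)) = (%_. 0)" using w that by (auto simp: orthc_def)
    ultimately show ?thesis by (metis LIMSEQ_unique tendsto_const)
  qed
  with u show "\<exists>u\<in>orthc n e. (%n. Q.sq (w n - u) + H.sq (w n - u)) \<leadsto> 0"
    by (auto simp: orthc_def A_sq intro!: bexI[of _ u])
qed (use QinH in \<open>auto simp: orthc_def Q.ip_add Q.ip_scale Q.ip_pos intro: Q.ip_sym\<close>)

definition proj :: "nat => (nat => 'v) => 'v => 'v" where
  "proj n e u = (\<Sum>i<n. ip u (e i) \<odot> e i)"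

lemma proj_orthc:
  assumes "eigfam n e l" "u \<in> Q"
  shows "proj n e u \<in> Q" "u - proj n e u \<in> orthc n e"
proof -
  have e: "i < n ==> e i \<in> Q" for i using assms by (auto simp: eigfam_def)
  have eH: "i < n ==> e i \<in> H" for i using e QinH by auto
  show 1: "proj n e u \<in> Q" unfolding proj_def by (intro Q.closed_sum Q.closed e) auto
  have "ip (u - proj n e u) (e j) = 0" if "j < n" for j
  proof -
    have "ip (proj n e u) (e j) = ip u (e j)" unfolding proj_def
      using assms eH that by (intro H.ip_orthonormal_sum) (auto simp: eigfam_def)
    thus ?thesis using 1 assms eH that QinH by (simp add: H.ip_diff)
  qed
  thus "u - proj n e u \<in> orthc n e" using 1 assms by (auto simp: orthc_def Q.closed)
qed

lemma eigfam_q_sum: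
  assumes "eigfam n e l"
  shows "Q.sq (\<Sum>i<n. c i \<odot> e i) = (\<Sum>i<n. l i * (cmod (c i))^2)"
proof -
  let ?u = "\<Sum>i<n. c i \<odot> e i"
  have e: "i < n ==> e i \<in> Q" for i using assms by (auto simp: eigfam_def)
  have eH: "i < n ==> e i \<in> H" for i using e QinH by auto
  have o: "ip (e i) (e j) = (if i = j then 1 else 0)" if "i < n" "j < n" for i j
    using assms that by (auto simp: eigfam_def)
  have u: "?u \<in> Q" by (intro Q.closed_sum Q.closed e) auto
  have c: "ip (e i) ?u = cnj (c i)" if "i < n" for i
    using H.ip_sym[of ?u "e i"] H.ip_orthonormal_sum[OF eH o, of n i c] that u QinH eH by auto
  have "q ?u ?u = (\<Sum>i<n. c i * q (e i) ?u)"
    using e u by (subst Q.ip_sum) (auto simp: Q.closed Q.ip_scale)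
  also have "\<dots> = (\<Sum>i<n. cplx (l i * (cmod (c i))^2))"
  proof (intro sum.cong refl)
    fix i assume "i \<in> {..<n}"
    hence i: "i < n" by simp
    hence "q (e i) ?u = cplx (l i) * cnj (c i)"
      using assms u c[OF i] by (simp add: eigfam_def)
    thus "c i * q (e i) ?u = cplx (l i * (cmod (c i))^2)"
      by (simp only: of_real_mult complex_norm_square) (simp add: mult_ac)
  qed
  finally show ?thesis by simp
qed

end

context hform
begin

text \<open>The substitute for compactness: below \<open>c\<close> the form can only fail to be coercive in finitely many directions.\<close>

definition finite_rank_bound :: "real => nat => (nat => 'v) => bool" where
  "finite_rank_bound c N f \<longleftrightarrow> (\<forall>j<N. f j \<in> H) &
     (\<forall>u\<in>Q. c * H.sq u <= Q.sq u + (\<Sum>j<N. (cmod (ip u (f j)))^2))"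

text \<open>With more than \<open>N\<close> vectors some combination annihilates all the \<open>f j\<close>, and on it the form is at least \<open>c\<close>.\<close>

lemma eigfam_size:
  assumes F: "finite_rank_bound c N f" and E: "eigfam n e l" and l: "\<forall>i<n. l i < c"
  shows "n <= N"
proof (rule ccontr)
  assume "\<not> n <= N"
  with homogeneous_system_nontrivial[of "{..<n}" N "%i j. ip (e i) (f j)"] obtain b
    where b: "\<exists>i<n. b i \<noteq> 0" "\<forall>j<N. (\<Sum>i<n. b i * ip (e i) (f j)) = 0" by auto
  define u where "u = (\<Sum>i<n. b i \<odot> e i)"
  have e: "i < n ==> e i \<in> Q" for i using E by (auto simp: eigfam_def)
  have eH: "i < n ==> e i \<in> H" for i using e QinH by auto
  have o: "ip (e i) (e j) = (if i = j then 1 else 0)" if "i < n" "j < n" for i j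
    using E that by (auto simp: eigfam_def)
  have u: "u \<in> Q" unfolding u_def by (intro Q.closed_sum Q.closed e) auto
  have "ip u (f j) = 0" if "j < N" for j
    unfolding u_def using b(2) that F eH
    by (subst H.ip_sum) (auto simp: H.closed H.ip_scale finite_rank_bound_def)
  hence "c * H.sq u <= Q.sq u" using F u by (fastforce simp: finite_rank_bound_def)
  moreover have "H.sq u = (\<Sum>i<n. (cmod (b i))^2)"
    unfolding u_def by (rule H.sq_orthonormal_sum[OF eH o]) auto
  moreover have "Q.sq u = (\<Sum>i<n. l i * (cmod (b i))^2)"
    unfolding u_def by (rule eigfam_q_sum[OF E])
  moreover have "(\<Sum>i<n. l i * (cmod (b i))^2) < (\<Sum>i<n. c * (cmod (b i))^2)"
  proof (rule sum_strict_mono_ex1)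
    show "\<forall>i\<in>{..<n}. l i * (cmod (b i))^2 <= c * (cmod (b i))^2"
      using l by (auto intro!: mult_right_mono simp: less_imp_le)
    show "\<exists>i\<in>{..<n}. l i * (cmod (b i))^2 < c * (cmod (b i))^2" using b(1) l by (auto intro!: bexI)
  qed simp
  ultimately show False by (simp add: sum_distrib_left)
qed

text \<open>A minimising sequence is bounded, hence the functionals of the finite-rank bound converge along a subsequence; on differences the
  bound then makes the sequence Cauchy, because the infimum is strictly below \<open>c\<close>.\<close>

lemma infimum_attained:
  assumes F: "finite_rank_bound c N f" and e: "\<forall>i<n. e i \<in> Q"
    and bad: "u0 \<in> orthc n e" "Q.sq u0 < c * H.sq u0"
  shows "\<exists>u s. u \<in> orthc n e & H.sq u = 1 & Q.sq u = s & s < c & (\<forall>v\<in>orthc n e. s * H.sq v <= Q.sq v)"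
proof -
  define R where "R = {Q.sq u | u. u \<in> orthc n e & H.sq u = 1}"
  have sub: "H.subspace (orthc n e)" by (rule orthc_subspace[OF e])
  have oQ: "u \<in> orthc n e ==> u \<in> Q" for u by (simp add: orthc_def)
  have normalise: "Q.sq u / H.sq u \<in> R" if u: "u \<in> orthc n e" and p: "0 < H.sq u" for u
  proof -
    let ?k = "cplx (1 / sqrt (H.sq u))"
    have "?k \<odot> u \<in> orthc n e" using sub u by (rule H.subspace_scale)
    moreover have "H.sq (?k \<odot> u) = 1" "Q.sq (?k \<odot> u) = Q.sq u / H.sq u"
      using p oQ[OF u] QinH by (simp_all add: H.sq_scale Q.sq_scale norm_divide power_divide)
    ultimately show ?thesis unfolding R_def by force
  qed
  have bdd: "bdd_below R" using Q.ip_pos oQ by (intro bdd_belowI[of _ 0]) (auto simp: R_def)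
  define s where "s = Inf R"
  have Hpos: "0 <= H.sq u" if "u \<in> orthc n e" for u using H.ip_pos oQ[OF that] QinH by simp
  have sle: "s * H.sq v <= Q.sq v" if v: "v \<in> orthc n e" for v
  proof (cases "H.sq v = 0")
    case True thus ?thesis using Q.ip_pos oQ[OF v] by simp
  next
    case False
    hence p: "0 < H.sq v" using Hpos[OF v] by simp
    hence "s <= Q.sq v / H.sq v" unfolding s_def using normalise[OF v p] bdd by (intro cInf_lower)
    thus ?thesis using p by (simp add: field_simps)
  qed
  have u0: "0 < H.sq u0"
  proof (rule ccontr)
    assume "\<not> 0 < H.sq u0"
    hence "H.sq u0 = 0" using Hpos[OF bad(1)] by simp
    thus False using bad(2) Q.ip_pos[OF oQ[OF bad(1)]] by simp
  qed
  have "s <= Q.sq u0 / H.sq u0" unfolding s_def using normalise[OF bad(1) u0] bdd by (intro cInf_lower)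
  also have "\<dots> < c" using bad(2) u0 by (simp add: field_simps)
  finally have sc: "s < c" .
  have "\<exists>w. w \<in> orthc n e & H.sq w = 1 & Q.sq w < s + 1 / real (Suc k)" for k
    using cInf_lessD[of R "s + 1 / real (Suc k)"] normalise[OF bad(1) u0] by (auto simp: s_def R_def)
  then obtain w where w: "!!k. w k \<in> orthc n e" "!!k. H.sq (w k) = 1" "!!k. Q.sq (w k) < s + 1 / real (Suc k)"
    by metis
  have wQ: "w k \<in> Q" for k using w oQ by auto
  have fH: "j < N ==> f j \<in> H" for j using F by (auto simp: finite_rank_bound_def)
  define g where "g k j = (if j < N then ip (w k) (f j) else 0)" for k j
  have "cmod (g k j) <= (%j. if j < N then sqrt (H.sq (f j)) else 0) j" for k j
    using H.Cauchy_Schwarz[of "w k" "f j"] wQ QinH fH w(2) by (auto simp: g_def)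
  from bounded_diagonal_subseq[of g, OF this] obtain r where r: "strict_mono r" "!!j. convergent (%k. g (r k) j)"
    by auto
  define x where "x k = w (r k)" for k
  have xo: "x k \<in> orthc n e" and xQ: "x k \<in> Q" and xH: "x k \<in> H" and x1: "H.sq (x k) = 1" for k
    using w wQ QinH by (auto simp: x_def)
  have xq: "Q.sq (x k) < s + 1 / real (Suc k)" for k
  proof -
    have "1 / real (Suc (r k)) <= 1 / real (Suc k)"
      using seq_suble[OF r(1), of k] by (intro divide_left_mono) auto
    thus ?thesis using w(3)[of "r k"] by (simp add: x_def)
  qed
  have ps: "Q.sq (x k - x m) - s * H.sq (x k - x m) <= 2 / real (Suc k) + 2 / real (Suc m)" for k m
  proof -
    have "x k + x m \<in> orthc n e" using sub xo by (simp add: H.subspace_add)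
    from sle[OF this] have "s * H.sq (x k + x m) <= Q.sq (x k + x m)" .
    moreover have "H.sq (x k + x m) = 4 - H.sq (x k - x m)"
      using H.parallelogram[of "x k" "x m"] xH x1 by simp
    moreover have "Q.sq (x k + x m) = 2 * Q.sq (x k) + 2 * Q.sq (x m) - Q.sq (x k - x m)"
      using Q.parallelogram[of "x k" "x m"] xQ by simp
    ultimately show ?thesis using xq[of k] xq[of m] by (simp add: algebra_simps)
  qed
  define G where "G k m = (\<Sum>j<N. (cmod (ip (x k - x m) (f j)))^2)" for k m
  have A_le: "(c - s) * A.sq (x k - x m) <= (c + 1) * (2 / real (Suc k) + 2 / real (Suc m)) + (\<bar>s\<bar> + 1) * G k m" for k m
  proof -
    define y p h t where "y = x k - x m" and "p = Q.sq y - s * H.sq y" and "h = H.sq y"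
      and "t = 2 / real (Suc k) + 2 / real (Suc m)"
    have "y \<in> Q" by (simp add: y_def xQ Q.closed)
    hence 1: "c * h <= Q.sq y + G k m" using F unfolding finite_rank_bound_def h_def G_def y_def by blast
    have 2: "p <= t" using ps[of k m] by (simp add: p_def y_def t_def)
    have s0: "0 <= s" unfolding s_def using normalise[OF bad(1) u0] Q.ip_pos oQ
      by (intro cInf_greatest) (auto simp: R_def)
    have 3: "(c - s) * h <= p + G k m" using 1 by (simp add: p_def h_def algebra_simps)
    have "(c - s) * A.sq y = (c - s) * p + (s + 1) * ((c - s) * h)"
      by (simp add: A_sq p_def h_def algebra_simps)
    also have "\<dots> <= (c - s) * p + (s + 1) * (p + G k m)"
      using 3 s0 by (intro add_left_mono mult_left_mono) auto
    also have "\<dots> = (c + 1) * p + (s + 1) * G k m" by (simp add: algebra_simps)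
    also have "\<dots> <= (c + 1) * t + (s + 1) * G k m"
      using 2 s0 sc by (intro add_right_mono mult_left_mono) auto
    finally show ?thesis using s0 by (simp add: y_def t_def)
  qed
  have "\<exists>M. \<forall>k\<ge>M. \<forall>m\<ge>M. A.sq (x k - x m) < \<epsilon>" if \<epsilon>: "0 < \<epsilon>" for \<epsilon>
  proof -
    define \<beta> where "\<beta> k = (c + 1) * (4 / real (Suc k)) + (\<bar>s\<bar> + 1) * (\<Sum>j<N. (2 * cmod (ip (x k) (f j) - lim (%k. g (r k) j)))^2 )" for k
    have cv: "(%k. ip (x k) (f j)) \<leadsto> lim (%k. g (r k) j)" if "j < N" for j
      using r(2)[of j] that unfolding convergent_LIMSEQ_iff by (simp add: g_def x_def)
    have "(%k. (c + 1) * (4 * (1 / real (Suc k))) + (\<bar>s\<bar> + 1) * (\<Sum>j<N. (2 * cmod (ip (x k) (f j) - lim (%k. g (r k) j)))^2 ))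
       \<leadsto> (c + 1) * (4 * 0) + (\<bar>s\<bar> + 1) * (\<Sum>j<N. (2 * cmod (lim (%k. g (r k) j) - lim (%k. g (r k) j)))^2)"
      by (intro tendsto_intros cv lim_const_over_n[THEN LIMSEQ_Suc]) auto
    hence "\<beta> \<leadsto> 0" by (simp add: \<beta>_def[abs_def])
    moreover have "0 < (c - s) * \<epsilon>" using sc \<epsilon> by simp
    ultimately have "\<forall>\<^sub>F k in sequentially. \<beta> k < (c - s) * \<epsilon>" by (rule order_tendstoD(2))
    then obtain M where M: "!!k. k \<ge> M ==> \<beta> k < (c - s) * \<epsilon>" by (auto simp: eventually_sequentially)
    have "A.sq (x k - x m) < \<epsilon>" if km: "k \<ge> M" "m \<ge> M" for k m
    proof -
      have "G k m <= (\<Sum>j<N. ((2 * cmod (ip (x k) (f j) - lim (%k. g (r k) j)))^2 + (2 * cmod (ip (x m) (f j) - lim (%k. g (r k) j)))^2) / 2)"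
        unfolding G_def
      proof (intro sum_mono)
        fix j assume j: "j \<in> {..<N}"
        define p1 p2 where "p1 = ip (x k) (f j) - lim (%k. g (r k) j)" and "p2 = ip (x m) (f j) - lim (%k. g (r k) j)"
        have "ip (x k - x m) (f j) = p1 - p2"
          using xH fH j by (simp add: H.ip_diff p1_def p2_def)
        hence "cmod (ip (x k - x m) (f j)) <= cmod p1 + cmod p2" using norm_triangle_ineq4 by metis
        hence "(cmod (ip (x k - x m) (f j)))^2 <= (cmod p1 + cmod p2)^2" by (rule power_mono) simp
        also have "\<dots> <= ((2 * cmod p1)^2 + (2 * cmod p2)^2) / 2"
          using sum_squares_ge_zero[of "cmod p1 - cmod p2" 0] by (simp add: power2_eq_square algebra_simps)
        finally show "(cmod (ip (x k - x m) (f j)))^2 <= ((2 * cmod (ip (x k) (f j) - lim (%k. g (r k) j)))^2 + (2 * cmod (ip (x m) (f j) - lim (%k. g (r k) j)))^2) / 2"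
          by (simp add: p1_def p2_def)
      qed
      hence "G k m <= ((\<Sum>j<N. (2 * cmod (ip (x k) (f j) - lim (%k. g (r k) j)))^2) + (\<Sum>j<N. (2 * cmod (ip (x m) (f j) - lim (%k. g (r k) j)))^2)) / 2"
        by (simp add: sum.distrib sum_divide_distrib[symmetric])
      hence "(\<bar>s\<bar> + 1) * G k m <= (\<bar>s\<bar> + 1) * (((\<Sum>j<N. (2 * cmod (ip (x k) (f j) - lim (%k. g (r k) j)))^2) + (\<Sum>j<N. (2 * cmod (ip (x m) (f j) - lim (%k. g (r k) j)))^2)) / 2)"
        by (intro mult_left_mono) auto
      moreover have "(\<beta> k + \<beta> m) / 2 = (c + 1) * (2 / real (Suc k) + 2 / real (Suc m)) + (\<bar>s\<bar> + 1) * (((\<Sum>j<N. (2 * cmod (ip (x k) (f j) - lim (%k. g (r k) j)))^2) + (\<Sum>j<N. (2 * cmod (ip (x m) (f j) - lim (%k. g (r k) j)))^2)) / 2)"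
      proof -
        have id: "(a * (4 / p) + b * S1 + (a * (4 / t) + b * S2)) / 2 = a * (2 / p + 2 / t) + b * ((S1 + S2) / 2)"
          for a b p t S1 S2 :: real by (simp add: algebra_simps add_divide_distrib)
        show ?thesis unfolding \<beta>_def by (rule id)
      qed
      ultimately have "(c - s) * A.sq (x k - x m) <= (\<beta> k + \<beta> m) / 2"
        using A_le[of k m] by linarith
      also have "\<dots> < (c - s) * \<epsilon>" using M[OF km(1)] M[OF km(2)] by simp
      finally show ?thesis using sc by simp
    qed
    thus ?thesis by blast
  qed
  hence "\<exists>u\<in>Q. (%k. A.sq (x k - u)) \<leadsto> 0" by (intro complete_A[OF xQ] allI impI)
  then obtain u where u: "u \<in> Q" "(%k. A.sq (x k - u)) \<leadsto> 0" by (elim bexE)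
  have "ip u (e j) = 0" if "j < n" for j
  proof -
    have "(%k. ip (x k) (e j)) \<leadsto> ip u (e j)"
      using e that QinH by (intro A_limits(1)[OF xQ u]) auto
    moreover have "(%k. ip (x k) (e j)) = (%_. 0)" using xo that by (auto simp: orthc_def)
    ultimately show ?thesis by (metis LIMSEQ_unique tendsto_const)
  qed
  hence uo: "u \<in> orthc n e" using u by (simp add: orthc_def)
  have "(%k. H.sq (x k)) \<leadsto> H.sq u" by (rule A_limits(3)[OF xQ u])
  hence u1: "H.sq u = 1" using x1 LIMSEQ_unique[OF tendsto_const] by fastforce
  have "Q.sq u <= s"
  proof (rule LIMSEQ_le)
    show "(%k. Q.sq (x k)) \<leadsto> Q.sq u" by (rule A_limits(4)[OF xQ u])
    show "(%k. s + 1 / real (Suc k)) \<leadsto> s"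
      using tendsto_add[OF tendsto_const[of s] lim_const_over_n[THEN LIMSEQ_Suc, of 1]] by simp
    show "\<exists>M. \<forall>k\<ge>M. Q.sq (x k) <= s + 1 / real (Suc k)" using xq by (auto simp: less_imp_le)
  qed
  moreover have "s <= Q.sq u" using sle[OF uo] u1 by simp
  ultimately have "Q.sq u = s" by linarith
  hence "u \<in> orthc n e & H.sq u = 1 & Q.sq u = s & s < c & (\<forall>v\<in>orthc n e. s * H.sq v <= Q.sq v)"
    using uo u1 sc sle by (intro conjI ballI)
  thus ?thesis by (intro exI[of _ u] exI[of _ s])
qed

lemma eigfam_extend:
  assumes F: "finite_rank_bound c N f" and E: "eigfam n e l" and l: "\<forall>i<n. l i < c"
    and bad: "u0 \<in> orthc n e" "Q.sq u0 < c * H.sq u0"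
  shows "\<exists>e' l'. eigfam (Suc n) e' l' & (\<forall>i<Suc n. l' i < c)"
proof -
  have e: "\<forall>i<n. e i \<in> Q" using E by (auto simp: eigfam_def)
  from infimum_attained[OF F e bad] obtain u s where u: "u \<in> orthc n e" "H.sq u = 1" "Q.sq u = s" "s < c"
    and min: "!!v. v \<in> orthc n e ==> s * H.sq v <= Q.sq v" by blast
  have uQ: "u \<in> Q" using u by (simp add: orthc_def)
  have oQ: "v \<in> orthc n e ==> v \<in> Q" for v by (simp add: orthc_def)
  interpret S: semi_ip scale "orthc n e" "%v w. q v w - cplx s * ip v w"
  proof
    show "H.subspace (orthc n e)" by (rule orthc_subspace[OF e])
    fix v w assume "v \<in> orthc n e" "w \<in> orthc n e"
    thus "q w v - cplx s * ip w v = cnj (q v w - cplx s * ip v w)"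
      using Q.ip_sym[of v w] H.ip_sym[of v w] oQ QinH by simp
  qed (use oQ QinH min in \<open>auto simp: Q.ip_add H.ip_add Q.ip_scale H.ip_scale algebra_simps\<close>)
  have ev: "q u v = cplx s * ip u v" if v: "v \<in> Q" for v
  proof -
    have 1: "q u w - cplx s * ip u w = 0" if w: "w \<in> orthc n e" for w
      using S.ip_null[OF u(1) w] u by simp
    have 2: "q u (e i) = 0" if i: "i < n" for i
    proof -
      have "q (e i) u = cplx (l i) * ip (e i) u" using E i uQ by (auto simp: eigfam_def)
      also have "ip (e i) u = 0" using u(1) H.ip_sym[of u "e i"] i e uQ QinH by (simp add: orthc_def)
      finally show ?thesis using Q.ip_sym[of "e i" u] i e uQ by simp
    qed
    have 3: "ip u (e i) = 0" if "i < n" for i using u(1) that by (simp add: orthc_def)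
    have "q u (proj n e v) = (\<Sum>i<n. q u (ip v (e i) \<odot> e i))"
      unfolding proj_def using e uQ by (intro Q.ip_sum2) (auto simp: Q.closed)
    moreover have "\<dots> = 0" using e uQ 2 by (intro sum.neutral) (auto simp: Q.ip_scale2)
    moreover have "ip u (proj n e v) = (\<Sum>i<n. ip u (ip v (e i) \<odot> e i))"
      unfolding proj_def using e uQ QinH by (intro H.ip_sum2) (auto simp: H.closed)
    moreover have "\<dots> = 0" using e uQ QinH 3 by (intro sum.neutral) (auto simp: H.ip_scale2)
    moreover have "q u v = q u (v - proj n e v) + q u (proj n e v)"
      "ip u v = ip u (v - proj n e v) + ip u (proj n e v)"
      using proj_orthc[OF E v] uQ v QinH oQ by (simp_all add: Q.ip_diff2 H.ip_diff2)
    ultimately show ?thesis using 1[OF proj_orthc(2)[OF E v]] by simp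
  qed
  have orthcong: "orthc i (e(n := u)) = orthc i e" if "i <= n" for i
    using that by (auto simp: orthc_def)
  have ui: "ip u (e i) = 0" "ip (e i) u = 0" if "i < n" for i
    using u(1) H.ip_sym[of u "e i"] that e uQ QinH by (auto simp: orthc_def)
  have ls: "l i <= s" if i: "i < n" for i
  proof -
    have "u \<in> orthc i e" using u(1) i by (simp add: orthc_def)
    hence "l i * H.sq u <= Q.sq u" using E i by (auto simp: eigfam_def)
    thus ?thesis using u by simp
  qed
  have uu: "ip u u = 1" using H.ip_self[OF QinH[OF uQ]] u by simp
  have "eigfam (Suc n) (e(n := u)) (l(n := s))"
    unfolding eigfam_def
  proof (intro conjI)
    show "\<forall>i<Suc n. (e(n := u)) i \<in> Q" using e uQ by auto
    show "\<forall>i<Suc n. \<forall>j<Suc n. ip ((e(n := u)) i) ((e(n := u)) j) = (if i = j then 1 else 0)"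
      using E ui uu by (auto simp: eigfam_def less_Suc_eq)
    show "\<forall>i<Suc n. \<forall>v\<in>Q. q ((e(n := u)) i) v = cplx ((l(n := s)) i) * ip ((e(n := u)) i) v"
      using E ev by (auto simp: eigfam_def less_Suc_eq)
    show "\<forall>j<Suc n. \<forall>i\<le>j. (l(n := s)) i <= (l(n := s)) j"
      using E ls by (auto simp: eigfam_def less_Suc_eq le_less)
    show "\<forall>i<Suc n. \<forall>v\<in>orthc i (e(n := u)). (l(n := s)) i * H.sq v <= Q.sq v"
      using E min orthcong by (auto simp: eigfam_def less_Suc_eq)
  qed
  moreover have "\<forall>i<Suc n. (l(n := s)) i < c" using l u by (auto simp: less_Suc_eq)
  ultimately show ?thesis by blast
qed

text \<open>Extending the family as long as some vector of the complement is below \<open>c\<close> must stop, by \<open>eigfam_size\<close>.\<close>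

theorem eigenbasis_below:
  assumes F: "finite_rank_bound c N f"
  shows "\<exists>n e l. eigfam n e l & (\<forall>i<n. l i < c) & (\<forall>u\<in>orthc n e. c * H.sq u <= Q.sq u)"
proof -
  define P where "P n \<longleftrightarrow> (\<exists>e l. eigfam n e l & (\<forall>i<n. l i < c))" for n
  have "P 0" by (auto simp: P_def eigfam_def)
  moreover have bd: "\<forall>n. P n --> n <= N" using eigfam_size[OF F] by (auto simp: P_def)
  ultimately have "P (Greatest P)" using GreatestI_nat by blast
  then obtain e l where E: "eigfam (Greatest P) e l" "\<forall>i<Greatest P. l i < c" by (auto simp: P_def)
  have "c * H.sq u <= Q.sq u" if "u \<in> orthc (Greatest P) e" for u
  proof (rule ccontr)
    assume "\<not> c * H.sq u <= Q.sq u"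
    with eigfam_extend[OF F E that] have "P (Suc (Greatest P))" by (auto simp: P_def)
    hence "Suc (Greatest P) <= Greatest P" using bd by (intro Greatest_le_nat) auto
    thus False by simp
  qed
  thus ?thesis using E by blast
qed

lemma eigfam_sum_orthc:
  assumes E: "eigfam n e l" and x: "x \<in> orthc n e"
  shows "ip (\<Sum>i<n. b i \<odot> e i) x = 0" "q (\<Sum>i<n. b i \<odot> e i) x = 0"
proof -
  have xQ: "x \<in> Q" using x by (simp add: orthc_def)
  have e: "e i \<in> Q" "e i \<in> H" if "i < n" for i using E that QinH by (auto simp: eigfam_def)
  have 1: "ip (e i) x = 0" if i: "i < n" for i
    using x i H.ip_sym[of x "e i"] e[OF i] QinH[OF xQ] by (simp add: orthc_def)
  have 2: "q (e i) x = 0" if i: "i < n" for i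
    using E i xQ 1[OF i] by (simp add: eigfam_def)
  have "ip (\<Sum>i<n. b i \<odot> e i) x = (\<Sum>i<n. ip (b i \<odot> e i) x)"
    by (rule H.ip_sum) (use e xQ QinH H.closed(4) in auto)
  also have "\<dots> = 0" by (rule sum.neutral) (use 1 e xQ QinH H.ip_scale in auto)
  finally show "ip (\<Sum>i<n. b i \<odot> e i) x = 0" .
  have "q (\<Sum>i<n. b i \<odot> e i) x = (\<Sum>i<n. q (b i \<odot> e i) x)"
    by (rule Q.ip_sum) (use e xQ Q.closed(4) in auto)
  also have "\<dots> = 0" by (rule sum.neutral) (use 2 e xQ Q.ip_scale in auto)
  finally show "q (\<Sum>i<n. b i \<odot> e i) x = 0" .
qed

text \<open>The equation decouples: a scalar equation along each eigenvector and a coercive one on the complement.\<close>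

lemma resolvent_below:
  assumes E: "eigfam n e l" and c: "\<forall>u\<in>orthc n e. c * H.sq u <= Q.sq u" and c0: "-1 < c"
    and z: "Re z < c" "\<forall>i<n. z \<noteq> cplx (l i)"
  shows "\<forall>f\<in>H. \<exists>u\<in>Q. \<forall>v\<in>Q. q u v - z * ip u v = ip f v"
    "\<exists>C. \<forall>u\<in>Q. \<forall>f\<in>H. (\<forall>v\<in>Q. q u v - z * ip u v = ip f v) --> sqrt (H.sq u) <= C * sqrt (H.sq f)"
proof -
  have e: "\<forall>i<n. e i \<in> Q" using E by (auto simp: eigfam_def)
  have eQ: "i < n ==> e i \<in> Q" and eH: "i < n ==> e i \<in> H" for i using e QinH by auto
  interpret O: hform scale H ip "orthc n e" q by (rule orthc_hform[OF e])
  have oQ: "v \<in> orthc n e ==> v \<in> Q" for v by (simp add: orthc_def)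
  have qe: "q (e i) v = cplx (l i) * ip (e i) v" if "i < n" "v \<in> Q" for i v
    using E that by (auto simp: eigfam_def)
  have qe2: "q v (e i) = cplx (l i) * ip v (e i)" if "i < n" "v \<in> Q" for i v
    using qe[OF that] Q.ip_sym[of "e i" v] H.ip_sym[of "e i" v] eQ eH that QinH by simp
  have o: "ip (e i) (e j) = (if i = j then 1 else 0)" if "i < n" "j < n" for i j
    using E that by (auto simp: eigfam_def)
  show "\<forall>f\<in>H. \<exists>u\<in>Q. \<forall>v\<in>Q. q u v - z * ip u v = ip f v"
  proof
    fix f assume f: "f \<in> H"
    from O.coercive_solvable[of c z] c c0 z f obtain w where w: "w \<in> orthc n e"
      "!!v. v \<in> orthc n e ==> q w v - z * ip w v = ip f v" by auto
    define b where "b i = ip f (e i) / (cplx (l i) - z)" for i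
    define u where "u = (\<Sum>i<n. b i \<odot> e i)"
    have uQ: "u \<in> Q" unfolding u_def by (intro Q.closed_sum Q.closed eQ) auto
    note wQ = oQ[OF w(1)]
    have "q (w + u) v - z * ip (w + u) v = ip f v" if v: "v \<in> Q" for v
    proof -
      have p: "proj n e v \<in> Q" "v - proj n e v \<in> orthc n e" using proj_orthc[OF E v] .
      have 1: "q w (e i) - z * ip w (e i) = 0" if "i < n" for i
        using qe2[OF that wQ] w(1) that by (simp add: orthc_def)
      have u_ip: "ip u (e i) = b i" if "i < n" for i unfolding u_def
        using that eH o by (intro H.ip_orthonormal_sum) auto
      have 2: "q u (e i) - z * ip u (e i) = ip f (e i)" if "i < n" for i
      proof -
        have "q u (e i) - z * ip u (e i) = (cplx (l i) - z) * b i"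
          using qe2[OF that uQ] u_ip[OF that] by (simp add: left_diff_distrib)
        thus ?thesis using z(2) that by (auto simp: b_def)
      qed
      have u0: "ip u x = 0" "q u x = 0" if x: "x \<in> orthc n e" for x
        using eigfam_sum_orthc[OF E x, of b] by (auto simp: u_def)
      have 3: "q (w + u) (e i) - z * ip (w + u) (e i) = ip f (e i)" if "i < n" for i
        using 1[OF that] 2[OF that] that eQ eH wQ uQ QinH
        by (simp add: Q.ip_add H.ip_add algebra_simps)
      have 4: "q (w + u) (proj n e v) - z * ip (w + u) (proj n e v) = ip f (proj n e v)"
      proof -
        have wuQ: "w + u \<in> Q" using wQ uQ by (rule Q.closed)
        have "q (w + u) (proj n e v) = (\<Sum>i<n. cnj (ip v (e i)) * q (w + u) (e i))"
          unfolding proj_def using eQ wuQ by (subst Q.ip_sum2) (auto intro: Q.closed(4) simp: Q.ip_scale2)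
        moreover have "ip (w + u) (proj n e v) = (\<Sum>i<n. cnj (ip v (e i)) * ip (w + u) (e i))"
          unfolding proj_def using eH QinH[OF wuQ] by (subst H.ip_sum2) (auto intro: H.closed(4) simp: H.ip_scale2)
        ultimately have "q (w + u) (proj n e v) - z * ip (w + u) (proj n e v) =
          (\<Sum>i<n. cnj (ip v (e i)) * (q (w + u) (e i) - z * ip (w + u) (e i)))"
          by (simp add: right_diff_distrib sum_subtractf sum_distrib_left mult.left_commute)
        also have "\<dots> = (\<Sum>i<n. cnj (ip v (e i)) * ip f (e i))" using 3 by simp
        also have "\<dots> = ip f (proj n e v)"
          unfolding proj_def using eH f by (subst H.ip_sum2) (auto intro: H.closed(4) simp: H.ip_scale2)
        finally show ?thesis .
      qed
      have 5: "q (w + u) (v - proj n e v) - z * ip (w + u) (v - proj n e v) = ip f (v - proj n e v)"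
        using w(2)[OF p(2)] u0[OF p(2)] wQ uQ oQ[OF p(2)] QinH by (simp add: Q.ip_add H.ip_add)
      show ?thesis using 4 5 p v wQ uQ f QinH oQ
        by (simp add: Q.ip_diff2 H.ip_diff2 Q.closed H.closed algebra_simps)
    qed
    thus "\<exists>u\<in>Q. \<forall>v\<in>Q. q u v - z * ip u v = ip f v" using wQ uQ Q.closed by blast
  qed
  show "\<exists>C. \<forall>u\<in>Q. \<forall>f\<in>H. (\<forall>v\<in>Q. q u v - z * ip u v = ip f v) --> sqrt (H.sq u) <= C * sqrt (H.sq f)"
  proof (intro exI ballI impI)
    fix u f assume u: "u \<in> Q" and f: "f \<in> H" and eq: "\<forall>v\<in>Q. q u v - z * ip u v = ip f v"
    have b: "cmod (ip u (e i)) <= sqrt (H.sq f) / cmod (cplx (l i) - z)" if i: "i < n" for i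
    proof -
      have "ip f (e i) = (cplx (l i) - z) * ip u (e i)"
        using eq eQ[OF i] qe2[OF i u] by (auto simp: algebra_simps)
      hence "cmod (cplx (l i) - z) * cmod (ip u (e i)) <= sqrt (H.sq f)"
        using H.Cauchy_Schwarz[OF f eH[OF i]] o[OF i i] by (simp add: norm_mult)
      moreover have "0 < cmod (cplx (l i) - z)" using z(2) i by auto
      ultimately show ?thesis by (simp add: pos_le_divide_eq mult.commute)
    qed
    let ?w = "u - proj n e u"
    have p: "proj n e u \<in> Q" "?w \<in> orthc n e" using proj_orthc[OF E u] .
    have wQ: "?w \<in> Q" using oQ[OF p(2)] .
    have "q (proj n e u) ?w = 0 & ip (proj n e u) ?w = 0"
      using eigfam_sum_orthc[OF E p(2)] by (auto simp: proj_def)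
    hence "q ?w ?w = q u ?w" "ip ?w ?w = ip u ?w"
      using Q.ip_diff[OF u p(1) wQ] H.ip_diff[OF QinH[OF u] QinH[OF p(1)] QinH[OF wQ]] by auto
    hence "q ?w ?w - z * ip ?w ?w = ip f ?w" using eq wQ by simp
    hence "(c - Re z) * sqrt (H.sq ?w) <= sqrt (H.sq f)"
      using c p(2) z(1) wQ f by (intro coercive_bound) auto
    hence w: "sqrt (H.sq ?w) <= 1 / (c - Re z) * sqrt (H.sq f)" using z(1) by (simp add: field_simps)
    have "sqrt (H.sq (proj n e u)) <= (\<Sum>i<n. sqrt (H.sq (ip u (e i) \<odot> e i)))"
      unfolding proj_def using eH by (intro H.triangle_sum H.closed) auto
    also have "\<dots> = (\<Sum>i<n. cmod (ip u (e i)))" using eH o by (simp add: H.sq_scale real_sqrt_mult)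
    also have "\<dots> <= (\<Sum>i<n. sqrt (H.sq f) / cmod (cplx (l i) - z))" using b by (intro sum_mono) auto
    also have "\<dots> = (\<Sum>i<n. 1 / cmod (cplx (l i) - z)) * sqrt (H.sq f)"
      by (simp add: sum_distrib_right)
    finally have "sqrt (H.sq (proj n e u)) <= (\<Sum>i<n. 1 / cmod (cplx (l i) - z)) * sqrt (H.sq f)" .
    moreover have "sqrt (H.sq u) <= sqrt (H.sq ?w) + sqrt (H.sq (proj n e u))"
      using H.triangle[of ?w "proj n e u"] wQ p QinH by simp
    ultimately show "sqrt (H.sq u) <= (1 / (c - Re z) + (\<Sum>i<n. 1 / cmod (cplx (l i) - z))) * sqrt (H.sq f)"
      using w by (simp add: distrib_right)
  qed
qed

lemma eigenvector_below:
  assumes E: "eigfam n e l" and c: "\<forall>u\<in>orthc n e. c * H.sq u <= Q.sq u"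
    and \<mu>: "\<mu> < c" and u: "u \<in> Q" and ev: "!!v. v \<in> Q ==> q u v = cplx \<mu> * ip u v"
    and z: "!!i. i < n ==> l i = \<mu> ==> ip u (e i) = 0"
  shows "H.sq u = 0"
proof -
  have "ip u (e i) = 0" if i: "i < n" for i
  proof (cases "l i = \<mu>")
    case False
    have eQ: "e i \<in> Q" and qe: "q (e i) u = cplx (l i) * ip (e i) u"
      using E i u by (auto simp: eigfam_def)
    have "q u (e i) = cplx (l i) * ip u (e i)"
      using qe Q.ip_sym[OF eQ u] H.ip_sym[of "e i" u] QinH eQ u by simp
    hence "(cplx (l i) - cplx \<mu>) * ip u (e i) = 0"
      using ev[OF eQ] by (metis left_diff_distrib right_minus_eq)
    thus ?thesis using False by (metis mult_eq_0_iff eq_iff_diff_eq_0 of_real_eq_iff)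
  qed (use z i in auto)
  hence "u \<in> orthc n e" using u by (simp add: orthc_def)
  hence "c * H.sq u <= \<mu> * H.sq u"
    using c ev[OF u] by auto
  hence "(c - \<mu>) * H.sq u <= 0" by (simp add: algebra_simps)
  hence "H.sq u <= 0" using \<mu> by (simp add: mult_le_0_iff)
  thus ?thesis using H.ip_pos[OF QinH[OF u]] by simp
qed

end

context hform
begin

text \<open>The second clause makes the vectors independent modulo vectors of norm zero.  The eigenvalues are the least levels of such families.\<close>

definition trial :: "nat => real => bool" where
  "trial k t \<longleftrightarrow> (\<exists>w. (\<forall>i<k. w i \<in> Q) &
     (\<forall>b. Q.sq (\<Sum>i<k. b i \<odot> w i) <= t * H.sq (\<Sum>i<k. b i \<odot> w i) &
          (H.sq (\<Sum>i<k. b i \<odot> w i) = 0 --> (\<forall>i<k. b i = 0))))"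

text \<open>Fewer than \<open>k\<close> orthogonality conditions leave a nonzero vector in a \<open>k\<close>-dimensional space.\<close>

lemma trial_orthc:
  assumes e: "\<forall>i<n. e i \<in> Q" and T: "trial k t" and nk: "n < k"
    and c: "\<forall>u\<in>orthc n e. c * H.sq u <= Q.sq u"
  shows "c <= t"
proof (rule ccontr)
  assume tc: "\<not> c <= t"
  from T obtain w where w: "!!i. i < k ==> w i \<in> Q"
    "!!b. Q.sq (\<Sum>i<k. b i \<odot> w i) <= t * H.sq (\<Sum>i<k. b i \<odot> w i)"
    "!!b. H.sq (\<Sum>i<k. b i \<odot> w i) = 0 ==> \<forall>i<k. b i = 0" unfolding trial_def by blast
  from homogeneous_system_nontrivial[of "{..<k}" n "%i j. ip (w i) (e j)"] nk obtain b
    where b: "\<exists>i<k. b i \<noteq> 0" "\<forall>j<n. (\<Sum>i<k. b i * ip (w i) (e j)) = 0" by auto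
  define u where "u = (\<Sum>i<k. b i \<odot> w i)"
  have u: "u \<in> Q" unfolding u_def by (intro Q.closed_sum Q.closed w) auto
  have "ip u (e j) = 0" if "j < n" for j
    unfolding u_def using b(2) that e w(1) QinH
    by (subst H.ip_sum) (auto simp: H.closed H.ip_scale)
  hence "u \<in> orthc n e" using u by (simp add: orthc_def)
  hence "c * H.sq u <= t * H.sq u" using c w(2)[of b] by (fastforce simp: u_def)
  hence "(c - t) * H.sq u <= 0" by (simp add: algebra_simps)
  hence "H.sq u <= 0" using tc by (simp add: mult_le_0_iff)
  hence "H.sq u = 0" using H.ip_pos[OF QinH[OF u]] by simp
  hence "\<forall>i<k. b i = 0" unfolding u_def by (rule w(3))
  thus False using b(1) by blast
qed

lemma trial_eigfam:
  assumes E: "eigfam n e l" and c: "\<forall>u\<in>orthc n e. c * H.sq u <= Q.sq u"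
    and T: "trial k t" and tc: "t < c" and k: "1 <= k"
  shows "k <= n" "l (k - 1) <= t"
proof -
  have e: "\<forall>i<n. e i \<in> Q" using E by (auto simp: eigfam_def)
  show kn: "k <= n" using trial_orthc[OF e T _ c] tc by force
  have "\<forall>i<k - 1. e i \<in> Q" using e kn by auto
  from trial_orthc[OF this T] E kn k show "l (k - 1) <= t" by (auto simp: eigfam_def)
qed

end

section \<open>Square-integrable functions\<close>

text \<open>Functions into the complex numbers form a vector space; almost-everywhere classes are never taken.\<close>

definition fscale :: "complex => ('a => complex) => 'a => complex" where
  "fscale c u = (%x. c * u x)"

abbreviation comb where "comb n c f \<equiv> (\<Sum>i<n. fscale (c i) (f i))"

lemma sum_fun_apply: "(\<Sum>i\<in>A. f i) x = (\<Sum>i\<in>A. f i x)" for f :: "'i => 'a => complex"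
  by (induction A rule: infinite_finite_induct) auto

lemma fscale_apply [simp]: "fscale c u x = c * u x" by (simp add: fscale_def)

interpretation fvec: vector_space fscale
  by unfold_locales (auto simp: fscale_def fun_eq_iff algebra_simps)

lemma L2I: "u \<in> borel_measurable M ==> integrable M (%x. (norm (u x))^2) ==> u \<in> L2 M"
  by (simp add: L2_def)

lemma L2_dest:
  assumes "u \<in> L2 M" shows L2_measurable: "u \<in> borel_measurable M"
    and L2_integrable: "integrable M (%x. (norm (u x))^2)"
  using assms by (auto simp: L2_def)

lemma two_mult_le_squares: "2 * (a * b) <= a^2 + b^2" for a b :: real
  using zero_le_power2[of "a - b"] by (simp add: power2_eq_square algebra_simps)

lemma L2_mult_integrable:
  assumes "u \<in> L2 M" "v \<in> L2 M" shows "integrable M (%x. u x * v x)"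
proof (rule Lintegrable_bound)
  show "integrable M (%x. (norm (u x))^2 + (norm (v x))^2)"
    using assms by (intro Lintegrable_add L2_integrable)
  show "(%x. u x * v x) \<in> borel_measurable M"
    using assms[THEN L2_measurable] by measurable
  have "norm (u x * v x) <= (norm (u x))^2 + (norm (v x))^2" for x
    using two_mult_le_squares[of "norm (u x)" "norm (v x)"] by (simp add: norm_mult)
       (smt (verit) mult_nonneg_nonneg norm_ge_zero)
  thus "AE x in M. norm (u x * v x) <= norm ((norm (u x))^2 + (norm (v x))^2)" by auto
qed

lemma L2_cnj: "u \<in> L2 M ==> (%x. cnj (u x)) \<in> L2 M"
proof -
  assume "u \<in> L2 M"
  moreover have "cnj \<in> borel_measurable borel"
    by (intro borel_measurable_continuous_onI continuous_on_cnj continuous_on_id)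
  ultimately show ?thesis by (auto simp: L2_def intro: measurable_compose[where f = u])
qed

lemma L2_inner_integrable:
  "u \<in> L2 M ==> v \<in> L2 M ==> integrable M (%x. u x * cnj (v x))"
  using L2_mult_integrable[OF _ L2_cnj] by auto

lemma L2_bound:
  assumes "u \<in> L2 M" "v \<in> borel_measurable M" "!!x. x \<in> space M ==> norm (v x) <= B * norm (u x)"
  shows "v \<in> L2 M"
proof (rule L2I[OF assms(2)], rule Lintegrable_bound)
  show "integrable M (%x. B^2 * (norm (u x))^2)"
    using assms L2_integrable by auto
  show "(%x. (norm (v x))^2) \<in> borel_measurable M" using assms(2) by measurable
  show "AE x in M. norm ((norm (v x))^2) <= norm (B^2 * (norm (u x))^2)"
    using assms(3) by (intro AE_I2) (auto simp flip: power_mult_distrib intro!: power_mono)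
qed

lemma L2_add: assumes "u \<in> L2 M" "v \<in> L2 M" shows "u + v \<in> L2 M"
proof (rule L2I)
  show m: "u + v \<in> borel_measurable M" unfolding plus_fun_def
    using assms[THEN L2_measurable] by measurable
  show "integrable M (%x. (norm ((u + v) x))^2)"
  proof (rule Lintegrable_bound)
    show "integrable M (%x. 2 * (norm (u x))^2 + 2 * (norm (v x))^2)"
      by (intro Lintegrable_add integrable_mult_right L2_integrable assms)
    show "(%x. (norm ((u + v) x))^2) \<in> borel_measurable M" using m by measurable
    have "(norm (u x + v x))^2 <= 2 * (norm (u x))^2 + 2 * (norm (v x))^2" for x
    proof -
      have "(norm (u x + v x))^2 <= (norm (u x) + norm (v x))^2" by (intro power_mono norm_triangle_ineq) auto
      also have "\<dots> <= 2 * (norm (u x))^2 + 2 * (norm (v x))^2"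
        using two_mult_le_squares[of "norm (u x)" "norm (v x)"] by (simp add: power2_sum)
      finally show ?thesis .
    qed
    thus "AE x in M. norm ((norm ((u + v) x))^2) <= norm (2 * (norm (u x))^2 + 2 * (norm (v x))^2)" by auto
  qed
qed

lemma L2_scale: "u \<in> L2 M ==> fscale c u \<in> L2 M"
  by (rule L2_bound[of u _ _ "norm c"]) (auto simp: norm_mult fscale_def dest: L2_measurable)

lemma L2_zero: "0 \<in> L2 M" by (auto simp: L2_def zero_fun_def)

lemma l2_inner_self: "l2_inner M u u = cplx (LINT x|M. (norm (u x))^2)"
  by (simp add: l2_inner_def flip: complex_norm_square of_real_power)

lemma l2_sq: "Re (l2_inner M u u) = (LINT x|M. (norm (u x))^2)" by (simp add: l2_inner_self)

lemma l2_norm_sqrt: "l2_norm M u = sqrt (Re (l2_inner M u u))" by (simp add: l2_norm_def l2_sq)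

interpretation l2: semi_ip fscale "L2 M" "l2_inner M" for M :: "'a measure"
proof
  show "fvec.subspace (L2 M)"
    unfolding fvec.subspace_def by (auto simp: L2_add L2_scale L2_zero)
  fix u v w :: "'a => complex" and c assume u: "u \<in> L2 M" and v: "v \<in> L2 M"
  show "l2_inner M (u + v) w = l2_inner M u w + l2_inner M v w" if "w \<in> L2 M"
    using u v that by (simp add: l2_inner_def distrib_right L2_inner_integrable)
  show "l2_inner M v u = cnj (l2_inner M u v)"
  proof -
    have "l2_inner M v u = (LINT x|M. cnj (u x * cnj (v x)))"
      unfolding l2_inner_def by (intro Lintegral_cong) (auto simp: mult.commute)
    also have "\<dots> = cnj (l2_inner M u v)" unfolding l2_inner_def by (rule Lintegral_cnj)
    finally show ?thesis .
  qed
next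
  fix u w :: "'a => complex" and c assume "u \<in> L2 M" "w \<in> L2 M"
  thus "l2_inner M (fscale c u) w = c * l2_inner M u w"
    by (simp add: l2_inner_def mult.assoc L2_inner_integrable)
next
  fix u :: "'a => complex"
  show "0 <= Re (l2_inner M u u)" by (simp add: l2_sq)
qed

abbreviation nsq where "nsq u \<equiv> Re (l2_inner lebesgue u u)"

abbreviation energy where "energy S u \<equiv> Re (grad_form S u u)"

lemma l2_sq_0_iff: "u \<in> L2 M ==> l2.sq M u = 0 \<longleftrightarrow> (AE x in M. u x = 0)"
  by (simp add: l2_sq integral_nonneg_eq_0_iff_AE L2_integrable)

lemma l2_nn: "u \<in> L2 M ==> (\<integral>\<^sup>+x. ennreal ((norm (u x))^2) \<partial>M) = ennreal (l2.sq M u)"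
  by (simp add: l2_sq nn_integral_eq_integral L2_integrable)

lemma L2_nnI:
  assumes "u \<in> borel_measurable M" "(\<integral>\<^sup>+x. ennreal ((norm (u x))^2) \<partial>M) <= ennreal B"
  shows "u \<in> L2 M" "0 <= B ==> l2.sq M u <= B"
proof -
  show u: "u \<in> L2 M" using assms by (intro L2I integrableI_nonneg) (auto simp: order_le_less_trans)
  show "0 <= B ==> l2.sq M u <= B" using assms(2) l2_nn[OF u] by simp
qed

text \<open>A subsequence with geometric increments converges almost everywhere, and Fatou identifies the limit in norm.\<close>

theorem L2_complete:
  assumes w: "!!n. w n \<in> L2 M" and C: "\<forall>e>0. \<exists>N. \<forall>m\<ge>N. \<forall>n\<ge>N. l2.sq M (w m - w n) < e"
  shows "\<exists>u\<in>L2 M. (%n. l2.sq M (w n - u)) \<leadsto> 0"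
proof -
  have "\<exists>N. \<forall>m\<ge>N. \<forall>n\<ge>N. l2.sq M (w m - w n) < (1/4) ^ k" for k using C by simp
  then obtain N where N: "!!k m n. m \<ge> N k ==> n \<ge> N k ==> l2.sq M (w m - w n) < (1/4) ^ k" by metis
  define r where "r k = (\<Sum>j\<le>k. N j)" for k
  have rN: "N k <= r k" for k unfolding r_def by (rule member_le_sum) auto
  have rS: "N k <= r (Suc k)" for k using rN[of k] by (simp add: r_def)
  define d where "d k x = norm (w (r (Suc k)) x - w (r k) x)" for k x
  have wm: "w n \<in> borel_measurable M" for n using w L2_measurable by blast
  have [measurable]: "d k \<in> borel_measurable M" for k unfolding d_def using wm by measurable
  have dn: "(\<integral>\<^sup>+x. ennreal ((d k x)^2) \<partial>M) <= ennreal ((1/4)^k)" for k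
  proof -
    have "(\<integral>\<^sup>+x. ennreal ((d k x)^2) \<partial>M) = ennreal (l2.sq M (w (r (Suc k)) - w (r k)))"
      using l2_nn[OF l2.closed(3)[OF w[of "r (Suc k)"] w[of "r k"]]] by (simp add: d_def)
    thus ?thesis using N[OF rS rN] by (simp add: less_imp_le ennreal_leI)
  qed
  \<comment> \<open>the weighted sum of squares controls the sum of the increments\<close>
  have fin: "AE x in M. (\<Sum>k. ennreal (2 ^ k * (d k x)^2)) \<noteq> \<infinity>"
  proof (rule nn_integral_noteq_infinite)
    have "(\<integral>\<^sup>+x. (\<Sum>k. ennreal (2 ^ k * (d k x)^2)) \<partial>M) = (\<Sum>k. \<integral>\<^sup>+x. ennreal (2 ^ k * (d k x)^2) \<partial>M)"
      by (rule nn_integral_suminf) auto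
    also have "\<dots> <= (\<Sum>k. ennreal ((1/2) ^ k))"
    proof (intro suminf_le)
      fix k
      have "(\<integral>\<^sup>+x. ennreal (2 ^ k * (d k x)^2) \<partial>M) = ennreal (2 ^ k) * (\<integral>\<^sup>+x. ennreal ((d k x)^2) \<partial>M)"
        by (subst nn_integral_cmult[symmetric]) (auto simp: ennreal_mult)
      also have "\<dots> <= ennreal (2 ^ k) * ennreal ((1/4) ^ k)" by (intro mult_left_mono dn) auto
      also have "\<dots> = ennreal ((1/2) ^ k)" by (simp add: ennreal_mult[symmetric] power_mult_distrib[symmetric])
      finally show "(\<integral>\<^sup>+x. ennreal (2 ^ k * (d k x)^2) \<partial>M) <= ennreal ((1/2) ^ k)" .
    qed auto
    also have "\<dots> = ennreal (\<Sum>k. (1/2) ^ k)" by (intro suminf_ennreal2 summable_geometric) auto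
    finally show "(\<integral>\<^sup>+x. (\<Sum>k. ennreal (2 ^ k * (d k x)^2)) \<partial>M) \<noteq> \<infinity>"
      unfolding infinity_ennreal_def by (rule neq_top_trans[OF ennreal_neq_top])
  qed auto
  have conv: "AE x in M. convergent (%k. w (r k) x)"
    using fin
  proof eventually_elim
    case (elim x)
    hence s: "summable (%k. 2 ^ k * (d k x)^2)" by (intro summable_suminf_not_top) auto
    have "summable (%k. d k x)"
    proof (rule summable_comparison_test)
      show "summable (%k. (1/2) ^ k + 2 ^ k * (d k x)^2)" by (intro summable_add s summable_geometric) auto
      have "norm (d k x) <= (1/2) ^ k + 2 ^ k * (d k x)^2" for k
      proof -
        define a where "a = (2::real) ^ k"
        have a: "a > 0" "(1/2) ^ k = 1 / a" by (auto simp: a_def power_divide)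
        have "0 <= (1 - a * d k x)^2" by simp
        hence "2 * (a * d k x) <= 1 + a^2 * (d k x)^2" by (simp add: power2_diff power_mult_distrib)
        hence "a * (2 * d k x) <= a * (1 / a + a * (d k x)^2)"
          using a by (simp add: distrib_left power2_eq_square mult_ac)
        hence "2 * d k x <= 1 / a + a * (d k x)^2" using a by (simp only: mult_le_cancel_left_pos)
        moreover have "0 <= d k x" by (simp add: d_def)
        ultimately show ?thesis unfolding a(2) a_def[symmetric] real_norm_def by linarith
      qed
      thus "\<exists>N. \<forall>k\<ge>N. norm (d k x) <= (1/2) ^ k + 2 ^ k * (d k x)^2" by blast
    qed
    hence "summable (%k. w (r (Suc k)) x - w (r k) x)" unfolding d_def by (rule summable_norm_cancel) 
    hence "convergent (%n. \<Sum>k<n. (w (r (Suc k)) x - w (r k) x))" by (simp add: summable_iff_convergent)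
    hence "convergent (%n. w (r n) x - w (r 0) x)" using sum_lessThan_telescope[of "%n. w (r n) x"] by simp
    from convergent_add[OF this convergent_const[of "w (r 0) x"]] show ?case by simp
  qed
  define u where "u x = lim (%k. w (r k) x)" for x
  have um [measurable]: "u \<in> borel_measurable M" unfolding u_def using wm by (intro borel_measurable_lim_metric) auto
  have lim: "AE x in M. (%k. w (r k) x) \<leadsto> u x"
    using conv by eventually_elim (simp add: u_def convergent_LIMSEQ_iff)
  have est: "(\<integral>\<^sup>+x. ennreal ((norm (w m x - u x))^2) \<partial>M) <= ennreal ((1/4) ^ k)" if m: "m \<ge> N k" for m k
  proof -
    have "(\<integral>\<^sup>+x. ennreal ((norm (w m x - u x))^2) \<partial>M) = (\<integral>\<^sup>+x. liminf (%j. ennreal ((norm (w m x - w (r j) x))^2)) \<partial>M)"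
    proof (rule nn_integral_cong_AE)
      show "AE x in M. ennreal ((norm (w m x - u x))^2) = liminf (%j. ennreal ((norm (w m x - w (r j) x))^2))"
        using lim
      proof eventually_elim
        case (elim x)
        hence "(%j. ennreal ((norm (w m x - w (r j) x))^2)) \<leadsto> ennreal ((norm (w m x - u x))^2)"
          by (intro tendsto_ennrealI tendsto_intros)
        from lim_imp_Liminf[OF sequentially_bot this] show ?case by (rule sym)
      qed
    qed
    also have "\<dots> <= liminf (%j. \<integral>\<^sup>+x. ennreal ((norm (w m x - w (r j) x))^2) \<partial>M)"
      using wm by (intro nn_integral_liminf) measurable
    also have "\<dots> <= ennreal ((1/4) ^ k)"
    proof (rule Liminf_le)
      show "\<forall>\<^sub>F j in sequentially. (\<integral>\<^sup>+x. ennreal ((norm (w m x - w (r j) x))^2) \<partial>M) <= ennreal ((1/4) ^ k)"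
      proof (rule eventually_sequentiallyI[of k])
        fix j assume "k <= j"
        hence "r k <= r j" unfolding r_def by (intro sum_mono2) auto
        hence "N k <= r j" using rN[of k] by simp
        from N[OF m this] show "(\<integral>\<^sup>+x. ennreal ((norm (w m x - w (r j) x))^2) \<partial>M) <= ennreal ((1/4) ^ k)"
          using l2_nn[OF l2.closed(3)[OF w[of m] w[of "r j"]]] by (simp add: less_imp_le ennreal_leI)
      qed
    qed simp
    finally show ?thesis .
  qed
  have d: "w m - u \<in> L2 M" "l2.sq M (w m - u) <= (1/4) ^ k" if "m \<ge> N k" for m k
    using L2_nnI[of "w m - u" M "(1/4)^k"] est[OF that] wm by (auto simp: fun_diff_def)
  have "w (N 0) - (w (N 0) - u) \<in> L2 M" by (rule l2.closed(3)[OF w d(1)[of 0]]) simp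
  hence u: "u \<in> L2 M" by simp
  have "(%n. l2.sq M (w n - u)) \<leadsto> 0"
  proof (rule LIMSEQ_I)
    fix \<epsilon> :: real assume "0 < \<epsilon>"
    then obtain k where k: "(1/4) ^ k < \<epsilon>" using real_arch_pow_inv[of \<epsilon> "1/4"] by auto
    have "norm (l2.sq M (w n - u) - 0) < \<epsilon>" if "n \<ge> N k" for n
      using d[OF that] k l2.ip_pos[OF d(1)[OF that]] by simp
    thus "\<exists>no. \<forall>n\<ge>no. norm (l2.sq M (w n - u) - 0) < \<epsilon>" by blast
  qed
  thus ?thesis using u by blast
qed

section \<open>Smooth functions of compact support\<close>

lemma partial_eq: "(f has_derivative f') (at x) ==> partial i f x = f' i"
  by (simp add: partial_def frechet_derivative_at[symmetric])

lemma Ck_SucI: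
  assumes "!!x. (f has_derivative D x) (at x)" "!!i. i \<in> Basis ==> Ck_fun k (%x. D x i)"
  shows "Ck_fun (Suc k) f"
proof -
  have "partial i f = (%x. D x i)" for i using partial_eq[OF assms(1)] by auto
  thus ?thesis using assms
    by (auto simp: differentiable_on_def differentiable_def intro: has_derivative_at_withinI)
qed

lemma Ck_SucD:
  assumes "Ck_fun (Suc k) f"
  shows "(f has_derivative frechet_derivative f (at x)) (at x)"
    "i \<in> Basis ==> Ck_fun k (%x. frechet_derivative f (at x) i)"
  using assms by (auto simp: differentiable_on_def frechet_derivative_works partial_def[abs_def])

lemma Ck_fun_decrease: "Ck_fun (Suc k) f ==> Ck_fun k f"
proof (induction k arbitrary: f)
  case 0 thus ?case by (simp add: differentiable_imp_continuous_on)
next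
  case (Suc k)
  hence "f differentiable_on UNIV" "!!i. i \<in> Basis ==> Ck_fun (Suc k) (partial i f)" by (subst (asm) Ck_fun.simps(2), blast)+
  with Suc.IH show ?case by (subst Ck_fun.simps(2)) blast
qed

lemma Ck_const: "Ck_fun k (%x. c)"
proof (induction k arbitrary: c)
  case (Suc k) show ?case by (rule Ck_SucI[where D = "%x h. 0"]) (auto intro: Suc)
qed simp

lemma Ck_add: "Ck_fun k f ==> Ck_fun k g ==> Ck_fun k (%x. f x + g x)"
proof (induction k arbitrary: f g)
  case (Suc k)
  show ?case
    by (rule Ck_SucI[OF has_derivative_add]) (use Suc in \<open>auto intro: Ck_SucD simp del: Ck_fun.simps\<close>)
qed (auto intro: continuous_intros)

lemma Ck_mult: "Ck_fun k f ==> Ck_fun k g ==> Ck_fun k (%x. f x * g x)"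
proof (induction k arbitrary: f g)
  case (Suc k)
  show ?case
    by (rule Ck_SucI[OF has_derivative_mult])
       (use Suc in \<open>auto intro!: Ck_add Suc.IH intro: Ck_SucD Ck_fun_decrease simp del: Ck_fun.simps\<close>)
qed (auto intro: continuous_intros)

lemma Ck_prod: "(!!i. i \<in> I ==> Ck_fun k (f i)) ==> Ck_fun k (%x. \<Prod>i\<in>I. f i x)"
  by (induction I rule: infinite_finite_induct) (auto intro: Ck_const Ck_mult)

lemma Ck_linear: "Ck_fun k f ==> bounded_linear L ==> Ck_fun k (%x. L (f x))"
proof (induction k arbitrary: f)
  case (Suc k)
  show ?case
    by (rule Ck_SucI[OF bounded_linear.has_derivative[OF Suc.prems(2)]])
       (use Suc in \<open>auto intro!: Suc.IH intro: Ck_SucD simp del: Ck_fun.simps\<close>)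
qed (auto intro: bounded_linear.continuous_on)

lemma partial_affine:
  assumes "(f has_derivative f') (at (s *\<^sub>R x + b))"
  shows "((%x. f (s *\<^sub>R x + b)) has_derivative (%h. f' (s *\<^sub>R h))) (at x)"
proof -
  have "((%x. s *\<^sub>R x + b) has_derivative (%h. s *\<^sub>R h)) (at x)" by (auto intro!: derivative_eq_intros)
  from has_derivative_compose[OF this assms] show ?thesis .
qed

lemma Ck_affine: "Ck_fun k f ==> Ck_fun k (%x. f (s *\<^sub>R x + b))"
proof (induction k arbitrary: f)
  case 0 thus ?case by (auto intro!: continuous_on_compose2[of UNIV f] continuous_intros)
next
  case (Suc k)
  show ?case
  proof (rule Ck_SucI)
    show "((%x. f (s *\<^sub>R x + b)) has_derivative (%h. frechet_derivative f (at (s *\<^sub>R x + b)) (s *\<^sub>R h))) (at x)" for x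
      using Suc.prems by (intro partial_affine Ck_SucD)
    fix i :: 'a assume i: "i \<in> Basis"
    have "frechet_derivative f (at y) (s *\<^sub>R i) = s *\<^sub>R frechet_derivative f (at y) i" for y
      using Ck_SucD(1)[OF Suc.prems, of y] by (intro linear_scale) (rule has_derivative_linear)
    moreover have "Ck_fun k (%x. of_real s * frechet_derivative f (at (s *\<^sub>R x + b)) i)"
      by (intro Ck_mult Ck_const Suc.IH Ck_SucD Suc.prems i)
    ultimately show "Ck_fun k (%x. frechet_derivative f (at (s *\<^sub>R x + b)) (s *\<^sub>R i))"
      by (simp add: scaleR_conv_of_real)
  qed
qed

lemma partial_affine_eq:
  assumes "Ck_fun (Suc 0) f"
  shows "partial i (%x. f (s *\<^sub>R x + b)) x = of_real s * partial i f (s *\<^sub>R x + b)"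
proof -
  have d: "(f has_derivative frechet_derivative f (at (s *\<^sub>R x + b))) (at (s *\<^sub>R x + b))" by (rule Ck_SucD[OF assms])
  have "partial i (%x. f (s *\<^sub>R x + b)) x = frechet_derivative f (at (s *\<^sub>R x + b)) (s *\<^sub>R i)"
    by (rule partial_eq[OF partial_affine[OF d]])
  also have "\<dots> = s *\<^sub>R frechet_derivative f (at (s *\<^sub>R x + b)) i"
    using d by (intro linear_scale) (rule has_derivative_linear)
  finally show ?thesis by (simp add: partial_def scaleR_conv_of_real)
qed

subsection \<open>The flat function\<close>

fun flat_poly :: "nat => real poly" where
  "flat_poly 0 = 1"
| "flat_poly (Suc n) = [:0, 0, 1:] * (flat_poly n - pderiv (flat_poly n))"

text \<open>All derivatives of \<open>exp (-1/t)\<close> are polynomials in \<open>1/t\<close> times \<open>exp (-1/t)\<close>; the index counts derivatives.\<close>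

definition flat :: "nat => real => real" where
  "flat n t = (if t <= 0 then 0 else poly (flat_poly n) (1 / t) * exp (- (1 / t)))"

lemma poly_times_exp_tendsto_0: "((%s. poly p s * exp (- s)) \<longlongrightarrow> 0) at_top" for p :: "real poly"
proof -
  have "((%s. \<Sum>i\<le>degree p. coeff p i * (s ^ i / exp s)) \<longlongrightarrow> (\<Sum>i\<le>degree p. coeff p i * 0)) at_top"
    by (intro tendsto_intros tendsto_power_div_exp_0)
  thus ?thesis by (simp add: poly_altdef sum_distrib_right exp_minus divide_inverse mult.assoc)
qed

lemma flat_deriv: "(flat n has_real_derivative flat (Suc n) t) (at t)"
proof -
  consider "t < 0" | "t > 0" | "t = 0" by linarith
  thus ?thesis
  proof cases
    case 1
    have "((%t. 0) has_real_derivative 0) (at t)" by simp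
    moreover have "\<forall>\<^sub>F x in nhds t. flat n x = 0"
    proof -
      have "\<forall>\<^sub>F x in nhds t. x \<in> {..<0}" using 1 by (intro eventually_nhds_in_open) auto
      thus ?thesis by eventually_elim (auto simp: flat_def)
    qed
    ultimately show ?thesis using 1 by (subst DERIV_cong_ev[OF refl]) (auto simp: flat_def)
  next
    case 2
    have "((%t. poly (flat_poly n) (1 / t) * exp (- (1 / t))) has_real_derivative flat (Suc n) t) (at t)"
      using 2 by (auto intro!: derivative_eq_intros simp: flat_def field_simps power2_eq_square)
    moreover have "\<forall>\<^sub>F x in nhds t. flat n x = poly (flat_poly n) (1 / x) * exp (- (1 / x))"
    proof -
      have "\<forall>\<^sub>F x in nhds t. x \<in> {0<..}" using 2 by (intro eventually_nhds_in_open) auto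
      thus ?thesis by eventually_elim (auto simp: flat_def)
    qed
    ultimately show ?thesis by (subst DERIV_cong_ev[OF refl]) auto
  next
    case 3
    have "((%y. flat n y / y) \<longlongrightarrow> 0) (at 0)"
    proof (rule filterlim_split_at)
      have "\<forall>\<^sub>F y in at_left (0::real). flat n y / y = 0"
        by (auto simp: flat_def eventually_at_filter)
      thus "((%y. flat n y / y) \<longlongrightarrow> 0) (at_left 0)" by (simp add: tendsto_eventually)
      have "((%y. poly ([:0, 1:] * flat_poly n) (inverse y) * exp (- (inverse y))) \<longlongrightarrow> 0) (at_right 0)"
        by (rule filterlim_compose[OF poly_times_exp_tendsto_0 filterlim_inverse_at_top_right])
      moreover have "\<forall>\<^sub>F y in at_right (0::real). flat n y / y = poly ([:0, 1:] * flat_poly n) (inverse y) * exp (- (inverse y))"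
        by (auto simp: flat_def eventually_at_filter field_simps)
      ultimately show "((%y. flat n y / y) \<longlongrightarrow> 0) (at_right 0)" by (simp add: filterlim_cong)
    qed
    thus ?thesis using 3 by (simp add: has_field_derivative_iff flat_def)
  qed
qed

lemma Ck_flat: "Ck_fun k (%x::'a::euclidean_space. cplx (flat n (c * (x \<bullet> i) + d)))"
proof (induction k arbitrary: n)
  case 0
  have "continuous_on UNIV (flat n)"
    using flat_deriv by (intro DERIV_continuous_on) (auto intro: has_field_derivative_at_within)
  hence "continuous_on UNIV (%x. flat n (c * (x \<bullet> i) + d))"
    by (rule continuous_on_compose2) (auto intro!: continuous_intros)
  thus ?case by (auto intro!: continuous_intros)
next
  case (Suc k)
  show ?case
  proof (rule Ck_SucI)
    fix x :: 'a
    have "((%x. c * (x \<bullet> i) + d) has_derivative (%h. c * (h \<bullet> i))) (at x)"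
      by (auto intro!: derivative_eq_intros)
    moreover have "(flat n has_derivative (%h. flat (Suc n) (c * (x \<bullet> i) + d) * h)) (at (c * (x \<bullet> i) + d))"
      using flat_deriv[of n "c * (x \<bullet> i) + d"] by (simp add: has_field_derivative_def)
    ultimately have "((%x. flat n (c * (x \<bullet> i) + d)) has_derivative (%h. flat (Suc n) (c * (x \<bullet> i) + d) * (c * (h \<bullet> i)))) (at x)"
      by (rule has_derivative_compose)
    thus "((%x. cplx (flat n (c * (x \<bullet> i) + d))) has_derivative
        (%h. cplx (flat (Suc n) (c * (x \<bullet> i) + d) * (c * (h \<bullet> i))))) (at x)"
      by (rule has_derivative_of_real)
    fix j :: 'a
    show "Ck_fun k (%x. cplx (flat (Suc n) (c * (x \<bullet> i) + d) * (c * (j \<bullet> i))))"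
      unfolding of_real_mult by (intro Ck_mult Suc Ck_const)
  qed
qed

subsection \<open>Test functions\<close>

lemma test_functionsI:
  assumes "!!k. Ck_fun k \<phi>" "compact K" "!!x. \<phi> x \<noteq> 0 ==> x \<in> K" "K \<subseteq> S"
  shows "\<phi> \<in> test_functions S"
proof -
  have "closure {x. \<phi> x \<noteq> 0} \<subseteq> K"
    using assms by (intro closure_minimal) (auto simp: compact_imp_closed)
  thus ?thesis using assms compact_closure[of "{x. \<phi> x \<noteq> 0}"] compact_imp_bounded[OF assms(2)]
    by (auto simp: test_functions_def intro: bounded_subset dest: closure_subset[THEN subsetD])
qed

lemma test_functionsD:
  assumes "\<phi> \<in> test_functions S"
  shows "Ck_fun k \<phi>" "\<exists>K. compact K & K \<subseteq> S & (\<forall>x. \<phi> x \<noteq> 0 --> x \<in> K) & (\<forall>i x. partial i \<phi> x \<noteq> 0 --> x \<in> K)"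
proof -
  let ?K = "closure {x. \<phi> x \<noteq> 0}"
  show "Ck_fun k \<phi>" using assms by (auto simp: test_functions_def)
  have "partial i \<phi> x = 0" if x: "x \<notin> ?K" for i x
  proof -
    have "(\<phi> has_derivative (%h. 0)) (at x)"
    proof (rule has_derivative_transform_within_open[where f = "%x. 0" and s = "- ?K"])
      show "0 = \<phi> y" if "y \<in> - ?K" for y using that closure_subset[of "{x. \<phi> x \<noteq> 0}"] by auto
    qed (use x in auto)
    thus ?thesis by (rule partial_eq)
  qed
  thus "\<exists>K. compact K & K \<subseteq> S & (\<forall>x. \<phi> x \<noteq> 0 --> x \<in> K) & (\<forall>i x. partial i \<phi> x \<noteq> 0 --> x \<in> K)"
    using assms closure_subset[of "{x. \<phi> x \<noteq> 0}"] by (intro exI[of _ ?K]) (auto simp: test_functions_def)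
qed

lemma smooth_has_derivative:
  assumes "Ck_fun (Suc 0) \<phi>"
  shows "(\<phi> has_derivative (%h. \<Sum>i\<in>Basis. (h \<bullet> i) *\<^sub>R partial i \<phi> x)) (at x)"
proof -
  have d: "(\<phi> has_derivative frechet_derivative \<phi> (at x)) (at x)"
    by (rule Ck_SucD[OF assms])
  have "frechet_derivative \<phi> (at x) h = (\<Sum>i\<in>Basis. (h \<bullet> i) *\<^sub>R partial i \<phi> x)" for h
  proof -
    have l: "linear (frechet_derivative \<phi> (at x))" using d by (rule has_derivative_linear)
    have "frechet_derivative \<phi> (at x) h = frechet_derivative \<phi> (at x) (\<Sum>i\<in>Basis. (h \<bullet> i) *\<^sub>R i)"
      by (simp add: euclidean_representation)
    also have "\<dots> = (\<Sum>i\<in>Basis. (h \<bullet> i) *\<^sub>R frechet_derivative \<phi> (at x) i)"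
      by (simp add: linear_sum[OF l] linear_scale[OF l])
    finally show ?thesis by (simp add: partial_def)
  qed
  hence "frechet_derivative \<phi> (at x) = (%h. \<Sum>i\<in>Basis. (h \<bullet> i) *\<^sub>R partial i \<phi> x)" by (rule ext)
  with d show ?thesis by simp
qed

lemma test_has_derivative:
  "\<phi> \<in> test_functions S ==> (\<phi> has_derivative (%h. \<Sum>i\<in>Basis. (h \<bullet> i) *\<^sub>R partial i \<phi> x)) (at x)"
  by (rule smooth_has_derivative[OF test_functionsD(1)])

lemma test_partial:
  assumes "\<phi> \<in> test_functions S" "i \<in> Basis" shows "partial i \<phi> \<in> test_functions S"
proof -
  obtain K where K: "compact K" "K \<subseteq> S" "!!i x. partial i \<phi> x \<noteq> 0 ==> x \<in> K"
    using test_functionsD(2)[OF assms(1)] by blast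
  have "Ck_fun k (partial i \<phi>)" for k
    using test_functionsD(1)[OF assms(1), of "Suc k"] assms(2) by simp
  thus ?thesis using K by (intro test_functionsI[of _ K]) auto
qed

lemma test_mono: "\<phi> \<in> test_functions S ==> S \<subseteq> T ==> \<phi> \<in> test_functions T"
  by (auto simp: test_functions_def)

lemma test_add:
  assumes "\<phi> \<in> test_functions S" "\<psi> \<in> test_functions S" shows "(%x. \<phi> x + \<psi> x) \<in> test_functions S"
proof -
  obtain K L where K: "compact K" "K \<subseteq> S" "!!x. \<phi> x \<noteq> 0 ==> x \<in> K" and L: "compact L" "L \<subseteq> S" "!!x. \<psi> x \<noteq> 0 ==> x \<in> L"
    using assms[THEN test_functionsD(2)] by blast
  show ?thesis
  proof (rule test_functionsI[of _ "K \<union> L"])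
    show "x \<in> K \<union> L" if "\<phi> x + \<psi> x \<noteq> 0" for x
      using that K(3)[of x] L(3)[of x] by (cases "\<phi> x = 0") auto
  qed (use K L assms[THEN test_functionsD(1)] in \<open>auto intro: Ck_add compact_Un\<close>)
qed

lemma test_mult:
  assumes "\<phi> \<in> test_functions S" "!!k. Ck_fun k g" shows "(%x. g x * \<phi> x) \<in> test_functions S"
proof -
  obtain K where K: "compact K" "K \<subseteq> S" "!!x. \<phi> x \<noteq> 0 ==> x \<in> K"
    using assms(1)[THEN test_functionsD(2)] by blast
  show ?thesis by (rule test_functionsI[of _ K])
      (use K assms test_functionsD(1)[OF assms(1)] in \<open>auto intro: Ck_mult\<close>)
qed

lemma test_scale: "\<phi> \<in> test_functions S ==> (%x. c * \<phi> x) \<in> test_functions S"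
  by (rule test_mult) (auto intro: Ck_const)

lemma test_zero: "(%x. 0) \<in> test_functions S"
  by (rule test_functionsI[of _ "{}"]) (auto intro: Ck_const)

lemma test_cnj: assumes "\<phi> \<in> test_functions S" shows "(%x. cnj (\<phi> x)) \<in> test_functions S"
proof -
  obtain K where K: "compact K" "K \<subseteq> S" "!!x. \<phi> x \<noteq> 0 ==> x \<in> K"
    using assms(1)[THEN test_functionsD(2)] by blast
  show ?thesis by (rule test_functionsI[of _ K])
      (use K test_functionsD(1)[OF assms(1)] bounded_linear_cnj in \<open>auto intro: Ck_linear\<close>)
qed

lemma test_continuous: "\<phi> \<in> test_functions S ==> continuous_on UNIV \<phi>"
  using test_functionsD(1)[of \<phi> S 0] by simp

lemma test_bounded: 
  assumes "\<phi> \<in> test_functions S" shows "\<exists>B>0. \<forall>x. norm (\<phi> x) <= B"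
proof -
  obtain K where K: "compact K" "!!x. \<phi> x \<noteq> 0 ==> x \<in> K"
    using test_functionsD(2)[OF assms] by blast
  have "bounded (\<phi> ` K)"
    using K test_continuous[OF assms] by (intro compact_imp_bounded compact_continuous_image) (auto intro: continuous_on_subset)
  then obtain B where "B > 0" "!!x. x \<in> K ==> norm (\<phi> x) <= B" unfolding bounded_pos by auto
  thus ?thesis using K(2) by (intro exI[of _ B]) (metis less_imp_le norm_zero)
qed

lemma test_lipschitz:
  assumes "\<phi> \<in> test_functions S" shows "\<exists>B>0. \<forall>x y. norm (\<phi> x - \<phi> y) <= B * norm (x - y)"
proof -
  have "\<forall>i\<in>Basis. \<exists>B>0. \<forall>x. norm (partial i \<phi> x) <= B" using test_bounded test_partial[OF assms] by blast
  then obtain B where B: "!!i x. i \<in> Basis ==> norm (partial i \<phi> x) <= B i" "!!i. i \<in> Basis ==> B i > 0" by metis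
  have o: "onorm (%h. \<Sum>i\<in>Basis. (h \<bullet> i) *\<^sub>R partial i \<phi> x) <= (\<Sum>i\<in>Basis. B i)" for x
  proof (rule onorm_le)
    fix h :: 'a
    have "norm (\<Sum>i\<in>Basis. (h \<bullet> i) *\<^sub>R partial i \<phi> x) <= (\<Sum>i\<in>Basis. \<bar>h \<bullet> i\<bar> * norm (partial i \<phi> x))"
      by (rule order_trans[OF norm_sum]) simp
    also have "\<dots> <= (\<Sum>i\<in>Basis. norm h * B i)" using B by (intro sum_mono mult_mono) (auto simp: Basis_le_norm)
    finally show "norm (\<Sum>i\<in>Basis. (h \<bullet> i) *\<^sub>R partial i \<phi> x) <= (\<Sum>i\<in>Basis. B i) * norm h"
      by (simp add: sum_distrib_left mult.commute)
  qed
  have "norm (\<phi> x - \<phi> y) <= (\<Sum>i\<in>Basis. B i) * norm (x - y)" for x y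
  proof (rule differentiable_bound[where S = UNIV and f' = "%x h. \<Sum>i\<in>Basis. (h \<bullet> i) *\<^sub>R partial i \<phi> x"])
    show "(\<phi> has_derivative (%h. \<Sum>i\<in>Basis. (h \<bullet> i) *\<^sub>R partial i \<phi> x)) (at x within UNIV)" for x
      by (rule test_has_derivative[OF assms])
  qed (auto intro: o)
  moreover have "0 < (\<Sum>i\<in>(Basis::'a set). B i)" using B by (intro sum_pos) auto
  ultimately show ?thesis by blast
qed

text \<open>The quadratic remainder is uniform in the base point; it is what allows differentiation under the integral sign.\<close>

lemma test_taylor:
  assumes "\<phi> \<in> test_functions S"
  shows "\<exists>B>0. \<forall>x h. norm (\<phi> (x + h) - \<phi> x - (\<Sum>i\<in>Basis. (h \<bullet> i) *\<^sub>R partial i \<phi> x)) <= B * (norm h)^2"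
proof -
  have "\<forall>i\<in>Basis. \<exists>B>0. \<forall>x y. norm (partial i \<phi> x - partial i \<phi> y) <= B * norm (x - y)"
    using test_lipschitz test_partial[OF assms] by blast
  then obtain B where B: "!!i x y. i \<in> Basis ==> norm (partial i \<phi> x - partial i \<phi> y) <= B i * norm (x - y)"
    "!!i. i \<in> Basis ==> B i > 0" by metis
  have "norm (\<phi> (x + h) - \<phi> x - (\<Sum>i\<in>Basis. (h \<bullet> i) *\<^sub>R partial i \<phi> x)) <= (\<Sum>i\<in>Basis. B i) * (norm h)^2" for x h
  proof -
    have "norm (\<phi> (x + h) - \<phi> x - (\<Sum>i\<in>Basis. ((x + h - x) \<bullet> i) *\<^sub>R partial i \<phi> x)) <= norm (x + h - x) * ((\<Sum>i\<in>Basis. B i) * norm h)"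
    proof (rule differentiable_bound_linearization[where S = "closed_segment x (x + h)" and f' = "%y h. \<Sum>i\<in>Basis. (h \<bullet> i) *\<^sub>R partial i \<phi> y"])
      show "x + t *\<^sub>R (x + h - x) \<in> closed_segment x (x + h)" if "t \<in> {0..1}" for t :: real
        using that by (auto simp: in_segment algebra_simps intro!: exI[of _ t])
      fix y assume y: "y \<in> closed_segment x (x + h)"
      show "(\<phi> has_derivative (%h. \<Sum>i\<in>Basis. (h \<bullet> i) *\<^sub>R partial i \<phi> y)) (at y within closed_segment x (x + h))"
        by (rule has_derivative_at_withinI[OF test_has_derivative[OF assms]])
      have yx: "norm (y - x) <= norm h" using segment_bound(1)[OF y] by simp
      have "onorm (%i. (\<Sum>j\<in>Basis. (i \<bullet> j) *\<^sub>R partial j \<phi> y) - (\<Sum>j\<in>Basis. (i \<bullet> j) *\<^sub>R partial j \<phi> x)) <= (\<Sum>i\<in>Basis. B i) * norm h"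
      proof (rule onorm_le)
        fix k :: 'a
        have "norm ((\<Sum>j\<in>Basis. (k \<bullet> j) *\<^sub>R partial j \<phi> y) - (\<Sum>j\<in>Basis. (k \<bullet> j) *\<^sub>R partial j \<phi> x))
          = norm (\<Sum>j\<in>Basis. (k \<bullet> j) *\<^sub>R (partial j \<phi> y - partial j \<phi> x))"
          by (simp add: sum_subtractf scaleR_diff_right)
        also have "\<dots> <= (\<Sum>j\<in>Basis. \<bar>k \<bullet> j\<bar> * norm (partial j \<phi> y - partial j \<phi> x))"
          by (rule order_trans[OF norm_sum]) simp
        also have "\<dots> <= (\<Sum>j\<in>Basis. norm k * (B j * norm h))"
        proof (intro sum_mono mult_mono)
          fix j :: 'a assume j: "j \<in> Basis"
          have "norm (partial j \<phi> y - partial j \<phi> x) <= B j * norm (y - x)" by (rule B(1)[OF j])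
          also have "\<dots> <= B j * norm h" using B(2)[OF j] yx by (intro mult_left_mono) auto
          finally show "norm (partial j \<phi> y - partial j \<phi> x) <= B j * norm h" .
        qed (auto simp: Basis_le_norm)
        finally show "norm ((\<Sum>j\<in>Basis. (k \<bullet> j) *\<^sub>R partial j \<phi> y) - (\<Sum>j\<in>Basis. (k \<bullet> j) *\<^sub>R partial j \<phi> x)) <= (\<Sum>i\<in>Basis. B i) * norm h * norm k"
          by (simp add: sum_distrib_left sum_distrib_right mult_ac)
      qed
      thus "onorm ((%h. \<Sum>i\<in>Basis. (h \<bullet> i) *\<^sub>R partial i \<phi> y) - (%h. \<Sum>i\<in>Basis. (h \<bullet> i) *\<^sub>R partial i \<phi> x)) <= (\<Sum>i\<in>Basis. B i) * norm h"
        by (simp add: fun_diff_def)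
    qed auto
    thus ?thesis by (simp add: power2_eq_square mult_ac)
  qed
  moreover have "0 < (\<Sum>i\<in>(Basis::'a set). B i)" using B by (intro sum_pos) auto
  ultimately show ?thesis by blast
qed

subsection \<open>Box bumps\<close>

text \<open>For large \<open>m\<close> each factor is close to the indicator of a half-line, and the product to that of the box.\<close>

definition box_bump :: "real => 'a => 'a => 'a::euclidean_space => real" where
  "box_bump m a b x = (\<Prod>i\<in>Basis. flat 0 (m * (x \<bullet> i - a \<bullet> i)) * flat 0 (m * (b \<bullet> i - x \<bullet> i)))"

lemma flat0: "flat 0 t = (if t <= 0 then 0 else exp (- (1 / t)))" by (simp add: flat_def)

lemma box_bump_range: "0 <= box_bump m a b x" "box_bump m a b x <= 1"
  unfolding box_bump_def
  by (auto intro!: prod_nonneg prod_le_1 mult_le_one simp: flat0)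

lemma box_bump_pos: "0 < m ==> 0 < box_bump m a b x \<longleftrightarrow> x \<in> box a b"
proof -
  assume m: "0 < m"
  have nz: "flat 0 t \<noteq> 0 \<longleftrightarrow> 0 < t" for t by (simp add: flat0)
  have "box_bump m a b x \<noteq> 0 \<longleftrightarrow> x \<in> box a b"
    using m by (auto simp: box_bump_def nz mem_box zero_less_mult_iff)
  thus ?thesis using box_bump_range(1)[of m a b x] by linarith
qed

lemma box_bump_test:
  assumes "0 < m" "cbox a b \<subseteq> S" shows "(%x. cplx (box_bump m a b x)) \<in> test_functions S"
proof (rule test_functionsI[of _ "cbox a b"])
  have e: "m * (b \<bullet> i - x \<bullet> i) = (- m) * (x \<bullet> i) + m * (b \<bullet> i)" "m * (x \<bullet> i - a \<bullet> i) = m * (x \<bullet> i) + (- (m * (a \<bullet> i)))" for x i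
    by (auto simp: algebra_simps)
  show "Ck_fun k (%x. cplx (box_bump m a b x))" for k
    unfolding box_bump_def of_real_prod of_real_mult e by (intro Ck_prod Ck_mult Ck_flat)
  show "x \<in> cbox a b" if "cplx (box_bump m a b x) \<noteq> 0" for x
    using that box_bump_pos[OF assms(1), of a b x] box_bump_range(1)[of m a b x] box_subset_cbox by fastforce
qed (use assms in auto)

lemma box_bump_tendsto: "(%n. box_bump (real (Suc n)) a b x) \<leadsto> indicator (box a b) x"
proof -
  have f: "(%n. flat 0 (real (Suc n) * t)) \<leadsto> (if 0 < t then 1 else 0)" for t
  proof (cases "0 < t")
    case True
    have "(%n. exp (- ((1 / t) * (1 / real (Suc n))))) \<leadsto> exp (- ((1 / t) * 0))"
      by (intro tendsto_intros lim_const_over_n[THEN LIMSEQ_Suc])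
    thus ?thesis using True by (simp add: flat0 mult_le_0_iff mult.commute)
  next
    case False thus ?thesis by (simp add: flat0 mult_nonneg_nonpos)
  qed
  have "(%n. box_bump (real (Suc n)) a b x) \<leadsto>
    (\<Prod>i\<in>Basis. (if 0 < x \<bullet> i - a \<bullet> i then 1 else 0) * (if 0 < b \<bullet> i - x \<bullet> i then 1 else 0))"
    unfolding box_bump_def by (intro tendsto_intros f)
  also have "(\<Prod>i\<in>Basis. (if 0 < x \<bullet> i - a \<bullet> i then 1 else 0) * (if 0 < b \<bullet> i - x \<bullet> i then 1 else 0)) = (indicator (box a b) x :: real)"
  proof (cases "x \<in> box a b")
    case True thus ?thesis by (auto simp: mem_box intro!: prod.neutral)
  next
    case False
    then obtain i where "i \<in> Basis" "\<not> (0 < x \<bullet> i - a \<bullet> i & 0 < b \<bullet> i - x \<bullet> i)" by (auto simp: mem_box)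
    thus ?thesis using False by (auto intro!: bexI[of _ i] prod_zero)
  qed
  finally show ?thesis .
qed

section \<open>Eigenvalues of the operator associated with a form\<close>

locale l2form = hform fscale "L2 M" "l2_inner M" Q q
  for M :: "'a measure" and Q :: "('a => complex) set" and q
begin

abbreviation "T \<equiv> form_operator M Q q"

lemma eigenspace_iff:
  "u \<in> op_eigenspace T z \<longleftrightarrow> u \<in> Q & (\<forall>v\<in>Q. q u v = z * l2_inner M u v)"
proof -
  have "(%x. z * u x) = fscale z u" by (simp add: fscale_def)
  thus ?thesis using QinH L2_scale[of u M z] H.ip_scale[of u _ z]
    by (auto simp: op_eigenspace_def form_operator_def)
qed

lemma resolvent_setI:
  assumes solv: "\<forall>f\<in>L2 M. \<exists>u\<in>Q. \<forall>v\<in>Q. q u v - z * l2_inner M u v = l2_inner M f v"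
    and bound: "\<exists>C. \<forall>u\<in>Q. \<forall>f\<in>L2 M. (\<forall>v\<in>Q. q u v - z * l2_inner M u v = l2_inner M f v) -->
      sqrt (H.sq u) <= C * sqrt (H.sq f)"
  shows "z \<in> op_resolvent_set M T"
  unfolding op_resolvent_set_def
proof (intro CollectI conjI ballI)
  fix f assume f: "f \<in> L2 M"
  then obtain u where u: "u \<in> Q" "!!v. v \<in> Q ==> q u v - z * l2_inner M u v = l2_inner M f v" using solv by blast
  have eq: "(%x. f x + z * u x) = f + fscale z u" by (simp add: fun_eq_iff)
  have "q u v = l2_inner M (f + fscale z u) v" if v: "v \<in> Q" for v
    using u(2)[OF v] H.ip_add[OF f H.closed(4)[OF QinH[OF u(1)], of z] QinH[OF v]]
      H.ip_scale[OF QinH[OF u(1)] QinH[OF v], of z] by (simp add: algebra_simps)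
  hence "(u, f + fscale z u) \<in> T"
    using u(1) f QinH by (auto simp: form_operator_def intro: H.closed)
  thus "\<exists>u. (u, %x. f x + z * u x) \<in> T" unfolding eq[symmetric] by blast
next
  from bound obtain C where C: "!!u f. u \<in> Q ==> f \<in> L2 M ==>
      (\<forall>v\<in>Q. q u v - z * l2_inner M u v = l2_inner M f v) ==> sqrt (H.sq u) <= C * sqrt (H.sq f)" by blast
  show "\<exists>C. \<forall>(u, f)\<in>T. l2_norm M u <= C * l2_norm M (%x. f x - z * u x)"
  proof (intro exI ballI, clarify)
    fix u f assume "(u, f) \<in> T"
    hence u: "u \<in> Q" "f \<in> L2 M" and eq: "!!v. v \<in> Q ==> q u v = l2_inner M f v"
      by (auto simp: form_operator_def)
    have e: "(%x. f x - z * u x) = f - fscale z u" by (simp add: fun_eq_iff)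
    have zu: "fscale z u \<in> L2 M" using u QinH by (auto intro: H.closed)
    have "\<forall>v\<in>Q. q u v - z * l2_inner M u v = l2_inner M (f - fscale z u) v"
      using eq H.ip_diff[OF u(2) zu QinH] H.ip_scale[OF QinH[OF u(1)] QinH, of _ z] by simp
    from C[OF u(1) H.closed(3)[OF u(2) zu] this]
    show "l2_norm M u <= C * l2_norm M (%x. f x - z * u x)"
      unfolding e l2_norm_sqrt .
  qed
qed

context
  fixes n e l c
  assumes E: "eigfam n e l" and c: "\<forall>u\<in>orthc n e. c * H.sq u <= Q.sq u"
    and c0: "0 < c" and lc: "\<forall>i<n. l i < c"
begin

lemma e_facts: "i < n ==> e i \<in> Q" "i < n ==> e i \<in> L2 M"
  "i < n ==> j < n ==> l2_inner M (e i) (e j) = (if i = j then 1 else 0)"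
  "i < n ==> v \<in> Q ==> q (e i) v = cplx (l i) * l2_inner M (e i) v"
  using E QinH by (auto simp: eigfam_def)

lemma spectrum_below: "z \<in> op_spectrum M T ==> Re z < c ==> \<exists>i<n. z = cplx (l i)"
  using resolvent_setI[OF resolvent_below[OF E c _ _ _]] c0 by (force simp: op_spectrum_def)

text \<open>An eigenvector for \<open>\<mu>\<close> is a combination of the \<open>e i\<close> with \<open>l i = \<mu>\<close>, since a remainder orthogonal to these vanishes by \<open>eigenvector_below\<close>.\<close>

lemma multiplicity_below:
  assumes \<mu>: "\<mu> < c"
  shows "op_multiplicity M T (cplx \<mu>) = enat (card {i. i < n & l i = \<mu>})"
proof -
  define S where "S = {i. i < n & l i = \<mu>}"
  have fS: "finite S" by (simp add: S_def)
  obtain g where g: "bij_betw g {..<card S} S" using fS by (metis ex_bij_betw_nat_finite atLeast0LessThan)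
  have gS: "g j \<in> S" if "j < card S" for j using g that by (auto simp: bij_betw_def)
  have gn: "g j < n" "l (g j) = \<mu>" if "j < card S" for j using gS[OF that] by (auto simp: S_def)
  define P where "P m e' \<longleftrightarrow> (\<forall>i<m. e' i \<in> op_eigenspace T (cplx \<mu>)) &
     (\<forall>b. (AE x in M. (\<Sum>i<m. b i * e' i x) = 0) --> (\<forall>i<m. b i = 0))" for m :: nat and e' :: "nat => 'a => complex"
  have AE: "(AE x in M. (\<Sum>i<m. b i * e' i x) = 0) \<longleftrightarrow> H.sq (\<Sum>i<m. fscale (b i) (e' i)) = 0"
    if "!!i. i < m ==> e' i \<in> L2 M" for m :: nat and b and e' :: "nat => 'a => complex"
  proof -
    have "(\<Sum>i<m. fscale (b i) (e' i)) \<in> L2 M" using that by (intro H.closed_sum H.closed) auto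
    from l2_sq_0_iff[OF this] show ?thesis by (simp add: sum_fun_apply)
  qed
  have upper: "m <= card S" if P: "P m e'" for m e'
  proof (rule ccontr)
    assume "\<not> m <= card S"
    with homogeneous_system_nontrivial[of "{..<m}" "card S" "%i j. l2_inner M (e' i) (e (g j))"] obtain b
      where b: "\<exists>i<m. b i \<noteq> 0" "!!j. j < card S ==> (\<Sum>i<m. b i * l2_inner M (e' i) (e (g j))) = 0" by auto
    have e'Q: "e' i \<in> Q" and e'q: "!!v. v \<in> Q ==> q (e' i) v = cplx \<mu> * l2_inner M (e' i) v" if "i < m" for i
      using P that by (auto simp: P_def eigenspace_iff)
    define u where "u = (\<Sum>i<m. fscale (b i) (e' i))"
    have uQ: "u \<in> Q" unfolding u_def by (intro Q.closed_sum Q.closed e'Q) auto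
    have ipu: "l2_inner M u v = (\<Sum>i<m. b i * l2_inner M (e' i) v)" if v: "v \<in> L2 M" for v
    proof -
      have "l2_inner M u v = (\<Sum>i<m. l2_inner M (fscale (b i) (e' i)) v)" unfolding u_def
        using e'Q QinH v by (intro H.ip_sum H.closed(4)) auto
      also have "\<dots> = (\<Sum>i<m. b i * l2_inner M (e' i) v)"
        using e'Q QinH v by (intro sum.cong H.ip_scale) auto
      finally show ?thesis .
    qed
    have qu: "q u v = cplx \<mu> * l2_inner M u v" if v: "v \<in> Q" for v
    proof -
      have "q u v = (\<Sum>i<m. q (fscale (b i) (e' i)) v)" unfolding u_def
        using e'Q v by (intro Q.ip_sum Q.closed(4)) auto
      also have "\<dots> = (\<Sum>i<m. b i * (cplx \<mu> * l2_inner M (e' i) v))"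
        using e'Q v e'q by (intro sum.cong) (auto simp: Q.ip_scale)
      finally show ?thesis using ipu[OF QinH[OF v]] by (simp add: sum_distrib_left mult.left_commute)
    qed
    have z: "l2_inner M u (e i) = 0" if i: "i < n" "l i = \<mu>" for i
    proof -
      have "i \<in> S" using i by (simp add: S_def)
      hence "i \<in> g ` {..<card S}" using g unfolding bij_betw_def by blast
      then obtain j where j: "j < card S" "g j = i" by blast
      show ?thesis unfolding ipu[OF e_facts(2)[OF i(1)]] using b(2)[OF j(1)] unfolding j(2) .
    qed
    have "H.sq u = 0" by (rule eigenvector_below[OF E c \<mu> uQ qu z])
    hence "AE x in M. (\<Sum>i<m. b i * e' i x) = 0"
      using AE[of m e' b, OF QinH[OF e'Q]] unfolding u_def by blast
    hence "\<forall>i<m. b i = 0" using P unfolding P_def by blast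
    thus False using b(1) by blast
  qed
  have lower: "P (card S) (%j. e (g j))"
    unfolding P_def
  proof (intro conjI allI impI)
    fix j assume "j < card S"
    thus "e (g j) \<in> op_eigenspace T (cplx \<mu>)"
      using gn e_facts(1,4) by (simp add: eigenspace_iff)
  next
    fix b j assume ae: "AE x in M. (\<Sum>i<card S. b i * e (g i) x) = 0" and j: "j < card S"
    have inj: "g i = g k \<longleftrightarrow> i = k" if "i < card S" "k < card S" for i k
      using g that by (auto simp: bij_betw_def inj_on_def)
    have "H.sq (\<Sum>i<card S. fscale (b i) (e (g i))) = 0"
      by (rule iffD1[OF AE[of "card S" "%j. e (g j)" b] ae]) (rule e_facts(2)[OF gn(1)])
    moreover have "H.sq (\<Sum>i<card S. fscale (b i) (e (g i))) = (\<Sum>i<card S. (cmod (b i))^2)"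
      by (rule H.sq_orthonormal_sum) (simp_all add: gn(1) e_facts(2,3) inj)
    ultimately have "(\<Sum>i<card S. (cmod (b i))^2) = 0" by simp
    thus "b j = 0" using j by (simp add: sum_nonneg_eq_0_iff)
  qed
  have "op_multiplicity M T (cplx \<mu>) = Sup {enat m | m. \<exists>e'. P m e'}"
    unfolding op_multiplicity_def P_def ..
  also have "\<dots> = enat (card S)"
  proof (rule antisym)
    show "Sup {enat m | m. \<exists>e'. P m e'} <= enat (card S)" by (rule Sup_least) (use upper in auto)
    show "enat (card S) <= Sup {enat m | m. \<exists>e'. P m e'}" by (rule Sup_upper) (use lower in blast)
  qed
  finally show ?thesis by (simp add: S_def)
qed

lemma eigenvalue_count_below:
  assumes A: "A \<subseteq> {..<c}"
  shows "eigenvalue_count M T A = enat (card {i. i < n & l i \<in> A})"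
proof -
  have F: "(\<Sum>\<mu>\<in>F. op_multiplicity M T (cplx \<mu>)) = enat (card {i. i < n & l i \<in> F})"
    if F: "finite F" "F \<subseteq> A" for F
  proof -
    have "(\<Sum>\<mu>\<in>F. op_multiplicity M T (cplx \<mu>)) = (\<Sum>\<mu>\<in>F. enat (card {i. i < n & l i = \<mu>}))"
      using F A by (intro sum.cong refl multiplicity_below) auto
    also have "\<dots> = enat (\<Sum>\<mu>\<in>F. card {i. i < n & l i = \<mu>})"
      by (induction F rule: infinite_finite_induct) (auto simp: zero_enat_def)
    also have "(\<Sum>\<mu>\<in>F. card {i. i < n & l i = \<mu>}) = card (\<Union>\<mu>\<in>F. {i. i < n & l i = \<mu>})"
      using F by (subst card_UN_disjoint) auto
    also have "(\<Union>\<mu>\<in>F. {i. i < n & l i = \<mu>}) = {i. i < n & l i \<in> F}" by auto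
    finally show ?thesis .
  qed
  show ?thesis unfolding eigenvalue_count_def
  proof (rule antisym)
    show "(SUP F\<in>{F. finite F & F \<subseteq> A}. \<Sum>\<mu>\<in>F. op_multiplicity M T (cplx \<mu>)) <= enat (card {i. i < n & l i \<in> A})"
      using F by (intro SUP_least) (auto intro!: card_mono)
    let ?F = "l ` {i. i < n & l i \<in> A}"
    have eq: "{i. i < n & l i \<in> ?F} = {i. i < n & l i \<in> A}" by auto
    have fA: "finite ?F" "?F \<subseteq> A" by auto
    have "enat (card {i. i < n & l i \<in> A}) = (\<Sum>\<mu>\<in>?F. op_multiplicity M T (cplx \<mu>))"
      using F[OF fA] unfolding eq by (rule sym)
    also have "\<dots> <= (SUP F\<in>{F. finite F & F \<subseteq> A}. \<Sum>\<mu>\<in>F. op_multiplicity M T (cplx \<mu>))"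
      by (rule SUP_upper) (use fA in auto)
    finally show "enat (card {i. i < n & l i \<in> A}) <= (SUP F\<in>{F. finite F & F \<subseteq> A}. \<Sum>\<mu>\<in>F. op_multiplicity M T (cplx \<mu>))" .
  qed
qed

text \<open>Below \<open>c\<close> the spectrum is a finite set of eigenvalues of finite multiplicity, all of which are discrete.\<close>

lemma bottom_ess_ge: "ereal c <= bottom_ess M T"
  unfolding bottom_ess_def
proof (intro INF_greatest)
  fix z assume z: "z \<in> op_essential_spectrum M T"
  hence zs: "z \<in> op_spectrum M T" and nd: "z \<notin> op_discrete_spectrum M T" by (auto simp: op_essential_spectrum_def)
  show "ereal c <= ereal (Re z)"
  proof (rule ccontr)
    assume "\<not> ereal c <= ereal (Re z)"
    hence zc: "Re z < c" by simp
    from spectrum_below[OF zs zc] obtain i where i: "i < n" "z = cplx (l i)" by auto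
    let ?L = "(%i. cplx (l i)) ` {..<n}"
    have "\<not> z islimpt op_spectrum M T"
    proof
      assume lp: "z islimpt op_spectrum M T"
      have "open ({z. Re z < c} \<inter> - (?L - {z}))"
        by (intro open_Int open_halfspace_Re_lt open_Compl finite_imp_closed) auto
      then obtain y where "y \<in> op_spectrum M T" "y \<in> {z. Re z < c} \<inter> - (?L - {z})" "y \<noteq> z"
        using lp zc unfolding islimpt_def by (metis (no_types, lifting) ComplI DiffD2 IntI insertI1 mem_Collect_eq)
      thus False using spectrum_below[of y] by auto
    qed
    moreover have "op_multiplicity M T z = enat (card {j. j < n & l j = l i})"
      unfolding i(2) using lc i(1) by (intro multiplicity_below) auto
    moreover have "0 < card {j. j < n & l j = l i}" using i(1) by (auto simp: card_gt_0_iff)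
    ultimately have "z \<in> op_discrete_spectrum M T" using zs by (simp add: op_discrete_spectrum_def zero_enat_def)
    thus False using nd by simp
  qed
qed

lemma lambda_k_below:
  assumes k: "1 <= k" "k <= n"
  shows "lambda_k M T k = ereal (l (k - 1))"
proof -
  have mono: "i <= j ==> j < n ==> l i <= l j" for i j using E by (auto simp: eigfam_def)
  have "enat k <= eigenvalue_count M T {..<c}"
  proof -
    have "{i. i < n & l i \<in> {..<c}} = {..<n}" using lc by auto
    thus ?thesis using eigenvalue_count_below[of "{..<c}"] k by simp
  qed
  also have "\<dots> <= eigenvalue_count M T {t. ereal t < bottom_ess M T}"
    unfolding eigenvalue_count_def
  proof (rule SUP_subset_mono)
    have "{..<c} \<subseteq> {t. ereal t < bottom_ess M T}"
      using bottom_ess_ge by (auto intro: less_le_trans[of _ "ereal c"])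
    thus "{F. finite F & F \<subseteq> {..<c}} \<subseteq> {F. finite F & F \<subseteq> {t. ereal t < bottom_ess M T}}" by auto
  qed simp
  finally have "lambda_k M T k = ereal (LEAST t. enat k <= eigenvalue_count M T {..t})"
    by (simp add: lambda_k_def)
  also have "(LEAST t. enat k <= eigenvalue_count M T {..t}) = l (k - 1)"
  proof (rule Least_equality)
    have lk: "l (k - 1) < c" using lc k by auto
    have "{..<k} \<subseteq> {i. i < n & l i \<in> {..l (k - 1)}}" using mono k by auto
    hence "card {..<k} <= card {i. i < n & l i \<in> {..l (k - 1)}}" by (intro card_mono) auto
    thus "enat k <= eigenvalue_count M T {..l (k - 1)}"
      by (subst eigenvalue_count_below) (use lk in auto)
    fix t assume t: "enat k <= eigenvalue_count M T {..t}"
    show "l (k - 1) <= t"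
    proof (rule ccontr)
      assume "\<not> l (k - 1) <= t"
      hence tl: "t < l (k - 1)" by simp
      hence "eigenvalue_count M T {..t} = enat (card {i. i < n & l i \<in> {..t}})"
        using lk by (intro eigenvalue_count_below) auto
      moreover have "{i. i < n & l i \<in> {..t}} \<subseteq> {..<k - 1}"
      proof
        fix i assume i: "i \<in> {i. i < n & l i \<in> {..t}}"
        show "i \<in> {..<k - 1}"
        proof (rule ccontr)
          assume "i \<notin> {..<k - 1}"
          hence "l (k - 1) <= l i" using i mono[of "k - 1" i] by auto
          thus False using i tl by auto
        qed
      qed
      hence "card {i. i < n & l i \<in> {..t}} <= card {..<k - 1}" by (intro card_mono) auto
      ultimately show False using t k by auto
    qed
  qed
  finally show ?thesis .
qed

end

text \<open>Below \<open>c\<close> the counting definition of the eigenvalue, with its case distinction on the essential spectrum, reduces to the ordered list \<open>l\<close>.\<close>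

theorem lambda_k_characterization:
  assumes F: "finite_rank_bound c N f" and c0: "0 < c" and T: "trial k t0" "t0 < c" and k: "1 <= k"
  shows "\<exists>\<nu> e. lambda_k M T k = ereal \<nu> & 0 <= \<nu> & (\<forall>i<k. e i \<in> Q) &
    (\<forall>i<k. \<forall>j<k. l2_inner M (e i) (e j) = (if i = j then 1 else 0)) &
    (\<forall>b. Q.sq (comb k b e) <= \<nu> * (\<Sum>i<k. (cmod (b i))^2)) &
    (\<forall>t<c. trial k t --> \<nu> <= t)"
proof -
  from eigenbasis_below[OF F] obtain n e l where E: "eigfam n e l" and lc: "\<forall>i<n. l i < c"
    and c: "\<forall>u\<in>orthc n e. c * H.sq u <= Q.sq u" by blast
  have kn: "k <= n" using trial_eigfam(1)[OF E c T k] .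
  have Ek: "eigfam k e l" using E kn unfolding eigfam_def by auto
  have lk: "lambda_k M T k = ereal (l (k - 1))" by (rule lambda_k_below[OF E c c0 lc k kn])
  note ef = e_facts[OF E c c0 lc]
  have qb: "Q.sq (comb k b e) <= l (k - 1) * (\<Sum>i<k. (cmod (b i))^2)" for b
    unfolding eigfam_q_sum[OF Ek] sum_distrib_left
    using Ek k by (intro sum_mono mult_right_mono) (auto simp: eigfam_def)
  have "0 <= Q.sq (e (k - 1))" using ef(1) kn k by (intro Q.ip_pos) auto
  also have "Q.sq (e (k - 1)) = l (k - 1)"
    using ef(4)[of "k - 1" "e (k - 1)"] ef(1)[of "k - 1"] ef(3)[of "k - 1" "k - 1"] kn k by auto
  finally have "0 <= l (k - 1)" .
  thus ?thesis using lk qb ef kn trial_eigfam(2)[OF E c _ _ k]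
    by (intro exI[of _ "l (k - 1)"] exI[of _ e]) auto
qed

end

section \<open>Test functions and integration\<close>

lemma lborel_integral_translate:
  fixes f :: "'a::euclidean_space => 'b::{banach, second_countable_topology}"
  assumes [measurable]: "f \<in> borel_measurable borel"
  shows "(LINT x|lborel. f (a + x)) = (LINT x|lborel. f x)"
proof -
  have "(LINT x|lborel. f x) = (LINT x|distr lborel borel ((+) a). f x)" by (simp add: lborel_distr_plus)
  also have "\<dots> = (LINT x|lborel. f (a + x))" by (rule integral_distr) auto
  finally show ?thesis ..
qed

lemma test_support_ball:
  assumes "\<phi> \<in> test_functions S"
  shows "\<exists>R>0. \<forall>x. norm x > R --> \<phi> x = 0 & (\<forall>i. partial i \<phi> x = 0)"
proof -
  obtain K where K: "compact K" "!!x. \<phi> x \<noteq> 0 ==> x \<in> K" "!!i x. partial i \<phi> x \<noteq> 0 ==> x \<in> K"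
    using test_functionsD(2)[OF assms] by blast
  obtain R where "R > 0" "!!x. x \<in> K ==> norm x <= R"
    using compact_imp_bounded[OF K(1)] unfolding bounded_pos by auto
  thus ?thesis using K by (intro exI[of _ R]) (auto simp: not_le[symmetric])
qed

lemma test_borel: "\<phi> \<in> test_functions S ==> \<phi> \<in> borel_measurable borel"
  by (intro borel_measurable_continuous_onI test_continuous)

lemma bounded_support_integrable:
  fixes f :: "'a::euclidean_space => 'b::{banach, second_countable_topology}"
  assumes "f \<in> borel_measurable lborel" "!!x. norm (f x) <= B" "!!x. norm x > R ==> f x = 0"
  shows "integrable lborel f"
proof (rule integrableI_bounded_set[of "cball 0 R" _ _ B])
  show "emeasure lborel (cball 0 R :: 'a set) < \<infinity>" by (rule emeasure_bounded_finite) auto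
qed (use assms in \<open>auto intro!: AE_I2\<close>)

lemma test_integrable:
  assumes "\<phi> \<in> test_functions S" shows "integrable lborel \<phi>" "integrable lborel (%x. (norm (\<phi> x))^2)"
proof -
  obtain R where R: "!!x. norm x > R ==> \<phi> x = 0" using test_support_ball[OF assms] by blast
  obtain B where B: "!!x. norm (\<phi> x) <= B" using test_bounded[OF assms] by blast
  have [measurable]: "\<phi> \<in> borel_measurable borel" by (rule test_borel[OF assms])
  show "integrable lborel \<phi>" by (rule bounded_support_integrable[of _ B R]) (use R B in auto)
  show "integrable lborel (%x. (norm (\<phi> x))^2)"
    by (rule bounded_support_integrable[of _ "B^2" R]) (use R B in \<open>auto intro!: power_mono\<close>)
qed

lemma L2_lborel_lebesgue: "u \<in> L2 lborel ==> u \<in> L2 lebesgue"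
  by (auto simp: L2_def integrable_completion borel_measurable_subalgebra intro: measurable_completion)

lemma l2_lborel_lebesgue:
  assumes "u \<in> borel_measurable lborel" "v \<in> borel_measurable lborel"
  shows "l2_inner lebesgue u v = l2_inner lborel u v"
  unfolding l2_inner_def using assms borel_measurable_continuous_onI[OF continuous_on_cnj[OF continuous_on_id]]
  by (intro integral_completion) (auto intro!: borel_measurable_times measurable_compose[where f = v])

lemma L2_restrict: "S \<in> sets M ==> u \<in> L2 M ==> u \<in> L2 (restrict_space M S)"
  by (auto simp: L2_def integrable_restrict_space simp del: real_scaleR_def
      intro: measurable_restrict_space1 integrable_mult_indicator)

lemma test_L2_lborel: "\<phi> \<in> test_functions S ==> \<phi> \<in> L2 lborel"
  using test_borel test_integrable by (auto simp: L2_def)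

lemma test_L2: "\<phi> \<in> test_functions S ==> A \<in> sets lebesgue ==> \<phi> \<in> L2 (lebesgue_on A)"
  by (intro L2_restrict L2_lborel_lebesgue test_L2_lborel)

lemma test_L2_UNIV: "\<phi> \<in> test_functions S ==> \<phi> \<in> L2 lebesgue"
  by (intro L2_lborel_lebesgue test_L2_lborel)

lemma norm_shift_gt: "R + 1 < norm x ==> norm h <= 1 ==> R < norm (h + x)"
  using norm_triangle_ineq4[of "h + x" h] by simp

text \<open>The integral of a translate is constant in the translation, and its difference quotients tend to the integral of the derivative.\<close>

theorem integral_partial_eq_0:
  assumes \<phi>: "\<phi> \<in> test_functions S" and i: "i \<in> Basis"
  shows "(LINT x|lborel. partial i \<phi> x) = 0"
proof -
  obtain R where R: "R > 0" "!!x. norm x > R ==> \<phi> x = 0" using test_support_ball[OF \<phi>] by blast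
  obtain B where B: "B > 0" "!!x y. norm (\<phi> x - \<phi> y) <= B * norm (x - y)" using test_lipschitz[OF \<phi>] by blast
  obtain C where C: "C > 0" "!!x h. norm (\<phi> (x + h) - \<phi> x - (\<Sum>i\<in>Basis. (h \<bullet> i) *\<^sub>R partial i \<phi> x)) <= C * (norm h)^2"
    using test_taylor[OF \<phi>] by blast
  have [measurable]: "\<phi> \<in> borel_measurable borel" by (rule test_borel[OF \<phi>])
  define s where "s n x = real (Suc n) *\<^sub>R (\<phi> ((1 / real (Suc n)) *\<^sub>R i + x) - \<phi> x)" for n x
  have "(%n. LINT x|lborel. s n x) \<leadsto> (LINT x|lborel. partial i \<phi> x)"
  proof (rule integral_dominated_convergence[where w = "%x. B * indicator (cball 0 (R + 1)) x"])
    show "partial i \<phi> \<in> borel_measurable lborel" using test_borel[OF test_partial[OF \<phi> i]] by simp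
    show "s n \<in> borel_measurable lborel" for n unfolding s_def by measurable
    show "integrable lborel (%x::'a. B * indicator (cball 0 (R + 1)) x)"
      by (intro integrable_mult_right integrable_real_indicator emeasure_bounded_finite) auto
    show "AE x in lborel. (%n. s n x) \<leadsto> partial i \<phi> x"
    proof (rule AE_I2)
      fix x :: 'a
      have "norm (s n x - partial i \<phi> x) <= C * (1 / real (Suc n))" for n
      proof -
        define t where "t = 1 / real (Suc n)"
        have t: "t > 0" "real (Suc n) = 1 / t" by (auto simp: t_def)
        have "(\<Sum>j\<in>Basis. ((t *\<^sub>R i) \<bullet> j) *\<^sub>R partial j \<phi> x) = t *\<^sub>R partial i \<phi> x"
          using i by (simp add: inner_Basis if_distrib[of "%c. c *\<^sub>R _"] if_distrib[of "%c. _ * c"] cong: if_cong)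
        hence "norm (\<phi> (x + t *\<^sub>R i) - \<phi> x - t *\<^sub>R partial i \<phi> x) <= C * t^2"
          using C(2)[of x "t *\<^sub>R i"] i t by simp
        moreover have "s n x - partial i \<phi> x = (1 / t) *\<^sub>R (\<phi> (x + t *\<^sub>R i) - \<phi> x - t *\<^sub>R partial i \<phi> x)"
          using t by (simp add: s_def scaleR_diff_right add.commute)
        ultimately have "norm (s n x - partial i \<phi> x) <= (1 / t) * (C * t^2)"
          using t by (simp add: divide_right_mono)
        thus ?thesis using t by (simp add: power2_eq_square t_def)
      qed
      hence "(%n. s n x - partial i \<phi> x) \<leadsto> 0"
        by (rule Lim_null_comparison[OF always_eventually[OF allI] tendsto_mult_right_zero[OF lim_const_over_n[THEN LIMSEQ_Suc, of 1]]])
      thus "(%n. s n x) \<leadsto> partial i \<phi> x" by (rule LIM_zero_cancel)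
    qed
    show "AE x in lborel. norm (s n x) <= B * indicator (cball 0 (R + 1)) x" for n
    proof (rule AE_I2)
      fix x :: 'a
      let ?h = "(1 / real (Suc n)) *\<^sub>R i"
      have h: "norm ?h <= 1" using i by (simp add: field_simps)
      show "norm (s n x) <= B * indicator (cball 0 (R + 1)) x"
      proof (cases "norm x <= R + 1")
        case True
        have "norm (s n x) <= real (Suc n) * (B * norm (?h + x - x))"
          unfolding s_def norm_scaleR using B(2)[of "?h + x" x] by (simp only: abs_of_nat mult_left_mono of_nat_0_le_iff)
        also have "\<dots> = B" using i by simp
        finally show ?thesis using True by simp
      next
        case False
        hence "norm (?h + x) > R" using h by (intro norm_shift_gt) auto
        thus ?thesis using False R by (simp add: s_def)
      qed
    qed
  qed
  moreover have "(LINT x|lborel. s n x) = 0" for n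
  proof -
    have it: "integrable lborel (%x. \<phi> ((1 / real (Suc n)) *\<^sub>R i + x))"
    proof -
      obtain D where D: "!!x. norm (\<phi> x) <= D" using test_bounded[OF \<phi>] by blast
      show ?thesis
      proof (rule bounded_support_integrable[of _ D "R + 1"])
        fix x :: 'a assume "R + 1 < norm x"
        moreover have "norm ((1 / real (Suc n)) *\<^sub>R i) <= 1" using i by (simp add: field_simps)
        ultimately have "norm ((1 / real (Suc n)) *\<^sub>R i + x) > R" by (intro norm_shift_gt)
        thus "\<phi> ((1 / real (Suc n)) *\<^sub>R i + x) = 0" by (rule R(2))
      qed (use D in auto)
    qed
    show ?thesis unfolding s_def
      using test_integrable(1)[OF \<phi>] it lborel_integral_translate[of \<phi> "(1 / real (Suc n)) *\<^sub>R i"] by simp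
  qed
  ultimately show ?thesis by (simp add: LIMSEQ_const_iff)
qed

lemma partial_mult:
  assumes "Ck_fun (Suc 0) \<phi>" "Ck_fun (Suc 0) \<psi>"
  shows "partial i (%x. \<phi> x * \<psi> x) x = \<phi> x * partial i \<psi> x + partial i \<phi> x * \<psi> x"
  using partial_eq[OF has_derivative_mult[OF Ck_SucD(1)[OF assms(1)] Ck_SucD(1)[OF assms(2)]]]
  by (simp add: partial_def)

lemma smooth_partial: "(!!k. Ck_fun k f) ==> i \<in> Basis ==> Ck_fun k (partial i f)"
  using Ck_fun.simps(2)[of k f] by blast

lemma smooth_borel: "(!!k. Ck_fun k f) ==> f \<in> borel_measurable borel"
  using Ck_fun.simps(1)[of f] by (intro borel_measurable_continuous_onI) blast

lemma smooth_integration_by_parts: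
  assumes "!!k. Ck_fun k \<phi>" "\<psi> \<in> test_functions T" "i \<in> Basis"
  shows "(LINT x|lborel. \<phi> x * partial i \<psi> x) = - (LINT x|lborel. partial i \<phi> x * \<psi> x)"
proof -
  have "(LINT x|lborel. partial i (%x. \<phi> x * \<psi> x) x) = 0"
    by (rule integral_partial_eq_0[OF test_mult[OF assms(2,1)] assms(3)])
  moreover have "integrable lborel (%x. \<phi> x * partial i \<psi> x)"
    by (rule test_integrable(1)[OF test_mult[OF test_partial[OF assms(2,3)] assms(1)]])
  moreover have "integrable lborel (%x. partial i \<phi> x * \<psi> x)"
    by (rule test_integrable(1)[OF test_mult[OF assms(2) smooth_partial[OF assms(1,3)]]])
  ultimately show ?thesis
    by (simp add: partial_mult[OF assms(1) test_functionsD(1)[OF assms(2)]] eq_neg_iff_add_eq_0)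
qed

section \<open>The fundamental lemma of the calculus of variations\<close>

lemma borel_representative:
  fixes f :: "'a::euclidean_space => complex"
  assumes "f \<in> borel_measurable lebesgue"
  shows "\<exists>g\<in>borel_measurable borel. AE x in lebesgue. f x = g x"
proof -
  have "(%x. Re (f x)) \<in> borel_measurable lebesgue" "(%x. Im (f x)) \<in> borel_measurable lebesgue"
    using assms by measurable
  then obtain a b where ab: "a \<in> borel_measurable lborel" "AE x in lborel. Re (f x) = a x"
      "b \<in> borel_measurable lborel" "AE x in lborel. Im (f x) = b x"
    using completion_ex_borel_measurable_real by metis
  have "AE x in lborel. f x = Complex (a x) (b x)"
    using ab(2,4) by eventually_elim (simp add: complex_eq_iff)
  hence "AE x in lebesgue. f x = Complex (a x) (b x)" by (rule AE_completion)
  moreover have "(%x. Complex (a x) (b x)) \<in> borel_measurable borel"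
    using ab(1,3) by (simp add: borel_measurable_complex_iff)
  ultimately show ?thesis by (rule bexI)
qed

text \<open>Boxes generate the Borel sets and are stable under intersection.\<close>

lemma zero_if_zero_on_boxes:
  fixes F :: "'a::euclidean_space => complex"
  assumes F: "integrable lborel F" and box: "!!a b. (LINT x|lborel. indicator (box a b) x *\<^sub>R F x) = 0"
    and all: "(LINT x|lborel. F x) = 0"
  shows "AE x in lborel. F x = 0"
proof (rule sigma_finite_measure.density_zero[OF sigma_finite_lborel F])
  fix A :: "'a set" assume "A \<in> sets lborel"
  have sb: "sets (borel :: 'a measure) = sigma_sets UNIV (range (%(a, b). box a b))"
    by (subst borel_eq_box) (rule sets_measure_of, simp)
  have A: "A \<in> sigma_sets UNIV (range (%(a, b). box a b))"
    using \<open>A \<in> sets lborel\<close> unfolding sets_lborel sb .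
  have Is: "Int_stable (range (%(a, b). box a b :: 'a set))"
    by (auto simp: Int_stable_def box_Int_box)
  have si: "set_integrable lborel B F" if "B \<in> sigma_sets UNIV (range (%(a, b). box a b))" for B
    unfolding set_integrable_def using F that by (intro integrable_mult_indicator) (simp_all only: sets_lborel sb)
  show "(LINT x:A|lborel. F x) = 0"
  proof (rule sigma_sets_induct_disjoint[OF Is _ A])
    show "range (%(a, b). box a b) \<subseteq> Pow (UNIV :: 'a set)" by simp
  next
    fix B :: "'a set" assume "B \<in> range (%(a, b). box a b)"
    thus "(LINT x:B|lborel. F x) = 0" by (auto simp: box set_lebesgue_integral_def)
  next
    show "(LINT x:{}|lborel. F x) = 0" by (simp add: set_lebesgue_integral_def)
  next
    fix B :: "'a set" assume B: "B \<in> sigma_sets UNIV (range (%(a, b). box a b))" "(LINT x:B|lborel. F x) = 0"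
    have "(LINT x:(UNIV - B)|lborel. F x) = (LINT x|lborel. F x - indicator B x *\<^sub>R F x)"
      unfolding set_lebesgue_integral_def by (intro Lintegral_cong) (auto split: split_indicator)
    also have "\<dots> = (LINT x|lborel. F x) - (LINT x|lborel. indicator B x *\<^sub>R F x)"
      using F si[OF B(1)] by (intro Lintegral_diff) (auto simp: set_integrable_def)
    finally show "(LINT x:(UNIV - B)|lborel. F x) = 0" using all B(2) by (simp add: set_lebesgue_integral_def)
  next
    fix B :: "nat => 'a set" assume B: "disjoint_family B" "range B \<subseteq> sigma_sets UNIV (range (%(a, b). box a b))"
      "!!i. (LINT x:(B i)|lborel. F x) = 0"
    have "(LINT x:(\<Union>i. B i)|lborel. F x) = (\<Sum>i. (LINT x:(B i)|lborel. F x))"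
    proof (rule lebesgue_integral_countable_add)
      show "B i \<in> sets lborel" for i using B(2) unfolding sets_lborel sb by blast
      show "i \<noteq> j ==> B i \<inter> B j = {}" for i j using B(1) by (auto simp: disjoint_family_on_def)
      show "set_integrable lborel (\<Union> (range B)) F" using B(2) by (intro si sigma_sets.Union) auto
    qed
    thus "(LINT x:(\<Union>i. B i)|lborel. F x) = 0" using B(3) by simp
  qed
qed

text \<open>Testing with a test function times \<open>box_bump\<close> and letting the bumps tend to the indicator leaves zero integrals over all boxes.\<close>

theorem du_Bois_Reymond:
  fixes S :: "'a::euclidean_space set"
  assumes S: "open S" and g: "g \<in> L2 (lebesgue_on S)"
    and z: "!!\<phi>. \<phi> \<in> test_functions S ==> (LINT x|lebesgue_on S. g x * \<phi> x) = 0"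
  shows "AE x in lebesgue_on S. g x = 0"
proof -
  have Sm: "S \<in> sets lebesgue" using S by (simp add: borel_open)
  define G where "G x = indicator S x *\<^sub>R g x" for x
  have G: "G \<in> L2 lebesgue"
  proof (rule L2I)
    show "G \<in> borel_measurable lebesgue" unfolding G_def[abs_def]
      using L2_measurable[OF g] Sm by (simp add: borel_measurable_restrict_space_iff)
    have "integrable lebesgue (%x. indicator S x *\<^sub>R (norm (g x))^2)"
      using L2_integrable[OF g] Sm by (simp add: integrable_restrict_space)
    moreover have "(%x. indicator S x *\<^sub>R (norm (g x))^2) = (%x. (norm (G x))^2)"
      by (auto simp: G_def fun_eq_iff split: split_indicator)
    ultimately show "integrable lebesgue (%x. (norm (G x))^2)" by simp
  qed
  obtain G' where G'm [measurable]: "G' \<in> borel_measurable borel" and G': "AE x in lebesgue. G x = G' x"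
    using borel_representative[OF L2_measurable[OF G]] by blast
  have G'2: "G' \<in> L2 lborel"
  proof (rule L2I)
    have "integrable lebesgue (%x. (norm (G' x))^2)"
      by (rule integrable_cong_AE_imp[OF L2_integrable[OF G]]) (use G' in \<open>auto simp: measurable_completion\<close>)
    thus "integrable lborel (%x. (norm (G' x))^2)" by (simp add: integrable_completion)
  qed simp
  have zG: "(LINT x|lborel. G' x * \<phi> x) = 0" if \<phi>: "\<phi> \<in> test_functions S" for \<phi>
  proof -
    have [measurable]: "\<phi> \<in> borel_measurable borel" by (rule test_borel[OF \<phi>])
    have "(LINT x|lborel. G' x * \<phi> x) = (LINT x|lebesgue. G' x * \<phi> x)"
      by (rule integral_completion[symmetric]) measurable
    also have "\<dots> = (LINT x|lebesgue. G x * \<phi> x)"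
    proof (rule integral_cong_AE)
      have p: "\<phi> \<in> borel_measurable lebesgue" by (intro measurable_completion) simp
      show "(%x. G x * \<phi> x) \<in> borel_measurable lebesgue" "(%x. G' x * \<phi> x) \<in> borel_measurable lebesgue"
        using L2_measurable[OF G] p measurable_completion[of G' lborel borel] by simp_all
      show "AE x in lebesgue. G' x * \<phi> x = G x * \<phi> x" using G' by eventually_elim simp
    qed
    also have "\<dots> = (LINT x|lebesgue_on S. g x * \<phi> x)"
      using Sm by (simp add: integral_restrict_space G_def mult.assoc)
    finally show ?thesis using z[OF \<phi>] by simp
  qed
  have ind: "integrable lborel (%x. indicator (cbox a b) x *\<^sub>R G' x)" for a b
  proof -
    have "(%x. cplx (indicator (cbox a b) x)) \<in> L2 lborel"
    proof (rule L2I)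
      have "integrable lborel (indicator (cbox a b) :: 'a => real)"
        by (intro integrable_real_indicator emeasure_bounded_finite) auto
      moreover have "(%x. (norm (cplx (indicator (cbox a b) x)))^2) = indicator (cbox a b)"
        by (auto split: split_indicator)
      ultimately show "integrable lborel (%x. (norm (cplx (indicator (cbox a b) x)))^2)" by simp
    qed measurable
    from L2_mult_integrable[OF this G'2] show ?thesis by (simp add: scaleR_conv_of_real)
  qed
  have zbox: "(LINT x|lborel. indicator (box a b) x *\<^sub>R G' x) = 0" if ab: "cbox a b \<subseteq> S" for a b
  proof -
    have "(%n. LINT x|lborel. G' x * cplx (box_bump (real (Suc n)) a b x)) \<leadsto>
        (LINT x|lborel. indicator (box a b) x *\<^sub>R G' x)"
    proof (rule integral_dominated_convergence[where w = "%x. norm (indicator (cbox a b) x *\<^sub>R G' x)"])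
      have [measurable]: "(%x. cplx (box_bump (real (Suc n)) a b x)) \<in> borel_measurable borel" for n
        by (rule test_borel[OF box_bump_test[OF _ ab]]) simp
      show "(%x. G' x * cplx (box_bump (real (Suc n)) a b x)) \<in> borel_measurable lborel" for n by measurable
      show "AE x in lborel. (%n. G' x * cplx (box_bump (real (Suc n)) a b x)) \<leadsto> indicator (box a b) x *\<^sub>R G' x"
      proof (rule AE_I2)
        fix x
        have "(%n. G' x * cplx (box_bump (real (Suc n)) a b x)) \<leadsto> G' x * cplx (indicator (box a b) x)"
          by (intro tendsto_intros box_bump_tendsto)
        thus "(%n. G' x * cplx (box_bump (real (Suc n)) a b x)) \<leadsto> indicator (box a b) x *\<^sub>R G' x"
          by (simp add: scaleR_conv_of_real mult.commute)
      qed
      show "AE x in lborel. norm (G' x * cplx (box_bump (real (Suc n)) a b x)) <= norm (indicator (cbox a b) x *\<^sub>R G' x)" for n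
      proof (rule AE_I2)
        fix x
        have b: "0 <= box_bump (real (Suc n)) a b x" "box_bump (real (Suc n)) a b x <= 1" by (rule box_bump_range)+
        have "x \<in> cbox a b" if "box_bump (real (Suc n)) a b x \<noteq> 0"
          using that b(1) box_bump_pos[of "real (Suc n)" a b x] box_subset_cbox[of a b] by auto
        thus "norm (G' x * cplx (box_bump (real (Suc n)) a b x)) <= norm (indicator (cbox a b) x *\<^sub>R G' x)"
          using b by (cases "box_bump (real (Suc n)) a b x = 0") (auto simp: norm_mult mult_left_le)
      qed
      show "integrable lborel (%x. norm (indicator (cbox a b) x *\<^sub>R G' x))" using ind by (rule integrable_norm)
    qed measurable
    moreover have "(LINT x|lborel. G' x * cplx (box_bump (real (Suc n)) a b x)) = 0" for n
      by (rule zG[OF box_bump_test[OF _ ab]]) simp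
    ultimately show ?thesis by (simp add: LIMSEQ_const_iff)
  qed
  have loc: "AE x in lborel. x \<in> box c d --> G' x = 0" if cd: "cbox c d \<subseteq> S" for c d
  proof -
    have "AE x in lborel. indicator (box c d) x *\<^sub>R G' x = 0"
    proof (rule zero_if_zero_on_boxes)
      have "integrable lborel (%x. indicator (box c d) x *\<^sub>R (indicator (cbox c d) x *\<^sub>R G' x))"
        by (rule integrable_mult_indicator[OF _ ind]) simp
      moreover have "(%x. indicator (box c d) x *\<^sub>R (indicator (cbox c d) x *\<^sub>R G' x)) = (%x. indicator (box c d) x *\<^sub>R G' x)"
        using box_subset_cbox[of c d] by (auto simp: fun_eq_iff split: split_indicator)
      ultimately show "integrable lborel (%x. indicator (box c d) x *\<^sub>R G' x)" by simp
      show "(LINT x|lborel. indicator (box c d) x *\<^sub>R G' x) = 0" by (rule zbox[OF cd])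
      fix a b :: 'a
      obtain a' b' where ab': "box a b \<inter> box c d = box a' b'" unfolding box_Int_box by blast
      have "(LINT x|lborel. indicator (box a b) x *\<^sub>R indicator (box c d) x *\<^sub>R G' x) = (LINT x|lborel. indicator (box a' b') x *\<^sub>R G' x)"
        unfolding ab'[symmetric] by (intro Lintegral_cong) (auto split: split_indicator)
      also have "\<dots> = 0"
      proof (cases "box a' b' = {}")
        case False
        hence "cbox a' b' = closure (box a' b')" by (rule closure_box[symmetric])
        also have "\<dots> \<subseteq> cbox c d" using ab' box_subset_cbox[of c d] by (intro closure_minimal) auto
        finally show ?thesis using cd by (intro zbox) auto
      qed simp
      finally show "(LINT x|lborel. indicator (box a b) x *\<^sub>R indicator (box c d) x *\<^sub>R G' x) = 0" .
    qed
    thus ?thesis by eventually_elim auto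
  qed
  define \<B> where "\<B> = {box c d | c d :: 'a. cbox c d \<subseteq> S}"
  obtain \<C> where \<C>: "\<C> \<subseteq> \<B>" "countable \<C>" "\<Union>\<C> = \<Union>\<B>"
    by (rule Lindelof[of \<B>]) (auto simp: \<B>_def open_box)
  have cover: "S \<subseteq> \<Union>\<C>"
  proof
    fix x assume "x \<in> S"
    then obtain a b where "cbox a b \<subseteq> S" "x \<in> box a b" using open_contains_cbox[OF S] by metis
    thus "x \<in> \<Union>\<C>" unfolding \<C>(3) \<B>_def by blast
  qed
  have "AE x in lborel. \<forall>B\<in>\<C>. x \<in> B --> G' x = 0"
    using \<C>(1,2) loc by (subst AE_ball_countable) (auto simp: \<B>_def)
  hence "AE x in lborel. x \<in> S --> G' x = 0" by eventually_elim (use cover in blast)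
  hence "AE x in lebesgue. x \<in> S --> G' x = 0" by (rule AE_completion)
  with G' have "AE x in lebesgue. x \<in> S --> g x = 0"
    by eventually_elim (auto simp: G_def)
  thus ?thesis using Sm by (simp add: AE_restrict_space_iff)
qed

section \<open>Sobolev spaces\<close>

lemma l2_inner_cong_AE:
  assumes "u \<in> L2 M" "u' \<in> L2 M" "v \<in> L2 M" "v' \<in> L2 M" "AE x in M. u x = u' x" "AE x in M. v x = v' x"
  shows "l2_inner M u v = l2_inner M u' v'"
  unfolding l2_inner_def
proof (rule integral_cong_AE)
  show "AE x in M. u x * cnj (v x) = u' x * cnj (v' x)" using assms(5,6) by eventually_elim simp
qed (intro borel_measurable_integrable L2_inner_integrable assms)+

lemma integral_lebesgue_on_test:
  assumes "S \<in> sets lebesgue" "!!x. x \<notin> S ==> \<psi> x = 0"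
  shows "(LINT x|lebesgue_on S. f x * \<psi> x) = (LINT x|lebesgue. f x * \<psi> x :: complex)"
proof -
  have "(LINT x|lebesgue_on S. f x * \<psi> x) = (LINT x|lebesgue. indicator S x *\<^sub>R (f x * \<psi> x))"
    using assms(1) by (simp add: integral_restrict_space)
  also have "\<dots> = (LINT x|lebesgue. f x * \<psi> x)"
    using assms(2) by (intro Lintegral_cong) (auto split: split_indicator)
  finally show ?thesis .
qed

lemma test_vanish: assumes "\<psi> \<in> test_functions S" "x \<notin> S" shows "\<psi> x = 0" "partial i \<psi> x = 0"
  using test_functionsD(2)[OF assms(1)] assms(2) by blast+

lemma open_sets_lebesgue: "open S ==> S \<in> sets lebesgue" by (simp add: borel_open)

lemma smooth_weak_partial:
  assumes "!!k. Ck_fun k \<phi>" "i \<in> Basis" "S \<in> sets lebesgue"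
  shows "is_weak_partial S i \<phi> (partial i \<phi>)"
  unfolding is_weak_partial_def
proof
  fix \<psi> assume \<psi>: "\<psi> \<in> test_functions S"
  note [measurable] = smooth_borel[OF assms(1)] test_borel[OF \<psi>] test_borel[OF test_partial[OF \<psi> assms(2)]]
     smooth_borel[OF smooth_partial[OF assms(1,2)]]
  have "(LINT x|lebesgue_on S. \<phi> x * partial i \<psi> x) = (LINT x|lborel. \<phi> x * partial i \<psi> x)"
    using test_vanish[OF \<psi>] assms(3) by (subst integral_lebesgue_on_test) (auto intro!: integral_completion)
  also have "\<dots> = - (LINT x|lborel. partial i \<phi> x * \<psi> x)"
    by (rule smooth_integration_by_parts[OF assms(1) \<psi> assms(2)])
  also have "(LINT x|lborel. partial i \<phi> x * \<psi> x) = (LINT x|lebesgue_on S. partial i \<phi> x * \<psi> x)"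
    using test_vanish[OF \<psi>] assms(3) by (subst integral_lebesgue_on_test) (auto intro!: integral_completion[symmetric])
  finally show "(LINT x|lebesgue_on S. \<phi> x * partial i \<psi> x) = - (LINT x|lebesgue_on S. partial i \<phi> x * \<psi> x)" .
qed

lemma test_weak_partial:
  "\<phi> \<in> test_functions T ==> i \<in> Basis ==> S \<in> sets lebesgue ==> is_weak_partial S i \<phi> (partial i \<phi>)"
  by (rule smooth_weak_partial[OF test_functionsD(1)])

lemma weak_partial_add:
  assumes "open S" "i \<in> Basis" "u \<in> L2 (lebesgue_on S)" "v \<in> L2 (lebesgue_on S)" "g \<in> L2 (lebesgue_on S)" "h \<in> L2 (lebesgue_on S)"
    "is_weak_partial S i u g" "is_weak_partial S i v h"
  shows "is_weak_partial S i (u + v) (g + h)"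
  unfolding is_weak_partial_def
proof
  fix \<psi> assume \<psi>: "\<psi> \<in> test_functions S"
  have t: "\<psi> \<in> L2 (lebesgue_on S)" "partial i \<psi> \<in> L2 (lebesgue_on S)"
    using \<psi> assms(1,2) by (auto intro!: test_L2 test_partial open_sets_lebesgue)
  show "(LINT x|lebesgue_on S. (u + v) x * partial i \<psi> x) = - (LINT x|lebesgue_on S. (g + h) x * \<psi> x)"
    using assms(7,8) \<psi> L2_mult_integrable[OF assms(3) t(2)] L2_mult_integrable[OF assms(4) t(2)]
      L2_mult_integrable[OF assms(5) t(1)] L2_mult_integrable[OF assms(6) t(1)]
    by (simp add: distrib_right is_weak_partial_def)
qed

lemma weak_partial_scale:
  assumes "is_weak_partial S i u g" shows "is_weak_partial S i (fscale c u) (fscale c g)"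
  using assms by (simp add: is_weak_partial_def mult.assoc)

lemma weak_partial_spec:
  assumes "u \<in> H1 S" "i \<in> Basis"
  shows "weak_partial S i u \<in> L2 (lebesgue_on S)" "is_weak_partial S i u (weak_partial S i u)"
  using someI_ex[of "%g. g \<in> L2 (lebesgue_on S) & is_weak_partial S i u g"] assms
  by (auto simp: H1_def weak_partial_def)

lemma H1_L2: "u \<in> H1 S ==> u \<in> L2 (lebesgue_on S)" by (simp add: H1_def)

lemma H1I: "u \<in> L2 (lebesgue_on S) ==> (!!i. i \<in> Basis ==> g i \<in> L2 (lebesgue_on S)) ==>
    (!!i. i \<in> Basis ==> is_weak_partial S i u (g i)) ==> u \<in> H1 S"
  by (auto simp: H1_def)

text \<open>Makes the choice in the definition of the weak derivative harmless.\<close>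

lemma weak_partial_unique:
  assumes S: "open S" and i: "i \<in> Basis" and g: "g \<in> L2 (lebesgue_on S)" "h \<in> L2 (lebesgue_on S)"
    "is_weak_partial S i u g" "is_weak_partial S i u h"
  shows "AE x in lebesgue_on S. g x = h x"
proof -
  have "AE x in lebesgue_on S. (g - h) x = 0"
  proof (rule du_Bois_Reymond[OF S l2.closed(3)[OF g(1,2)]])
    fix \<psi> assume \<psi>: "\<psi> \<in> test_functions S"
    have t: "\<psi> \<in> L2 (lebesgue_on S)" using \<psi> S by (intro test_L2 open_sets_lebesgue)
    have "(LINT x|lebesgue_on S. g x * \<psi> x) = (LINT x|lebesgue_on S. h x * \<psi> x)"
      using g(3,4) \<psi> by (simp add: is_weak_partial_def)
    thus "(LINT x|lebesgue_on S. (g - h) x * \<psi> x) = 0"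
      using L2_mult_integrable[OF g(1) t] L2_mult_integrable[OF g(2) t] by (simp add: left_diff_distrib)
  qed
  thus ?thesis by simp
qed

lemma grad_form_eq:
  assumes S: "open S"
    and g: "!!i. i \<in> Basis ==> g i \<in> L2 (lebesgue_on S)" "!!i. i \<in> Basis ==> is_weak_partial S i u (g i)" "u \<in> L2 (lebesgue_on S)"
    and h: "!!i. i \<in> Basis ==> h i \<in> L2 (lebesgue_on S)" "!!i. i \<in> Basis ==> is_weak_partial S i v (h i)" "v \<in> L2 (lebesgue_on S)"
  shows "grad_form S u v = (\<Sum>i\<in>Basis. l2_inner (lebesgue_on S) (g i) (h i))"
  unfolding grad_form_def
proof (intro sum.cong refl l2_inner_cong_AE)
  fix i :: 'a assume i: "i \<in> Basis"
  have u: "u \<in> H1 S" and v: "v \<in> H1 S" using H1I g h by blast+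
  note wu = weak_partial_spec[OF u i] and wv = weak_partial_spec[OF v i]
  show "weak_partial S i u \<in> L2 (lebesgue_on S)" "weak_partial S i v \<in> L2 (lebesgue_on S)" by (rule wu wv)+
  show "g i \<in> L2 (lebesgue_on S)" "h i \<in> L2 (lebesgue_on S)" using g h i by blast+
  show "AE x in lebesgue_on S. weak_partial S i u x = g i x"
    using weak_partial_unique[OF S i wu(1) g(1)[OF i] wu(2) g(2)[OF i]] .
  show "AE x in lebesgue_on S. weak_partial S i v x = h i x"
    using weak_partial_unique[OF S i wv(1) h(1)[OF i] wv(2) h(2)[OF i]] .
qed

lemma H1_subspace: assumes S: "open S" shows "fvec.subspace (H1 S)"
  unfolding fvec.subspace_def
proof (intro conjI ballI allI)
  show "0 \<in> H1 S" by (rule H1I[of _ _ "%i. 0"]) (auto simp: L2_zero is_weak_partial_def)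
  fix u v assume u: "u \<in> H1 S" and v: "v \<in> H1 S"
  show "u + v \<in> H1 S"
    by (rule H1I[of _ _ "%i. weak_partial S i u + weak_partial S i v"])
       (intro L2_add H1_L2[OF u] H1_L2[OF v] weak_partial_spec[OF u] weak_partial_spec[OF v] weak_partial_add S; assumption)+
next
  fix c u assume u: "u \<in> H1 S"
  show "fscale c u \<in> H1 S"
    by (rule H1I[of _ _ "%i. fscale c (weak_partial S i u)"])
       (intro L2_scale H1_L2[OF u] weak_partial_spec[OF u] weak_partial_scale; assumption)+
qed

lemma grad_semi_ip: assumes S: "open S" shows "semi_ip fscale (H1 S) (grad_form S)"
proof unfold_locales
  show "fvec.subspace (H1 S)" by (rule H1_subspace[OF S])
  fix u v w :: "'a => complex"
  assume u: "u \<in> H1 S" and v: "v \<in> H1 S" and w: "w \<in> H1 S"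
  have "grad_form S (u + v) w = (\<Sum>i\<in>Basis. l2_inner (lebesgue_on S) (weak_partial S i u + weak_partial S i v) (weak_partial S i w))"
    by (rule grad_form_eq[OF S]) (intro L2_add H1_L2[OF u] H1_L2[OF v] H1_L2[OF w] weak_partial_spec[OF u] weak_partial_spec[OF v] weak_partial_spec[OF w] weak_partial_add S; assumption)+
  also have "\<dots> = (\<Sum>i\<in>Basis. l2_inner (lebesgue_on S) (weak_partial S i u) (weak_partial S i w) + l2_inner (lebesgue_on S) (weak_partial S i v) (weak_partial S i w))"
    by (rule sum.cong[OF refl], rule l2.ip_add) (intro weak_partial_spec(1) u v w; assumption)+
  finally show "grad_form S (u + v) w = grad_form S u w + grad_form S v w" by (simp add: grad_form_def sum.distrib)
next
  fix u w c assume u: "u \<in> H1 S" and w: "w \<in> H1 S"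
  have "grad_form S (fscale c u) w = (\<Sum>i\<in>Basis. l2_inner (lebesgue_on S) (fscale c (weak_partial S i u)) (weak_partial S i w))"
    by (rule grad_form_eq[OF S]) (intro L2_scale H1_L2[OF u] H1_L2[OF w] weak_partial_spec[OF u] weak_partial_spec[OF w] weak_partial_scale; assumption)+
  also have "\<dots> = (\<Sum>i\<in>Basis. c * l2_inner (lebesgue_on S) (weak_partial S i u) (weak_partial S i w))"
    by (rule sum.cong[OF refl], rule l2.ip_scale) (intro weak_partial_spec(1) u w; assumption)+
  finally show "grad_form S (fscale c u) w = c * grad_form S u w" by (simp add: grad_form_def sum_distrib_left)
next
  fix u v assume u: "u \<in> H1 S" and v: "v \<in> H1 S"
  show "grad_form S v u = cnj (grad_form S u v)"
    unfolding grad_form_def cnj_sum by (rule sum.cong[OF refl], rule l2.ip_sym) (intro weak_partial_spec(1) u v; assumption)+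
next
  fix u assume u: "u \<in> H1 S"
  show "0 <= energy S u"
    unfolding grad_form_def Re_sum by (rule sum_nonneg, rule l2.ip_pos) (intro weak_partial_spec(1) u; assumption)
qed

lemma grad_sq:
  assumes S: "open S"
    and g: "!!i. i \<in> Basis ==> g i \<in> L2 (lebesgue_on S)" "!!i. i \<in> Basis ==> is_weak_partial S i u (g i)" "u \<in> L2 (lebesgue_on S)"
  shows "energy S u = (\<Sum>i\<in>Basis. l2.sq (lebesgue_on S) (g i))"
proof -
  have "grad_form S u u = (\<Sum>i\<in>Basis. l2_inner (lebesgue_on S) (g i) (g i))"
    by (rule grad_form_eq[OF S]) (use g in auto)
  thus ?thesis by simp
qed

lemma weak_partial_diff:
  assumes "open S" "i \<in> Basis" "u \<in> L2 (lebesgue_on S)" "v \<in> L2 (lebesgue_on S)" "g \<in> L2 (lebesgue_on S)" "h \<in> L2 (lebesgue_on S)"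
    "is_weak_partial S i u g" "is_weak_partial S i v h"
  shows "is_weak_partial S i (u - v) (g - h)"
proof -
  have m: "fscale (-1) f = - f" for f :: "'a => complex" by (simp add: fun_eq_iff)
  have "is_weak_partial S i (u + fscale (-1) v) (g + fscale (-1) h)"
    using assms by (intro weak_partial_add weak_partial_scale L2_scale)
  thus ?thesis unfolding m by simp
qed

lemma weak_partial_limit:
  assumes S: "open S" and i: "i \<in> Basis"
    and w: "!!n. w n \<in> L2 (lebesgue_on S)" "!!n. d n \<in> L2 (lebesgue_on S)" "!!n. is_weak_partial S i (w n) (d n)"
    and u: "u \<in> L2 (lebesgue_on S)" "g \<in> L2 (lebesgue_on S)"
    and lim: "(%n. l2.sq (lebesgue_on S) (w n - u)) \<leadsto> 0" "(%n. l2.sq (lebesgue_on S) (d n - g)) \<leadsto> 0"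
  shows "is_weak_partial S i u g"
  unfolding is_weak_partial_def
proof
  fix \<psi> assume \<psi>: "\<psi> \<in> test_functions S"
  have conv: "(%n. LINT x|lebesgue_on S. a n x * \<phi> x) \<leadsto> (LINT x|lebesgue_on S. b x * \<phi> x)"
    if "!!n. a n \<in> L2 (lebesgue_on S)" "b \<in> L2 (lebesgue_on S)" "(%n. l2.sq (lebesgue_on S) (a n - b)) \<leadsto> 0" "\<phi> \<in> test_functions S"
    for a b \<phi>
  proof -
    have "(%x. cnj (\<phi> x)) \<in> L2 (lebesgue_on S)" by (intro test_L2[OF test_cnj[OF that(4)]] open_sets_lebesgue S)
    from l2.tendsto_ip[OF that(1,2) this that(3)] show ?thesis by (simp add: l2_inner_def)
  qed
  have "(%n. LINT x|lebesgue_on S. w n x * partial i \<psi> x) \<leadsto> (LINT x|lebesgue_on S. u x * partial i \<psi> x)"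
    by (rule conv[OF w(1) u(1) lim(1) test_partial[OF \<psi> i]])
  moreover have "(%n. - (LINT x|lebesgue_on S. d n x * \<psi> x)) \<leadsto> - (LINT x|lebesgue_on S. g x * \<psi> x)"
    by (intro tendsto_minus conv[OF w(2) u(2) lim(2) \<psi>])
  moreover have "(LINT x|lebesgue_on S. w n x * partial i \<psi> x) = - (LINT x|lebesgue_on S. d n x * \<psi> x)" for n
    using w(3)[of n] \<psi> by (simp add: is_weak_partial_def)
  ultimately show "(LINT x|lebesgue_on S. u x * partial i \<psi> x) = - (LINT x|lebesgue_on S. g x * \<psi> x)"
    using LIMSEQ_unique by auto
qed

text \<open>Completeness: the functions and their weak derivatives converge in \<open>L2\<close>, and weak derivatives survive the limit.\<close>

theorem H1_l2form: assumes S: "open S" shows "l2form (lebesgue_on S) (H1 S) (grad_form S)"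
proof -
  interpret G: semi_ip fscale "H1 S" "grad_form S" by (rule grad_semi_ip[OF S])
  show ?thesis
  proof (intro l2form.intro hform.intro hform_axioms.intro)
    show "H1 S \<subseteq> L2 (lebesgue_on S)" by (auto simp: H1_def)
    fix w :: "nat => 'a => complex" assume w: "!!n. w n \<in> H1 S" and C: "\<forall>e>0. \<exists>N. \<forall>m\<ge>N. \<forall>n\<ge>N.
      energy S (w m - w n) + l2.sq (lebesgue_on S) (w m - w n) < e"
    define D where "D n i = weak_partial S i (w n)" for n i
    have D: "i \<in> Basis ==> D n i \<in> L2 (lebesgue_on S)" "i \<in> Basis ==> is_weak_partial S i (w n) (D n i)" for n i
      using weak_partial_spec[OF w] by (auto simp: D_def)
    have wL: "w n \<in> L2 (lebesgue_on S)" for n using w H1_L2 by blast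
    have gs: "energy S (w m - w n) = (\<Sum>i\<in>Basis. l2.sq (lebesgue_on S) (D m i - D n i))" for m n
      by (rule grad_sq[OF S]) (intro l2.closed(3) D wL weak_partial_diff S; assumption)+
    have C1: "\<forall>e>0. \<exists>N. \<forall>m\<ge>N. \<forall>n\<ge>N. l2.sq (lebesgue_on S) (w m - w n) < e"
    proof (intro allI impI)
      fix e :: real assume "0 < e"
      from C[rule_format, OF this] obtain N where "\<forall>m\<ge>N. \<forall>n\<ge>N. energy S (w m - w n) + l2.sq (lebesgue_on S) (w m - w n) < e"
        by (elim exE)
      note N = this[rule_format]
      have p: "0 <= energy S (w m - w n)" for m n by (intro G.ip_pos G.closed(3) w)
      have "l2.sq (lebesgue_on S) (w m - w n) < e" if "m \<ge> N" "n \<ge> N" for m n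
        using N[OF that] p[of m n] by linarith
      thus "\<exists>N. \<forall>m\<ge>N. \<forall>n\<ge>N. l2.sq (lebesgue_on S) (w m - w n) < e" by blast
    qed
    have C2: "\<forall>e>0. \<exists>N. \<forall>m\<ge>N. \<forall>n\<ge>N. l2.sq (lebesgue_on S) (D m i - D n i) < e" if i: "i \<in> Basis" for i
    proof (intro allI impI)
      fix e :: real assume "0 < e"
      from C[rule_format, OF this] obtain N where "\<forall>m\<ge>N. \<forall>n\<ge>N. energy S (w m - w n) + l2.sq (lebesgue_on S) (w m - w n) < e"
        by (elim exE)
      note N = this[rule_format]
      have "l2.sq (lebesgue_on S) (D m i - D n i) < e" if "m \<ge> N" "n \<ge> N" for m n
      proof -
        have "l2.sq (lebesgue_on S) (D m i - D n i) <= (\<Sum>i\<in>Basis. l2.sq (lebesgue_on S) (D m i - D n i))"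
          by (rule member_le_sum[OF i]) (auto intro!: l2.ip_pos l2.closed(3) D)
        also have "\<dots> < e" using N[OF that] l2.ip_pos[OF l2.closed(3)[OF wL[of m] wL[of n]]] gs[of m n] by linarith
        finally show ?thesis .
      qed
      thus "\<exists>N. \<forall>m\<ge>N. \<forall>n\<ge>N. l2.sq (lebesgue_on S) (D m i - D n i) < e" by blast
    qed
    obtain u where u: "u \<in> L2 (lebesgue_on S)" "(%n. l2.sq (lebesgue_on S) (w n - u)) \<leadsto> 0"
      by (rule bexE[OF L2_complete[OF wL C1]])
    have "\<forall>i\<in>Basis. \<exists>g. g \<in> L2 (lebesgue_on S) & (%n. l2.sq (lebesgue_on S) (D n i - g)) \<leadsto> 0"
      using L2_complete[OF D(1) C2] unfolding Bex_def by (rule ballI)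
    from bchoice[OF this] obtain g where gg: "\<forall>i\<in>Basis. g i \<in> L2 (lebesgue_on S) & (%n. l2.sq (lebesgue_on S) (D n i - g i)) \<leadsto> 0"
      by (elim exE)
    have g: "g i \<in> L2 (lebesgue_on S)" "(%n. l2.sq (lebesgue_on S) (D n i - g i)) \<leadsto> 0" if "i \<in> Basis" for i
      using gg that by auto
    have ug: "is_weak_partial S i u (g i)" if i: "i \<in> Basis" for i
      by (rule weak_partial_limit[OF S i wL D(1)[OF i] D(2)[OF i] u(1) g(1)[OF i] u(2) g(2)[OF i]])
    have uH: "u \<in> H1 S" by (rule H1I[OF u(1) g(1) ug])
    have "energy S (w n - u) = (\<Sum>i\<in>Basis. l2.sq (lebesgue_on S) (D n i - g i))" for n
      by (rule grad_sq[OF S]) (intro l2.closed(3) D g(1) u(1) wL weak_partial_diff S ug; assumption)+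
    moreover have "(%n. (\<Sum>i\<in>Basis. l2.sq (lebesgue_on S) (D n i - g i)) + l2.sq (lebesgue_on S) (w n - u)) \<leadsto> (\<Sum>i\<in>(Basis::'a set). 0) + 0"
      by (intro tendsto_add tendsto_sum g u)
    ultimately show "\<exists>u\<in>H1 S. (%n. energy S (w n - u) + l2.sq (lebesgue_on S) (w n - u)) \<leadsto> 0"
      using uH by (intro bexI[of _ u]) simp_all
  qed (rule l2.semi_ip_axioms G.semi_ip_axioms)+
qed

lemma test_H1: "open S ==> \<phi> \<in> test_functions T ==> \<phi> \<in> H1 S"
  by (rule H1I[of _ _ "%i. partial i \<phi>"]) (auto intro!: test_L2 test_partial test_weak_partial open_sets_lebesgue)

definition h1sq :: "'a::euclidean_space set => ('a => complex) => real" where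
  "h1sq S u = energy S u + l2.sq (lebesgue_on S) u"

lemma H1_norm_eq: "H1_norm S u = sqrt (h1sq S u)"
  by (simp add: H1_norm_def h1sq_def l2_norm_sqrt grad_form_def l2_sq add.commute)

lemma h1sq_A: "open S ==> h1sq S u = Re (hform.a (l2_inner (lebesgue_on S)) (grad_form S) u u)"
  unfolding h1sq_def by (rule hform.A_sq[OF l2form.axioms[OF H1_l2form], symmetric])

lemma H10_iff:
  "u \<in> H10 S \<longleftrightarrow> u \<in> H1 S & (\<forall>\<epsilon>>0. \<exists>\<phi>\<in>test_functions S. sqrt (h1sq S (u - \<phi>)) < \<epsilon>)"
  by (simp add: H10_def H1_norm_eq fun_diff_def)

theorem H10_l2form: assumes S: "open S" shows "l2form (lebesgue_on S) (H10 S) (grad_form S)"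
proof -
  interpret G: l2form "lebesgue_on S" "H1 S" "grad_form S" by (rule H1_l2form[OF S])
  have hA: "h1sq S u = G.A.sq u" for u by (rule h1sq_A[OF S])
  have sub: "H10 S \<subseteq> H1 S" by (auto simp: H10_def)
  have tH: "\<phi> \<in> test_functions S ==> \<phi> \<in> H1 S" for \<phi> by (rule test_H1[OF S])
  have plus: "\<phi> + \<psi> \<in> test_functions S" if "\<phi> \<in> test_functions S" "\<psi> \<in> test_functions S" for \<phi> \<psi>
    using test_add[OF that] by (simp add: plus_fun_def)
  have scal: "fscale c \<phi> \<in> test_functions S" if "\<phi> \<in> test_functions S" for c \<phi>
    using test_scale[OF that] by (simp add: fscale_def)
  have ss: "fvec.subspace (H10 S)"
    unfolding fvec.subspace_def
  proof (intro conjI ballI allI)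
    have "sqrt (h1sq S (0 - (%x. 0))) = 0" unfolding hA zero_fun_def[symmetric] by (simp add: G.A.ip_zero G.A.closed)
    thus "0 \<in> H10 S" using test_zero[of S] G.Q.closed(1) unfolding H10_iff
      by (intro conjI allI impI bexI[of _ "%x. 0"]) simp_all
  next
    fix u v assume u: "u \<in> H10 S" and v: "v \<in> H10 S"
    hence uv: "u \<in> H1 S" "v \<in> H1 S" using sub by auto
    show "u + v \<in> H10 S" unfolding H10_iff
    proof (intro conjI allI impI)
      fix \<epsilon> :: real assume "0 < \<epsilon>"
      then obtain \<phi> \<psi> where p: "\<phi> \<in> test_functions S" "sqrt (h1sq S (u - \<phi>)) < \<epsilon> / 2"
          "\<psi> \<in> test_functions S" "sqrt (h1sq S (v - \<psi>)) < \<epsilon> / 2"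
        using u v unfolding H10_iff by (meson half_gt_zero)
      have "sqrt (G.A.sq ((u - \<phi>) + (v - \<psi>))) <= sqrt (G.A.sq (u - \<phi>)) + sqrt (G.A.sq (v - \<psi>))"
        by (intro G.A.triangle G.Q.closed uv tH p)
      hence "sqrt (h1sq S ((u + v) - (\<phi> + \<psi>))) < \<epsilon>" using p unfolding hA by (simp add: add_diff_add)
      thus "\<exists>\<phi>\<in>test_functions S. sqrt (h1sq S (u + v - \<phi>)) < \<epsilon>" using plus p by blast
    qed (intro G.Q.closed uv)
  next
    fix c u assume u: "u \<in> H10 S"
    hence uH: "u \<in> H1 S" using sub by auto
    show "fscale c u \<in> H10 S" unfolding H10_iff
    proof (intro conjI allI impI)
      fix \<epsilon> :: real assume "0 < \<epsilon>"
      hence "0 < \<epsilon> / (cmod c + 1)" by (simp add: add_nonneg_pos)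
      then obtain \<phi> where p: "\<phi> \<in> test_functions S" "sqrt (h1sq S (u - \<phi>)) < \<epsilon> / (cmod c + 1)"
        using u unfolding H10_iff by meson
      have "sqrt (G.A.sq (fscale c (u - \<phi>))) = cmod c * sqrt (G.A.sq (u - \<phi>))"
        using G.A.sq_scale[OF G.Q.closed(3)[OF uH tH[OF p(1)]], of c] by (simp add: real_sqrt_mult)
      also have "\<dots> <= (cmod c + 1) * sqrt (G.A.sq (u - \<phi>))"
        using G.A.ip_pos[OF G.Q.closed(3)[OF uH tH[OF p(1)]]] by (intro mult_right_mono) auto
      also have "\<dots> < \<epsilon>" using p(2) unfolding hA by (simp add: pos_less_divide_eq add_nonneg_pos mult.commute)
      finally have "sqrt (h1sq S (fscale c u - fscale c \<phi>)) < \<epsilon>"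
        unfolding hA by (simp add: fvec.scale_right_diff_distrib)
      thus "\<exists>\<phi>\<in>test_functions S. sqrt (h1sq S (fscale c u - \<phi>)) < \<epsilon>" using scal p by blast
    qed (intro G.Q.closed uH)
  qed
  show ?thesis
  proof (intro l2form.intro hform.intro hform_axioms.intro)
    show "semi_ip fscale (L2 (lebesgue_on S)) (l2_inner (lebesgue_on S))" by (rule l2.semi_ip_axioms)
    show "semi_ip fscale (H10 S) (grad_form S)"
    proof unfold_locales
      show "fvec.subspace (H10 S)" by (rule ss)
    qed (use sub in \<open>auto intro: G.Q.ip_add G.Q.ip_scale G.Q.ip_sym G.Q.ip_pos\<close>)
    show "H10 S \<subseteq> L2 (lebesgue_on S)" using sub H1_L2 by auto
    fix w :: "nat => 'a => complex" assume w: "!!n. w n \<in> H10 S" and C: "\<forall>e>0. \<exists>N. \<forall>m\<ge>N. \<forall>n\<ge>N.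
      energy S (w m - w n) + l2.sq (lebesgue_on S) (w m - w n) < e"
    have wH: "w n \<in> H1 S" for n using w sub by auto
    obtain u where u: "u \<in> H1 S" "(%n. h1sq S (w n - u)) \<leadsto> 0"
      using G.complete[OF wH C] unfolding h1sq_def by (elim bexE)
    have "u \<in> H10 S" unfolding H10_iff
    proof (intro conjI allI impI u)
      fix \<epsilon> :: real assume \<epsilon>: "0 < \<epsilon>"
      have "(%n. sqrt (h1sq S (w n - u))) \<leadsto> sqrt 0" by (intro tendsto_intros u)
      hence "\<forall>\<^sub>F n in sequentially. sqrt (h1sq S (w n - u)) < \<epsilon> / 2" using \<epsilon> by (intro order_tendstoD(2)) auto
      then obtain n where n: "sqrt (h1sq S (w n - u)) < \<epsilon> / 2" by (auto simp: eventually_sequentially)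
      obtain \<phi> where p: "\<phi> \<in> test_functions S" "sqrt (h1sq S (w n - \<phi>)) < \<epsilon> / 2"
        using w[of n] \<epsilon> unfolding H10_iff by (meson half_gt_zero)
      have "sqrt (G.A.sq ((u - w n) + (w n - \<phi>))) <= sqrt (G.A.sq (u - w n)) + sqrt (G.A.sq (w n - \<phi>))"
        by (intro G.A.triangle G.Q.closed u wH tH p)
      hence "sqrt (h1sq S (u - \<phi>)) < \<epsilon>" using p n G.A.sq_diff_commute[OF u(1) wH[of n]] unfolding hA by simp
      thus "\<exists>\<phi>\<in>test_functions S. sqrt (h1sq S (u - \<phi>)) < \<epsilon>" using p by blast
    qed
    thus "\<exists>u\<in>H10 S. (%n. energy S (w n - u) + l2.sq (lebesgue_on S) (w n - u)) \<leadsto> 0"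
      using u(2) unfolding h1sq_def by blast
  qed
qed

section \<open>Simultaneous dilation and mollification\<close>

text \<open>The convolution of \<open>K\<close> with a dilation of \<open>f\<close>, up to normalisation: the support of \<open>f\<close> is multiplied by \<open>s\<close> and then spread by that of \<open>K\<close>.\<close>

definition mollify :: "('a::euclidean_space => complex) => real => ('a => complex) => 'a => complex" where
  "mollify K s f x = (LINT y|lebesgue. f y * K (x - s *\<^sub>R y))"

lemma test_reflect:
  assumes K: "K \<in> test_functions T" and s: "s \<noteq> 0"
  shows "(%y. K (x - s *\<^sub>R y)) \<in> test_functions UNIV"
proof -
  obtain R where R: "R > 0" "!!x. norm x > R ==> K x = 0" using test_support_ball[OF K] by blast
  have e: "x - s *\<^sub>R y = (- s) *\<^sub>R y + x" for y by simp
  show ?thesis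
  proof (rule test_functionsI[of _ "cball 0 ((norm x + R) / \<bar>s\<bar>)"])
    show "Ck_fun k (%y. K (x - s *\<^sub>R y))" for k unfolding e by (intro Ck_affine test_functionsD[OF K])
    fix y assume "K (x - s *\<^sub>R y) \<noteq> 0"
    hence "norm (x - s *\<^sub>R y) <= R" using R(2) not_le by blast
    hence "\<bar>s\<bar> * norm y <= norm x + R"
      using norm_triangle_ineq4[of x "x - s *\<^sub>R y"] by simp
    thus "y \<in> cball 0 ((norm x + R) / \<bar>s\<bar>)" using s by (simp add: pos_le_divide_eq mult.commute)
  qed auto
qed

lemma partial_reflect:
  assumes K: "K \<in> test_functions T"
  shows "partial i (%y. K (x - s *\<^sub>R y)) y = - (of_real s * partial i K (x - s *\<^sub>R y))"
proof -
  have e: "x - s *\<^sub>R y = (- s) *\<^sub>R y + x" for y by simp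
  show ?thesis unfolding e
    by (subst partial_affine_eq[OF test_functionsD(1)[OF K]]) simp
qed

lemma L2_indicator_lborel:
  assumes [measurable]: "A \<in> sets borel" and fin: "emeasure lborel A < \<infinity>"
  shows "(%y. cplx (indicator A y)) \<in> L2 lborel"
proof (rule L2I)
  have "integrable lborel (indicator A :: 'a => real)" using fin by (intro integrable_real_indicator) auto
  thus "integrable lborel (%x. (norm (cplx (indicator A x)))^2)"
    by (rule Lintegrable_cong[THEN iffD1, rotated -1]) (auto split: split_indicator)
qed measurable

lemma L2_indicator_ball:
  "(%y::'a::euclidean_space. cplx (indicator (cball 0 \<rho>) y)) \<in> L2 lborel"
  "(%y::'a. cplx (indicator (cball 0 \<rho>) y)) \<in> L2 lebesgue"
  by (auto intro!: L2_indicator_lborel L2_lborel_lebesgue emeasure_bounded_finite)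

lemma mollify_has_derivative:
  assumes K: "K \<in> test_functions T" and s: "s \<noteq> 0" and f: "f \<in> L2 lebesgue"
  shows "(mollify K s f has_derivative (%h. \<Sum>i\<in>Basis. (h \<bullet> i) *\<^sub>R mollify (partial i K) s f x)) (at x)"
proof -
  obtain B where B: "B > 0" "!!x h. norm (K (x + h) - K x - (\<Sum>i\<in>Basis. (h \<bullet> i) *\<^sub>R partial i K x)) <= B * (norm h)^2"
    using test_taylor[OF K] by blast
  obtain R where R: "R > 0" "!!x. norm x > R ==> K x = 0" "!!i x. norm x > R ==> partial i K x = 0"
    using test_support_ball[OF K] by blast
  define \<rho> where "\<rho> = (norm x + R + 1) / \<bar>s\<bar>"
  define D where "D = (LINT y|lebesgue. norm (f y * cplx (indicator (cball 0 \<rho>) y)))"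
  have Di: "integrable lebesgue (%y. norm (f y * cplx (indicator (cball 0 \<rho>) y)))"
    by (rule integrable_norm[OF L2_mult_integrable[OF f L2_indicator_ball(2)]])
  have fi: "integrable lebesgue (%y. f y * k (z - s *\<^sub>R y))" if "k \<in> test_functions T" for k z
    by (rule L2_mult_integrable[OF f test_L2_UNIV[OF test_reflect[OF that s]]])
  have est: "norm (mollify K s f (x + h) - mollify K s f x - (\<Sum>i\<in>Basis. (h \<bullet> i) *\<^sub>R mollify (partial i K) s f x)) <= (D * B) * (norm h)^2"
    if h: "norm h <= 1" for h
  proof -
    define E where "E y = K (x - s *\<^sub>R y + h) - K (x - s *\<^sub>R y) - (\<Sum>i\<in>Basis. (h \<bullet> i) *\<^sub>R partial i K (x - s *\<^sub>R y))" for y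
    have e: "x + h - s *\<^sub>R y = x - s *\<^sub>R y + h" for y by simp
    have i1: "integrable lebesgue (%y. f y * K (x - s *\<^sub>R y + h))" using fi[OF K, of "x + h"] unfolding e .
    have i3: "integrable lebesgue (%y. \<Sum>i\<in>Basis. (h \<bullet> i) *\<^sub>R (f y * partial i K (x - s *\<^sub>R y)))"
      by (intro Lintegrable_sum integrable_scaleR_right fi test_partial[OF K])
    have "mollify K s f (x + h) - mollify K s f x - (\<Sum>i\<in>Basis. (h \<bullet> i) *\<^sub>R mollify (partial i K) s f x)
      = (LINT y|lebesgue. f y * K (x - s *\<^sub>R y + h) - f y * K (x - s *\<^sub>R y) - (\<Sum>i\<in>Basis. (h \<bullet> i) *\<^sub>R (f y * partial i K (x - s *\<^sub>R y))))"
      unfolding mollify_def e using i1 i3 fi[OF K, of x] fi[OF test_partial[OF K], of _ x]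
      by (simp add: Lintegral_sum)
    also have "\<dots> = (LINT y|lebesgue. f y * E y)"
      by (intro Lintegral_cong) (auto simp: E_def right_diff_distrib sum_distrib_left)
    also have "norm \<dots> <= (LINT y|lebesgue. norm (f y * E y))" by (rule integral_norm_bound)
    also have "\<dots> <= (LINT y|lebesgue. norm (f y * cplx (indicator (cball 0 \<rho>) y)) * (B * (norm h)^2))"
    proof (rule Bochner_Integration.integral_mono')
      show "integrable lebesgue (%y. norm (f y * cplx (indicator (cball 0 \<rho>) y)) * (B * (norm h)^2))"
        by (intro integrable_mult_left Di)
      fix y
      show "norm (f y * E y) <= norm (f y * cplx (indicator (cball 0 \<rho>) y)) * (B * (norm h)^2)"
      proof (cases "norm y <= \<rho>")
        case True
        have "norm (E y) <= B * (norm h)^2" unfolding E_def by (rule B(2))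
        thus ?thesis using True by (simp add: norm_mult mult_left_mono)
      next
        case False
        hence "norm x + R + 1 < norm (s *\<^sub>R y)" using s by (simp add: \<rho>_def not_le divide_less_eq mult.commute)
        hence 1: "R + 1 < norm (x - s *\<^sub>R y)" using norm_triangle_ineq4[of x "x - s *\<^sub>R y"] by simp
        hence "R < norm (h + (x - s *\<^sub>R y))" using h by (intro norm_shift_gt)
        hence "E y = 0" using R 1 by (simp add: E_def add.commute[of h])
        thus ?thesis using B by simp
      qed
    qed (use B in \<open>auto intro!: mult_nonneg_nonneg\<close>)
    also have "\<dots> = D * (B * (norm h)^2)" by (simp add: D_def)
    finally show ?thesis by simp
  qed
  show ?thesis
  proof (rule has_derivativeI_sandwich[of 1])
    show "bounded_linear (%h. \<Sum>i\<in>Basis. (h \<bullet> i) *\<^sub>R mollify (partial i K) s f x)"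
      by (intro bounded_linear_sum bounded_linear_scaleR_left[THEN bounded_linear_compose] bounded_linear_inner_left)
    show "((%y. (D * B) * norm (y - x)) \<longlongrightarrow> 0) (at x within UNIV)"
    proof -
      have "((%y. (D * B) * norm (y - x)) \<longlongrightarrow> (D * B) * norm (x - x)) (at x within UNIV)" by (intro tendsto_intros)
      thus ?thesis by simp
    qed
    fix y assume y: "y \<noteq> x" "dist y x < 1"
    have "norm (mollify K s f y - mollify K s f x - (\<Sum>i\<in>Basis. ((y - x) \<bullet> i) *\<^sub>R mollify (partial i K) s f x)) <= (D * B) * (norm (y - x))^2"
      using est[of "y - x"] y by (simp add: dist_norm)
    thus "norm (mollify K s f y - mollify K s f x - (\<Sum>i\<in>Basis. ((y - x) \<bullet> i) *\<^sub>R mollify (partial i K) s f x)) / norm (y - x) <= (D * B) * norm (y - x)"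
      using y by (simp add: divide_le_eq power2_eq_square mult.assoc)
  qed simp
qed

lemma mollify_smooth:
  assumes "K \<in> test_functions T" "s \<noteq> 0" "f \<in> L2 lebesgue"
  shows "Ck_fun k (mollify K s f)"
  using assms(1)
proof (induction k arbitrary: K)
  case 0
  show ?case
    using mollify_has_derivative[OF 0 assms(2,3)] by (auto simp: continuous_on_eq_continuous_at intro: has_derivative_continuous)
next
  case (Suc k)
  show ?case
  proof (rule Ck_SucI[OF mollify_has_derivative[OF Suc.prems assms(2,3)]])
    fix i :: 'a assume i: "i \<in> Basis"
    have "(\<Sum>j\<in>Basis. (i \<bullet> j) *\<^sub>R mollify (partial j K) s f x) = mollify (partial i K) s f x" for x
      using i by (simp add: inner_Basis if_distrib[of "%c. c *\<^sub>R _"] cong: if_cong)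
    thus "Ck_fun k (%x. \<Sum>j\<in>Basis. (i \<bullet> j) *\<^sub>R mollify (partial j K) s f x)"
      using Suc.IH[OF test_partial[OF Suc.prems i]] by simp
  qed
qed

lemma mollify_partial:
  assumes "K \<in> test_functions T" "s \<noteq> 0" "f \<in> L2 lebesgue" "i \<in> Basis"
  shows "partial i (mollify K s f) x = mollify (partial i K) s f x"
  using partial_eq[OF mollify_has_derivative[OF assms(1-3)], of i x] assms(4)
  by (simp add: inner_Basis if_distrib[of "%c. c *\<^sub>R _"] cong: if_cong)

text \<open>The function \<open>y \<mapsto> K (x - s y)\<close> is itself a test function, to which the definition of the weak derivative applies.\<close>

lemma mollify_weak_partial:
  assumes K: "K \<in> test_functions T" and s: "s \<noteq> 0" and i: "i \<in> Basis"
    and u: "is_weak_partial UNIV i u g"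
  shows "mollify (partial i K) s u x = mollify K s (fscale (1 / of_real s) g) x"
proof -
  have "(LINT y|lebesgue. u y * (- (of_real s * partial i K (x - s *\<^sub>R y)))) = - (LINT y|lebesgue. g y * K (x - s *\<^sub>R y))"
    using u test_reflect[OF K s, of x] unfolding is_weak_partial_def lebesgue_on_UNIV_eq partial_reflect[OF K, symmetric] by blast
  also have "(%y. u y * (- (of_real s * partial i K (x - s *\<^sub>R y)))) = (%y. - of_real s * (u y * partial i K (x - s *\<^sub>R y)))"
    by (auto simp: fun_eq_iff)
  finally have "of_real s * mollify (partial i K) s u x = mollify K s g x"
    unfolding mollify_def by simp
  moreover have "mollify K s (fscale (1 / of_real s) g) x = (1 / of_real s) * mollify K s g x"
    unfolding mollify_def by (simp add: mult.assoc del: times_divide_eq_left)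
  moreover have "mollify K s g x = of_real s * ((1 / of_real s) * mollify K s g x)" using s by simp
  ultimately show ?thesis using s by (metis mult_left_cancel of_real_eq_0_iff)
qed

lemma nn_integral_affine:
  fixes g :: "'a::euclidean_space => ennreal"
  assumes [measurable]: "g \<in> borel_measurable borel" and c: "c \<noteq> 0"
  shows "(\<integral>\<^sup>+x. g (t + c *\<^sub>R x) \<partial>lborel) = ennreal (1 / \<bar>c\<bar> ^ DIM('a)) * (\<integral>\<^sup>+x. g x \<partial>lborel)"
proof -
  have "(\<integral>\<^sup>+x. g x \<partial>lborel) = (\<integral>\<^sup>+x. g x \<partial>density (distr lborel borel (%x. t + c *\<^sub>R x)) (%_. \<bar>c\<bar>^DIM('a)))"
    using lborel_affine[OF c, of t] by simp
  also have "\<dots> = ennreal (\<bar>c\<bar>^DIM('a)) * (\<integral>\<^sup>+x. g (t + c *\<^sub>R x) \<partial>lborel)"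
    by (simp add: nn_integral_density nn_integral_distr nn_integral_cmult)
  finally have "ennreal (1 / \<bar>c\<bar> ^ DIM('a)) * (\<integral>\<^sup>+x. g x \<partial>lborel) =
      (ennreal (1 / \<bar>c\<bar> ^ DIM('a)) * ennreal (\<bar>c\<bar>^DIM('a))) * (\<integral>\<^sup>+x. g (t + c *\<^sub>R x) \<partial>lborel)"
    by (simp add: mult.assoc)
  also have "ennreal (1 / \<bar>c\<bar> ^ DIM('a)) * ennreal (\<bar>c\<bar>^DIM('a)) = 1"
    using c by (simp add: ennreal_mult[symmetric])
  finally show ?thesis by simp
qed

definition kernel :: "real => ('a::euclidean_space => real) => bool" where
  "kernel r \<kappa> \<longleftrightarrow> (%x. cplx (\<kappa> x)) \<in> test_functions UNIV & (\<forall>x. 0 <= \<kappa> x) &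
     (\<forall>x. \<kappa> x \<noteq> 0 --> norm x <= r) & (LINT x|lborel. \<kappa> x) = 1"

lemma kernel_measurable: "kernel r \<kappa> ==> \<kappa> \<in> borel_measurable borel"
  using measurable_compose[OF test_borel, of "%x. cplx (\<kappa> x)" UNIV Re borel]
  by (simp add: kernel_def)

lemma kernel_exists:
  assumes "0 < r" shows "\<exists>\<kappa> :: 'a::euclidean_space => real. kernel r \<kappa>"
proof -
  define \<epsilon> where "\<epsilon> = r / real DIM('a)"
  have \<epsilon>: "0 < \<epsilon>" using assms by (simp add: \<epsilon>_def)
  define b :: "'a => real" where "b = box_bump 1 (- (\<epsilon> *\<^sub>R One)) (\<epsilon> *\<^sub>R One)"
  have bt: "(%x. cplx (b x)) \<in> test_functions UNIV" unfolding b_def by (rule box_bump_test) auto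
  have bpos: "0 < b x \<longleftrightarrow> x \<in> box (- (\<epsilon> *\<^sub>R One)) (\<epsilon> *\<^sub>R One)" for x unfolding b_def by (rule box_bump_pos) simp
  have b0: "0 <= b x" for x unfolding b_def by (rule box_bump_range)
  have bi: "integrable lborel b"
    using integrable_Re[OF test_integrable(1)[OF bt]] by simp
  have pos: "0 < (LINT x|lborel. b x)"
  proof (rule ccontr)
    assume "\<not> 0 < (LINT x|lborel. b x)"
    hence "(LINT x|lborel. b x) = 0" using integral_nonneg_AE[OF AE_I2[of lborel "%x. 0 <= b x"]] b0 by (simp add: order.antisym not_less)
    hence "AE x in lborel. b x = 0" using bi b0 by (simp add: integral_nonneg_eq_0_iff_AE)
    moreover have "{x \<in> space lborel. b x \<noteq> 0} = box (- (\<epsilon> *\<^sub>R One)) (\<epsilon> *\<^sub>R One)"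
    proof -
      have "b x \<noteq> 0 \<longleftrightarrow> 0 < b x" for x using b0[of x] by auto
      thus ?thesis by (auto simp: bpos)
    qed
    ultimately have "box (- (\<epsilon> *\<^sub>R One)) (\<epsilon> *\<^sub>R One) \<in> null_sets (lborel :: 'a measure)"
      using AE_iff_null_sets[of "box (- (\<epsilon> *\<^sub>R One)) (\<epsilon> *\<^sub>R One)" "lborel :: 'a measure"] by (auto simp: set_eq_iff)
    moreover have "(0::'a) \<in> box (- (\<epsilon> *\<^sub>R One)) (\<epsilon> *\<^sub>R One)" using \<epsilon> by (auto simp: mem_box)
    ultimately show False using open_not_negligible[of "box (- (\<epsilon> *\<^sub>R One)) (\<epsilon> *\<^sub>R One :: 'a)"]
      by (auto simp: negligible_iff_null_sets open_box null_sets_completionI)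
  qed
  have "kernel r (%x. b x / (LINT x|lborel. b x))"
    unfolding kernel_def
  proof (intro conjI allI impI)
    show "(%x. cplx (b x / (LINT x|lborel. b x))) \<in> test_functions UNIV"
      using test_scale[OF bt, of "cplx (1 / (LINT x|lborel. b x))"] by (simp add: mult.commute)
    show "0 <= b x / (LINT x|lborel. b x)" for x using b0 pos by simp
    show "(LINT x|lborel. b x / (LINT x|lborel. b x)) = 1" using pos by simp
    fix x assume "b x / (LINT x|lborel. b x) \<noteq> 0"
    hence "x \<in> box (- (\<epsilon> *\<^sub>R One)) (\<epsilon> *\<^sub>R One)" using bpos[of x] b0[of x] by auto
    hence "\<bar>x \<bullet> i\<bar> <= \<epsilon>" if "i \<in> Basis" for i using that by (auto simp: mem_box abs_le_iff dest!: bspec[of _ _ i])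
    hence "(\<Sum>i\<in>Basis. \<bar>x \<bullet> i\<bar>) <= (\<Sum>i\<in>(Basis::'a set). \<epsilon>)" by (intro sum_mono)
    also have "\<dots> = r" by (simp add: \<epsilon>_def)
    finally show "norm x <= r" using norm_le_l1[of x] by simp
  qed
  thus ?thesis by blast
qed

lemma mollify_cong_AE:
  assumes "f \<in> L2 lebesgue" "g \<in> L2 lebesgue" "AE x in lebesgue. f x = g x" "K \<in> test_functions T" "s \<noteq> 0"
  shows "mollify K s f = mollify K s g"
proof
  fix x
  show "mollify K s f x = mollify K s g x" unfolding mollify_def
  proof (rule integral_cong_AE)
    show "AE y in lebesgue. f y * K (x - s *\<^sub>R y) = g y * K (x - s *\<^sub>R y)" using assms(3) by eventually_elim simp
  qed (intro borel_measurable_integrable L2_mult_integrable assms(1,2) test_L2_UNIV[OF test_reflect[OF assms(4,5)]])+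
qed

lemma L2_borel_representative:
  assumes "f \<in> L2 lebesgue"
  shows "\<exists>g\<in>L2 lborel. g \<in> borel_measurable borel & (AE x in lebesgue. f x = g x)"
proof -
  obtain g where g: "g \<in> borel_measurable borel" "AE x in lebesgue. f x = g x"
    using borel_representative[OF L2_measurable[OF assms]] by (rule bexE)
  have "integrable lebesgue (%x. (norm (g x))^2)"
    by (rule integrable_cong_AE_imp[OF L2_integrable[OF assms]]) (use g in \<open>auto simp: measurable_completion\<close>)
  hence "g \<in> L2 lborel" using g(1) by (intro L2I) (auto simp: integrable_completion)
  thus ?thesis using g by (intro bexI[of _ g] conjI)
qed

text \<open>Jensen for the probability density \<open>\<kappa>\<close>, then Fubini.\<close>

theorem mollify_L2:
  assumes \<kappa>: "kernel r \<kappa>" and s: "0 < s" and f: "f \<in> L2 (lebesgue :: 'a::euclidean_space measure)"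
  defines "K \<equiv> %x. cplx (\<kappa> x)"
  shows "mollify K s f \<in> L2 lebesgue" "nsq (mollify K s f) <= (1 / s ^ DIM('a)) * nsq f"
proof -
  have K: "K \<in> test_functions UNIV" using \<kappa> by (simp add: kernel_def K_def)
  obtain g where g: "g \<in> L2 lborel" "g \<in> borel_measurable borel" "AE x in lebesgue. f x = g x"
    using L2_borel_representative[OF f] by (elim bexE conjE)
  have gl: "g \<in> L2 lebesgue" by (rule L2_lborel_lebesgue[OF g(1)])
  have s0: "s \<noteq> 0" using s by simp
  have meq: "mollify K s f = mollify K s g" by (rule mollify_cong_AE[OF f gl g(3) K s0])
  note [measurable] = g(2) kernel_measurable[OF \<kappa>]
  have sqeq: "nsq f = l2.sq lborel g"
  proof -
    have "nsq f = nsq g"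
      using l2_inner_cong_AE[OF f gl f gl g(3) g(3)] by simp
    also have "\<dots> = l2.sq lborel g" by (subst l2_lborel_lebesgue) (use g(2) in auto)
    finally show ?thesis .
  qed
  have k1: "(\<integral>\<^sup>+x. ennreal (\<kappa> x) \<partial>lborel) = 1"
  proof -
    have "integrable lborel \<kappa>" using integrable_Re[OF test_integrable(1)[OF K]] by (simp add: K_def)
    hence "(\<integral>\<^sup>+x. ennreal (\<kappa> x) \<partial>lborel) = ennreal (LINT x|lborel. \<kappa> x)"
      using \<kappa> by (intro nn_integral_eq_integral) (auto simp: kernel_def)
    thus ?thesis using \<kappa> by (simp add: kernel_def)
  qed
  have kx: "(\<integral>\<^sup>+y. ennreal (\<kappa> (x - s *\<^sub>R y)) \<partial>lborel) = ennreal (1 / s ^ DIM('a))" for x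
    using nn_integral_affine[of "%y. ennreal (\<kappa> y)" "- s" x] s k1 by simp
  have ky: "(\<integral>\<^sup>+x. ennreal (\<kappa> (x - s *\<^sub>R y)) \<partial>lborel) = 1" for y
    using nn_integral_affine[of "%y. ennreal (\<kappa> y)" 1 "- s *\<^sub>R y"] k1 by (simp add: algebra_simps)
  have smooth: "continuous_on UNIV (mollify K s g)" using mollify_smooth[OF K s0 gl, of 0] by simp
  have mb [measurable]: "mollify K s g \<in> borel_measurable borel" by (rule borel_measurable_continuous_onI[OF smooth])
  have pt: "ennreal ((norm (mollify K s g x))^2) <= ennreal (1 / s ^ DIM('a)) * (\<integral>\<^sup>+y. ennreal ((norm (g y))^2 * \<kappa> (x - s *\<^sub>R y)) \<partial>lborel)" for x
  proof -
    have k0: "0 <= \<kappa> z" for z using \<kappa> by (simp add: kernel_def)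
    have int: "integrable lborel (%y. g y * K (x - s *\<^sub>R y))"
      by (rule L2_mult_integrable[OF g(1) test_L2_lborel[OF test_reflect[OF K s0]]])
    have "mollify K s g x = (LINT y|lborel. g y * K (x - s *\<^sub>R y))"
      unfolding mollify_def K_def by (rule integral_completion) measurable
    hence "ennreal (norm (mollify K s g x)) <= (\<integral>\<^sup>+y. ennreal (norm (g y * K (x - s *\<^sub>R y))) \<partial>lborel)"
      using integral_norm_bound_ennreal[OF int] by simp
    also have "\<dots> = (\<integral>\<^sup>+y. ennreal (norm (g y) * sqrt (\<kappa> (x - s *\<^sub>R y))) * ennreal (sqrt (\<kappa> (x - s *\<^sub>R y))) \<partial>lborel)"
      using k0 by (intro nn_integral_cong) (simp add: K_def norm_mult ennreal_mult'[symmetric] mult.assoc)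
    finally have "(ennreal (norm (mollify K s g x)))^2 <= (\<integral>\<^sup>+y. ennreal (norm (g y) * sqrt (\<kappa> (x - s *\<^sub>R y))) * ennreal (sqrt (\<kappa> (x - s *\<^sub>R y))) \<partial>lborel)^2"
      by (rule power_mono) simp
    also have "\<dots> <= (\<integral>\<^sup>+y. (ennreal (norm (g y) * sqrt (\<kappa> (x - s *\<^sub>R y))))^2 \<partial>lborel) * (\<integral>\<^sup>+y. (ennreal (sqrt (\<kappa> (x - s *\<^sub>R y))))^2 \<partial>lborel)"
      by (rule Cauchy_Schwarz_nn_integral) measurable
    also have "(\<integral>\<^sup>+y. (ennreal (norm (g y) * sqrt (\<kappa> (x - s *\<^sub>R y))))^2 \<partial>lborel) = (\<integral>\<^sup>+y. ennreal ((norm (g y))^2 * \<kappa> (x - s *\<^sub>R y)) \<partial>lborel)"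
      using k0 by (intro nn_integral_cong) (simp add: ennreal_power power_mult_distrib)
    also have "(\<integral>\<^sup>+y. (ennreal (sqrt (\<kappa> (x - s *\<^sub>R y))))^2 \<partial>lborel) = ennreal (1 / s ^ DIM('a))"
      using k0 kx[of x] by (simp add: ennreal_power)
    finally show ?thesis by (simp add: ennreal_power mult.commute)
  qed
  have "(\<integral>\<^sup>+x. ennreal ((norm (mollify K s g x))^2) \<partial>lborel) <= (\<integral>\<^sup>+x. ennreal (1 / s ^ DIM('a)) * (\<integral>\<^sup>+y. ennreal ((norm (g y))^2 * \<kappa> (x - s *\<^sub>R y)) \<partial>lborel) \<partial>lborel)"
    by (intro nn_integral_mono pt)
  also have "\<dots> = ennreal (1 / s ^ DIM('a)) * (\<integral>\<^sup>+x. (\<integral>\<^sup>+y. ennreal ((norm (g y))^2 * \<kappa> (x - s *\<^sub>R y)) \<partial>lborel) \<partial>lborel)"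
    by (rule nn_integral_cmult) measurable
  also have "(\<integral>\<^sup>+x. (\<integral>\<^sup>+y. ennreal ((norm (g y))^2 * \<kappa> (x - s *\<^sub>R y)) \<partial>lborel) \<partial>lborel) = (\<integral>\<^sup>+y. (\<integral>\<^sup>+x. ennreal ((norm (g y))^2 * \<kappa> (x - s *\<^sub>R y)) \<partial>lborel) \<partial>lborel)"
    by (rule lborel_pair.Fubini') measurable
  also have "\<dots> = (\<integral>\<^sup>+y. ennreal ((norm (g y))^2) \<partial>lborel)"
    using \<kappa> ky by (intro nn_integral_cong) (simp add: ennreal_mult' kernel_def nn_integral_cmult)
  also have "\<dots> = ennreal (l2.sq lborel g)" by (rule l2_nn[OF g(1)])
  also have "ennreal (1 / s ^ DIM('a)) * ennreal (l2.sq lborel g) = ennreal ((1 / s ^ DIM('a)) * l2.sq lborel g)"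
    by (subst ennreal_mult'[symmetric]) (use s in auto)
  finally have b: "(\<integral>\<^sup>+x. ennreal ((norm (mollify K s g x))^2) \<partial>lborel) <= ennreal ((1 / s ^ DIM('a)) * l2.sq lborel g)" .
  have L: "mollify K s g \<in> L2 lborel" by (rule L2_nnI(1)[OF _ b]) simp
  show "mollify K s f \<in> L2 lebesgue" unfolding meq by (rule L2_lborel_lebesgue[OF L])
  have "l2.sq lborel (mollify K s g) <= (1 / s ^ DIM('a)) * l2.sq lborel g"
    by (rule L2_nnI(2)[OF _ b]) (use s l2.ip_pos[OF g(1)] in auto)
  thus "nsq (mollify K s f) <= (1 / s ^ DIM('a)) * nsq f"
    unfolding meq sqeq by (subst l2_lborel_lebesgue) auto
qed

lemma mollify_pairing_Fubini:
  assumes \<kappa>: "kernel r \<kappa>" and r: "r <= 1" and s: "1/2 <= s" and \<phi>: "\<phi> \<in> test_functions UNIV"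
    and g: "g \<in> L2 lborel" "g \<in> borel_measurable borel"
  defines "K \<equiv> %x. cplx (\<kappa> x)"
  shows "(LINT x|lborel. mollify K s g x * \<phi> x) = (LINT y|lborel. g y * (LINT x|lborel. K (x - s *\<^sub>R y) * \<phi> x))"
proof -
  have K: "K \<in> test_functions UNIV" using \<kappa> by (simp add: kernel_def K_def)
  have s0: "s \<noteq> 0" using s by simp
  note [measurable] = g(2) kernel_measurable[OF \<kappa>] test_borel[OF \<phi>]
  obtain R where R: "R > 0" "!!x. norm x > R ==> \<phi> x = 0" using test_support_ball[OF \<phi>] by blast
  obtain B where B: "B > 0" "!!x. norm (\<phi> x) <= B" using test_bounded[OF \<phi>] by blast
  obtain C where C: "C > 0" "!!x. norm (K x) <= C" using test_bounded[OF K] by blast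
  have [measurable]: "K \<in> borel_measurable borel" unfolding K_def by measurable
  define \<rho> where "\<rho> = 2 * (R + 1)"
  have far: "K (x - s *\<^sub>R y) * \<phi> x = 0" if "norm y > \<rho>" for x y
  proof (rule ccontr)
    assume "K (x - s *\<^sub>R y) * \<phi> x \<noteq> 0"
    hence 1: "norm x <= R" "norm (x - s *\<^sub>R y) <= 1"
      using R(2)[of x] \<kappa> r by (auto simp: kernel_def K_def not_less[symmetric])
    have "(1/2) * norm y <= norm (s *\<^sub>R y)" unfolding norm_scaleR using s by (intro mult_right_mono) auto
    also have "\<dots> <= R + 1" using norm_triangle_ineq4[of x "x - s *\<^sub>R y"] 1 by simp
    finally show False using that by (simp add: \<rho>_def)
  qed
  have fi: "integrable lborel (%y. g y * K (x - s *\<^sub>R y))" for x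
    by (rule L2_mult_integrable[OF g(1) test_L2_lborel[OF test_reflect[OF K s0]]])
  note indL = L2_indicator_ball(1)[of \<rho>]
  define D where "D = (LINT y|lborel. norm (g y * cplx (indicator (cball 0 \<rho>) y)))"
  have Di: "integrable lborel (%y. norm (g y * cplx (indicator (cball 0 \<rho>) y)))"
    by (rule integrable_norm[OF L2_mult_integrable[OF g(1) indL]])
  define F where "F x y = g y * K (x - s *\<^sub>R y) * \<phi> x" for x y
  have [measurable]: "case_prod F \<in> borel_measurable (lborel \<Otimes>\<^sub>M lborel)" unfolding F_def by measurable
  have "integrable (lborel \<Otimes>\<^sub>M lborel) (case_prod F)"
  proof (rule lborel_pair.Fubini_integrable)
    show "AE x in lborel. integrable lborel (%y. case_prod F (x, y))"
      using fi by (auto simp: F_def)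
    show "integrable lborel (%x. LINT y|lborel. norm (case_prod F (x, y)))"
    proof (rule bounded_support_integrable[of _ "C * B * D" R])
      show "(%x. LINT y|lborel. norm (case_prod F (x, y))) \<in> borel_measurable lborel" by measurable
      fix x
      have "(LINT y|lborel. norm (case_prod F (x, y))) <= (LINT y|lborel. (C * B) * norm (g y * cplx (indicator (cball 0 \<rho>) y)))"
      proof (rule Bochner_Integration.integral_mono')
        show "integrable lborel (%y. (C * B) * norm (g y * cplx (indicator (cball 0 \<rho>) y)))"
          by (intro integrable_mult_right Di)
        fix y
        show "norm (case_prod F (x, y)) <= (C * B) * norm (g y * cplx (indicator (cball 0 \<rho>) y))"
        proof (cases "norm y <= \<rho>")
          case True
          have "norm (K (x - s *\<^sub>R y)) * norm (\<phi> x) <= C * B" using B C by (intro mult_mono) auto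
          hence "norm (g y) * (norm (K (x - s *\<^sub>R y)) * norm (\<phi> x)) <= norm (g y) * (C * B)" by (rule mult_left_mono) simp
          thus ?thesis using True by (simp add: F_def norm_mult mult_ac)
        next
          case False
          thus ?thesis using far[of y x] B C by (auto simp: F_def)
        qed
      qed (use B C in \<open>auto intro!: mult_nonneg_nonneg\<close>)
      also have "\<dots> = C * B * D" by (simp add: D_def)
      finally show "norm (LINT y|lborel. norm (case_prod F (x, y))) <= C * B * D" by simp
      show "R < norm x ==> (LINT y|lborel. norm (case_prod F (x, y))) = 0" by (simp add: F_def R(2))
    qed
  qed measurable
  from lborel_pair.Fubini_integral[OF this]
  have "(LINT y|lborel. LINT x|lborel. F x y) = (LINT x|lborel. LINT y|lborel. F x y)" .
  moreover have "(LINT y|lborel. F x y) = mollify K s g x * \<phi> x" for x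
  proof -
    have "mollify K s g x = (LINT y|lborel. g y * K (x - s *\<^sub>R y))"
      unfolding mollify_def by (rule integral_completion) measurable
    thus ?thesis unfolding F_def using fi by simp
  qed
  moreover have "(LINT x|lborel. F x y) = g y * (LINT x|lborel. K (x - s *\<^sub>R y) * \<phi> x)" for y
    by (simp add: F_def mult.assoc)
  ultimately show ?thesis by simp
qed

text \<open>By Fubini the operation moves to the test function, where it converges uniformly with a fixed bounded support.
  This gives weak convergence, which is all that \<open>mazur\<close> asks for.\<close>

theorem mollify_pairing:
  assumes \<kappa>: "!!n. kernel (r n) (\<kappa> n)" and r: "!!n. r n <= 1" "r \<leadsto> 0"
    and s: "!!n. 1/2 <= s n" "s \<leadsto> 1" and \<phi>: "\<phi> \<in> test_functions UNIV" and f: "f \<in> L2 (lebesgue :: 'a::euclidean_space measure)"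
  defines "K \<equiv> %n x. cplx (\<kappa> n x)"
  shows "(%n. LINT x|lebesgue. mollify (K n) (s n) f x * \<phi> x) \<leadsto> (LINT x|lebesgue. f x * \<phi> x)"
proof -
  have K: "K n \<in> test_functions UNIV" for n using \<kappa> by (simp add: kernel_def K_def)
  have s0: "s n \<noteq> 0" for n using s(1)[of n] by auto
  obtain g where g: "g \<in> L2 lborel" "g \<in> borel_measurable borel" "AE x in lebesgue. f x = g x"
    using L2_borel_representative[OF f] by (elim bexE conjE)
  have gl: "g \<in> L2 lebesgue" by (rule L2_lborel_lebesgue[OF g(1)])
  note [measurable] = g(2) test_borel[OF \<phi>]
  have [measurable]: "K n \<in> borel_measurable borel" for n by (rule test_borel[OF K])
  obtain R where R: "R > 0" "!!x. norm x > R ==> \<phi> x = 0" using test_support_ball[OF \<phi>] by blast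
  obtain B where B: "B > 0" "!!x. norm (\<phi> x) <= B" using test_bounded[OF \<phi>] by blast
  obtain L where L: "L > 0" "!!x y. norm (\<phi> x - \<phi> y) <= L * norm (x - y)" using test_lipschitz[OF \<phi>] by blast
  define J where "J n y = (LINT x|lborel. K n (x - s n *\<^sub>R y) * \<phi> x)" for n y
  have Ki: "integrable lborel (\<kappa> n)" for n using integrable_Re[OF test_integrable(1)[OF K[of n]]] by (simp add: K_def)
  have sh: "integrable lborel (%x. \<kappa> n (x - a))" "(LINT x|lborel. \<kappa> n (x - a)) = 1" for n a
  proof -
    have m: "\<kappa> n \<in> borel_measurable borel" by (rule kernel_measurable[OF \<kappa>])
    show "(LINT x|lborel. \<kappa> n (x - a)) = 1"
      using lborel_integral_translate[OF m, of "- a"] \<kappa>[of n] by (simp add: kernel_def)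
    have "(%x. K n (x - 1 *\<^sub>R a)) = (%x. K n (1 *\<^sub>R x + (- a)))" by simp
    have "(%x. K n (1 *\<^sub>R x + (- a))) \<in> test_functions UNIV"
    proof -
      obtain \<rho> where \<rho>: "!!x. norm x > \<rho> ==> K n x = 0" using test_support_ball[OF K[of n]] by blast
      show ?thesis
      proof (rule test_functionsI[of _ "cball 0 (\<rho> + norm a)"])
        show "Ck_fun k (%x. K n (1 *\<^sub>R x + (- a)))" for k by (intro Ck_affine test_functionsD[OF K])
        fix x assume "K n (1 *\<^sub>R x + (- a)) \<noteq> 0"
        hence "norm (x - a) <= \<rho>" using \<rho>[of "x - a"] by (force simp: not_less[symmetric])
        thus "x \<in> cball 0 (\<rho> + norm a)" using norm_triangle_ineq[of "x - a" a] by simp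
      qed auto
    qed
    from integrable_Re[OF test_integrable(1)[OF this]] show "integrable lborel (%x. \<kappa> n (x - a))" by (simp add: K_def)
  qed
  have Kphi: "integrable lborel (%x. K n (x - a) * \<phi> x)" for n a
  proof (rule Lintegrable_bound[of _ "%x. B * \<kappa> n (x - a)"])
    show "integrable lborel (%x. B * \<kappa> n (x - a))" by (intro integrable_mult_right sh)
    show "AE x in lborel. norm (K n (x - a) * \<phi> x) <= norm (B * \<kappa> n (x - a))"
      using B \<kappa>[of n] by (intro AE_I2) (auto simp: norm_mult K_def abs_mult mult.commute kernel_def intro!: mult_right_mono)
  qed measurable
  have Jdiff: "norm (J n y - \<phi> y) <= L * (r n + \<bar>s n - 1\<bar> * norm y)" for n y
  proof -
    have Kc: "integrable lborel (%x. K n (x - a))" "(LINT x|lborel. K n (x - a)) = 1" for a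
      using sh[of n a] by (simp_all add: K_def)
    have "J n y - \<phi> y = (LINT x|lborel. K n (x - s n *\<^sub>R y) * \<phi> x - K n (x - s n *\<^sub>R y) * \<phi> y)"
      unfolding J_def using Kphi Kc by simp
    also have "norm \<dots> <= (LINT x|lborel. norm (K n (x - s n *\<^sub>R y) * \<phi> x - K n (x - s n *\<^sub>R y) * \<phi> y))"
      by (rule integral_norm_bound)
    also have "\<dots> <= (LINT x|lborel. \<kappa> n (x - s n *\<^sub>R y) * (L * (r n + \<bar>s n - 1\<bar> * norm y)))"
    proof (rule Lintegral_mono)
      show "integrable lborel (%x. norm (K n (x - s n *\<^sub>R y) * \<phi> x - K n (x - s n *\<^sub>R y) * \<phi> y))"
        by (intro integrable_norm Lintegrable_diff Kphi integrable_mult_left Kc)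
      show "integrable lborel (%x. \<kappa> n (x - s n *\<^sub>R y) * (L * (r n + \<bar>s n - 1\<bar> * norm y)))"
        by (intro integrable_mult_left sh)
      fix x
      show "norm (K n (x - s n *\<^sub>R y) * \<phi> x - K n (x - s n *\<^sub>R y) * \<phi> y) <= \<kappa> n (x - s n *\<^sub>R y) * (L * (r n + \<bar>s n - 1\<bar> * norm y))"
      proof (cases "\<kappa> n (x - s n *\<^sub>R y) = 0")
        case False
        hence 1: "norm (x - s n *\<^sub>R y) <= r n" using \<kappa>[of n] by (simp add: kernel_def)
        have "x - y = (x - s n *\<^sub>R y) + (s n - 1) *\<^sub>R y" by (simp add: algebra_simps)
        hence "norm (x - y) <= norm (x - s n *\<^sub>R y) + norm ((s n - 1) *\<^sub>R y)" by (metis norm_triangle_ineq)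
        hence 2: "norm (x - y) <= r n + \<bar>s n - 1\<bar> * norm y" using 1 by simp
        have "norm (\<phi> x - \<phi> y) <= L * norm (x - y)" by (rule L(2))
        also have "\<dots> <= L * (r n + \<bar>s n - 1\<bar> * norm y)" using L(1) 2 by (intro mult_left_mono) auto
        finally have "norm (\<phi> x - \<phi> y) <= L * (r n + \<bar>s n - 1\<bar> * norm y)" .
        hence "\<kappa> n (x - s n *\<^sub>R y) * norm (\<phi> x - \<phi> y) <= \<kappa> n (x - s n *\<^sub>R y) * (L * (r n + \<bar>s n - 1\<bar> * norm y))"
          using \<kappa>[of n] by (intro mult_left_mono) (auto simp: kernel_def)
        moreover have "norm (K n (x - s n *\<^sub>R y) * \<phi> x - K n (x - s n *\<^sub>R y) * \<phi> y) = \<kappa> n (x - s n *\<^sub>R y) * norm (\<phi> x - \<phi> y)"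
          unfolding right_diff_distrib[symmetric] using \<kappa>[of n] by (simp add: norm_mult K_def kernel_def)
        ultimately show ?thesis by simp
      qed (simp add: K_def)
    qed
    also have "\<dots> = L * (r n + \<bar>s n - 1\<bar> * norm y)" using sh by simp
    finally show ?thesis .
  qed
  have Jlim: "(%n. J n y) \<leadsto> \<phi> y" for y
  proof -
    have "(%n. L * (r n + \<bar>s n - 1\<bar> * norm y)) \<leadsto> L * (0 + \<bar>1 - 1\<bar> * norm y)"
      by (intro tendsto_intros r s)
    hence "(%n. L * (r n + \<bar>s n - 1\<bar> * norm y)) \<leadsto> 0" by simp
    hence "(%n. J n y - \<phi> y) \<leadsto> 0"
      by (rule Lim_null_comparison[OF always_eventually[OF allI[OF Jdiff]]])
    thus ?thesis by (rule LIM_zero_cancel)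
  qed
  define \<rho> where "\<rho> = 2 * (R + 1)"
  have Jbound: "norm (J n y) <= B * indicator (cball 0 \<rho>) y" for n y
  proof (cases "norm y <= \<rho>")
    case True
    have "norm (J n y) <= (LINT x|lborel. norm (K n (x - s n *\<^sub>R y) * \<phi> x))" unfolding J_def by (rule integral_norm_bound)
    also have "\<dots> <= (LINT x|lborel. B * \<kappa> n (x - s n *\<^sub>R y))"
      using B \<kappa>[of n] by (intro Lintegral_mono integrable_norm Kphi integrable_mult_right sh)
        (auto simp: norm_mult K_def mult.commute kernel_def intro!: mult_right_mono)
    also have "\<dots> = B" using sh by simp
    finally show ?thesis using True by simp
  next
    case False
    have "K n (x - s n *\<^sub>R y) * \<phi> x = 0" for x
    proof (rule ccontr)
      assume "K n (x - s n *\<^sub>R y) * \<phi> x \<noteq> 0"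
      hence 1: "norm x <= R" "norm (x - s n *\<^sub>R y) <= 1"
        using R(2)[of x] \<kappa>[of n] r(1)[of n] by (auto simp: kernel_def K_def not_less[symmetric])
      have "(1/2) * norm y <= norm (s n *\<^sub>R y)" unfolding norm_scaleR using s(1)[of n] by (intro mult_right_mono) auto
      also have "\<dots> <= R + 1" using norm_triangle_ineq4[of x "x - s n *\<^sub>R y"] 1 by simp
      finally show False using False by (simp add: \<rho>_def)
    qed
    hence "J n y = (LINT x::'a|lborel. 0)" unfolding J_def by (simp only:)
    thus ?thesis using False by simp
  qed
  note indL = L2_indicator_ball(1)[of \<rho>]
  have Di: "integrable lborel (%y. B * norm (g y * cplx (indicator (cball 0 \<rho>) y)))"
    by (intro integrable_mult_right integrable_norm[OF L2_mult_integrable[OF g(1) indL]])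
  have "(%n. LINT y|lborel. g y * J n y) \<leadsto> (LINT y|lborel. g y * \<phi> y)"
  proof (rule integral_dominated_convergence[OF _ _ Di])
    show "(%y. g y * J n y) \<in> borel_measurable lborel" for n unfolding J_def by measurable
    show "AE y in lborel. (%n. g y * J n y) \<leadsto> g y * \<phi> y" by (intro AE_I2 tendsto_intros Jlim)
    show "AE y in lborel. norm (g y * J n y) <= B * norm (g y * cplx (indicator (cball 0 \<rho>) y))" for n
    proof (rule AE_I2)
      fix y
      have "norm (g y) * norm (J n y) <= norm (g y) * (B * indicator (cball 0 \<rho>) y)" by (intro mult_left_mono Jbound) simp
      thus "norm (g y * J n y) <= B * norm (g y * cplx (indicator (cball 0 \<rho>) y))"
        by (simp add: norm_mult mult.left_commute)
    qed
  qed measurable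
  moreover have "(LINT x|lebesgue. mollify (K n) (s n) f x * \<phi> x) = (LINT y|lborel. g y * J n y)" for n
  proof -
    have [measurable]: "mollify (K n) (s n) g \<in> borel_measurable borel" by (rule smooth_borel[OF mollify_smooth[OF K s0 gl]])
    have "(LINT x|lebesgue. mollify (K n) (s n) f x * \<phi> x) = (LINT x|lebesgue. mollify (K n) (s n) g x * \<phi> x)"
      using mollify_cong_AE[OF f gl g(3) K s0] by simp
    also have "\<dots> = (LINT x|lborel. mollify (K n) (s n) g x * \<phi> x)" by (rule integral_completion) measurable
    also have "\<dots> = (LINT y|lborel. g y * J n y)"
      unfolding J_def K_def by (rule mollify_pairing_Fubini[OF \<kappa> r(1) s(1) \<phi> g(1,2)])
    finally show ?thesis .
  qed
  moreover have "(LINT x|lebesgue. f x * \<phi> x) = (LINT y|lborel. g y * \<phi> y)"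
  proof -
    have "(LINT x|lebesgue. f x * \<phi> x) = (LINT x|lebesgue. g x * \<phi> x)"
    proof (rule integral_cong_AE)
      show "AE x in lebesgue. f x * \<phi> x = g x * \<phi> x" using g(3) by eventually_elim simp
    qed (intro borel_measurable_integrable L2_mult_integrable f gl test_L2_UNIV[OF \<phi>])+
    also have "\<dots> = (LINT y|lborel. g y * \<phi> y)" by (rule integral_completion) measurable
    finally show ?thesis .
  qed
  ultimately show ?thesis by simp
qed

section \<open>Approximation in the Sobolev norm\<close>

lemma h1sq_null:
  fixes S :: "'a::euclidean_space set"
  assumes S: "open S" and z: "z \<in> H1 S" and ae: "AE x in lebesgue_on S. z x = 0"
  shows "h1sq S z = 0"
proof -
  have zL: "z \<in> L2 (lebesgue_on S)" by (rule H1_L2[OF z])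
  have w0: "is_weak_partial S i z 0" if i: "i \<in> Basis" for i
    unfolding is_weak_partial_def
  proof
    fix \<psi> assume \<psi>: "\<psi> \<in> test_functions S"
    have "(LINT x|lebesgue_on S. z x * partial i \<psi> x) = (LINT x|lebesgue_on S. 0)"
    proof (rule integral_cong_AE)
      show "AE x in lebesgue_on S. z x * partial i \<psi> x = 0" using ae by eventually_elim simp
      show "(%x. z x * partial i \<psi> x) \<in> borel_measurable (lebesgue_on S)"
        by (intro borel_measurable_integrable L2_mult_integrable zL test_L2[OF test_partial[OF \<psi> i]] open_sets_lebesgue S)
    qed simp
    thus "(LINT x|lebesgue_on S. z x * partial i \<psi> x) = - (LINT x|lebesgue_on S. (0 :: 'a => complex) x * \<psi> x)" by simp
  qed
  have "energy S z = (\<Sum>i\<in>(Basis::'a set). l2.sq (lebesgue_on S) (0 :: 'a => complex))"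
    by (rule grad_sq[OF S, of "%i. 0"]) (use L2_zero w0 zL in auto)
  also have "\<dots> = 0" by (simp add: l2.ip_zero L2_zero)
  finally show ?thesis using ae l2_sq_0_iff[OF zL] by (simp add: h1sq_def)
qed

lemma H1_UNIV_l2form: "l2form lebesgue (H1 UNIV) (grad_form UNIV)"
  using H1_l2form[OF open_UNIV] by (simp add: lebesgue_on_UNIV_eq)

interpretation HU: l2form lebesgue "H1 UNIV" "grad_form UNIV" by (rule H1_UNIV_l2form)

lemma h1sq_UNIV: "h1sq UNIV u = HU.A.sq u"
  unfolding HU.A_sq by (simp add: h1sq_def lebesgue_on_UNIV_eq)

lemma mollify_partial_H1:
  assumes u: "u \<in> H1 UNIV" and K: "K \<in> test_functions T" and s: "s \<noteq> 0" and i: "i \<in> Basis"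
  shows "partial i (mollify K s u) = mollify K s (fscale (1 / of_real s) (weak_partial UNIV i u))"
proof
  fix x show "partial i (mollify K s u) x = mollify K s (fscale (1 / of_real s) (weak_partial UNIV i u)) x"
    unfolding mollify_partial[OF K s HU.QinH[OF u] i]
    by (rule mollify_weak_partial[OF K s i weak_partial_spec(2)[OF u i]])
qed

text \<open>The regularisations are bounded and converge weakly to \<open>u\<close>; convex combinations of them converge in norm by \<open>mazur\<close>.
  Any convex class containing the regularisations therefore approximates \<open>u\<close>.\<close>

theorem mollify_approximation:
  assumes u: "u \<in> H1 (UNIV :: 'a::euclidean_space set)"
    and \<kappa>: "!!n. kernel (r n) (\<kappa> n)" and r: "!!n. r n <= 1" "r \<leadsto> 0"
    and s: "!!n. 1/2 <= s n" "s \<leadsto> 1"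
    and X: "HU.midconvex X" "!!n. mollify (%x. cplx (\<kappa> n x)) (s n) u \<in> X"
  shows "\<exists>v. (\<forall>N. v N \<in> X \<inter> H1 UNIV) & (%N. h1sq UNIV (v N - u)) \<leadsto> 0"
proof -
  have uL: "u \<in> L2 lebesgue" using H1_L2[OF u] by (simp add: lebesgue_on_UNIV_eq)
  define g where "g i = weak_partial UNIV i u" for i
  have g: "g i \<in> L2 lebesgue" "is_weak_partial UNIV i u (g i)" if "i \<in> Basis" for i
    using weak_partial_spec[OF u that] by (simp_all add: g_def lebesgue_on_UNIV_eq)
  define K where "K n x = cplx (\<kappa> n x)" for n x
  have K: "K n \<in> test_functions UNIV" for n using \<kappa>[of n] by (simp add: kernel_def K_def[abs_def])
  have sp: "0 < s n" "s n \<noteq> 0" for n using s(1)[of n] by auto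
  define w where "w n = mollify (K n) (s n) u" for n
  have mL: "mollify (K n) (s n) f \<in> L2 lebesgue" "nsq (mollify (K n) (s n) f) <= 2 ^ DIM('a) * nsq f"
    if f: "f \<in> L2 lebesgue" for f n
  proof -
    show "mollify (K n) (s n) f \<in> L2 lebesgue" unfolding K_def by (rule mollify_L2[OF \<kappa> sp(1) f])
    have "(1/2) ^ DIM('a) <= s n ^ DIM('a)" using s by (intro power_mono) auto
    hence "1 / s n ^ DIM('a) <= 1 / (1/2) ^ DIM('a)" using sp by (intro divide_left_mono) auto
    hence "1 / s n ^ DIM('a) <= 2 ^ DIM('a)" by (simp add: power_divide)
    hence "(1 / s n ^ DIM('a)) * nsq f <= 2 ^ DIM('a) * nsq f"
      by (intro mult_right_mono l2.ip_pos f)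
    thus "nsq (mollify (K n) (s n) f) <= 2 ^ DIM('a) * nsq f"
      using mollify_L2(2)[OF \<kappa> sp(1) f, of n n] unfolding K_def by linarith
  qed
  have wsm: "Ck_fun k (w n)" for k n unfolding w_def by (rule mollify_smooth[OF K sp(2) uL])
  have pw: "partial i (w n) = mollify (K n) (s n) (fscale (1 / of_real (s n)) (g i))" if i: "i \<in> Basis" for i n
    unfolding w_def g_def by (rule mollify_partial_H1[OF u K sp(2) i])
  have wL: "w n \<in> L2 lebesgue" for n unfolding w_def by (rule mL[OF uL])
  have pL: "partial i (w n) \<in> L2 lebesgue" if i: "i \<in> Basis" for i n
    unfolding pw[OF i] by (rule mL[OF L2_scale[OF g(1)[OF i]]])
  have pwk: "is_weak_partial UNIV i (w n) (partial i (w n))" if i: "i \<in> Basis" for i n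
    by (rule smooth_weak_partial[OF wsm i]) simp
  have wH: "w n \<in> H1 UNIV" for n
    by (rule H1I[of _ _ "%i. partial i (w n)"]) (use wL pL pwk in \<open>auto simp: lebesgue_on_UNIV_eq\<close>)
  have psq: "nsq (partial i (w n)) <= 2 ^ DIM('a) * (4 * nsq (g i))" if i: "i \<in> Basis" for i n
  proof -
    have "nsq (fscale (1 / of_real (s n)) (g i)) = (1 / s n)^2 * nsq (g i)"
      using sp(1)[of n] by (subst l2.sq_scale[OF g(1)[OF i]]) (simp add: norm_divide)
    also have "\<dots> <= 2^2 * nsq (g i)"
    proof (intro mult_right_mono power_mono l2.ip_pos g(1)[OF i])
      have "1 / s n <= 1 / (1/2)" using s(1)[of n] sp(1)[of n] by (intro divide_left_mono) auto
      thus "1 / s n <= 2" by simp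
    qed (use sp in \<open>auto simp: less_imp_le\<close>)
    finally have "2 ^ DIM('a) * nsq (fscale (1 / of_real (s n)) (g i)) <= 2 ^ DIM('a) * (4 * nsq (g i))"
      by (intro mult_left_mono) auto
    thus ?thesis unfolding pw[OF i] using mL(2)[OF L2_scale[OF g(1)[OF i]], of n "1 / of_real (s n)"] by linarith
  qed
  have gw: "energy UNIV (w n) = (\<Sum>i\<in>Basis. nsq (partial i (w n)))" for n
    using grad_sq[OF open_UNIV, of "%i. partial i (w n)" "w n"] pL pwk wL by (simp add: lebesgue_on_UNIV_eq)
  define B where "B = (\<Sum>i\<in>Basis. 2 ^ DIM('a) * (4 * nsq (g i))) + 2 ^ DIM('a) * nsq u"
  have wB: "HU.A.sq (w n) <= B" for n
    unfolding HU.A_sq gw B_def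
  proof (rule add_mono)
    show "(\<Sum>i\<in>Basis. nsq (partial i (w n))) <= (\<Sum>i\<in>Basis. 2 ^ DIM('a) * (4 * nsq (g i)))"
      by (rule sum_mono) (rule psq)
    show "nsq (w n) <= 2 ^ DIM('a) * nsq u" unfolding w_def by (rule mL[OF uL])
  qed
  have X': "X \<inter> H1 UNIV \<subseteq> H1 UNIV" "HU.midconvex (X \<inter> H1 UNIV)" "w n \<in> X \<inter> H1 UNIV" for n
  proof -
    show "HU.midconvex (X \<inter> H1 UNIV)" using X(1) HU.Q.closed unfolding HU.midconvex_def by blast
    show "w n \<in> X \<inter> H1 UNIV" using X(2)[of n] wH[of n] by (simp add: w_def K_def[abs_def])
  qed auto
  from HU.mazur[of "X \<inter> H1 UNIV" w B, OF X'(1,2,3) wB] obtain u' v where u': "u' \<in> H1 UNIV" and v: "\<forall>N. v N \<in> X \<inter> H1 UNIV"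
    "(%N. HU.A.sq (v N - u')) \<leadsto> 0"
    and lim: "\<forall>\<phi>\<in>L2 lebesgue. \<forall>L. (%n. l2_inner lebesgue (w n) \<phi>) \<leadsto> L --> l2_inner lebesgue u' \<phi> = L"
    by (elim bexE exE conjE)
  have dH: "u' - u \<in> H1 UNIV" by (rule HU.Q.closed(3)[OF u' u])
  have u'L: "u' \<in> L2 lebesgue" by (rule HU.QinH[OF u'])
  have "AE x in lebesgue_on UNIV. (u' - u) x = 0"
  proof (rule du_Bois_Reymond[OF open_UNIV H1_L2[OF dH]])
    fix \<phi> :: "'a => complex" assume \<phi>: "\<phi> \<in> test_functions UNIV"
    have c: "(%x. cnj (\<phi> x)) \<in> L2 lebesgue" by (rule test_L2_UNIV[OF test_cnj[OF \<phi>]])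
    have "(%n. l2_inner lebesgue (w n) (%x. cnj (\<phi> x))) \<leadsto> l2_inner lebesgue u (%x. cnj (\<phi> x))"
      using mollify_pairing[OF \<kappa> r s \<phi> uL] by (simp add: l2_inner_def w_def K_def[abs_def])
    hence "l2_inner lebesgue u' (%x. cnj (\<phi> x)) = l2_inner lebesgue u (%x. cnj (\<phi> x))"
      using lim[rule_format, OF c] by blast
    hence "(LINT x|lebesgue. u' x * \<phi> x) = (LINT x|lebesgue. u x * \<phi> x)" by (simp add: l2_inner_def)
    thus "(LINT x|lebesgue_on UNIV. (u' - u) x * \<phi> x) = 0"
      using L2_mult_integrable[OF u'L test_L2_UNIV[OF \<phi>]] L2_mult_integrable[OF uL test_L2_UNIV[OF \<phi>]]
      by (simp add: lebesgue_on_UNIV_eq left_diff_distrib)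
  qed
  hence z: "HU.A.sq (u' - u) = 0" using h1sq_null[OF open_UNIV dH] by (simp only: h1sq_UNIV)
  have vH: "v N \<in> H1 UNIV" for N using v(1) by auto
  have "HU.A.sq (v N - u) <= 2 * HU.A.sq (v N - u')" for N
    using HU.A.sq_add_le[OF HU.Q.closed(3)[OF vH[of N] u'] dH] z by simp
  moreover have "0 <= HU.A.sq (v N - u)" for N by (rule HU.A.ip_pos[OF HU.Q.closed(3)[OF vH u]])
  ultimately have "(%N. HU.A.sq (v N - u)) \<leadsto> 0"
    by (intro tendsto_sandwich[OF _ _ tendsto_const tendsto_mult_right_zero[OF v(2), of 2]] always_eventually allI)
  thus ?thesis using v(1) unfolding h1sq_UNIV by blast
qed

text \<open>Choosing the dilation \<open>s < 1\<close> first, the compact set \<open>s C\<close> has positive distance to the complement of \<open>S\<close>, so that a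
  sufficiently narrow kernel keeps the support inside \<open>S\<close>.\<close>

theorem test_approximation:
  fixes C S :: "'a::euclidean_space set"
  assumes S: "open S" and C: "compact C" and star: "!!s x. 0 < s ==> s < 1 ==> x \<in> C ==> s *\<^sub>R x \<in> S"
    and u: "u \<in> H1 UNIV" and ae: "AE x in lebesgue. x \<notin> C --> u x = 0"
  shows "\<exists>v. (\<forall>N. v N \<in> test_functions S) & (%N. h1sq UNIV (v N - u)) \<leadsto> 0"
proof -
  define s where "s n = 1 - 1 / real (n + 2)" for n
  have s: "1/2 <= s n" "s n < 1" "0 < s n" for n by (auto simp: s_def field_simps)
  have s1: "s \<leadsto> 1"
  proof -
    have "(%n. 1 - 1 / real (n + 2)) \<leadsto> 1 - 0"
      by (intro tendsto_diff tendsto_const LIMSEQ_ignore_initial_segment[OF lim_const_over_n])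
    thus ?thesis by (simp add: s_def[abs_def])
  qed
  have Cn: "compact ((*\<^sub>R) (s n) ` C)" "(*\<^sub>R) (s n) ` C \<subseteq> S" for n
    using star s compact_scaling[OF C, of "s n"] by auto
  have "\<exists>e>0. (\<Union>x\<in>(*\<^sub>R) (s n) ` C. cball x e) \<subseteq> S" for n
    using compact_subset_open_imp_cball_epsilon_subset[OF Cn(1) S Cn(2)] by metis
  then obtain e where e: "!!n. e n > 0" "!!n. (\<Union>x\<in>(*\<^sub>R) (s n) ` C. cball x (e n)) \<subseteq> S" by metis
  define r where "r n = min (e n) (1 / real (Suc n))" for n
  have r: "0 < r n" "r n <= 1" "r n <= e n" for n using e(1)[of n] by (auto simp: r_def min_le_iff_disj)
  have r0: "r \<leadsto> 0"
  proof (rule tendsto_sandwich[OF _ _ tendsto_const lim_const_over_n[THEN LIMSEQ_Suc, of 1]])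
    show "\<forall>\<^sub>F n in sequentially. 0 <= r n" using r(1) by (auto simp: less_imp_le)
    show "\<forall>\<^sub>F n in sequentially. r n <= 1 / real (Suc n)" by (auto simp: r_def)
  qed
  have "\<exists>\<kappa> :: 'a => real. kernel (r n) \<kappa>" for n by (rule kernel_exists[OF r(1)])
  then obtain \<kappa> :: "nat => 'a => real" where \<kappa>: "!!n. kernel (r n) (\<kappa> n)" by metis
  have uL: "u \<in> L2 lebesgue" by (rule HU.QinH[OF u])
  have "\<exists>v. (\<forall>N. v N \<in> test_functions S \<inter> H1 UNIV) & (%N. h1sq UNIV (v N - u)) \<leadsto> 0"
  proof (rule mollify_approximation[OF u \<kappa> r(2) r0 s(1) s1])
    have "(%x. (1/2) * (f x + g x)) \<in> test_functions S" if "f \<in> test_functions S" "g \<in> test_functions S" for f g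
      by (rule test_scale[OF test_add[OF that]])
    thus "HU.midconvex (test_functions S)" unfolding HU.midconvex_def fscale_def by simp
    fix n
    define K where "K x = cplx (\<kappa> n x)" for x
    have K: "K \<in> test_functions UNIV" using \<kappa>[of n] by (simp add: kernel_def K_def[abs_def])
    have s0: "s n \<noteq> 0" using s(3)[of n] by simp
    show "mollify (%x. cplx (\<kappa> n x)) (s n) u \<in> test_functions S"
      unfolding K_def[symmetric]
    proof (rule test_functionsI[of _ "\<Union>x\<in>(*\<^sub>R) (s n) ` C. \<Union>y\<in>cball 0 (r n). {x + y}"])
      show "Ck_fun k (mollify K (s n) u)" for k by (rule mollify_smooth[OF K s0 uL])
      show "compact (\<Union>x\<in>(*\<^sub>R) (s n) ` C. \<Union>y\<in>cball 0 (r n). {x + y})" by (intro compact_sums' Cn) simp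
      show "(\<Union>x\<in>(*\<^sub>R) (s n) ` C. \<Union>y\<in>cball 0 (r n). {x + y}) \<subseteq> S"
      proof clarify
        fix x y :: 'a assume "x \<in> C" "y \<in> cball 0 (r n)"
        hence "s n *\<^sub>R x + y \<in> cball (s n *\<^sub>R x) (e n)" using r(3)[of n] by (auto simp: dist_norm)
        thus "s n *\<^sub>R x + y \<in> S" using e(2)[of n] \<open>x \<in> C\<close> by blast
      qed
      fix x assume nz: "mollify K (s n) u x \<noteq> 0"
      show "x \<in> (\<Union>x\<in>(*\<^sub>R) (s n) ` C. \<Union>y\<in>cball 0 (r n). {x + y})"
      proof (rule ccontr)
        assume nx: "x \<notin> (\<Union>x\<in>(*\<^sub>R) (s n) ` C. \<Union>y\<in>cball 0 (r n). {x + y})"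
        have "K (x - s n *\<^sub>R y) = 0" if y: "y \<in> C" for y
        proof (rule ccontr)
          assume "K (x - s n *\<^sub>R y) \<noteq> 0"
          hence "x - s n *\<^sub>R y \<in> cball 0 (r n)" using \<kappa>[of n] by (auto simp: K_def kernel_def)
          moreover have "x = s n *\<^sub>R y + (x - s n *\<^sub>R y)" by simp
          ultimately show False using nx y by blast
        qed
        note Kz = this
        have "AE y in lebesgue. u y * K (x - s n *\<^sub>R y) = 0" using ae by eventually_elim (use Kz in auto)
        hence "mollify K (s n) u x = 0" unfolding mollify_def by (rule integral_eq_zero_AE)
        thus False using nz by simp
      qed
    qed
  qed
  thus ?thesis by blast
qed

section \<open>Translations and the local Rellich inequality\<close>

lemma norm_smooth_increment:
  assumes v: "!!k. Ck_fun k v"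
  shows "ennreal ((norm (v (x + z) - v x))^2) \<le>
    (\<integral>\<^sup>+t. indicator {0..1} t * ennreal ((norm z)^2 * (\<Sum>i\<in>Basis. (norm (partial i v (x + t *\<^sub>R z)))^2)) \<partial>(lborel :: real measure))"
proof -
  define d where "d t = (\<Sum>i\<in>Basis. (z \<bullet> i) *\<^sub>R partial i v (x + t *\<^sub>R z))" for t
  have cp: "continuous_on UNIV (partial i v)" if "i \<in> Basis" for i
    using smooth_partial[OF v that, of 0] by simp
  have cd: "continuous_on A d" for A unfolding d_def
    by (intro continuous_on_sum continuous_on_scaleR continuous_on_const continuous_on_compose2[OF cp]) (auto intro!: continuous_intros)
  have dv: "((%t. v (x + t *\<^sub>R z)) has_vector_derivative d t) (at t within A)" for t A
  proof -
    have 1: "((%t. x + t *\<^sub>R z) has_derivative (%h. h *\<^sub>R z)) (at t within A)"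
      by (auto intro!: derivative_eq_intros)
    have 2: "(v has_derivative (%h. \<Sum>i\<in>Basis. (h \<bullet> i) *\<^sub>R partial i v (x + t *\<^sub>R z))) (at (x + t *\<^sub>R z))"
      by (rule smooth_has_derivative[OF v])
    have "((%t. v (x + t *\<^sub>R z)) has_derivative (%h. \<Sum>i\<in>Basis. ((h *\<^sub>R z) \<bullet> i) *\<^sub>R partial i v (x + t *\<^sub>R z))) (at t within A)"
      by (rule has_derivative_compose[OF 1 2])
    moreover have "(%h. \<Sum>i\<in>Basis. ((h *\<^sub>R z) \<bullet> i) *\<^sub>R partial i v (x + t *\<^sub>R z)) = (%h. h *\<^sub>R d t)"
      by (simp add: d_def scaleR_sum_right)
    ultimately show ?thesis by (simp add: has_vector_derivative_def)
  qed
  have [measurable]: "d \<in> borel_measurable borel" by (rule borel_measurable_continuous_onI[OF cd])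
  have int: "integrable lborel (%t. indicator {0..1} t *\<^sub>R d t)"
    using borel_integrable_atLeastAtMost'[OF cd, of 0 1] by (simp add: set_integrable_def)
  have "v (x + z) - v x = (LINT t|lborel. indicator {0..1} t *\<^sub>R d t)"
    using integral_FTC_atLeastAtMost[of 0 1 "%t. v (x + t *\<^sub>R z)" d, OF _ dv cd] by simp
  hence "ennreal (norm (v (x + z) - v x)) <= (\<integral>\<^sup>+t. ennreal (norm (indicator {0..1} t *\<^sub>R d t)) \<partial>lborel)"
    using integral_norm_bound_ennreal[OF int] by simp
  also have "\<dots> = (\<integral>\<^sup>+t. ennreal (indicator {0..1} t * norm (d t)) * indicator {0..1} t \<partial>lborel)"
    by (intro nn_integral_cong) (auto split: split_indicator)
  finally have "(ennreal (norm (v (x + z) - v x)))^2 <= (\<integral>\<^sup>+t. ennreal (indicator {0..1} t * norm (d t)) * indicator {0..1} t \<partial>lborel)^2"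
    by (rule power_mono) simp
  also have "\<dots> <= (\<integral>\<^sup>+t. (ennreal (indicator {0..1} t * norm (d t)))^2 \<partial>lborel) * (\<integral>\<^sup>+t. (indicator {0..1::real} t)^2 \<partial>lborel)"
    by (rule Cauchy_Schwarz_nn_integral) measurable
  also have "(\<integral>\<^sup>+t. (indicator {0..1::real} t)^2 \<partial>lborel) = (1::ennreal)"
  proof -
    have "(\<integral>\<^sup>+t. (indicator {0..1::real} t)^2 \<partial>lborel) = (\<integral>\<^sup>+t. indicator {0..1::real} t \<partial>lborel)"
      by (intro nn_integral_cong) (auto split: split_indicator)
    thus ?thesis by (simp add: nn_integral_indicator)
  qed
  also have "(\<integral>\<^sup>+t. (ennreal (indicator {0..1} t * norm (d t)))^2 \<partial>lborel) * 1 \<le>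
     (\<integral>\<^sup>+t. indicator {0..1} t * ennreal ((norm z)^2 * (\<Sum>i\<in>Basis. (norm (partial i v (x + t *\<^sub>R z)))^2)) \<partial>lborel)"
    unfolding mult_1_right
  proof (rule nn_integral_mono)
    fix t :: real
    have "norm (d t) <= (\<Sum>i\<in>Basis. \<bar>z \<bullet> i\<bar> * norm (partial i v (x + t *\<^sub>R z)))"
      unfolding d_def by (rule order_trans[OF norm_sum]) simp
    hence "(norm (d t))^2 <= (\<Sum>i\<in>Basis. \<bar>z \<bullet> i\<bar> * norm (partial i v (x + t *\<^sub>R z)))^2" by (rule power_mono) simp
    also have "\<dots> <= (\<Sum>i\<in>Basis. \<bar>z \<bullet> i\<bar>^2) * (\<Sum>i\<in>Basis. (norm (partial i v (x + t *\<^sub>R z)))^2)"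
      by (rule Cauchy_Schwarz_ineq_sum)
    also have "(\<Sum>i\<in>Basis. \<bar>z \<bullet> i\<bar>^2) = (norm z)^2"
      unfolding power2_norm_eq_inner euclidean_inner[of z z] by (simp add: power2_eq_square)
    finally show "(ennreal (indicator {0..1} t * norm (d t)))^2 <= indicator {0..1} t * ennreal ((norm z)^2 * (\<Sum>i\<in>Basis. (norm (partial i v (x + t *\<^sub>R z)))^2))"
      by (auto simp: ennreal_power split: split_indicator intro: ennreal_leI)
  qed
  finally show ?thesis by (simp add: ennreal_power)
qed

text \<open>The fundamental theorem of calculus along the segment from \<open>x\<close> to \<open>x + z\<close>, integrated over \<open>x\<close>.\<close>

theorem smooth_translation:
  fixes v :: "'a::euclidean_space => complex"
  assumes v: "!!k. Ck_fun k v" and p: "!!i. i \<in> Basis ==> partial i v \<in> L2 lborel"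
  shows "(\<integral>\<^sup>+x. ennreal ((norm (v (x + z) - v x))^2) \<partial>lborel) <= ennreal ((norm z)^2 * (\<Sum>i\<in>Basis. l2.sq lborel (partial i v)))"
proof -
  define G where "G x = ennreal ((norm z)^2 * (\<Sum>i\<in>Basis. (norm (partial i v x))^2))" for x
  have pm: "partial i v \<in> borel_measurable borel" if "i \<in> Basis" for i by (rule smooth_borel[OF smooth_partial[OF v that]])
  have nm: "(%x. norm (partial i v x)) \<in> borel_measurable borel" if "i \<in> Basis" for i
    using pm[OF that] by measurable
  have [measurable]: "G \<in> borel_measurable borel" unfolding G_def
    by (intro measurable_compose[OF _ measurable_ennreal] borel_measurable_times borel_measurable_const borel_measurable_sum
        borel_measurable_power nm)
  have GI: "(\<integral>\<^sup>+x. G x \<partial>lborel) = ennreal ((norm z)^2 * (\<Sum>i\<in>Basis. l2.sq lborel (partial i v)))"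
  proof -
    have i: "integrable lborel (%x. (norm z)^2 * (\<Sum>i\<in>Basis. (norm (partial i v x))^2))"
      by (intro integrable_mult_right Lintegrable_sum L2_integrable p)
    have "(\<integral>\<^sup>+x. G x \<partial>lborel) = ennreal (LINT x|lborel. (norm z)^2 * (\<Sum>i\<in>Basis. (norm (partial i v x))^2))"
      unfolding G_def by (rule nn_integral_eq_integral[OF i]) (auto intro!: AE_I2 mult_nonneg_nonneg sum_nonneg)
    also have "(LINT x|lborel. (norm z)^2 * (\<Sum>i\<in>Basis. (norm (partial i v x))^2)) = (norm z)^2 * (\<Sum>i\<in>Basis. l2.sq lborel (partial i v))"
      unfolding l2_sq by (simp add: Lintegral_sum L2_integrable[OF p])
    finally show ?thesis .
  qed
  have "(\<integral>\<^sup>+x. ennreal ((norm (v (x + z) - v x))^2) \<partial>lborel) <= (\<integral>\<^sup>+x. (\<integral>\<^sup>+t. indicator {0..1} t * G (x + t *\<^sub>R z) \<partial>(lborel :: real measure)) \<partial>lborel)"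
    unfolding G_def by (intro nn_integral_mono norm_smooth_increment v)
  also have "\<dots> = (\<integral>\<^sup>+t. (\<integral>\<^sup>+x. indicator {0..1} t * G (x + t *\<^sub>R z) \<partial>lborel) \<partial>(lborel :: real measure))"
    by (rule lborel_pair.Fubini') measurable
  also have "\<dots> = (\<integral>\<^sup>+t. indicator {0..1::real} t * (\<integral>\<^sup>+x. G x \<partial>lborel) \<partial>lborel)"
  proof (rule nn_integral_cong)
    fix t :: real
    have "(\<integral>\<^sup>+x. indicator {0..1} t * G (x + t *\<^sub>R z) \<partial>lborel) = indicator {0..1} t * (\<integral>\<^sup>+x. G (t *\<^sub>R z + 1 *\<^sub>R x) \<partial>lborel)"
      by (subst nn_integral_cmult) (auto simp: add.commute)
    also have "(\<integral>\<^sup>+x. G (t *\<^sub>R z + 1 *\<^sub>R x) \<partial>lborel) = (\<integral>\<^sup>+x. G x \<partial>lborel)"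
      by (subst nn_integral_affine) auto
    finally show "(\<integral>\<^sup>+x. indicator {0..1} t * G (x + t *\<^sub>R z) \<partial>lborel) = indicator {0..1} t * (\<integral>\<^sup>+x. G x \<partial>lborel)" .
  qed
  also have "\<dots> = (\<integral>\<^sup>+x. G x \<partial>lborel)" by (simp add: nn_integral_multc)
  finally show ?thesis unfolding GI .
qed

lemma L2_borel_lborel: "u \<in> L2 lebesgue ==> u \<in> borel_measurable borel ==> u \<in> L2 lborel"
  by (auto simp: L2_def integrable_completion)

text \<open>The regularisations are smooth, and smoothness is preserved by convex combinations.\<close>

lemma smooth_dense:
  assumes u: "u \<in> H1 (UNIV :: 'a::euclidean_space set)"
  shows "\<exists>v. (\<forall>N. v N \<in> H1 UNIV & (\<forall>k. Ck_fun k (v N)) & (\<forall>i\<in>Basis. partial i (v N) \<in> L2 lborel)) &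
    (%N. h1sq UNIV (v N - u)) \<leadsto> 0"
proof -
  define X where "X = {v :: 'a => complex. (\<forall>k. Ck_fun k v) & (\<forall>i\<in>Basis. partial i v \<in> L2 lborel)}"
  have uL: "u \<in> L2 lebesgue" by (rule HU.QinH[OF u])
  have "\<exists>\<kappa> :: 'a => real. kernel (1 / real (Suc n)) \<kappa>" for n by (rule kernel_exists) simp
  then obtain \<kappa> :: "nat => 'a => real" where \<kappa>: "!!n. kernel (1 / real (Suc n)) (\<kappa> n)" by metis
  have "\<exists>v. (\<forall>N. v N \<in> X \<inter> H1 UNIV) & (%N. h1sq UNIV (v N - u)) \<leadsto> 0"
  proof (rule mollify_approximation[where s = "%_. 1", OF u \<kappa>])
    show "(%n. 1 / real (Suc n)) \<leadsto> 0" by (rule lim_const_over_n[THEN LIMSEQ_Suc])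
    show "HU.midconvex X" unfolding HU.midconvex_def
    proof (intro ballI)
      fix f g assume fg: "f \<in> X" "g \<in> X"
      have e: "fscale (1/2) (f + g) = (%x. (1/2) * (f x + g x))" by (simp add: fscale_def)
      have d: "((%x. (1/2) * (f x + g x)) has_derivative (%h. (1/2) * (frechet_derivative f (at x) h + frechet_derivative g (at x) h))) (at x)" for x
        using fg by (intro has_derivative_mult_right has_derivative_add Ck_SucD(1)) (auto simp: X_def)
      have "partial i (fscale (1/2) (f + g)) = fscale (1/2) (partial i f + partial i g)" for i
        unfolding e using partial_eq[OF d, of i] by (auto simp: partial_def)
      moreover have "Ck_fun k (fscale (1/2) (f + g))" for k
        unfolding e using fg by (intro Ck_mult Ck_const Ck_add) (auto simp: X_def)
      ultimately show "fscale (1/2) (f + g) \<in> X" using fg by (auto simp: X_def intro!: L2_scale L2_add)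
    qed
    fix n
    have K: "(%x. cplx (\<kappa> n x)) \<in> test_functions UNIV" using \<kappa>[of n] by (simp add: kernel_def)
    have sm: "Ck_fun k (mollify (%x. cplx (\<kappa> n x)) 1 u)" for k by (rule mollify_smooth[OF K _ uL]) simp
    have "partial i (mollify (%x. cplx (\<kappa> n x)) 1 u) \<in> L2 lborel" if i: "i \<in> Basis" for i
    proof (rule L2_borel_lborel)
      have "weak_partial UNIV i u \<in> L2 lebesgue" using weak_partial_spec(1)[OF u i] by (simp add: lebesgue_on_UNIV_eq)
      thus "partial i (mollify (%x. cplx (\<kappa> n x)) 1 u) \<in> L2 lebesgue"
        using mollify_partial_H1[OF u K _ i, of 1] mollify_L2(1)[OF \<kappa>[of n], of 1] L2_scale by simp
      show "partial i (mollify (%x. cplx (\<kappa> n x)) 1 u) \<in> borel_measurable borel"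
        by (rule smooth_borel[OF smooth_partial[OF sm i]])
    qed
    thus "mollify (%x. cplx (\<kappa> n x)) 1 u \<in> X" using sm by (simp add: X_def)
  qed auto
  thus ?thesis unfolding X_def by blast
qed

lemma grad_smooth:
  assumes v: "!!k. Ck_fun k v" "!!i. i \<in> Basis ==> partial i v \<in> L2 lborel" "v \<in> L2 lebesgue"
  shows "energy UNIV v = (\<Sum>i\<in>Basis. l2.sq lborel (partial i v))"
proof -
  have "energy UNIV v = (\<Sum>i\<in>Basis. nsq (partial i v))"
    using grad_sq[OF open_UNIV, of "%i. partial i v" v] L2_lborel_lebesgue[OF v(2)] v(3) smooth_weak_partial[OF v(1)]
    by (simp add: lebesgue_on_UNIV_eq)
  also have "\<dots> = (\<Sum>i\<in>Basis. l2.sq lborel (partial i v))"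
    using L2_measurable[OF v(2)] by (intro sum.cong refl) (simp add: l2_lborel_lebesgue)
  finally show ?thesis .
qed

subsection \<open>A grid of cubes\<close>

text \<open>The lower corner of the grid cube of side \<open>\<epsilon>\<close> that contains \<open>x\<close>, in units of \<open>\<epsilon>\<close>.\<close>

definition cell :: "real => 'a::euclidean_space => 'a" where
  "cell \<epsilon> x = (\<Sum>i\<in>Basis. of_int \<lfloor>(x \<bullet> i) / \<epsilon>\<rfloor> *\<^sub>R i)"

definition cube :: "real => 'a::euclidean_space => 'a set" where
  "cube \<epsilon> z = {x. cell \<epsilon> x = z}"

lemma cell_inner: "i \<in> Basis ==> cell \<epsilon> x \<bullet> i = of_int \<lfloor>(x \<bullet> i) / \<epsilon>\<rfloor>"
  by (simp add: cell_def)

lemma cell_measurable [measurable]: "cell \<epsilon> \<in> borel_measurable borel"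
  unfolding cell_def by measurable

lemma cube_measurable [measurable]: "cube \<epsilon> z \<in> sets borel"
  unfolding cube_def by measurable

lemma cube_iff:
  assumes "0 < \<epsilon>" "z = cell \<epsilon> y"
  shows "x \<in> cube \<epsilon> z \<longleftrightarrow> (\<forall>i\<in>Basis. \<epsilon> * (z \<bullet> i) <= x \<bullet> i & x \<bullet> i < \<epsilon> * (z \<bullet> i) + \<epsilon>)"
proof -
  have "x \<in> cube \<epsilon> z \<longleftrightarrow> (\<forall>i\<in>Basis. \<lfloor>(x \<bullet> i) / \<epsilon>\<rfloor> = \<lfloor>(y \<bullet> i) / \<epsilon>\<rfloor>)"
    unfolding cube_def assms(2) by (auto simp: euclidean_eq_iff[of "cell \<epsilon> x"] cell_inner)
  also have "\<dots> \<longleftrightarrow> (\<forall>i\<in>Basis. of_int \<lfloor>(y \<bullet> i) / \<epsilon>\<rfloor> <= (x \<bullet> i) / \<epsilon> & (x \<bullet> i) / \<epsilon> < of_int \<lfloor>(y \<bullet> i) / \<epsilon>\<rfloor> + 1)"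
    by (intro ball_cong refl) (simp add: floor_eq_iff)
  also have "\<dots> \<longleftrightarrow> (\<forall>i\<in>Basis. \<epsilon> * (z \<bullet> i) <= x \<bullet> i & x \<bullet> i < \<epsilon> * (z \<bullet> i) + \<epsilon>)"
    using assms by (intro ball_cong refl) (simp add: cell_inner pos_le_divide_eq pos_divide_less_eq algebra_simps)
  finally show ?thesis .
qed

lemma emeasure_cube:
  assumes "0 < \<epsilon>" "z \<in> range (cell \<epsilon> :: 'a::euclidean_space => 'a)"
  shows "emeasure lborel (cube \<epsilon> z) = ennreal (\<epsilon> ^ DIM('a))"
proof -
  obtain y where y: "z = cell \<epsilon> y" using assms by auto
  define b where "b = \<epsilon> *\<^sub>R z + \<epsilon> *\<^sub>R One"
  have bi: "i \<in> Basis ==> b \<bullet> i = \<epsilon> * (z \<bullet> i) + \<epsilon>" for i by (simp add: b_def inner_simps)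
  have 1: "box (\<epsilon> *\<^sub>R z) b \<subseteq> cube \<epsilon> z" "cube \<epsilon> z \<subseteq> cbox (\<epsilon> *\<^sub>R z) b"
    by (auto simp: cube_iff[OF assms(1) y] mem_box bi less_imp_le)
  have p: "(\<Prod>i\<in>Basis. (b - \<epsilon> *\<^sub>R z) \<bullet> i) = \<epsilon> ^ DIM('a)"
    by (simp add: inner_diff_left bi)
  have le: "\<forall>i\<in>Basis. \<epsilon> *\<^sub>R z \<bullet> i <= b \<bullet> i" using assms(1) by (simp add: bi)
  have "emeasure lborel (box (\<epsilon> *\<^sub>R z) b) <= emeasure lborel (cube \<epsilon> z)" "emeasure lborel (cube \<epsilon> z) <= emeasure lborel (cbox (\<epsilon> *\<^sub>R z) b)"
    using 1 by (intro emeasure_mono; simp)+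
  thus ?thesis using le p by (simp add: emeasure_lborel_box_eq emeasure_lborel_cbox_eq)
qed

lemma finite_cells: assumes "0 < \<epsilon>" shows "finite (cell \<epsilon> ` cball (0::'a::euclidean_space) R)"
proof (rule finite_subset)
  let ?A = "{\<lfloor>- R / \<epsilon>\<rfloor>..\<lfloor>R / \<epsilon>\<rfloor>}"
  show "finite ((%f. \<Sum>i\<in>Basis. of_int (f i) *\<^sub>R i) ` (PiE (Basis :: 'a set) (%_. ?A)))"
    by (intro finite_imageI finite_PiE) auto
  show "cell \<epsilon> ` cball 0 R \<subseteq> (%f. \<Sum>i\<in>Basis. of_int (f i) *\<^sub>R i) ` (PiE (Basis :: 'a set) (%_. ?A))"
  proof clarify
    fix x :: 'a assume x: "x \<in> cball 0 R"
    define f where "f = restrict (%i. \<lfloor>(x \<bullet> i) / \<epsilon>\<rfloor>) Basis"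
    have "f \<in> PiE Basis (%_. ?A)"
    proof (rule PiE_I)
      fix i :: 'a assume i: "i \<in> Basis"
      have "\<bar>x \<bullet> i\<bar> <= R" using Basis_le_norm[OF i, of x] x by simp
      hence "- R / \<epsilon> <= (x \<bullet> i) / \<epsilon>" "(x \<bullet> i) / \<epsilon> <= R / \<epsilon>" using assms by (auto simp: field_simps abs_le_iff)
      thus "f i \<in> ?A" using i by (auto simp: f_def intro!: floor_mono)
    qed (simp add: f_def)
    moreover have "cell \<epsilon> x = (\<Sum>i\<in>Basis. of_int (f i) *\<^sub>R i)" unfolding cell_def f_def by (intro sum.cong) auto
    ultimately show "cell \<epsilon> x \<in> (%f. \<Sum>i\<in>Basis. of_int (f i) *\<^sub>R i) ` (PiE (Basis :: 'a set) (%_. ?A))" by blast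
  qed
qed

text \<open>The variance identity, which turns a deviation from the mean into differences of values, that is, translations.\<close>

lemma mean_square_deviation:
  fixes v :: "'a::euclidean_space => complex"
  assumes v: "v \<in> L2 lborel" and [measurable]: "v \<in> borel_measurable borel" "Q \<in> sets borel"
    and m: "emeasure lborel Q = ennreal m" "0 < m"
  defines "B \<equiv> LINT x|lborel. indicator Q x * (norm (v x))^2"
    and "I \<equiv> LINT x|lborel. indicator Q x *\<^sub>R v x"
  shows "(\<integral>\<^sup>+x. (\<integral>\<^sup>+y. indicator Q x * indicator Q y * ennreal ((norm (v x - v y))^2) \<partial>lborel) \<partial>lborel) = ennreal (2 * m * B - 2 * (norm I)^2)"
proof -
  have Bi: "integrable lborel (%x. indicator Q x * (norm (v x))^2)"
    by (rule integrable_real_mult_indicator[OF _ L2_integrable[OF v], simplified mult.commute]) simp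
  have ii: "integrable lborel (indicator Q :: 'a => real)" using m by (intro integrable_real_indicator) auto
  have mi: "(LINT x|lborel. indicator Q x) = m" using m by (simp add: measure_def)
  have Ii: "integrable lborel (%x. indicator Q x *\<^sub>R v x)"
    using L2_mult_integrable[OF L2_indicator_lborel v, of Q] m by (simp add: scaleR_conv_of_real)
  have pt: "indicator Q y * (norm (a - v y))^2 = (norm a)^2 * indicator Q y + indicator Q y * (norm (v y))^2 - 2 * Re (a * cnj (indicator Q y *\<^sub>R v y))" for a y
    unfolding cmod_power2 by (simp add: power2_eq_square algebra_simps split: split_indicator)
  have Rei: "integrable lborel (%y. 2 * Re (a * cnj (indicator Q y *\<^sub>R v y)))" for a
    by (intro integrable_mult_right integrable_Re integrable_cnj Ii)
  have hi: "integrable lborel (%y. indicator Q y * (norm (a - v y))^2)" for a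
    unfolding pt by (intro Lintegrable_diff Lintegrable_add integrable_mult_right ii Bi Rei)
  have h: "(LINT y|lborel. indicator Q y * (norm (a - v y))^2) = (norm a)^2 * m + B - 2 * Re (a * cnj I)" for a
  proof -
    have "(LINT y|lborel. 2 * Re (a * cnj (indicator Q y *\<^sub>R v y))) = 2 * Re (LINT y|lborel. a * cnj (indicator Q y *\<^sub>R v y))"
      using Ii by (subst integral_mult_right_zero) (intro arg_cong[where f = "(*) 2"] integral_Re integrable_mult_right integrable_cnj)
    also have "(LINT y|lborel. a * cnj (indicator Q y *\<^sub>R v y)) = a * cnj I"
      unfolding I_def by (subst integral_mult_right_zero) (simp only: Lintegral_cnj)
    finally have *: "(LINT y|lborel. 2 * Re (a * cnj (indicator Q y *\<^sub>R v y))) = 2 * Re (a * cnj I)" .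
    have "(LINT y|lborel. indicator Q y * (norm (a - v y))^2) = (LINT y|lborel. (norm a)^2 * indicator Q y + indicator Q y * (norm (v y))^2) - (LINT y|lborel. 2 * Re (a * cnj (indicator Q y *\<^sub>R v y)))"
      unfolding pt by (intro Lintegral_diff Lintegrable_add integrable_mult_right ii Bi Rei)
    also have "(LINT y|lborel. (norm a)^2 * indicator Q y + indicator Q y * (norm (v y))^2) = (norm a)^2 * m + B"
      unfolding B_def using ii Bi mi by (subst Lintegral_add) auto
    finally show ?thesis unfolding * .
  qed
  have inner: "(\<integral>\<^sup>+y. indicator Q x * indicator Q y * ennreal ((norm (v x - v y))^2) \<partial>lborel) =
      ennreal (indicator Q x * ((norm (v x))^2 * m + B - 2 * Re (v x * cnj I)))" for x
  proof -
    have "(\<integral>\<^sup>+y. indicator Q x * indicator Q y * ennreal ((norm (v x - v y))^2) \<partial>lborel) = indicator Q x * (\<integral>\<^sup>+y. ennreal (indicator Q y * (norm (v x - v y))^2) \<partial>lborel)"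
      by (subst nn_integral_cmult[symmetric]) (auto intro!: nn_integral_cong split: split_indicator)
    also have "(\<integral>\<^sup>+y. ennreal (indicator Q y * (norm (v x - v y))^2) \<partial>lborel) = ennreal (LINT y|lborel. indicator Q y * (norm (v x - v y))^2)"
      by (rule nn_integral_eq_integral[OF hi]) auto
    finally show ?thesis unfolding h by (auto split: split_indicator)
  qed
  have oi: "integrable lborel (%x. indicator Q x * ((norm (v x))^2 * m + B - 2 * Re (v x * cnj I)))"
    and ov: "(LINT x|lborel. indicator Q x * ((norm (v x))^2 * m + B - 2 * Re (v x * cnj I))) = 2 * m * B - 2 * (norm I)^2"
  proof -
    have e: "indicator Q x * ((norm (v x))^2 * m + B - 2 * Re (v x * cnj I)) =
        m * (indicator Q x * (norm (v x))^2) + B * indicator Q x - 2 * Re ((indicator Q x *\<^sub>R v x) * cnj I)" for x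
      by (simp add: algebra_simps split: split_indicator)
    have Ri: "integrable lborel (%x. 2 * Re ((indicator Q x *\<^sub>R v x) * cnj I))"
      by (intro integrable_mult_right integrable_Re integrable_mult_left Ii)
    have Rv: "(LINT x|lborel. 2 * Re ((indicator Q x *\<^sub>R v x) * cnj I)) = 2 * (norm I)^2"
    proof -
      have "(LINT x|lborel. 2 * Re ((indicator Q x *\<^sub>R v x) * cnj I)) = 2 * Re (LINT x|lborel. (indicator Q x *\<^sub>R v x) * cnj I)"
        using Ii by (subst integral_mult_right_zero) (intro arg_cong[where f = "(*) 2"] integral_Re integrable_mult_left)
      also have "(LINT x|lborel. (indicator Q x *\<^sub>R v x) * cnj I) = I * cnj I"
        unfolding I_def by (rule integral_mult_left_zero)
      also have "Re (I * cnj I) = (norm I)^2" unfolding cmod_power2 by (simp add: power2_eq_square)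
      finally show ?thesis .
    qed
    show "integrable lborel (%x. indicator Q x * ((norm (v x))^2 * m + B - 2 * Re (v x * cnj I)))"
      unfolding e by (intro Lintegrable_diff Lintegrable_add integrable_mult_right ii Bi Ri)
    have "(LINT x|lborel. m * (indicator Q x * (norm (v x))^2) + B * indicator Q x - 2 * Re ((indicator Q x *\<^sub>R v x) * cnj I)) =
       (LINT x|lborel. m * (indicator Q x * (norm (v x))^2) + B * indicator Q x) - 2 * (norm I)^2"
      unfolding Rv[symmetric] by (intro Lintegral_diff Lintegrable_add integrable_mult_right ii Bi Ri)
    also have "(LINT x|lborel. m * (indicator Q x * (norm (v x))^2) + B * indicator Q x) = m * B + B * m"
      using ii Bi mi by (subst Lintegral_add) (auto simp: B_def)
    finally show "(LINT x|lborel. indicator Q x * ((norm (v x))^2 * m + B - 2 * Re (v x * cnj I))) = 2 * m * B - 2 * (norm I)^2"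
      unfolding e by simp
  qed
  have "0 <= (norm a)^2 * m + B - 2 * Re (a * cnj I)" for a
    unfolding h[symmetric] by (rule integral_nonneg_AE) auto
  hence "(\<integral>\<^sup>+x. ennreal (indicator Q x * ((norm (v x))^2 * m + B - 2 * Re (v x * cnj I))) \<partial>lborel) = ennreal (2 * m * B - 2 * (norm I)^2)"
    unfolding ov[symmetric] by (intro nn_integral_eq_integral oi AE_I2 mult_nonneg_nonneg) auto
  thus ?thesis unfolding inner .
qed

lemma ennreal_sum_le: "ennreal (\<Sum>i\<in>A. f i) <= (\<Sum>i\<in>A. ennreal (f i))"
proof (induction A rule: infinite_finite_induct)
  case (insert x F)
  have "ennreal (f x + sum f F) <= ennreal (max 0 (f x) + max 0 (sum f F))" by (intro ennreal_leI) auto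
  also have "\<dots> = ennreal (f x) + ennreal (sum f F)" by (cases "0 <= f x"; cases "0 <= sum f F") (simp_all add: max_def ennreal_neg)
  also have "\<dots> <= ennreal (f x) + (\<Sum>i\<in>F. ennreal (f i))" by (intro add_left_mono insert)
  finally show ?case using insert by simp
qed auto

text \<open>A Poincare inequality on every grid cube.  Two points of a cube differ by at most \<open>\<epsilon>\<close> in each coordinate, so the
  double integrals over all cubes are at most an integral over small translations.\<close>

theorem smooth_grid_inequality:
  fixes v :: "'a::euclidean_space => complex" and R :: real
  assumes v: "!!k. Ck_fun k v" and vL: "v \<in> L2 lborel" and p: "!!i. i \<in> Basis ==> partial i v \<in> L2 lborel"
    and \<epsilon>: "0 < \<epsilon>"
  defines "Z \<equiv> cell \<epsilon> ` cball (0::'a) R"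
  shows "(LINT x|lborel. indicator (cball 0 R) x * (norm (v x))^2) \<le>
    2 ^ DIM('a) * (real DIM('a))^2 * \<epsilon>^2 * (\<Sum>i\<in>Basis. l2.sq lborel (partial i v)) +
    (\<Sum>z\<in>Z. (norm (LINT x|lborel. indicator (cube \<epsilon> z) x *\<^sub>R v x))^2 / \<epsilon> ^ DIM('a))"
proof -
  define m where "m = \<epsilon> ^ DIM('a)"
  have m: "0 < m" using \<epsilon> by (simp add: m_def)
  define G where "G = (\<Sum>i\<in>Basis. l2.sq lborel (partial i v))"
  have G0: "0 <= G" unfolding G_def by (intro sum_nonneg l2.ip_pos p)
  define B where "B z = (LINT x|lborel. indicator (cube \<epsilon> z) x * (norm (v x))^2)" for z
  define I where "I z = (LINT x|lborel. indicator (cube \<epsilon> z) x *\<^sub>R v x)" for z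
  have [measurable]: "v \<in> borel_measurable borel" by (rule smooth_borel[OF v])
  have fZ: "finite Z" unfolding Z_def by (rule finite_cells[OF \<epsilon>])
  have Zr: "z \<in> range (cell \<epsilon>)" if "z \<in> Z" for z using that by (auto simp: Z_def)
  define K :: "'a => ennreal" where "K w = indicator (cbox (- (\<epsilon> *\<^sub>R One)) (\<epsilon> *\<^sub>R One)) w" for w
  have [measurable]: "K \<in> borel_measurable borel" unfolding K_def[abs_def] by measurable
  have dev: "(\<integral>\<^sup>+x. (\<integral>\<^sup>+y. indicator (cube \<epsilon> z) x * indicator (cube \<epsilon> z) y * ennreal ((norm (v x - v y))^2) \<partial>lborel) \<partial>lborel) = ennreal (2 * m * B z - 2 * (norm (I z))^2)"
    if z: "z \<in> Z" for z
    unfolding B_def I_def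
    by (rule mean_square_deviation[OF vL _ _ _ m]) (use emeasure_cube[OF \<epsilon> Zr[OF z]] in \<open>simp_all add: m_def\<close>)
  have overlap: "(\<Sum>z\<in>Z. indicator (cube \<epsilon> z) x * indicator (cube \<epsilon> z) y) <= (K (y - x) :: ennreal)" for x y
  proof (cases "cell \<epsilon> x = cell \<epsilon> y")
    case True
    have "(\<Sum>z\<in>Z. indicator (cube \<epsilon> z) x * indicator (cube \<epsilon> z) y) = (\<Sum>z\<in>Z. if cell \<epsilon> x = z then 1 else (0::ennreal))"
      using True by (intro sum.cong) (auto simp: cube_def split: split_indicator)
    also have "\<dots> <= 1" using fZ by (simp add: sum.delta)
    also have "1 = (K (y - x) :: ennreal)"
    proof -
      have y: "y \<in> cube \<epsilon> (cell \<epsilon> x)" and x: "x \<in> cube \<epsilon> (cell \<epsilon> x)" using True by (auto simp: cube_def)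
      have "- \<epsilon> <= (y - x) \<bullet> i & (y - x) \<bullet> i <= \<epsilon>" if i: "i \<in> Basis" for i
        using y x i unfolding cube_iff[OF \<epsilon> refl] by (fastforce simp: inner_diff_left)
      hence "y - x \<in> cbox (- (\<epsilon> *\<^sub>R One)) (\<epsilon> *\<^sub>R One)" unfolding mem_box by simp
      thus ?thesis by (simp add: K_def)
    qed
    finally show ?thesis .
  next
    case False
    have "(\<Sum>z\<in>Z. indicator (cube \<epsilon> z) x * indicator (cube \<epsilon> z) y) = (\<Sum>z\<in>Z. (0::ennreal))"
      using False by (intro sum.cong) (auto simp: cube_def split: split_indicator)
    thus ?thesis by simp
  qed
  have "ennreal (\<Sum>z\<in>Z. 2 * m * B z - 2 * (norm (I z))^2) <= (\<Sum>z\<in>Z. ennreal (2 * m * B z - 2 * (norm (I z))^2))"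
    by (rule ennreal_sum_le)
  also have "\<dots> = (\<Sum>z\<in>Z. (\<integral>\<^sup>+x. (\<integral>\<^sup>+y. indicator (cube \<epsilon> z) x * indicator (cube \<epsilon> z) y * ennreal ((norm (v x - v y))^2) \<partial>lborel) \<partial>lborel))"
    using dev by (intro sum.cong) auto
  also have "\<dots> = (\<integral>\<^sup>+x. (\<integral>\<^sup>+y. (\<Sum>z\<in>Z. indicator (cube \<epsilon> z) x * indicator (cube \<epsilon> z) y * ennreal ((norm (v x - v y))^2)) \<partial>lborel) \<partial>lborel)"
    by (subst nn_integral_sum[symmetric], measurable, intro nn_integral_cong, subst nn_integral_sum[symmetric]) measurable
  also have "\<dots> <= (\<integral>\<^sup>+x. (\<integral>\<^sup>+y. K (y - x) * ennreal ((norm (v x - v y))^2) \<partial>lborel) \<partial>lborel)"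
    unfolding sum_distrib_right[symmetric] by (intro nn_integral_mono mult_right_mono overlap) simp
  also have "\<dots> = (\<integral>\<^sup>+x. (\<integral>\<^sup>+w. K w * ennreal ((norm (v (x + w) - v x))^2) \<partial>lborel) \<partial>lborel)"
  proof (rule nn_integral_cong)
    fix x :: 'a
    show "(\<integral>\<^sup>+y. K (y - x) * ennreal ((norm (v x - v y))^2) \<partial>lborel) = (\<integral>\<^sup>+w. K w * ennreal ((norm (v (x + w) - v x))^2) \<partial>lborel)"
      using nn_integral_affine[of "%y. K (y - x) * ennreal ((norm (v x - v y))^2)" 1 x] by (simp add: norm_minus_commute)
  qed
  also have "\<dots> = (\<integral>\<^sup>+w. (\<integral>\<^sup>+x. K w * ennreal ((norm (v (x + w) - v x))^2) \<partial>lborel) \<partial>lborel)"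
    by (rule lborel_pair.Fubini') measurable
  also have "\<dots> <= (\<integral>\<^sup>+w. K w * ennreal ((real DIM('a))^2 * \<epsilon>^2 * G) \<partial>lborel)"
  proof (rule nn_integral_mono)
    fix w :: 'a
    have "(\<integral>\<^sup>+x. K w * ennreal ((norm (v (x + w) - v x))^2) \<partial>lborel) = K w * (\<integral>\<^sup>+x. ennreal ((norm (v (x + w) - v x))^2) \<partial>lborel)"
      by (rule nn_integral_cmult) measurable
    also have "\<dots> <= K w * ennreal ((real DIM('a))^2 * \<epsilon>^2 * G)"
    proof (cases "w \<in> cbox (- (\<epsilon> *\<^sub>R One)) (\<epsilon> *\<^sub>R One)")
      case True
      have "norm w <= (\<Sum>i\<in>Basis. \<bar>w \<bullet> i\<bar>)" by (rule norm_le_l1)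
      also have "\<dots> <= (\<Sum>i\<in>(Basis::'a set). \<epsilon>)"
        using True by (intro sum_mono) (auto simp: mem_box abs_le_iff dest!: bspec)
      also have "\<dots> = real DIM('a) * \<epsilon>" by simp
      finally have "(norm w)^2 <= (real DIM('a))^2 * \<epsilon>^2" unfolding power_mult_distrib[symmetric] by (rule power_mono) simp
      hence "(norm w)^2 * G <= (real DIM('a))^2 * \<epsilon>^2 * G" using G0 by (rule mult_right_mono)
      hence "(\<integral>\<^sup>+x. ennreal ((norm (v (x + w) - v x))^2) \<partial>lborel) <= ennreal ((real DIM('a))^2 * \<epsilon>^2 * G)"
        using smooth_translation[OF v p, of w] unfolding G_def[symmetric] by (meson ennreal_leI order_trans)
      thus ?thesis by (rule mult_left_mono) simp
    qed (simp add: K_def)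
    finally show "(\<integral>\<^sup>+x. K w * ennreal ((norm (v (x + w) - v x))^2) \<partial>lborel) <= K w * ennreal ((real DIM('a))^2 * \<epsilon>^2 * G)" .
  qed
  also have "\<dots> = ennreal ((2 * \<epsilon>) ^ DIM('a)) * ennreal ((real DIM('a))^2 * \<epsilon>^2 * G)"
  proof -
    have "emeasure lborel (cbox (- (\<epsilon> *\<^sub>R One)) (\<epsilon> *\<^sub>R One :: 'a)) = ennreal ((2 * \<epsilon>) ^ DIM('a))"
      using \<epsilon> by (simp add: emeasure_lborel_cbox_eq inner_simps)
    thus ?thesis by (simp add: nn_integral_multc K_def)
  qed
  also have "\<dots> = ennreal ((2 * \<epsilon>) ^ DIM('a) * ((real DIM('a))^2 * \<epsilon>^2 * G))"
    using \<epsilon> by (simp add: ennreal_mult')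
  finally have "(\<Sum>z\<in>Z. 2 * m * B z - 2 * (norm (I z))^2) <= (2 * \<epsilon>) ^ DIM('a) * ((real DIM('a))^2 * \<epsilon>^2 * G)"
    using \<epsilon> G0 by (subst (asm) ennreal_le_iff) auto
  moreover have "(\<Sum>z\<in>Z. 2 * m * B z - 2 * (norm (I z))^2) = 2 * m * (\<Sum>z\<in>Z. B z) - 2 * (\<Sum>z\<in>Z. (norm (I z))^2)"
    unfolding sum_subtractf sum_distrib_left ..
  moreover have "(2 * \<epsilon>) ^ DIM('a) * ((real DIM('a))^2 * \<epsilon>^2 * G) = m * (2 ^ DIM('a) * (real DIM('a))^2 * \<epsilon>^2 * G)"
    by (simp add: m_def power_mult_distrib)
  ultimately have "2 * m * (\<Sum>z\<in>Z. B z) - 2 * (\<Sum>z\<in>Z. (norm (I z))^2) <= m * (2 ^ DIM('a) * (real DIM('a))^2 * \<epsilon>^2 * G)"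
    by linarith
  also have "\<dots> <= 2 * (m * (2 ^ DIM('a) * (real DIM('a))^2 * \<epsilon>^2 * G))"
    using m G0 by (simp add: mult_nonneg_nonneg)
  finally have "m * (\<Sum>z\<in>Z. B z) <= m * (2 ^ DIM('a) * (real DIM('a))^2 * \<epsilon>^2 * G + (\<Sum>z\<in>Z. (norm (I z))^2) / m)"
    using m by (simp add: distrib_left)
  hence main: "(\<Sum>z\<in>Z. B z) <= 2 ^ DIM('a) * (real DIM('a))^2 * \<epsilon>^2 * G + (\<Sum>z\<in>Z. (norm (I z))^2) / m"
    using m by (simp only: mult_le_cancel_left_pos)
  have Bi: "integrable lborel (%x. indicator A x * (norm (v x))^2)" if "A \<in> sets borel" for A
    using integrable_mult_indicator[of A lborel "%x. (norm (v x))^2"] that L2_integrable[OF vL] by simp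
  have "(LINT x|lborel. indicator (cball 0 R) x * (norm (v x))^2) <= (LINT x|lborel. (\<Sum>z\<in>Z. indicator (cube \<epsilon> z) x * (norm (v x))^2))"
  proof (rule Lintegral_mono)
    fix x :: 'a
    show "indicator (cball 0 R) x * (norm (v x))^2 <= (\<Sum>z\<in>Z. indicator (cube \<epsilon> z) x * (norm (v x))^2)"
    proof (cases "x \<in> cball 0 R")
      case True
      hence cZ: "cell \<epsilon> x \<in> Z" by (simp add: Z_def)
      have "indicator (cube \<epsilon> (cell \<epsilon> x)) x * (norm (v x))^2 <= (\<Sum>z\<in>Z. indicator (cube \<epsilon> z) x * (norm (v x))^2)"
        by (rule member_le_sum[OF cZ _ fZ]) auto
      thus ?thesis using True by (simp add: cube_def)
    qed (simp add: sum_nonneg)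
  qed (intro Lintegrable_sum Bi; simp)+
  also have "\<dots> = (\<Sum>z\<in>Z. B z)"
    unfolding B_def by (intro Lintegral_sum Bi) simp
  finally show ?thesis using main unfolding G_def I_def m_def sum_divide_distrib by linarith
qed

text \<open>Rellich's compactness theorem in quantitative form: on a ball the \<open>L2\<close> norm is controlled by an arbitrarily small part of the energy and
  finitely many functionals, the means over grid cubes.\<close>

theorem local_rellich:
  fixes R \<eta> :: real
  assumes \<eta>: "0 < \<eta>"
  shows "\<exists>(N::nat) f. (\<forall>j<N. f j \<in> L2 lebesgue) & (\<forall>u\<in>H1 (UNIV :: 'a::euclidean_space set).
    nsq (%x. cplx (indicator (cball 0 R) x) * u x) \<le>
      \<eta> * energy UNIV u + (\<Sum>j<N. (cmod (l2_inner lebesgue u (f j)))^2))"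
proof -
  define C where "C = 2 ^ DIM('a) * (real DIM('a))^2"
  have C: "0 < C" by (simp add: C_def)
  define \<epsilon> where "\<epsilon> = sqrt (\<eta> / C)"
  have \<epsilon>: "0 < \<epsilon>" "C * \<epsilon>^2 = \<eta>" using \<eta> C by (simp_all add: \<epsilon>_def)
  define Z where "Z = cell \<epsilon> ` cball (0::'a) R"
  have fZ: "finite Z" unfolding Z_def by (rule finite_cells[OF \<epsilon>(1)])
  obtain z where z: "bij_betw z {..<card Z} Z" using fZ by (metis ex_bij_betw_nat_finite atLeast0LessThan)
  define m where "m = \<epsilon> ^ DIM('a)"
  have m: "0 < m" using \<epsilon> by (simp add: m_def)
  define f where "f j x = cplx (1 / sqrt m) * cplx (indicator (cube \<epsilon> (z j)) x)" for j x
  have zZ: "z j \<in> range (cell \<epsilon>)" if "j < card Z" for j using z that by (auto simp: bij_betw_def Z_def)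
  have fL: "f j \<in> L2 lborel" if "j < card Z" for j
  proof -
    have "(%x. cplx (indicator (cube \<epsilon> (z j)) x)) \<in> L2 lborel"
      by (rule L2_indicator_lborel) (simp_all add: emeasure_cube[OF \<epsilon>(1) zZ[OF that]])
    from L2_scale[OF this, of "cplx (1 / sqrt m)"] show ?thesis
      by (simp add: fscale_def f_def[abs_def])
  qed
  have fl: "f j \<in> L2 lebesgue" if "j < card Z" for j by (rule L2_lborel_lebesgue[OF fL[OF that]])
  define P where "P u = (%x. cplx (indicator (cball 0 R) x) * u x)" for u :: "'a => complex"
  have PL: "P u \<in> L2 lebesgue" "nsq (P u) <= nsq u" if u: "u \<in> L2 lebesgue" for u
  proof -
    have [measurable]: "cball (0::'a) R \<in> sets lebesgue" by simp
    have [measurable]: "u \<in> borel_measurable lebesgue" by (rule L2_measurable[OF u])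
    show L: "P u \<in> L2 lebesgue"
      by (rule L2_bound[OF u, of _ 1]) (auto simp: P_def norm_mult split: split_indicator)
    show "nsq (P u) <= nsq u"
      unfolding l2_sq by (rule Lintegral_mono[OF L2_integrable[OF L] L2_integrable[OF u]])
        (auto simp: P_def norm_mult split: split_indicator)
  qed
  have smooth: "nsq (P v) <= \<eta> * energy UNIV v + (\<Sum>j<card Z. (cmod (l2_inner lebesgue v (f j)))^2)"
    if v: "v \<in> H1 UNIV" "!!k. Ck_fun k v" "!!i. i \<in> Basis ==> partial i v \<in> L2 lborel" for v
  proof -
    have vl: "v \<in> L2 lebesgue" by (rule HU.QinH[OF v(1)])
    have vb [measurable]: "v \<in> borel_measurable borel" by (rule smooth_borel[OF v(2)])
    have vL: "v \<in> L2 lborel" by (rule L2_borel_lborel[OF vl vb])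
    have ib: "(%x. cplx (indicator (cball (0::'a) R) x)) \<in> borel_measurable borel"
      using L2_measurable[OF L2_indicator_ball(1), of R] by simp
    have [measurable]: "P v \<in> borel_measurable borel" unfolding P_def by (rule borel_measurable_times[OF ib vb])
    have "nsq (P v) = l2.sq lborel (P v)" by (subst l2_lborel_lebesgue) simp_all
    also have "\<dots> = (LINT x|lborel. indicator (cball 0 R) x * (norm (v x))^2)"
      unfolding l2_sq P_def by (intro Lintegral_cong) (auto simp: norm_mult split: split_indicator)
    also have "\<dots> <= C * \<epsilon>^2 * (\<Sum>i\<in>Basis. l2.sq lborel (partial i v)) +
      (\<Sum>z\<in>Z. (norm (LINT x|lborel. indicator (cube \<epsilon> z) x *\<^sub>R v x))^2 / \<epsilon> ^ DIM('a))"
      using smooth_grid_inequality[OF v(2) vL v(3) \<epsilon>(1), of R] unfolding Z_def C_def by blast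
    also have "(\<Sum>z\<in>Z. (norm (LINT x|lborel. indicator (cube \<epsilon> z) x *\<^sub>R v x))^2 / \<epsilon> ^ DIM('a)) =
        (\<Sum>j<card Z. (norm (LINT x|lborel. indicator (cube \<epsilon> (z j)) x *\<^sub>R v x))^2 / \<epsilon> ^ DIM('a))"
      by (rule sum.reindex_bij_betw[OF z, symmetric])
    also have "\<dots> = (\<Sum>j<card Z. (cmod (l2_inner lebesgue v (f j)))^2)"
    proof (rule sum.cong[OF refl])
      fix j assume "j \<in> {..<card Z}"
      hence j: "j < card Z" by simp
      have "l2_inner lebesgue v (f j) = l2_inner lborel v (f j)"
        by (rule l2_lborel_lebesgue) (use L2_measurable[OF fL[OF j]] vb in auto)
      also have "\<dots> = (LINT x|lborel. cplx (1 / sqrt m) * (indicator (cube \<epsilon> (z j)) x *\<^sub>R v x))"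
        unfolding l2_inner_def f_def by (intro Lintegral_cong) (auto simp: scaleR_conv_of_real)
      also have "\<dots> = cplx (1 / sqrt m) * (LINT x|lborel. indicator (cube \<epsilon> (z j)) x *\<^sub>R v x)"
        by (rule integral_mult_right_zero)
      finally have "(cmod (l2_inner lebesgue v (f j)))^2 = (1 / sqrt m)^2 * (norm (LINT x|lborel. indicator (cube \<epsilon> (z j)) x *\<^sub>R v x))^2"
        using m by (simp add: norm_mult norm_divide power_mult_distrib power_divide)
      thus "(norm (LINT x|lborel. indicator (cube \<epsilon> (z j)) x *\<^sub>R v x))^2 / \<epsilon> ^ DIM('a) = (cmod (l2_inner lebesgue v (f j)))^2"
        using m by (simp add: m_def[symmetric] power_divide)
    qed
    also have "C * \<epsilon>^2 * (\<Sum>i\<in>Basis. l2.sq lborel (partial i v)) = \<eta> * energy UNIV v"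
      unfolding \<epsilon>(2) by (subst grad_smooth[OF v(2,3) vl]) auto
    finally show ?thesis .
  qed
  have "nsq (P u) <= \<eta> * energy UNIV u + (\<Sum>j<card Z. (cmod (l2_inner lebesgue u (f j)))^2)"
    if u: "u \<in> H1 UNIV" for u
  proof -
    obtain v where v: "!!N. v N \<in> H1 UNIV" "!!N k. Ck_fun k (v N)" "!!N i. i \<in> Basis ==> partial i (v N) \<in> L2 lborel"
      and lim: "(%N. h1sq UNIV (v N - u)) \<leadsto> 0" using smooth_dense[OF u] by blast
    have lim': "(%N. HU.A.sq (v N - u)) \<leadsto> 0" using lim unfolding h1sq_UNIV .
    have uL: "u \<in> L2 lebesgue" by (rule HU.QinH[OF u])
    have vL: "v N \<in> L2 lebesgue" for N by (rule HU.QinH[OF v(1)])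
    have PP: "P (v N) - P u = P (v N - u)" for N by (simp add: P_def fun_eq_iff algebra_simps)
    have "(%N. nsq (P (v N) - P u)) \<leadsto> 0"
    proof (rule tendsto_sandwich[OF always_eventually always_eventually tendsto_const HU.A_tendsto(1)[OF v(1) u lim']]; intro allI)
      fix N
      show "0 <= nsq (P (v N) - P u)" by (intro l2.ip_pos l2.closed(3) PL(1) uL vL)
      show "nsq (P (v N) - P u) <= nsq (v N - u)"
        unfolding PP by (intro PL(2) l2.closed(3) uL vL)
    qed
    hence 1: "(%N. nsq (P (v N))) \<leadsto> nsq (P u)"
      by (rule l2.tendsto_sq[OF PL(1)[OF vL] PL(1)[OF uL]])
    have 2: "(%N. \<eta> * energy UNIV (v N) + (\<Sum>j<card Z. (cmod (l2_inner lebesgue (v N) (f j)))^2)) \<leadsto>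
        \<eta> * energy UNIV u + (\<Sum>j<card Z. (cmod (l2_inner lebesgue u (f j)))^2)"
    proof (intro tendsto_add tendsto_mult tendsto_const tendsto_sum tendsto_power tendsto_norm)
      show "(%N. energy UNIV (v N)) \<leadsto> energy UNIV u" by (rule HU.A_limits(4)[OF v(1) u lim'])
      fix j assume "j \<in> {..<card Z}"
      thus "(%N. l2_inner lebesgue (v N) (f j)) \<leadsto> l2_inner lebesgue u (f j)"
        using HU.A_limits(1)[OF v(1) u lim' fl] by simp
    qed
    show ?thesis by (rule LIMSEQ_le[OF 1 2]) (use smooth v in blast)
  qed
  hence "(\<forall>j<card Z. f j \<in> L2 lebesgue) & (\<forall>u\<in>H1 UNIV. nsq (%x. cplx (indicator (cball 0 R) x) * u x) \<le>
      \<eta> * energy UNIV u + (\<Sum>j<card Z. (cmod (l2_inner lebesgue u (f j)))^2))"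
    using fl unfolding P_def by simp
  thus ?thesis by blast
qed

section \<open>The Schroedinger form\<close>

lemma L2_cong_AE:
  assumes "u \<in> L2 M" "v \<in> borel_measurable M" "AE x in M. u x = v x"
  shows "v \<in> L2 M"
proof (rule L2I[OF assms(2)])
  show "integrable M (%x. (norm (v x))^2)"
    by (rule integrable_cong_AE_imp[OF L2_integrable[OF assms(1)]]) (use assms(2,3) in auto)
qed

text \<open>The form of the potential is the square of the norm of this function.\<close>

definition pot :: "('a => real) => ('a => complex) => 'a => complex" where
  "pot V u = (%x. cplx (sqrt (V x)) * u x)"

lemma pot_linear: "pot V (u + v) = pot V u + pot V v" "pot V (u - v) = pot V u - pot V v"
  "pot V (fscale c u) = fscale c (pot V u)" "pot V 0 = 0"
  by (auto simp: pot_def fun_eq_iff algebra_simps)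

lemma domain_iff: "u \<in> schroedinger_domain V \<longleftrightarrow> u \<in> H1 UNIV & pot V u \<in> L2 lebesgue"
  by (simp add: schroedinger_domain_def pot_def)

lemma form_eq: "schroedinger_form h V u v = cplx (h^2) * grad_form UNIV u v + l2_inner lebesgue (pot V u) (pot V v)"
  by (simp add: schroedinger_form_def pot_def)

lemma form_sq: "Re (schroedinger_form h V u u) = h^2 * energy UNIV u + nsq (pot V u)"
  by (simp add: form_eq)

text \<open>Only completeness needs an argument: the limit of \<open>pot V (w n)\<close> is identified with \<open>pot V u\<close> on each set \<open>V <= k\<close>, where
  multiplication by the square root of \<open>V\<close> is bounded.\<close>

theorem schroedinger_l2form:
  assumes Vm: "V \<in> borel_measurable borel" and V0: "!!x. 0 <= V x" and h: "0 < h"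
  shows "l2form lebesgue (schroedinger_domain V) (schroedinger_form h V)"
proof -
  let ?D = "schroedinger_domain V" and ?q = "schroedinger_form h V"
  have DH: "u \<in> ?D ==> u \<in> H1 UNIV" and DP: "u \<in> ?D ==> pot V u \<in> L2 lebesgue" for u by (auto simp: domain_iff)
  have Vl: "(%x. cplx (sqrt (V x))) \<in> borel_measurable lebesgue"
  proof -
    have "(%x. cplx (sqrt (V x))) \<in> borel_measurable borel" using Vm by measurable
    thus ?thesis by (intro measurable_completion) simp
  qed
  have semi: "semi_ip fscale ?D ?q"
  proof unfold_locales
    show "fvec.subspace ?D" unfolding fvec.subspace_def
      by (auto simp: domain_iff pot_linear intro: HU.Q.closed l2.closed)
  next
    fix u v w assume "u \<in> ?D" "v \<in> ?D" "w \<in> ?D"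
    thus "?q (u + v) w = ?q u w + ?q v w"
      unfolding form_eq pot_linear using HU.Q.ip_add[OF DH DH DH] l2.ip_add[OF DP DP DP] by (simp add: distrib_left)
  next
    fix u w c assume "u \<in> ?D" "w \<in> ?D"
    thus "?q (fscale c u) w = c * ?q u w"
      unfolding form_eq pot_linear using HU.Q.ip_scale[OF DH DH] l2.ip_scale[OF DP DP] by (simp add: distrib_left)
  next
    fix u v assume D: "u \<in> ?D" "v \<in> ?D"
    have "grad_form UNIV v u = cnj (grad_form UNIV u v)" by (rule HU.Q.ip_sym[OF DH[OF D(1)] DH[OF D(2)]])
    moreover have "l2_inner lebesgue (pot V v) (pot V u) = cnj (l2_inner lebesgue (pot V u) (pot V v))"
      by (rule l2.ip_sym[OF DP[OF D(1)] DP[OF D(2)]])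
    ultimately show "?q v u = cnj (?q u v)"
      unfolding form_eq by (simp only: complex_cnj_add complex_cnj_mult complex_cnj_complex_of_real)
  next
    fix u assume "u \<in> ?D"
    thus "0 <= Re (?q u u)" unfolding form_sq using HU.Q.ip_pos[OF DH] l2.ip_pos[OF DP] by (simp add: add_nonneg_nonneg)
  qed
  interpret P: semi_ip fscale ?D ?q by (rule semi)
  show ?thesis
  proof (intro l2form.intro hform.intro hform_axioms.intro)
    show "semi_ip fscale (L2 lebesgue) (l2_inner lebesgue)" by (rule l2.semi_ip_axioms)
    show "?D \<subseteq> L2 lebesgue" using DH HU.QinH by blast
    fix w :: "nat => 'a => complex" assume w: "!!n. w n \<in> ?D"
      and C: "\<forall>e>0. \<exists>N. \<forall>m\<ge>N. \<forall>n\<ge>N. Re (?q (w m - w n) (w m - w n)) + nsq (w m - w n) < e"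
    have wH: "w n \<in> H1 UNIV" and wP: "pot V (w n) \<in> L2 lebesgue" and wL: "w n \<in> L2 lebesgue" for n
      using DH[OF w] DP[OF w] HU.QinH by auto
    define s where "s m n = Re (?q (w m - w n) (w m - w n)) + nsq (w m - w n)" for m n
    have parts: "h^2 * energy UNIV (w m - w n) <= s m n" "nsq (pot V (w m) - pot V (w n)) <= s m n"
      "nsq (w m - w n) <= s m n" for m n
    proof -
      have "0 <= h^2 * energy UNIV (w m - w n)"
        by (intro mult_nonneg_nonneg HU.Q.ip_pos HU.Q.closed(3) wH) simp
      moreover have "0 <= nsq (pot V (w m) - pot V (w n))" by (intro l2.ip_pos l2.closed(3) wP)
      moreover have "0 <= nsq (w m - w n)" by (intro l2.ip_pos l2.closed(3) wL)
      moreover have "s m n = h^2 * energy UNIV (w m - w n) + nsq (pot V (w m) - pot V (w n)) + nsq (w m - w n)"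
        unfolding s_def form_sq pot_linear ..
      ultimately show "h^2 * energy UNIV (w m - w n) <= s m n" "nsq (pot V (w m) - pot V (w n)) <= s m n"
        "nsq (w m - w n) <= s m n" by linarith+
    qed
    have small: "\<exists>N. \<forall>m\<ge>N. \<forall>n\<ge>N. s m n < e" if "e > 0" for e
      using C[rule_format, OF that] unfolding s_def .
    have "\<exists>u\<in>H1 UNIV. (%n. HU.A.sq (w n - u)) \<leadsto> 0"
    proof (rule HU.complete_A[OF wH], intro allI impI)
      fix e :: real assume e: "0 < e"
      have k: "0 < 1 / h^2 + 1" by (simp add: add_nonneg_pos)
      from small[of "e / (1 / h^2 + 1)"] e k obtain N where N: "!!m n. m \<ge> N ==> n \<ge> N ==> s m n < e / (1 / h^2 + 1)" by auto
      have "HU.A.sq (w m - w n) < e" if "m \<ge> N" "n \<ge> N" for m n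
      proof -
        have "energy UNIV (w m - w n) <= 1 / h^2 * s m n"
          using parts(1)[of m n] h by (simp add: field_simps)
        hence "HU.A.sq (w m - w n) <= s m n * (1 / h^2 + 1)"
          using parts(3)[of m n] unfolding HU.A_sq by (simp add: distrib_left mult.commute)
        also have "\<dots> < e" using N[OF that] k by (simp only: pos_less_divide_eq)
        finally show ?thesis .
      qed
      thus "\<exists>N. \<forall>m\<ge>N. \<forall>n\<ge>N. HU.A.sq (w m - w n) < e" by blast
    qed
    then obtain u where u: "u \<in> H1 UNIV" "(%n. HU.A.sq (w n - u)) \<leadsto> 0" by (elim bexE)
    have uL: "u \<in> L2 lebesgue" by (rule HU.QinH[OF u(1)])
    have "\<exists>y\<in>L2 lebesgue. (%n. nsq (pot V (w n) - y)) \<leadsto> 0"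
    proof (rule L2_complete[OF wP], intro allI impI)
      fix e :: real assume "0 < e"
      from small[OF this] obtain N where N: "\<forall>m\<ge>N. \<forall>n\<ge>N. s m n < e" by (elim exE)
      show "\<exists>N. \<forall>m\<ge>N. \<forall>n\<ge>N. nsq (pot V (w m) - pot V (w n)) < e"
        using N parts(2) by (intro exI[of _ N]) (meson le_less_trans)
    qed
    then obtain y where y: "y \<in> L2 lebesgue" "(%n. nsq (pot V (w n) - y)) \<leadsto> 0" by (elim bexE)
    have um: "u \<in> borel_measurable lebesgue" and ym: "y \<in> borel_measurable lebesgue" using uL y(1) L2_measurable by auto
    have pm: "pot V u \<in> borel_measurable lebesgue" unfolding pot_def using Vl um by (rule borel_measurable_times)
    have limu: "(%n. nsq (w n - u)) \<leadsto> 0" by (rule HU.A_tendsto(1)[OF wH u])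
    have "AE x in lebesgue. V x <= real k --> y x = pot V u x" for k
    proof -
      define A where "A = {x. V x <= real k}"
      have A: "A \<in> sets lebesgue" unfolding A_def using Vm by (intro sets_completionI_sets) (simp add: borel_measurable_iff_le[THEN iffD1, rule_format])
      define E where "E x = ennreal (indicator A x * (norm (y x - pot V u x))^2)" for x
      have Em: "E \<in> borel_measurable lebesgue" unfolding E_def using A ym pm by measurable
      have pt: "indicator A x * (norm (y x - pot V u x))^2 <= 2 * (norm ((pot V (w n) - y) x))^2 + 2 * real k * (norm ((w n - u) x))^2" for x n
      proof (cases "x \<in> A")
        case True
        have "y x - pot V u x = - (pot V (w n) x - y x) + cplx (sqrt (V x)) * (w n x - u x)"
          by (simp add: pot_def algebra_simps)
        hence "norm (y x - pot V u x) <= norm (pot V (w n) x - y x) + norm (cplx (sqrt (V x)) * (w n x - u x))"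
          by (metis norm_minus_cancel norm_triangle_ineq)
        hence "(norm (y x - pot V u x))^2 <= (norm (pot V (w n) x - y x) + norm (cplx (sqrt (V x)) * (w n x - u x)))^2"
          by (rule power_mono) simp
        also have "\<dots> <= 2 * (norm (pot V (w n) x - y x))^2 + 2 * (norm (cplx (sqrt (V x)) * (w n x - u x)))^2"
          using two_mult_le_squares[of "norm (pot V (w n) x - y x)" "norm (cplx (sqrt (V x)) * (w n x - u x))"]
          by (simp add: power2_sum)
        also have "(norm (cplx (sqrt (V x)) * (w n x - u x)))^2 = V x * (norm (w n x - u x))^2"
          using V0[of x] by (simp add: norm_mult power_mult_distrib)
        also have "\<dots> <= real k * (norm (w n x - u x))^2" using True by (intro mult_right_mono) (auto simp: A_def)
        finally show ?thesis using True by simp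
      qed simp
      have b: "(\<integral>\<^sup>+x. E x \<partial>lebesgue) <= ennreal (2 * nsq (pot V (w n) - y) + 2 * real k * nsq (w n - u))" for n
      proof -
        have L: "pot V (w n) - y \<in> L2 lebesgue" "w n - u \<in> L2 lebesgue" by (rule l2.closed(3) wP y wL uL)+
        have i: "integrable lebesgue (%x. 2 * (norm ((pot V (w n) - y) x))^2 + 2 * real k * (norm ((w n - u) x))^2)"
          by (intro Lintegrable_add integrable_mult_right L2_integrable L)
        have "(\<integral>\<^sup>+x. E x \<partial>lebesgue) <= (\<integral>\<^sup>+x. ennreal (2 * (norm ((pot V (w n) - y) x))^2 + 2 * real k * (norm ((w n - u) x))^2) \<partial>lebesgue)"
          unfolding E_def by (intro nn_integral_mono ennreal_leI pt)
        also have "\<dots> = ennreal (LINT x|lebesgue. 2 * (norm ((pot V (w n) - y) x))^2 + 2 * real k * (norm ((w n - u) x))^2)"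
          by (rule nn_integral_eq_integral[OF i]) auto
        also have "(LINT x|lebesgue. 2 * (norm ((pot V (w n) - y) x))^2 + 2 * real k * (norm ((w n - u) x))^2) = 2 * nsq (pot V (w n) - y) + 2 * real k * nsq (w n - u)"
          unfolding l2_sq using L2_integrable[OF L(1)] L2_integrable[OF L(2)] by (subst Lintegral_add) auto
        finally show ?thesis .
      qed
      have "(\<integral>\<^sup>+x. E x \<partial>lebesgue) <= ennreal (2 * 0 + 2 * real k * 0)"
      proof (rule LIMSEQ_le_const)
        show "(%n. ennreal (2 * nsq (pot V (w n) - y) + 2 * real k * nsq (w n - u))) \<leadsto> ennreal (2 * 0 + 2 * real k * 0)"
          by (intro tendsto_ennrealI tendsto_add tendsto_mult tendsto_const limu y(2))
      qed (use b in blast)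
      hence "(\<integral>\<^sup>+x. E x \<partial>lebesgue) = 0" by simp
      hence "AE x in lebesgue. E x = 0" using Em by (simp add: nn_integral_0_iff_AE)
      thus ?thesis by eventually_elim (auto simp: E_def A_def ennreal_eq_0_iff split: split_indicator_asm)
    qed
    hence "AE x in lebesgue. \<forall>k. V x <= real k --> y x = pot V u x" unfolding AE_all_countable by blast
    hence ae: "AE x in lebesgue. y x = pot V u x"
      by eventually_elim (use real_arch_simple in blast)
    have pL: "pot V u \<in> L2 lebesgue" by (rule L2_cong_AE[OF y(1) pm ae])
    have uD: "u \<in> ?D" using u(1) pL by (simp add: domain_iff)
    have "Re (?q (w n - u) (w n - u)) + nsq (w n - u) = h^2 * energy UNIV (w n - u) + nsq (pot V (w n) - y) + nsq (w n - u)" for n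
    proof -
      have d: "pot V (w n) - pot V u \<in> L2 lebesgue" "pot V (w n) - y \<in> L2 lebesgue" by (rule l2.closed(3) wP pL y)+
      have "AE x in lebesgue. (pot V (w n) - pot V u) x = (pot V (w n) - y) x" using ae by eventually_elim simp
      from l2_inner_cong_AE[OF d d this this] show ?thesis unfolding form_sq pot_linear by (simp only:)
    qed
    moreover have "(%n. h^2 * energy UNIV (w n - u) + nsq (pot V (w n) - y) + nsq (w n - u)) \<leadsto> h^2 * 0 + 0 + 0"
      by (intro tendsto_add tendsto_mult tendsto_const HU.A_tendsto(2)[OF wH u] limu y(2))
    ultimately show "\<exists>u\<in>?D. (%n. Re (?q (w n - u) (w n - u)) + nsq (w n - u)) \<leadsto> 0"
      using uD by (intro bexI[of _ u]) simp_all
  qed (rule semi)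
qed

lemma L2_cut:
  assumes "u \<in> L2 lebesgue" "A \<in> sets lebesgue"
  shows "(%x. cplx (indicator A x) * u x) \<in> L2 lebesgue"
    "nsq (%x. cplx (indicator A x) * u x) = (LINT x|lebesgue. indicator A x * (norm (u x))^2)"
proof -
  have [measurable]: "A \<in> sets lebesgue" "u \<in> borel_measurable lebesgue" using assms L2_measurable by auto
  show "(%x. cplx (indicator A x) * u x) \<in> L2 lebesgue"
    by (rule L2_bound[OF assms(1), of _ 1]) (auto simp: norm_mult split: split_indicator)
  show "nsq (%x. cplx (indicator A x) * u x) = (LINT x|lebesgue. indicator A x * (norm (u x))^2)"
    unfolding l2_sq by (intro Lintegral_cong) (auto simp: norm_mult split: split_indicator)
qed

lemma rank_bound_scaled:
  assumes c: "0 < c" and R: "\<forall>j<N. f j \<in> L2 M"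
    and b: "a <= \<eta> + (\<Sum>j<N. (cmod (l2_inner M u (f j)))^2)" and u: "u \<in> L2 M"
  shows "c * a <= c * \<eta> + (\<Sum>j<N. (cmod (l2_inner M u (fscale (cplx (sqrt c)) (f j))))^2)"
proof -
  have "(\<Sum>j<N. (cmod (l2_inner M u (fscale (cplx (sqrt c)) (f j))))^2) = (\<Sum>j<N. c * (cmod (l2_inner M u (f j)))^2)"
    using R u c by (intro sum.cong refl) (simp add: l2.ip_scale2 norm_mult power_mult_distrib)
  also have "\<dots> = c * (\<Sum>j<N. (cmod (l2_inner M u (f j)))^2)" by (simp add: sum_distrib_left)
  finally show ?thesis using mult_left_mono[OF b, of c] c by (simp add: distrib_left)
qed

text \<open>Outside the ball the potential gives \<open>c\<close>; inside, the local Rellich inequality does.\<close>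

theorem schroedinger_rank_bound:
  assumes Vm: "V \<in> borel_measurable borel" and V0: "!!x. 0 <= V x" and h: "0 < h"
    and c: "0 < c" and V: "!!x. R < norm x ==> c <= V x"
  shows "\<exists>(N::nat) f. (\<forall>j<N. f j \<in> L2 lebesgue) & (\<forall>u\<in>schroedinger_domain V.
    c * nsq u <= Re (schroedinger_form h V u u) + (\<Sum>j<N. (cmod (l2_inner lebesgue u (f j)))^2))"
proof -
  have "0 < h^2 / c" using h c by simp
  from local_rellich[OF this, of R] obtain N :: nat and f :: "nat => 'a => complex" where f: "\<forall>j<N. f j \<in> L2 lebesgue"
    and r: "!!u. u \<in> H1 UNIV ==> nsq (%x. cplx (indicator (cball 0 R) x) * u x) \<le>
      h^2 / c * energy UNIV u + (\<Sum>j<N. (cmod (l2_inner lebesgue u (f j)))^2)" by blast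
  show ?thesis
  proof (intro exI conjI ballI)
    show "\<forall>j<N. fscale (cplx (sqrt c)) (f j) \<in> L2 lebesgue" using f L2_scale by blast
    fix u assume u: "u \<in> schroedinger_domain V"
    hence uH: "u \<in> H1 UNIV" and pL: "pot V u \<in> L2 lebesgue" by (auto simp: domain_iff)
    have uL: "u \<in> L2 lebesgue" by (rule HU.QinH[OF uH])
    let ?P = "%x. cplx (indicator (cball 0 R) x) * u x"
    have PL: "?P \<in> L2 lebesgue" by (rule L2_cut(1)[OF uL]) simp
    have "c * nsq u = (LINT x|lebesgue. c * (norm (u x))^2)" by (simp add: l2_sq)
    also have "\<dots> <= (LINT x|lebesgue. c * (norm (?P x))^2 + (norm (pot V u x))^2)"
    proof (rule Lintegral_mono)
      show "integrable lebesgue (%x. c * (norm (u x))^2)" by (intro integrable_mult_right L2_integrable uL)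
      show "integrable lebesgue (%x. c * (norm (?P x))^2 + (norm (pot V u x))^2)"
        by (intro Lintegrable_add integrable_mult_right L2_integrable PL pL)
      fix x
      show "c * (norm (u x))^2 <= c * (norm (?P x))^2 + (norm (pot V u x))^2"
      proof (cases "norm x <= R")
        case True thus ?thesis by (simp add: norm_mult)
      next
        case False
        hence "c * (norm (u x))^2 <= V x * (norm (u x))^2" using V by (intro mult_right_mono) auto
        thus ?thesis using False V0[of x] by (simp add: pot_def norm_mult power_mult_distrib)
      qed
    qed
    also have "\<dots> = c * nsq ?P + nsq (pot V u)"
      unfolding l2_sq using L2_integrable[OF PL] L2_integrable[OF pL] by (subst Lintegral_add) auto
    also have "c * nsq ?P <= c * (h^2 / c * energy UNIV u) + (\<Sum>j<N. (cmod (l2_inner lebesgue u (fscale (cplx (sqrt c)) (f j))))^2)"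
      by (rule rank_bound_scaled[OF c f r[OF uH] uL])
    finally show "c * nsq u <= Re (schroedinger_form h V u u) + (\<Sum>j<N. (cmod (l2_inner lebesgue u (fscale (cplx (sqrt c)) (f j))))^2)"
      using c unfolding form_sq by simp
  qed
qed

section \<open>The Dirichlet form\<close>

lemma test_inner_on:
  assumes "\<phi> \<in> test_functions S" "S \<in> sets lebesgue"
  shows "l2_inner (lebesgue_on S) \<phi> f = l2_inner lebesgue \<phi> f"
proof -
  have "l2_inner (lebesgue_on S) \<phi> f = (LINT x|lebesgue_on S. cnj (f x) * \<phi> x)" by (simp add: l2_inner_def mult.commute)
  also have "\<dots> = (LINT x|lebesgue. cnj (f x) * \<phi> x)"
    by (rule integral_lebesgue_on_test[OF assms(2) test_vanish(1)[OF assms(1)]])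
  finally show ?thesis by (simp add: l2_inner_def mult.commute)
qed

lemma test_grad_on:
  assumes S: "open S" and \<phi>: "\<phi> \<in> test_functions S"
  shows "energy S \<phi> = energy UNIV \<phi>"
proof -
  have m: "S \<in> sets lebesgue" by (rule open_sets_lebesgue[OF S])
  have "energy S \<phi> = (\<Sum>i\<in>Basis. l2.sq (lebesgue_on S) (partial i \<phi>))"
    by (rule grad_sq[OF S]) (use \<phi> m in \<open>auto intro: test_L2 test_partial test_weak_partial\<close>)
  also have "\<dots> = (\<Sum>i\<in>Basis. l2.sq (lebesgue_on UNIV) (partial i \<phi>))"
    using \<phi> m by (intro sum.cong refl) (simp add: test_inner_on[OF test_partial] lebesgue_on_UNIV_eq)
  also have "\<dots> = energy UNIV \<phi>"
    by (rule grad_sq[OF open_UNIV, symmetric]) (use \<phi> in \<open>auto intro: test_L2 test_partial test_weak_partial\<close>)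
  finally show ?thesis .
qed

lemma H10_limit:
  assumes S: "open S" and u: "u \<in> H10 S"
  shows "\<exists>\<phi>. (\<forall>n. \<phi> n \<in> test_functions S) & (%n. energy S (\<phi> n)) \<leadsto> energy S u &
    (%n. l2.sq (lebesgue_on S) (\<phi> n)) \<leadsto> l2.sq (lebesgue_on S) u &
    (\<forall>f\<in>L2 (lebesgue_on S). (%n. l2_inner (lebesgue_on S) (\<phi> n) f) \<leadsto> l2_inner (lebesgue_on S) u f)"
proof -
  interpret G: l2form "lebesgue_on S" "H1 S" "grad_form S" by (rule H1_l2form[OF S])
  have uH: "u \<in> H1 S" using u by (simp add: H10_def)
  have "\<exists>\<phi>\<in>test_functions S. sqrt (h1sq S (u - \<phi>)) < 1 / real (Suc n)" for n
    using u unfolding H10_iff by simp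
  then obtain \<phi> where \<phi>: "!!n. \<phi> n \<in> test_functions S" "!!n. sqrt (h1sq S (u - \<phi> n)) < 1 / real (Suc n)" by metis
  have pH: "\<phi> n \<in> H1 S" for n by (rule test_H1[OF S \<phi>(1)])
  have pos: "0 <= h1sq S (u - \<phi> n)" for n unfolding h1sq_A[OF S] by (intro G.A.ip_pos G.Q.closed(3) uH pH)
  have "(%n. sqrt (h1sq S (u - \<phi> n))) \<leadsto> 0"
    by (rule tendsto_sandwich[OF _ _ tendsto_const lim_const_over_n[THEN LIMSEQ_Suc, of 1]])
       (use \<phi>(2) pos in \<open>auto simp: less_imp_le\<close>)
  hence "(%n. (sqrt (h1sq S (u - \<phi> n)))^2) \<leadsto> 0^2" by (rule tendsto_power)
  hence "(%n. h1sq S (u - \<phi> n)) \<leadsto> 0" using pos by simp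
  hence lim: "(%n. G.A.sq (\<phi> n - u)) \<leadsto> 0"
    unfolding h1sq_A[OF S] using G.A.sq_diff_commute[OF uH pH] by simp
  show ?thesis
    using \<phi>(1) G.A_limits[OF pH uH lim] by (intro exI[of _ \<phi>]) blast
qed

theorem dirichlet_rank_bound:
  assumes S: "open S" and R: "S \<subseteq> cball 0 R" and c: "0 < c"
  shows "\<exists>(N::nat) f. (\<forall>j<N. f j \<in> L2 (lebesgue_on S)) & (\<forall>u\<in>H10 S.
    c * l2.sq (lebesgue_on S) u <= energy S u + (\<Sum>j<N. (cmod (l2_inner (lebesgue_on S) u (f j)))^2))"
proof -
  have m: "S \<in> sets lebesgue" by (rule open_sets_lebesgue[OF S])
  have "0 < 1 / c" using c by simp
  from local_rellich[OF this, of R] obtain N :: nat and f :: "nat => 'a => complex" where f: "\<forall>j<N. f j \<in> L2 lebesgue"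
    and r: "!!u. u \<in> H1 UNIV ==> nsq (%x. cplx (indicator (cball 0 R) x) * u x) \<le>
      1 / c * energy UNIV u + (\<Sum>j<N. (cmod (l2_inner lebesgue u (f j)))^2)" by blast
  have fS: "\<forall>j<N. f j \<in> L2 (lebesgue_on S)" using f L2_restrict[OF m] by blast
  have test: "l2.sq (lebesgue_on S) \<phi> <= 1 / c * energy S \<phi> + (\<Sum>j<N. (cmod (l2_inner (lebesgue_on S) \<phi> (f j)))^2)"
    if \<phi>: "\<phi> \<in> test_functions S" for \<phi>
  proof -
    have "(%x. cplx (indicator (cball 0 R) x) * \<phi> x) = \<phi>"
      using test_vanish(1)[OF \<phi>] R by (auto simp: fun_eq_iff subset_iff split: split_indicator)
    thus ?thesis using r[OF test_H1[OF open_UNIV \<phi>]] by (simp add: test_inner_on[OF \<phi> m] test_grad_on[OF S \<phi>])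
  qed
  have main: "l2.sq (lebesgue_on S) u <= 1 / c * energy S u + (\<Sum>j<N. (cmod (l2_inner (lebesgue_on S) u (f j)))^2)"
    if u: "u \<in> H10 S" for u
  proof -
    from H10_limit[OF S u] obtain \<phi> where \<phi>: "!!n. \<phi> n \<in> test_functions S"
      and 1: "(%n. energy S (\<phi> n)) \<leadsto> energy S u"
      and 2: "(%n. l2.sq (lebesgue_on S) (\<phi> n)) \<leadsto> l2.sq (lebesgue_on S) u"
      and 3: "!!f. f \<in> L2 (lebesgue_on S) ==> (%n. l2_inner (lebesgue_on S) (\<phi> n) f) \<leadsto> l2_inner (lebesgue_on S) u f"
      by blast
    have "(%n. 1 / c * energy S (\<phi> n) + (\<Sum>j<N. (cmod (l2_inner (lebesgue_on S) (\<phi> n) (f j)))^2)) \<leadsto>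
      1 / c * energy S u + (\<Sum>j<N. (cmod (l2_inner (lebesgue_on S) u (f j)))^2)"
      by (intro tendsto_add tendsto_mult tendsto_const tendsto_sum tendsto_power tendsto_norm 1 3) (use fS in auto)
    from LIMSEQ_le[OF 2 this] test \<phi> show ?thesis by blast
  qed
  show ?thesis
  proof (intro exI conjI ballI)
    show "\<forall>j<N. fscale (cplx (sqrt c)) (f j) \<in> L2 (lebesgue_on S)" using fS L2_scale by blast
    fix u assume u: "u \<in> H10 S"
    have uL: "u \<in> L2 (lebesgue_on S)" using u by (auto simp: H10_def H1_def)
    show "c * l2.sq (lebesgue_on S) u <= energy S u + (\<Sum>j<N. (cmod (l2_inner (lebesgue_on S) u (fscale (cplx (sqrt c)) (f j))))^2)"
      using rank_bound_scaled[OF c fS main[OF u] uL] c by simp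
  qed
qed

text \<open>A translation by \<open>3 R\<close> moves the support off itself, so that the increment dominates the function.\<close>

theorem friedrichs_inequality:
  assumes S: "open S" and R: "S \<subseteq> cball 0 R" "0 < R" and u: "u \<in> H10 S"
  shows "l2.sq (lebesgue_on S) u <= (3 * R)^2 * energy S u"
proof -
  have m: "S \<in> sets lebesgue" by (rule open_sets_lebesgue[OF S])
  have test: "l2.sq (lebesgue_on S) \<phi> <= (3 * R)^2 * energy S \<phi>" if \<phi>: "\<phi> \<in> test_functions S" for \<phi>
  proof -
    obtain i :: 'a where i: "i \<in> Basis" using nonempty_Basis by blast
    define z where "z = (3 * R) *\<^sub>R i"
    have nz: "norm z = 3 * R" using i R by (simp add: z_def)
    have pL: "partial j \<phi> \<in> L2 lborel" if "j \<in> Basis" for j by (rule test_L2_lborel[OF test_partial[OF \<phi> that]])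
    have "norm (\<phi> x) <= norm (\<phi> (x + z) - \<phi> x)" for x
    proof (cases "\<phi> x = 0")
      case False
      hence "norm x <= R" using test_vanish(1)[OF \<phi>, of x] R(1) by (auto simp: subset_iff)
      hence "R < norm (x + z)" using norm_triangle_ineq4[of "x + z" x] nz R(2) by simp
      hence "\<phi> (x + z) = 0" using test_vanish(1)[OF \<phi>, of "x + z"] R(1) by force
      thus ?thesis by simp
    qed simp
    hence "(\<integral>\<^sup>+x. ennreal ((norm (\<phi> x))^2) \<partial>lborel) <= (\<integral>\<^sup>+x. ennreal ((norm (\<phi> (x + z) - \<phi> x))^2) \<partial>lborel)"
      by (intro nn_integral_mono ennreal_leI power_mono) auto
    also have "\<dots> <= ennreal ((norm z)^2 * (\<Sum>i\<in>Basis. l2.sq lborel (partial i \<phi>)))"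
      by (rule smooth_translation[OF test_functionsD(1)[OF \<phi>] pL])
    finally have "l2.sq lborel \<phi> <= (norm z)^2 * (\<Sum>i\<in>Basis. l2.sq lborel (partial i \<phi>))"
      by (rule L2_nnI(2)[rotated]) (use test_borel[OF \<phi>] in \<open>auto intro!: mult_nonneg_nonneg sum_nonneg l2.ip_pos pL\<close>)
    also have "(\<Sum>i\<in>Basis. l2.sq lborel (partial i \<phi>)) = energy UNIV \<phi>"
      by (rule grad_smooth[OF test_functionsD(1)[OF \<phi>] pL test_L2_UNIV[OF \<phi>], symmetric])
    also have "l2.sq lborel \<phi> = l2.sq (lebesgue_on S) \<phi>"
      using test_borel[OF \<phi>] by (simp add: test_inner_on[OF \<phi> m] l2_lborel_lebesgue)
    finally show ?thesis by (simp add: nz test_grad_on[OF S \<phi>])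
  qed
  from H10_limit[OF S u] obtain \<phi> where \<phi>: "!!n. \<phi> n \<in> test_functions S"
    and 1: "(%n. energy S (\<phi> n)) \<leadsto> energy S u"
    and 2: "(%n. l2.sq (lebesgue_on S) (\<phi> n)) \<leadsto> l2.sq (lebesgue_on S) u" by blast
  from LIMSEQ_le[OF 2 tendsto_mult[OF tendsto_const 1]] test \<phi> show ?thesis by blast
qed

section \<open>Eigenvalues as least trial levels\<close>

context l2form
begin

definition orthonormal_trial :: "nat => real => (nat => 'a => complex) => bool" where
  "orthonormal_trial k t e \<longleftrightarrow> (\<forall>i<k. e i \<in> Q) & (\<forall>i<k. \<forall>j<k. l2_inner M (e i) (e j) = (if i = j then 1 else 0)) &
    (\<forall>b. Q.sq (comb k b e) <= t * (\<Sum>i<k. (cmod (b i))^2))"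

lemma orthonormal_trialD:
  assumes "orthonormal_trial k t e"
  shows "i < k ==> e i \<in> Q" "i < k ==> e i \<in> L2 M" "i < k ==> j < k ==> l2_inner M (e i) (e j) = (if i = j then 1 else 0)"
    "Q.sq (comb k b e) <= t * (\<Sum>i<k. (cmod (b i))^2)"
    "H.sq (comb k b e) = (\<Sum>i<k. (cmod (b i))^2)"
proof -
  show Q: "i < k ==> e i \<in> Q" and o: "i < k ==> j < k ==> l2_inner M (e i) (e j) = (if i = j then 1 else 0)" for i j
    using assms by (auto simp: orthonormal_trial_def)
  show L: "i < k ==> e i \<in> L2 M" for i using Q QinH by blast
  show "Q.sq (comb k b e) <= t * (\<Sum>i<k. (cmod (b i))^2)" using assms by (simp add: orthonormal_trial_def)
  show "H.sq (comb k b e) = (\<Sum>i<k. (cmod (b i))^2)" by (rule l2.sq_orthonormal_sum[OF L o])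
qed

lemma trial_orthonormal: assumes "orthonormal_trial k t e" shows "trial k t"
  unfolding trial_def using orthonormal_trialD(1,4,5)[OF assms]
  by (intro exI[of _ e]) (auto simp: sum_nonneg_eq_0_iff)

text \<open>The minimum over trial levels; it is attained by an orthonormal family.\<close>

theorem lambda_k_least_trial:
  assumes "finite_rank_bound c N f" "0 < c" "trial k t0" "t0 < c" "1 <= k"
  shows "\<exists>\<nu> e. lambda_k M T k = ereal \<nu> & orthonormal_trial k \<nu> e & (\<forall>t. trial k t --> \<nu> <= t)"
proof -
  obtain \<nu> e where *: "lambda_k M T k = ereal \<nu>" "orthonormal_trial k \<nu> e" and m: "\<forall>t<c. trial k t --> \<nu> <= t"
    using lambda_k_characterization[OF assms] unfolding orthonormal_trial_def by blast
  have "\<nu> <= t" if "trial k t" for t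
    using m that assms(3,4) by (cases "t < c") force+
  with * show ?thesis by blast
qed

end

section \<open>Dilations\<close>

definition dil :: "real => ('a::euclidean_space => 'b) => 'a => 'b" where
  "dil s u = (%x. u (s *\<^sub>R x))"

lemma dil_integral:
  fixes f :: "'a::euclidean_space => 'b::{banach, second_countable_topology}"
  assumes s: "0 < s" and f: "f \<in> borel_measurable lebesgue"
  shows "dil s f \<in> borel_measurable lebesgue" "integrable lebesgue f ==> integrable lebesgue (dil s f)"
    "(LINT x|lebesgue. f x) = s ^ DIM('a) *\<^sub>R (LINT x|lebesgue. dil s f x)"
proof -
  have m: "(*\<^sub>R) s \<in> (lebesgue :: 'a measure) \<rightarrow>\<^sub>M lebesgue" by (rule lebesgue_measurable_scaling)
  have T: "(%x. 0 + (\<Sum>j\<in>Basis. (s * (x \<bullet> j)) *\<^sub>R j)) = ((*\<^sub>R) s :: 'a => 'a)"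
    unfolding scaleR_scaleR[symmetric] scaleR_sum_right[symmetric] euclidean_representation by simp
  have L: "(lebesgue :: 'a measure) = density (distr lebesgue lebesgue ((*\<^sub>R) s)) (%_. ennreal (s ^ DIM('a)))"
    using lebesgue_affine_euclidean[of "%_. s" "0::'a"] s unfolding T by simp
  show d: "dil s f \<in> borel_measurable lebesgue" unfolding dil_def by (rule measurable_compose[OF m f])
  have fd: "f \<in> borel_measurable (distr lebesgue lebesgue ((*\<^sub>R) s))" using f by simp
  have "integrable lebesgue f \<longleftrightarrow> integrable (density (distr lebesgue lebesgue ((*\<^sub>R) s)) (%_. ennreal (s ^ DIM('a)))) f" using L by simp
  also have "\<dots> \<longleftrightarrow> integrable (distr lebesgue lebesgue ((*\<^sub>R) s)) (%x. s ^ DIM('a) *\<^sub>R f x)"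
    using s by (intro integrable_density fd) auto
  also have "\<dots> \<longleftrightarrow> integrable lebesgue (%x. s ^ DIM('a) *\<^sub>R dil s f x)"
    unfolding dil_def using f by (intro integrable_distr_eq m) auto
  finally show "integrable lebesgue f ==> integrable lebesgue (dil s f)"
    using integrable_scaleR_right[of "1 / s ^ DIM('a)" lebesgue "%x. s ^ DIM('a) *\<^sub>R dil s f x"] s by simp
  have "(LINT x|lebesgue. f x) = (LINT x|density (distr lebesgue lebesgue ((*\<^sub>R) s)) (%_. ennreal (s ^ DIM('a))). f x)" using L by simp
  also have "\<dots> = (LINT x|distr lebesgue lebesgue ((*\<^sub>R) s). s ^ DIM('a) *\<^sub>R f x)"
    using s by (intro integral_density fd) auto
  also have "\<dots> = (LINT x|lebesgue. s ^ DIM('a) *\<^sub>R dil s f x)"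
    unfolding dil_def using f by (intro integral_distr m) auto
  also have "\<dots> = s ^ DIM('a) *\<^sub>R (LINT x|lebesgue. dil s f x)" by (rule integral_scaleR_right)
  finally show "(LINT x|lebesgue. f x) = s ^ DIM('a) *\<^sub>R (LINT x|lebesgue. dil s f x)" .
qed

lemma dil_L2:
  fixes u :: "'a::euclidean_space => complex"
  assumes s: "0 < s" and u: "u \<in> L2 lebesgue"
  shows "dil s u \<in> L2 lebesgue" "nsq u = s ^ DIM('a) * nsq (dil s u)"
proof -
  have i: "integrable lebesgue (%x. (norm (u x))^2)" by (rule L2_integrable[OF u])
  note d = dil_integral[OF s borel_measurable_integrable[OF i]]
  show "dil s u \<in> L2 lebesgue"
    by (rule L2I[OF dil_integral(1)[OF s L2_measurable[OF u]]]) (use d(2)[OF i] in \<open>simp add: dil_def\<close>)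
  show "nsq u = s ^ DIM('a) * nsq (dil s u)"
    using d(3) by (simp add: l2_sq dil_def)
qed

lemma dil_weak_partial:
  assumes s: "0 < s" and i: "i \<in> Basis" and u: "u \<in> L2 lebesgue" and g: "g \<in> L2 lebesgue"
    and w: "is_weak_partial UNIV i u g"
  shows "is_weak_partial UNIV i (dil s u) (fscale (of_real s) (dil s g))"
  unfolding is_weak_partial_def lebesgue_on_UNIV_eq
proof
  fix \<phi> :: "'a => complex" assume \<phi>: "\<phi> \<in> test_functions UNIV"
  define \<psi> where "\<psi> y = \<phi> (0 - (- 1 / s) *\<^sub>R y)" for y
  have \<psi>: "\<psi> \<in> test_functions UNIV" unfolding \<psi>_def by (rule test_reflect[OF \<phi>]) (use s in simp)
  have p: "partial i \<psi> y = of_real (1 / s) * partial i \<phi> ((1 / s) *\<^sub>R y)" for y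
    using partial_affine_eq[OF test_functionsD(1)[OF \<phi>], of i "1 / s" 0 y] by (simp add: \<psi>_def[abs_def])
  have pi: "partial i \<psi> \<in> test_functions UNIV" by (rule test_partial[OF \<psi> i])
  have "(LINT x|lebesgue. u x * partial i \<psi> x) = s ^ DIM('a) *\<^sub>R (LINT x|lebesgue. dil s (%x. u x * partial i \<psi> x) x)"
    by (rule dil_integral(3)[OF s]) (intro borel_measurable_integrable L2_mult_integrable u test_L2_UNIV[OF pi])
  moreover have "dil s (%x. u x * partial i \<psi> x) = (%x. of_real (1 / s) * (dil s u x * partial i \<phi> x))"
    using s by (simp add: dil_def p fun_eq_iff)
  moreover have "(LINT x|lebesgue. g x * \<psi> x) = s ^ DIM('a) *\<^sub>R (LINT x|lebesgue. dil s (%x. g x * \<psi> x) x)"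
    by (rule dil_integral(3)[OF s]) (intro borel_measurable_integrable L2_mult_integrable g test_L2_UNIV[OF \<psi>])
  moreover have "dil s (%x. g x * \<psi> x) = (%x. dil s g x * \<phi> x)"
    using s by (simp add: dil_def \<psi>_def fun_eq_iff)
  moreover have "(LINT x|lebesgue. u x * partial i \<psi> x) = - (LINT x|lebesgue. g x * \<psi> x)"
    using w \<psi> by (simp add: is_weak_partial_def lebesgue_on_UNIV_eq)
  ultimately have "of_real (1 / s) * (LINT x|lebesgue. dil s u x * partial i \<phi> x) = - (LINT x|lebesgue. dil s g x * \<phi> x)"
    using s by (simp only: integral_mult_right_zero) (simp flip: scaleR_minus_right)
  hence "(LINT x|lebesgue. dil s u x * partial i \<phi> x) = - (of_real s * (LINT x|lebesgue. dil s g x * \<phi> x))"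
    using s by (simp add: field_simps)
  moreover have "(LINT x|lebesgue. fscale (of_real s) (dil s g) x * \<phi> x) = of_real s * (LINT x|lebesgue. dil s g x * \<phi> x)"
    unfolding fscale_apply mult.assoc by (rule integral_mult_right_zero)
  ultimately show "(LINT x|lebesgue. dil s u x * partial i \<phi> x) = - (LINT x|lebesgue. fscale (of_real s) (dil s g) x * \<phi> x)" by simp
qed

lemma dil_H1:
  fixes u :: "'a::euclidean_space => complex"
  assumes s: "0 < s" and u: "u \<in> H1 UNIV"
  shows "dil s u \<in> H1 UNIV" "s^2 * energy UNIV u = s ^ DIM('a) * energy UNIV (dil s u)"
proof -
  define g where "g i = weak_partial UNIV i u" for i
  have g: "g i \<in> L2 lebesgue" "is_weak_partial UNIV i u (g i)" if "i \<in> Basis" for i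
    using weak_partial_spec[OF u that] by (auto simp: g_def lebesgue_on_UNIV_eq)
  have uL: "u \<in> L2 lebesgue" by (rule HU.QinH[OF u])
  note D = dil_L2(1)[OF s uL] L2_scale[OF dil_L2(1)[OF s g(1)]] dil_weak_partial[OF s _ uL g]
  show "dil s u \<in> H1 UNIV"
    by (rule H1I[of _ _ "%i. fscale (of_real s) (dil s (g i))"]) (use D in \<open>auto simp: lebesgue_on_UNIV_eq\<close>)
  have "energy UNIV (dil s u) = (\<Sum>i\<in>Basis. l2.sq (lebesgue_on UNIV) (fscale (of_real s) (dil s (g i))))"
    by (rule grad_sq[OF open_UNIV]) (use D in \<open>auto simp: lebesgue_on_UNIV_eq\<close>)
  also have "\<dots> = s^2 * (\<Sum>i\<in>Basis. nsq (dil s (g i)))"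
    unfolding sum_distrib_left lebesgue_on_UNIV_eq using dil_L2(1)[OF s g(1)] by (intro sum.cong refl) (simp add: l2.sq_scale)
  finally have "s ^ DIM('a) * energy UNIV (dil s u) = s^2 * (\<Sum>i\<in>Basis. s ^ DIM('a) * nsq (dil s (g i)))"
    by (simp add: sum_distrib_left mult_ac)
  also have "(\<Sum>i\<in>Basis. s ^ DIM('a) * nsq (dil s (g i))) = (\<Sum>i\<in>Basis. l2.sq (lebesgue_on UNIV) (g i))"
    using dil_L2(2)[OF s g(1)] by (intro sum.cong) (simp_all add: lebesgue_on_UNIV_eq)
  also have "\<dots> = energy UNIV u"
    by (rule grad_sq[OF open_UNIV, symmetric]) (use g uL in \<open>auto simp: lebesgue_on_UNIV_eq\<close>)
  finally show "s^2 * energy UNIV u = s ^ DIM('a) * energy UNIV (dil s u)" ..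
qed

lemma dil_schroedinger:
  fixes u :: "'a::euclidean_space => complex"
  assumes s: "0 < s" and c: "0 < c" and h: "h'^2 * s^2 = c * h^2" and V': "!!x. V' x = c * V (s *\<^sub>R x)"
    and u: "u \<in> schroedinger_domain V"
  shows "dil s u \<in> schroedinger_domain V'"
    "c * Re (schroedinger_form h V u u) = s ^ DIM('a) * Re (schroedinger_form h' V' (dil s u) (dil s u))"
proof -
  have uH: "u \<in> H1 UNIV" and pL: "pot V u \<in> L2 lebesgue" using u by (auto simp: domain_iff)
  have p: "pot V' (dil s u) = fscale (cplx (sqrt c)) (dil s (pot V u))"
    by (simp add: pot_def dil_def V' real_sqrt_mult fun_eq_iff)
  have dL: "dil s (pot V u) \<in> L2 lebesgue" by (rule dil_L2(1)[OF s pL])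
  show "dil s u \<in> schroedinger_domain V'"
    unfolding domain_iff p by (intro conjI dil_H1(1)[OF s uH] L2_scale dL)
  have "nsq (pot V' (dil s u)) = c * nsq (dil s (pot V u))"
    unfolding p using c by (simp add: l2.sq_scale[OF dL])
  hence 1: "s ^ DIM('a) * nsq (pot V' (dil s u)) = c * nsq (pot V u)"
    using dil_L2(2)[OF s pL] by simp
  have "s^2 * (s ^ DIM('a) * (h'^2 * energy UNIV (dil s u))) = (h'^2 * s^2) * (s^2 * energy UNIV u)"
    unfolding dil_H1(2)[OF s uH] by (simp add: mult_ac)
  also have "\<dots> = s^2 * (c * (h^2 * energy UNIV u))" unfolding h by (simp add: mult_ac)
  finally have "s ^ DIM('a) * (h'^2 * energy UNIV (dil s u)) = c * (h^2 * energy UNIV u)"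
    using s by simp
  with 1 show "c * Re (schroedinger_form h V u u) = s ^ DIM('a) * Re (schroedinger_form h' V' (dil s u) (dil s u))"
    unfolding form_sq distrib_left by linarith
qed

abbreviation schroedinger_trial where
  "schroedinger_trial h V \<equiv> hform.trial fscale (l2_inner lebesgue) (schroedinger_domain V) (schroedinger_form h V)"

text \<open>A dilation multiplies the norm and both parts of the form by the same power of \<open>s\<close>, up to the factors that \<open>h\<close> and \<open>V\<close> absorb.\<close>

theorem dil_trial:
  fixes V :: "'a::euclidean_space => real"
  assumes V: "V \<in> borel_measurable borel" "!!x. 0 <= V x" and h: "0 < h" "0 < h'"
    and s: "0 < s" and c: "0 < c" and hh: "h'^2 * s^2 = c * h^2" and V': "!!x. V' x = c * V (s *\<^sub>R x)"
    and T: "schroedinger_trial h V k t"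
  shows "schroedinger_trial h' V' k (c * t)"
proof -
  interpret P: l2form lebesgue "schroedinger_domain V" "schroedinger_form h V" by (rule schroedinger_l2form[OF V h(1)])
  have V'm: "V' \<in> borel_measurable borel"
  proof -
    have "(%x. c * V (s *\<^sub>R x)) \<in> borel_measurable borel" using V(1) by measurable
    thus ?thesis unfolding V'[symmetric] .
  qed
  interpret P': l2form lebesgue "schroedinger_domain V'" "schroedinger_form h' V'"
    by (rule schroedinger_l2form[OF V'm _ h(2)]) (use V(2) c in \<open>simp add: V'\<close>)
  from T obtain w where w: "\<forall>i<k. w i \<in> schroedinger_domain V"
    "!!b. P.Q.sq (comb k b w) <= t * nsq (comb k b w)"
    "!!b. nsq (comb k b w) = 0 --> (\<forall>i<k. b i = 0)" unfolding P.trial_def by blast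
  have S: "(\<Sum>i<k. fscale (b i) (dil s (w i))) = dil s (comb k b w)" for b
    by (simp add: fun_eq_iff sum_fun_apply dil_def)
  have D: "(comb k b w) \<in> schroedinger_domain V" for b
    using w(1) by (intro P.Q.closed_sum P.Q.closed(4)) auto
  have sd: "0 < s ^ DIM('a)" using s by simp
  have "P'.Q.sq (dil s u) <= c * t * nsq (dil s u)"
    if u: "u \<in> schroedinger_domain V" "P.Q.sq u <= t * nsq u" for u
  proof -
    have "s ^ DIM('a) * P'.Q.sq (dil s u) = c * P.Q.sq u" by (rule dil_schroedinger(2)[OF s c hh V' u(1), symmetric])
    also have "\<dots> <= c * (t * nsq u)" using u(2) c by simp
    also have "\<dots> = s ^ DIM('a) * (c * t * nsq (dil s u))"
      unfolding dil_L2(2)[OF s P.QinH[OF u(1)]] by simp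
    finally show ?thesis using sd by simp
  qed
  moreover have "nsq (dil s u) = 0 \<longleftrightarrow> nsq u = 0" if "u \<in> schroedinger_domain V" for u
    using dil_L2(2)[OF s P.QinH[OF that]] s by simp
  ultimately show ?thesis
    unfolding P'.trial_def using w D dil_schroedinger(1)[where V = V and V' = V', OF s c hh V']
    by (intro exI[of _ "%i. dil s (w i)"]) (simp add: S)
qed

section \<open>Trial families of test functions\<close>

text \<open>The loss in level when an orthonormal family is moved by \<open>\<kappa>\<close>.\<close>

lemma perturbed_level:
  fixes t t' :: real
  assumes "0 <= t" "t < t'"
  shows "\<exists>\<kappa>. 0 < \<kappa> & \<kappa> < 1 & (sqrt t + \<kappa>)^2 <= t' * (1 - \<kappa>)^2"
proof -
  have "((%\<kappa>. t' * (1 - \<kappa>)^2 - (sqrt t + \<kappa>)^2) \<longlongrightarrow> t' * (1 - 0)^2 - (sqrt t + 0)^2) (at_right 0)"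
    by (intro tendsto_intros)
  moreover have "0 < t' * (1 - 0)^2 - (sqrt t + 0)^2" using assms by simp
  ultimately have "\<forall>\<^sub>F \<kappa> in at_right 0. 0 < t' * (1 - \<kappa>)^2 - (sqrt t + \<kappa>)^2" by (rule order_tendstoD(1))
  moreover have "\<forall>\<^sub>F \<kappa> in at_right 0. \<kappa> < (1::real)" "\<forall>\<^sub>F \<kappa> in at_right 0. (0::real) < \<kappa>"
    by (auto intro: order_tendstoD(2)[OF tendsto_ident_at] eventually_at_right_less)
  ultimately have "\<forall>\<^sub>F \<kappa> in at_right 0. 0 < \<kappa> & \<kappa> < 1 & (sqrt t + \<kappa>)^2 <= t' * (1 - \<kappa>)^2"
    by eventually_elim simp
  thus ?thesis by (rule eventually_happens'[rotated]) simp
qed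

context l2form
begin

lemma orthonormal_trial_perturb:
  assumes E: "orthonormal_trial k t e" and t: "0 <= t"
    and \<kappa>: "0 < \<kappa>" "\<kappa> < 1" "(sqrt t + \<kappa>)^2 <= t' * (1 - \<kappa>)^2"
    and \<phi>: "!!i. i < k ==> \<phi> i \<in> Q" "!!i. i < k ==> sqrt (A.sq (e i - \<phi> i)) <= \<kappa> / real (Suc k)"
  shows "Q.sq (comb k b \<phi>) <= t' * H.sq (comb k b \<phi>)"
    "H.sq (comb k b \<phi>) = 0 --> (\<forall>i<k. b i = 0)"
proof -
  note eE = orthonormal_trialD[OF E]
  define u where "u = (comb k b e)"
  define v where "v = (comb k b \<phi>)"
  define n where "n = sqrt (\<Sum>i<k. (cmod (b i))^2)"
  have n: "0 <= n" "n^2 = (\<Sum>i<k. (cmod (b i))^2)" by (simp_all add: n_def sum_nonneg)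
  have uQ: "u \<in> Q" and vQ: "v \<in> Q" unfolding u_def v_def using eE(1) \<phi>(1) by (intro Q.closed_sum Q.closed(4); simp)+
  have bn: "cmod (b i) <= n" if "i < k" for i
    unfolding n_def by (rule real_le_rsqrt) (use that in \<open>auto intro!: member_le_sum\<close>)
  have dQ: "e i - \<phi> i \<in> Q" if "i < k" for i using that eE(1) \<phi>(1) by (intro Q.closed(3))
  have uv: "u - v = (\<Sum>i<k. fscale (b i) (e i - \<phi> i))"
    unfolding u_def v_def sum_subtractf[symmetric] by (intro sum.cong refl) (simp add: fun_eq_iff algebra_simps)
  have "sqrt (A.sq (u - v)) <= (\<Sum>i<k. sqrt (A.sq (fscale (b i) (e i - \<phi> i))))"
    unfolding uv by (rule A.triangle_sum) (simp add: Q.closed(4) dQ)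
  also have "\<dots> <= (\<Sum>i<k. n * (\<kappa> / real (Suc k)))"
  proof (rule sum_mono)
    fix i assume "i \<in> {..<k}"
    hence i: "i < k" by simp
    have "sqrt (A.sq (fscale (b i) (e i - \<phi> i))) = cmod (b i) * sqrt (A.sq (e i - \<phi> i))"
      using A.sq_scale[OF dQ[OF i]] by (simp add: real_sqrt_mult)
    also have "\<dots> <= n * (\<kappa> / real (Suc k))" using A.ip_pos[OF dQ[OF i]] by (intro mult_mono bn \<phi>(2) i n) auto
    finally show "sqrt (A.sq (fscale (b i) (e i - \<phi> i))) <= n * (\<kappa> / real (Suc k))" .
  qed
  also have "\<dots> = (n * \<kappa>) * (real k / real (Suc k))" by simp
  also have "\<dots> <= (n * \<kappa>) * 1" using n \<kappa> by (intro mult_left_mono) auto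
  finally have d: "sqrt (A.sq (u - v)) <= \<kappa> * n" by (simp add: mult.commute)
  have dq: "u - v \<in> Q" by (rule Q.closed(3)[OF uQ vQ])
  have d1: "sqrt (Q.sq (v - u)) <= \<kappa> * n" and d2: "sqrt (H.sq (u - v)) <= \<kappa> * n"
    using d real_sqrt_le_mono[OF sq_le(1)[OF dq]] real_sqrt_le_mono[OF sq_le(2)[OF dq]] unfolding Q.sq_diff_commute[OF vQ uQ] by linarith+
  have "sqrt (Q.sq (u + (v - u))) <= sqrt (Q.sq u) + sqrt (Q.sq (v - u))" by (intro Q.triangle uQ Q.closed(3) vQ)
  moreover have "sqrt (Q.sq u) <= sqrt t * n"
    using real_sqrt_le_mono[OF eE(4)[of b]] unfolding u_def[symmetric] n(2)[symmetric] real_sqrt_mult using n(1) by simp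
  ultimately have q: "sqrt (Q.sq v) <= (sqrt t + \<kappa>) * n" using d1 by (simp add: distrib_right)
  have "sqrt (H.sq (v + (u - v))) <= sqrt (H.sq v) + sqrt (H.sq (u - v))" by (intro H.triangle QinH vQ dq)
  moreover have "H.sq u = n^2" unfolding u_def n(2) by (rule eE(5))
  ultimately have h: "(1 - \<kappa>) * n <= sqrt (H.sq v)" using d2 n(1) by (simp add: left_diff_distrib)
  have hp: "0 <= H.sq v" "0 <= Q.sq v" by (intro H.ip_pos QinH vQ, rule Q.ip_pos[OF vQ])
  have t': "0 <= t'"
  proof (rule ccontr)
    assume "\<not> 0 <= t'"
    hence "t' * (1 - \<kappa>)^2 < 0" using \<kappa>(2) by (simp add: mult_less_0_iff)
    with \<kappa>(3) show False using zero_le_power2[of "sqrt t + \<kappa>"] by linarith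
  qed
  have "Q.sq v = (sqrt (Q.sq v))^2" using hp by simp
  also have "\<dots> <= ((sqrt t + \<kappa>) * n)^2" using q hp by (intro power_mono) auto
  also have "\<dots> <= t' * (1 - \<kappa>)^2 * n^2" unfolding power_mult_distrib by (intro mult_right_mono \<kappa>(3)) simp
  also have "\<dots> = t' * ((1 - \<kappa>) * n)^2" by (simp add: power_mult_distrib)
  also have "\<dots> <= t' * (sqrt (H.sq v))^2" using h \<kappa>(2) n(1) t' by (intro mult_left_mono power_mono) auto
  finally show "Q.sq (comb k b \<phi>) <= t' * H.sq (comb k b \<phi>)"
    using hp unfolding v_def by simp
  show "H.sq (comb k b \<phi>) = 0 --> (\<forall>i<k. b i = 0)"
  proof (intro impI allI)
    fix i assume z: "H.sq (comb k b \<phi>) = 0" and i: "i < k"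
    from z have "H.sq v = 0" unfolding v_def .
    with h have "(1 - \<kappa>) * n <= 0" by simp
    hence "n = 0" using \<kappa>(2) n(1) by (simp add: mult_le_0_iff)
    thus "b i = 0" using bn[OF i] by simp
  qed
qed

end

lemma test_H10: assumes S: "open S" and \<phi>: "\<phi> \<in> test_functions S" shows "\<phi> \<in> H10 S"
proof -
  interpret G: l2form "lebesgue_on S" "H1 S" "grad_form S" by (rule H1_l2form[OF S])
  have "h1sq S (\<phi> - \<phi>) = 0" unfolding h1sq_A[OF S] by (simp add: G.A.ip_zero G.Q.closed)
  hence "\<forall>\<epsilon>>0. \<exists>\<psi>\<in>test_functions S. sqrt (h1sq S (\<phi> - \<psi>)) < \<epsilon>" using \<phi> by (metis real_sqrt_zero)
  thus ?thesis unfolding H10_iff using test_H1[OF S \<phi>] by blast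
qed

lemma test_sum: "(!!i. i < (k::nat) ==> \<phi> i \<in> test_functions S) ==> (comb k b \<phi>) \<in> test_functions S"
proof (induction k)
  case 0 thus ?case using test_zero by (simp add: zero_fun_def)
next
  case (Suc k)
  have "(comb k b \<phi>) \<in> test_functions S" "fscale (b k) (\<phi> k) \<in> test_functions S"
    using Suc test_scale[OF Suc.prems[of k], of "b k"] by (simp_all add: fscale_def)
  from test_add[OF this] show ?case by (simp only: sum.lessThan_Suc plus_fun_def)
qed

theorem dirichlet_test_family:
  assumes S: "open S" and E: "l2form.orthonormal_trial (lebesgue_on S) (H10 S) (grad_form S) k t e" and t: "0 <= t" "t < t'"
  shows "\<exists>\<phi>. (\<forall>i<k. \<phi> i \<in> test_functions S) & (\<forall>b.
    energy UNIV (comb k b \<phi>) <= t' * nsq (comb k b \<phi>) &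
    (nsq (comb k b \<phi>) = 0 --> (\<forall>i<k. b i = 0)))"
proof -
  interpret D: l2form "lebesgue_on S" "H10 S" "grad_form S" by (rule H10_l2form[OF S])
  have m: "S \<in> sets lebesgue" by (rule open_sets_lebesgue[OF S])
  from perturbed_level[OF t] obtain \<kappa> where \<kappa>: "0 < \<kappa>" "\<kappa> < 1" "(sqrt t + \<kappa>)^2 <= t' * (1 - \<kappa>)^2" by blast
  have pos: "0 < \<kappa> / real (Suc k)" using \<kappa> by simp
  have "\<exists>\<phi>\<in>test_functions S. sqrt (h1sq S (e i - \<phi>)) < \<kappa> / real (Suc k)" if "i < k" for i
    using D.orthonormal_trialD(1)[OF E that] pos unfolding H10_iff by blast
  hence "\<forall>i. \<exists>\<phi>. i < k --> \<phi> \<in> test_functions S & sqrt (h1sq S (e i - \<phi>)) < \<kappa> / real (Suc k)" by blast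
  from choice[OF this] obtain \<phi> where \<phi>: "!!i. i < k ==> \<phi> i \<in> test_functions S"
    "!!i. i < k ==> sqrt (h1sq S (e i - \<phi> i)) < \<kappa> / real (Suc k)" by blast
  have A: "sqrt (D.A.sq (e i - \<phi> i)) <= \<kappa> / real (Suc k)" if "i < k" for i
    using \<phi>(2)[OF that] unfolding D.A_sq h1sq_def by simp
  note P = D.orthonormal_trial_perturb[OF E t(1) \<kappa> test_H10[OF S \<phi>(1)] A]
  have T: "(comb k b \<phi>) \<in> test_functions S" for b by (rule test_sum[OF \<phi>(1)])
  show ?thesis
    using \<phi>(1) P unfolding test_grad_on[OF S T] test_inner_on[OF T m] by (intro exI[of _ \<phi>]) simp
qed

text \<open>Bumps on \<open>k\<close> disjoint boxes along the diagonal near \<open>0\<close> are orthogonal.\<close>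

theorem dirichlet_trial_exists:
  fixes S :: "'a::euclidean_space set"
  assumes S: "open S" "0 \<in> S"
  shows "\<exists>t. hform.trial fscale (l2_inner (lebesgue_on S)) (H10 S) (grad_form S) k t"
proof -
  interpret D: l2form "lebesgue_on S" "H10 S" "grad_form S" by (rule H10_l2form[OF S(1)])
  have m: "S \<in> sets lebesgue" by (rule open_sets_lebesgue[OF S(1)])
  obtain r where r: "0 < r" "cball 0 r \<subseteq> S" using S open_contains_cball by blast
  define \<epsilon> where "\<epsilon> = r / (real DIM('a) * real (Suc k))"
  have \<epsilon>: "0 < \<epsilon>" "real DIM('a) * (real (Suc k) * \<epsilon>) = r" using r by (auto simp: \<epsilon>_def)
  define a where "a i = (real i * \<epsilon>) *\<^sub>R (One :: 'a)" for i
  define b where "b i = (real (Suc i) * \<epsilon>) *\<^sub>R (One :: 'a)" for i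
  define f where "f i x = cplx (box_bump 1 (a i) (b i) x)" for i x
  have box: "x \<in> box (a i) (b i) \<longleftrightarrow> (\<forall>j\<in>Basis. real i * \<epsilon> < x \<bullet> j & x \<bullet> j < real (Suc i) * \<epsilon>)"
    "x \<in> cbox (a i) (b i) \<longleftrightarrow> (\<forall>j\<in>Basis. real i * \<epsilon> <= x \<bullet> j & x \<bullet> j <= real (Suc i) * \<epsilon>)" for x i
    unfolding mem_box by (simp_all add: a_def b_def)
  have fT: "f i \<in> test_functions S" if i: "i < k" for i
    unfolding f_def[abs_def]
  proof (rule box_bump_test)
    show "cbox (a i) (b i) \<subseteq> S"
    proof
      fix x assume x: "x \<in> cbox (a i) (b i)"
      have "norm x <= (\<Sum>j\<in>Basis. \<bar>x \<bullet> j\<bar>)" by (rule norm_le_l1)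
      also have "\<dots> <= (\<Sum>j\<in>(Basis::'a set). real (Suc k) * \<epsilon>)"
      proof (rule sum_mono)
        fix j :: 'a assume j: "j \<in> Basis"
        have "real (Suc i) * \<epsilon> <= real (Suc k) * \<epsilon>" using i \<epsilon> by (intro mult_right_mono) auto
        moreover have "0 <= real i * \<epsilon>" using \<epsilon> by simp
        ultimately show "\<bar>x \<bullet> j\<bar> <= real (Suc k) * \<epsilon>" using x j unfolding box by force
      qed
      also have "\<dots> = r" using \<epsilon>(2) by simp
      finally show "x \<in> S" using r by auto
    qed
  qed simp
  have fnz: "f i x \<noteq> 0 \<longleftrightarrow> x \<in> box (a i) (b i)" for i x
    using box_bump_pos[of 1 "a i" "b i" x] box_bump_range(1)[of 1 "a i" "b i" x] by (auto simp: f_def)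
  have disj: "f i x * cnj (f j x) = 0" if "i \<noteq> j" for i j x
  proof (rule ccontr)
    assume "f i x * cnj (f j x) \<noteq> 0"
    hence B: "x \<in> box (a i) (b i)" "x \<in> box (a j) (b j)" using fnz by auto
    obtain l :: 'a where "l \<in> Basis" using nonempty_Basis by blast
    with B have "real i * \<epsilon> < real (Suc j) * \<epsilon>" "real j * \<epsilon> < real (Suc i) * \<epsilon>" unfolding box by force+
    hence "i < Suc j" "j < Suc i" using \<epsilon>(1) by (simp_all del: of_nat_Suc)
    with that show False by simp
  qed
  have fL: "f i \<in> L2 (lebesgue_on S)" if "i < k" for i by (rule test_L2[OF fT[OF that] m])
  have fpos: "0 < l2.sq (lebesgue_on S) (f i)" if i: "i < k" for i
  proof -
    have fl: "f i \<in> L2 lebesgue" by (rule test_L2_UNIV[OF fT[OF i]])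
    have "nsq (f i) \<noteq> 0"
    proof
      assume "nsq (f i) = 0"
      hence "AE x in lebesgue. f i x = 0" using l2_sq_0_iff[OF fl] by simp
      moreover have s: "{x \<in> space lebesgue. \<not> f i x = 0} = box (a i) (b i)" using fnz by auto
      ultimately have "box (a i) (b i) \<in> null_sets lebesgue"
        using AE_iff_null[of lebesgue "%x. f i x = 0"] by (simp add: borel_open)
      hence "negligible (box (a i) (b i))" by (simp add: negligible_iff_null_sets)
      moreover have "((real i + 1/2) * \<epsilon>) *\<^sub>R One \<in> box (a i) (b i)" unfolding box using \<epsilon>(1) by simp
      ultimately show False using open_not_negligible[OF open_box] by blast
    qed
    thus ?thesis using l2.ip_pos[OF fL[OF i]] test_inner_on[OF fT[OF i] m] by simp
  qed
  define n where "n i = l2.sq (lebesgue_on S) (f i)" for i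
  define e where "e i = fscale (cplx (1 / sqrt (n i))) (f i)" for i
  have eH: "e i \<in> H10 S" if "i < k" for i unfolding e_def by (intro D.Q.closed(4) test_H10[OF S(1)] fT that)
  have o: "l2_inner (lebesgue_on S) (e i) (e j) = (if i = j then 1 else 0)" if ij: "i < k" "j < k" for i j
  proof -
    have "l2_inner (lebesgue_on S) (e i) (e j) = cplx (1 / sqrt (n i)) * (cplx (1 / sqrt (n j)) * l2_inner (lebesgue_on S) (f i) (f j))"
      unfolding e_def using fL[OF ij(1)] fL[OF ij(2)] by (simp add: l2.ip_scale l2.ip_scale2 L2_scale)
    moreover have "l2_inner (lebesgue_on S) (f i) (f j) = (if i = j then cplx (n i) else 0)"
    proof (cases "i = j")
      case True
      thus ?thesis using l2.ip_self[OF fL[OF ij(1)]] by (simp add: n_def)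
    next
      case False
      thus ?thesis by (simp add: l2_inner_def disj[OF False])
    qed
    moreover have "cplx (1 / sqrt (n i)) * (cplx (1 / sqrt (n i)) * cplx (n i)) = cplx (1 / sqrt (n i) * (1 / sqrt (n i) * n i))"
      by (simp only: of_real_mult)
    moreover have "1 / sqrt (n i) * (1 / sqrt (n i) * n i) = 1" using fpos[OF ij(1)] by (simp add: n_def[symmetric] real_div_sqrt)
    ultimately show ?thesis by (auto simp del: of_real_mult of_real_divide)
  qed
  define G where "G i = energy S (e i)" for i
  have G: "0 <= G i" if "i < k" for i unfolding G_def by (rule D.Q.ip_pos[OF eH[OF that]])
  have "D.Q.sq (comb k c e) <= (\<Sum>i<k. G i) * (\<Sum>i<k. (cmod (c i))^2)" for c
  proof -
    have cl: "fscale (c i) (e i) \<in> H10 S" if "i < k" for i by (intro D.Q.closed(4) eH that)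
    have p: "0 <= D.Q.sq (comb k c e)" by (intro D.Q.ip_pos D.Q.closed_sum cl) simp
    have "sqrt (D.Q.sq (comb k c e)) <= (\<Sum>i<k. sqrt (D.Q.sq (fscale (c i) (e i))))"
      by (rule D.Q.triangle_sum) (simp add: cl)
    also have "\<dots> = (\<Sum>i<k. sqrt (G i) * cmod (c i))"
      using eH by (intro sum.cong refl) (simp add: D.Q.sq_scale real_sqrt_mult G_def)
    finally have "(sqrt (D.Q.sq (comb k c e)))^2 <= (\<Sum>i<k. sqrt (G i) * cmod (c i))^2"
      using p by (intro power_mono) auto
    also have "\<dots> <= (\<Sum>i<k. (sqrt (G i))^2) * (\<Sum>i<k. (cmod (c i))^2)" by (rule Cauchy_Schwarz_ineq_sum)
    also have "(\<Sum>i<k. (sqrt (G i))^2) = (\<Sum>i<k. G i)" using G by (intro sum.cong) auto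
    finally show ?thesis unfolding real_sqrt_pow2[OF p] .
  qed
  hence "D.orthonormal_trial k (\<Sum>i<k. G i) e" unfolding D.orthonormal_trial_def using eH o by blast
  thus ?thesis using D.trial_orthonormal by blast
qed

section \<open>Weak limits and restrictions\<close>

text \<open>Lower semicontinuity of the energy: the sets of bounded energy are convex, so \<open>mazur\<close> applies.\<close>

lemma H1_weak_limit:
  fixes w :: "nat => 'a::euclidean_space => complex"
  assumes w: "!!n. w n \<in> H1 UNIV" "!!n. energy UNIV (w n) <= B"
    and y: "y \<in> L2 lebesgue" "(%n. nsq (w n - y)) \<leadsto> 0"
  shows "y \<in> H1 UNIV" "energy UNIV y <= B"
proof -
  have wL: "w n \<in> L2 lebesgue" for n by (rule HU.QinH[OF w(1)])
  define X where "X = {v :: 'a => complex. v \<in> H1 UNIV & energy UNIV v <= B}"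
  have mid: "HU.midconvex X" unfolding HU.midconvex_def
  proof (intro ballI)
    fix u v assume "u \<in> X" "v \<in> X"
    hence H: "u \<in> H1 UNIV" "v \<in> H1 UNIV" and b: "HU.Q.sq u <= B" "HU.Q.sq v <= B" by (auto simp: X_def)
    have "HU.Q.sq (fscale (1/2) (u + v)) = HU.Q.sq (u + v) / 4"
      using HU.Q.sq_scale[OF HU.Q.closed(2)[OF H], of "1/2"] by (simp add: power2_eq_square)
    also have "\<dots> <= B" using HU.Q.sq_add_le[OF H] b by simp
    finally show "fscale (1/2) (u + v) \<in> X" unfolding X_def using HU.Q.closed(2)[OF H] by (simp add: HU.Q.closed(4))
  qed
  have "(%n. nsq (w n)) \<leadsto> nsq y" by (rule l2.tendsto_sq[OF wL y])
  hence "Bseq (%n. nsq (w n))" by (intro convergent_imp_Bseq convergentI)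
  then obtain K where K: "!!n. \<bar>nsq (w n)\<bar> <= K" unfolding Bseq_def by auto
  have bd: "HU.A.sq (w n) <= B + K" for n
    using w(2)[of n] abs_le_D1[OF K[of n]] unfolding HU.A_sq by linarith
  have "\<exists>u\<in>H1 UNIV. \<exists>v. (\<forall>N. v N \<in> X) & (%N. HU.A.sq (v N - u)) \<leadsto> 0 &
    (\<forall>\<phi>\<in>L2 lebesgue. \<forall>L. (%n. l2_inner lebesgue (w n) \<phi>) \<leadsto> L --> l2_inner lebesgue u \<phi> = L)"
    by (rule HU.mazur[OF _ mid _ bd]) (use w in \<open>auto simp: X_def\<close>)
  then obtain u v where u: "u \<in> H1 UNIV" and v: "!!N. v N \<in> X" "(%N. HU.A.sq (v N - u)) \<leadsto> 0"
    and ip: "!!\<phi> L. \<phi> \<in> L2 lebesgue ==> (%n. l2_inner lebesgue (w n) \<phi>) \<leadsto> L ==> l2_inner lebesgue u \<phi> = L"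
    by (elim bexE exE conjE) blast
  have vH: "v N \<in> H1 UNIV" "HU.Q.sq (v N) <= B" for N using v(1)[of N] by (auto simp: X_def)
  have uB: "HU.Q.sq u <= B"
    by (rule LIMSEQ_le_const2[OF HU.A_limits(4)[OF vH(1) u v(2)]]) (use vH(2) in blast)
  have uL: "u \<in> L2 lebesgue" by (rule HU.QinH[OF u])
  have dL: "u - y \<in> L2 lebesgue" by (rule l2.closed(3)[OF uL y(1)])
  have "l2_inner lebesgue u (u - y) = l2_inner lebesgue y (u - y)"
    by (rule ip[OF dL l2.tendsto_ip[OF wL y(1) dL y(2)]])
  hence "nsq (u - y) = 0" by (simp only: l2.ip_diff[OF uL y(1) dL]) simp
  hence ae: "AE x in lebesgue. u x = y x" using l2_sq_0_iff[OF dL] by simp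
  define g where "g i = weak_partial UNIV i u" for i
  have g: "g i \<in> L2 (lebesgue_on UNIV)" "is_weak_partial UNIV i u (g i)" if "i \<in> Basis" for i
    using weak_partial_spec[OF u that] by (auto simp: g_def)
  have gy: "is_weak_partial UNIV i y (g i)" if i: "i \<in> Basis" for i
    unfolding is_weak_partial_def lebesgue_on_UNIV_eq
  proof
    fix \<phi> :: "'a => complex" assume \<phi>: "\<phi> \<in> test_functions UNIV"
    have pL: "partial i \<phi> \<in> L2 lebesgue" by (rule test_L2_UNIV[OF test_partial[OF \<phi> i]])
    have "(LINT x|lebesgue. y x * partial i \<phi> x) = (LINT x|lebesgue. u x * partial i \<phi> x)"
      by (rule integral_cong_AE) (use ae in \<open>auto intro!: borel_measurable_integrable L2_mult_integrable y(1) uL pL\<close>)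
    thus "(LINT x|lebesgue. y x * partial i \<phi> x) = - (LINT x|lebesgue. g i x * \<phi> x)"
      using g(2)[OF i] \<phi> by (simp add: is_weak_partial_def lebesgue_on_UNIV_eq)
  qed
  have y': "y \<in> L2 (lebesgue_on UNIV)" using y(1) by (simp add: lebesgue_on_UNIV_eq)
  show "y \<in> H1 UNIV" by (rule H1I[OF y' g(1) gy])
  have "energy UNIV y = (\<Sum>i\<in>Basis. l2.sq (lebesgue_on UNIV) (g i))"
    by (rule grad_sq[OF open_UNIV g(1) gy y'])
  also have "\<dots> = energy UNIV u" by (rule grad_sq[OF open_UNIV g H1_L2[OF u], symmetric])
  finally show "energy UNIV y <= B" using uB by simp
qed

lemma L2_restrict_sq_le:
  assumes S: "S \<in> sets lebesgue" and u: "u \<in> L2 lebesgue"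
  shows "l2.sq (lebesgue_on S) u <= nsq u"
proof -
  have "l2.sq (lebesgue_on S) u = (LINT x|lebesgue. indicator S x * (norm (u x))^2 :: real)"
    unfolding l2_sq using S by (simp add: integral_restrict_space)
  also have "\<dots> <= (LINT x|lebesgue. (norm (u x))^2)"
    using integrable_mult_indicator[OF S L2_integrable[OF u]]
    by (intro Lintegral_mono L2_integrable u) (auto split: split_indicator)
  finally show ?thesis unfolding l2_sq .
qed

lemma H1_restrict:
  fixes S :: "'a::euclidean_space set"
  assumes S: "open S" and u: "u \<in> H1 UNIV"
  shows "u \<in> H1 S" "energy S u <= energy UNIV u" "h1sq S u <= h1sq UNIV u"
proof -
  have m: "S \<in> sets lebesgue" by (rule open_sets_lebesgue[OF S])
  have uL: "u \<in> L2 lebesgue" by (rule HU.QinH[OF u])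
  have uS: "u \<in> L2 (lebesgue_on S)" by (rule L2_restrict[OF m uL])
  define g where "g i = weak_partial UNIV i u" for i
  have g: "g i \<in> L2 lebesgue" "is_weak_partial UNIV i u (g i)" if "i \<in> Basis" for i
    using weak_partial_spec[OF u that] by (auto simp: g_def lebesgue_on_UNIV_eq)
  have gS: "g i \<in> L2 (lebesgue_on S)" if "i \<in> Basis" for i by (rule L2_restrict[OF m g(1)[OF that]])
  have w: "is_weak_partial S i u (g i)" if i: "i \<in> Basis" for i
    unfolding is_weak_partial_def
  proof
    fix \<phi> assume \<phi>: "\<phi> \<in> test_functions S"
    have "\<phi> \<in> test_functions UNIV" by (rule test_mono[OF \<phi>]) simp
    hence "(LINT x|lebesgue. u x * partial i \<phi> x) = - (LINT x|lebesgue. g i x * \<phi> x)"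
      using g(2)[OF i] by (simp add: is_weak_partial_def lebesgue_on_UNIV_eq)
    thus "(LINT x|lebesgue_on S. u x * partial i \<phi> x) = - (LINT x|lebesgue_on S. g i x * \<phi> x)"
      using integral_lebesgue_on_test[OF m test_vanish(2)[OF \<phi>], where f = u] integral_lebesgue_on_test[OF m test_vanish(1)[OF \<phi>], where f = "g i"] by simp
  qed
  show "u \<in> H1 S" by (rule H1I[OF uS gS w])
  have "energy S u = (\<Sum>i\<in>Basis. l2.sq (lebesgue_on S) (g i))" by (rule grad_sq[OF S gS w uS])
  also have "\<dots> <= (\<Sum>i\<in>Basis. l2.sq (lebesgue_on UNIV) (g i))"
    unfolding lebesgue_on_UNIV_eq by (intro sum_mono L2_restrict_sq_le m g(1))
  also have "\<dots> = energy UNIV u"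
    by (rule grad_sq[OF open_UNIV, symmetric]) (use g uL in \<open>auto simp: lebesgue_on_UNIV_eq\<close>)
  finally show "energy S u <= energy UNIV u" .
  thus "h1sq S u <= h1sq UNIV u"
    using L2_restrict_sq_le[OF m uL] by (simp add: h1sq_def lebesgue_on_UNIV_eq)
qed

text \<open>No mass is left on the boundary of \<open>S\<close>, as the test functions vanish there and converge on the whole space.\<close>

lemma H10_of_test_limit:
  assumes S: "open S" and y: "y \<in> H1 UNIV" and v: "!!N. v N \<in> test_functions S" "(%N. h1sq UNIV (v N - y)) \<leadsto> 0"
  shows "y \<in> H10 S" "l2.sq (lebesgue_on S) y = nsq y"
proof -
  interpret G: l2form "lebesgue_on S" "H1 S" "grad_form S" by (rule H1_l2form[OF S])
  have m: "S \<in> sets lebesgue" by (rule open_sets_lebesgue[OF S])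
  have vU: "v N \<in> H1 UNIV" for N by (rule test_H1[OF open_UNIV v(1)])
  have vS: "v N \<in> H1 S" for N by (rule test_H1[OF S v(1)])
  have yS: "y \<in> H1 S" by (rule H1_restrict(1)[OF S y])
  have lim: "(%N. h1sq S (v N - y)) \<leadsto> 0"
  proof (rule tendsto_sandwich[OF always_eventually always_eventually tendsto_const v(2)]; intro allI)
    fix N
    show "0 <= h1sq S (v N - y)" unfolding h1sq_A[OF S] by (intro G.A.ip_pos G.Q.closed(3) vS yS)
    show "h1sq S (v N - y) <= h1sq UNIV (v N - y)" by (intro H1_restrict(3)[OF S] HU.Q.closed(3) vU y)
  qed
  show "y \<in> H10 S" unfolding H10_iff
  proof (intro conjI yS allI impI)
    fix \<epsilon> :: real assume \<epsilon>: "0 < \<epsilon>"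
    have "\<forall>\<^sub>F N in sequentially. h1sq S (v N - y) < \<epsilon>^2" by (rule order_tendstoD(2)[OF lim]) (use \<epsilon> in simp)
    then obtain N where N: "h1sq S (v N - y) < \<epsilon>^2" by (auto simp: eventually_sequentially)
    have "h1sq S (y - v N) = h1sq S (v N - y)" unfolding h1sq_A[OF S] by (rule G.A.sq_diff_commute[OF yS vS])
    hence "sqrt (h1sq S (y - v N)) < sqrt (\<epsilon>^2)" using N by (simp only: real_sqrt_less_iff)
    thus "\<exists>\<phi>\<in>test_functions S. sqrt (h1sq S (y - \<phi>)) < \<epsilon>" using v(1) \<epsilon> by (intro bexI[of _ "v N"]) simp
  qed
  have "(%N. l2.sq (lebesgue_on S) (v N)) \<leadsto> l2.sq (lebesgue_on S) y"
    by (rule G.A_limits(3)[OF vS yS lim[unfolded h1sq_A[OF S]]])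
  moreover have "(%N. nsq (v N)) \<leadsto> nsq y"
    by (rule HU.A_limits(3)[OF vU y v(2)[unfolded h1sq_UNIV]])
  ultimately show "l2.sq (lebesgue_on S) y = nsq y"
    unfolding test_inner_on[OF v(1) m] by (rule LIMSEQ_unique)
qed

section \<open>Potentials that confine to a star-shaped domain\<close>

text \<open>Nothing is assumed in a layer around \<open>r = 1\<close>, where the rescaled potentials need not converge.\<close>

locale confinement =
  fixes r :: "'a::euclidean_space => real" and W :: "nat => 'a => real"
  assumes r_cont: "continuous_on UNIV r"
    and r_scale: "!!s x. 0 <= s ==> r (s *\<^sub>R x) = s * r x"
    and r_cobounded: "\<exists>R>0. \<forall>x. norm x <= R * r x"
    and W_measurable: "!!n. W n \<in> borel_measurable borel"
    and W_nonneg: "!!n x. 0 <= W n x"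
    and W_small: "!!s \<epsilon>. s < 1 ==> 0 < \<epsilon> ==> \<forall>\<^sub>F n in sequentially. \<forall>x. r x <= s --> W n x <= \<epsilon>"
    and W_large: "!!s m. 1 < s ==> \<forall>\<^sub>F n in sequentially. \<forall>x. s <= r x --> m <= W n x"
begin

definition "S = {x. r x < 1}"

lemma subsequence: assumes "strict_mono q" shows "confinement r (%n. W (q n))"
proof
  fix s \<epsilon> :: real assume "s < 1" "0 < \<epsilon>"
  from eventually_subseq[OF assms W_small[OF this]] show "\<forall>\<^sub>F n in sequentially. \<forall>x. r x <= s --> W (q n) x <= \<epsilon>" .
next
  fix s m :: real assume "1 < s"
  from eventually_subseq[OF assms W_large[OF this]] show "\<forall>\<^sub>F n in sequentially. \<forall>x. s <= r x --> m <= W (q n) x" .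
qed (rule r_cont r_scale r_cobounded W_measurable W_nonneg; assumption?)+

lemma domain: "open S" "0 \<in> S" "compact {x. r x <= 1}" "!!s x. 0 < s ==> s < 1 ==> r x <= 1 ==> s *\<^sub>R x \<in> S"
  "\<exists>R>0. S \<subseteq> cball 0 R & (\<forall>x. R < norm x --> 2 <= r x)"
proof -
  obtain R where R: "0 < R" "!!x. norm x <= R * r x" using r_cobounded by blast
  show "open S" unfolding S_def by (intro open_Collect_less r_cont continuous_on_const)
  show "0 \<in> S" unfolding S_def using r_scale[of 0 0] by simp
  have b: "norm x <= R * a" if "r x <= a" for x a
    using R(2)[of x] mult_left_mono[OF that, of R] R(1) by linarith
  show "compact {x. r x <= 1}"
    unfolding compact_eq_bounded_closed bounded_iff using b[of _ 1] r_cont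
    by (auto intro: closed_Collect_le continuous_on_const)
  show "s *\<^sub>R x \<in> S" if "0 < s" "s < 1" "r x <= 1" for s x
  proof -
    have "s * r x <= s * 1" using that by (intro mult_left_mono) auto
    hence "s * r x < 1" using that(2) by linarith
    thus ?thesis using that r_scale[of s x] by (simp add: S_def)
  qed
  have "S \<subseteq> cball 0 (2 * R)"
  proof
    fix x assume "x \<in> S"
    hence "norm x <= R * 1" by (intro b) (simp add: S_def)
    thus "x \<in> cball 0 (2 * R)" using R(1) by simp
  qed
  moreover have "2 <= r x" if "2 * R < norm x" for x using b[of x 2] that by (cases "2 <= r x") auto
  ultimately show "\<exists>R>0. S \<subseteq> cball 0 R & (\<forall>x. R < norm x --> 2 <= r x)" using R(1) by (intro exI[of _ "2 * R"]) auto
qed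

lemma P_form: "l2form lebesgue (schroedinger_domain (W n)) (schroedinger_form 1 (W n))"
  by (rule schroedinger_l2form[OF W_measurable W_nonneg]) simp

lemma D_form: "l2form (lebesgue_on S) (H10 S) (grad_form S)"
  by (rule H10_l2form[OF domain(1)])

abbreviation "dirichlet_trial \<equiv> hform.trial fscale (l2_inner (lebesgue_on S)) (H10 S) (grad_form S)"

text \<open>Positivity, needed to divide by the eigenvalue, is Friedrichs' inequality.\<close>

lemma dirichlet_eigenvalue:
  assumes k: "1 <= k"
  shows "\<exists>\<mu> e. lambda_k (lebesgue_on S) (dirichlet_laplacian S) k = ereal \<mu> & 0 < \<mu> &
    l2form.orthonormal_trial (lebesgue_on S) (H10 S) (grad_form S) k \<mu> e & (\<forall>t. dirichlet_trial k t --> \<mu> <= t)"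
proof -
  interpret D: l2form "lebesgue_on S" "H10 S" "grad_form S" by (rule D_form)
  obtain R where R: "0 < R" "S \<subseteq> cball 0 R" using domain(5) by blast
  obtain t0 where t0: "D.trial k t0" using dirichlet_trial_exists[OF domain(1,2)] by blast
  define c where "c = \<bar>t0\<bar> + 1"
  have c: "0 < c" "t0 < c" by (auto simp: c_def)
  obtain N :: nat and f where "D.finite_rank_bound c N f"
    using dirichlet_rank_bound[OF domain(1) R(2) c(1)] unfolding D.finite_rank_bound_def by blast
  from D.lambda_k_least_trial[OF this c(1) t0 c(2) k] obtain \<nu> e
    where *: "lambda_k (lebesgue_on S) (dirichlet_laplacian S) k = ereal \<nu>" "D.orthonormal_trial k \<nu> e" "\<forall>t. D.trial k t --> \<nu> <= t"
    unfolding dirichlet_laplacian_def by blast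
  have k0: "0 < k" using k by simp
  have s: "(\<Sum>i<k. fscale (if i = 0 then 1 else 0) (e i)) = e 0"
    using k0 by (simp add: fun_eq_iff sum_fun_apply if_distrib[of "%c. c * _"] sum.delta cong: if_cong)
  have "(\<Sum>i<k. (cmod (if i = 0 then 1 else 0))^2) = (1::real)"
    using k0 by (simp add: if_distrib[of cmod] if_distrib[of "%c. c^2"] sum.delta cong: if_cong)
  with D.orthonormal_trialD(4)[OF *(2), of "%i. if i = 0 then 1 else 0"] have "D.Q.sq (e 0) <= \<nu>" unfolding s by simp
  moreover have "1 <= (3 * R)^2 * D.Q.sq (e 0)"
    using friedrichs_inequality[OF domain(1) R(2,1) D.orthonormal_trialD(1)[OF *(2) k0]] D.orthonormal_trialD(3)[OF *(2) k0 k0] by simp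
  ultimately have "1 <= (3 * R)^2 * \<nu>" by (meson mult_left_mono order_trans zero_le_power2)
  hence "0 < \<nu>" by (meson less_le_trans zero_less_mult_pos not_le mult_nonneg_nonpos zero_le_power2 zero_less_one)
  with * show ?thesis by blast
qed

lemma test_small:
  assumes "\<phi> \<in> test_functions S" "0 < \<epsilon>"
  shows "\<forall>\<^sub>F n in sequentially. \<forall>x. \<phi> x \<noteq> 0 --> W n x <= \<epsilon>"
proof -
  obtain K where K: "compact K" "K \<subseteq> S" "!!x. \<phi> x \<noteq> 0 ==> x \<in> K" using test_functionsD(2)[OF assms(1)] by blast
  have "\<exists>s<1. \<forall>x\<in>K. r x <= s"
  proof (cases "K = {}")
    case False
    then obtain z where "z \<in> K" "\<forall>x\<in>K. r x <= r z"
      using continuous_attains_sup[OF K(1)] continuous_on_subset[OF r_cont] by blast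
    thus ?thesis using K(2) by (auto simp: S_def)
  qed (auto intro: exI[of _ 0])
  then obtain s where s: "s < 1" "\<forall>x\<in>K. r x <= s" by blast
  show ?thesis using W_small[OF s(1) assms(2)] by eventually_elim (use s K(3) in blast)
qed

text \<open>A test function sees \<open>W\<close> only on a compact subset of \<open>S\<close>.\<close>

theorem upper_bound:
  assumes E: "l2form.orthonormal_trial (lebesgue_on S) (H10 S) (grad_form S) k \<mu> e" and t: "0 <= \<mu>" "\<mu> < t"
  shows "\<forall>\<^sub>F n in sequentially. schroedinger_trial 1 (W n) k t"
proof -
  define t' where "t' = (\<mu> + t) / 2"
  have t': "\<mu> < t'" "0 < t - t'" using t by (auto simp: t'_def)
  from dirichlet_test_family[OF domain(1) E t(1) t'(1)] obtain \<phi> where \<phi>: "!!i. i < k ==> \<phi> i \<in> test_functions S"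
    and q: "!!b. energy UNIV (comb k b \<phi>) <= t' * nsq (comb k b \<phi>)"
    "!!b. nsq (comb k b \<phi>) = 0 --> (\<forall>i<k. b i = 0)" by blast
  have "\<forall>\<^sub>F n in sequentially. \<forall>i\<in>{..<k}. \<forall>x. \<phi> i x \<noteq> 0 --> W n x <= t - t'"
    by (rule eventually_ball_finite) (use test_small[OF \<phi> t'(2)] in auto)
  thus ?thesis
  proof eventually_elim
    fix n assume n: "\<forall>i\<in>{..<k}. \<forall>x. \<phi> i x \<noteq> 0 --> W n x <= t - t'"
    interpret P: l2form lebesgue "schroedinger_domain (W n)" "schroedinger_form 1 (W n)" by (rule P_form)
    have Wm: "(%x. cplx (sqrt (W n x))) \<in> borel_measurable lebesgue"
    proof -
      have "(%x. cplx (sqrt (W n x))) \<in> borel_measurable borel" using W_measurable[of n] by measurable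
      thus ?thesis by (intro measurable_completion) simp
    qed
    have in_dom: "v \<in> schroedinger_domain (W n) & P.Q.sq v <= energy UNIV v + (t - t') * nsq v"
      if v: "v \<in> test_functions S" and vW: "!!x. v x \<noteq> 0 ==> W n x <= t - t'" for v
    proof -
      have vL: "v \<in> L2 lebesgue" by (rule test_L2_UNIV[OF v])
      have pm: "pot (W n) v \<in> borel_measurable lebesgue" unfolding pot_def by (rule borel_measurable_times[OF Wm L2_measurable[OF vL]])
      have pn: "(norm (pot (W n) v x))^2 <= (t - t') * (norm (v x))^2" for x
        using vW[of x] W_nonneg[of n x] by (cases "v x = 0") (auto simp: pot_def norm_mult power_mult_distrib)
      have pL: "pot (W n) v \<in> L2 lebesgue"
      proof (rule L2_bound[OF vL pm])
        fix x
        have "(norm (pot (W n) v x))^2 <= (sqrt (t - t') * norm (v x))^2" using pn[of x] t' by (simp add: power_mult_distrib)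
        thus "norm (pot (W n) v x) <= sqrt (t - t') * norm (v x)" by (rule power2_le_imp_le) (use t' in simp)
      qed
      have "nsq (pot (W n) v) <= (LINT x|lebesgue. (t - t') * (norm (v x))^2)"
        unfolding l2_sq by (intro Lintegral_mono L2_integrable pL integrable_mult_right vL pn)
      thus ?thesis using pL test_H1[OF open_UNIV v] by (simp add: domain_iff form_sq l2_sq)
    qed
    have T: "(comb k b \<phi>) \<in> test_functions S" for b by (rule test_sum[OF \<phi>])
    have TW: "W n x <= t - t'" if nz: "(comb k b \<phi>) x \<noteq> 0" for b x
    proof -
      have "\<exists>i\<in>{..<k}. b i * \<phi> i x \<noteq> 0"
        using nz unfolding sum_fun_apply fscale_apply by (rule contrapos_np) (simp add: sum.neutral)
      thus ?thesis using n by auto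
    qed
    have "P.Q.sq (comb k b \<phi>) <= t * nsq (comb k b \<phi>)" for b
      using in_dom[OF T[of b] TW[where b = b]] q(1)[of b] by (simp add: left_diff_distrib)
    moreover have "\<forall>i<k. \<phi> i \<in> schroedinger_domain (W n)" using in_dom[OF \<phi>] n by blast
    ultimately show "P.trial k t" unfolding P.trial_def using q(2) by blast
  qed
qed

end

context confinement
begin

lemma unit_coefficients:
  fixes k :: nat and e :: "nat => 'a => complex"
  assumes "i < k"
  shows "(\<Sum>j<k. fscale (if j = i then 1 else 0) (e j)) = e i" "(\<Sum>j<k. (cmod (if j = i then 1 else 0))^2) = 1"
  using assms by (simp_all add: fun_eq_iff sum_fun_apply if_distrib[of "%c. c * _"] if_distrib[of cmod] if_distrib[of "%c. c^2"] sum.delta cong: if_cong)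

text \<open>Where \<open>W >= L\<close>, a function \<open>w\<close> of bounded potential energy has norm at most \<open>t / L\<close>, so it may be removed at that cost.\<close>

lemma tail_estimate:
  assumes L: "0 < L" "!!x. s <= r x ==> L <= W n x" and w: "pot (W n) w \<in> L2 lebesgue" "nsq (pot (W n) w) <= t"
    and z: "z \<in> L2 lebesgue" and y: "y \<in> L2 lebesgue"
    and pt: "!!x. s <= r x ==> (norm (y x))^2 <= (norm (z x))^2 + 2 * (norm (w x))^2"
    and pt': "!!x. r x < s ==> norm (y x) <= norm (z x)"
  shows "nsq y <= nsq z + 2 * t / L"
proof -
  have "nsq y <= (LINT x|lebesgue. (norm (z x))^2 + 2 / L * (norm (pot (W n) w x))^2)"
    unfolding l2_sq
  proof (rule Lintegral_mono)
    show "integrable lebesgue (%x. (norm (y x))^2)" by (rule L2_integrable[OF y])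
    show "integrable lebesgue (%x. (norm (z x))^2 + 2 / L * (norm (pot (W n) w x))^2)"
      by (intro Lintegrable_add integrable_mult_right L2_integrable z w)
    fix x
    have p: "(norm (pot (W n) w x))^2 = W n x * (norm (w x))^2"
      using W_nonneg[of n x] by (simp add: pot_def norm_mult power_mult_distrib)
    show "(norm (y x))^2 <= (norm (z x))^2 + 2 / L * (norm (pot (W n) w x))^2"
    proof (cases "s <= r x")
      case True
      have "L * (norm (w x))^2 <= W n x * (norm (w x))^2" by (intro mult_right_mono L(2) True) simp
      hence "2 * (norm (w x))^2 <= 2 / L * (norm (pot (W n) w x))^2" unfolding p using L(1) by (simp add: field_simps)
      thus ?thesis using pt[OF True] by linarith
    next
      case False
      hence "(norm (y x))^2 <= (norm (z x))^2" by (intro power_mono pt') auto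
      moreover have "0 <= 2 / L * (norm (pot (W n) w x))^2" using L(1) by simp
      ultimately show ?thesis by linarith
    qed
  qed
  also have "\<dots> = nsq z + 2 / L * nsq (pot (W n) w)"
    unfolding l2_sq using L2_integrable[OF z] L2_integrable[OF w(1)] by (subst Lintegral_add) auto
  also have "\<dots> <= nsq z + 2 / L * t" using L(1) w(2) by (intro add_left_mono mult_left_mono) auto
  finally show ?thesis by simp
qed

text \<open>The subsequence is chosen to make all functionals of the local Rellich inequalities, with \<open>\<eta> = 1/(m+1)\<close>, converge simultaneously; the code
  \<open>p\<close> stands for the triple of the trial function \<open>i\<close>, the index \<open>m\<close> and the functional \<open>j\<close>.\<close>

theorem limit_trial:
  fixes e :: "nat => nat => 'a => complex"
  assumes E: "!!n. l2form.orthonormal_trial lebesgue (schroedinger_domain (W n)) (schroedinger_form 1 (W n)) k t (e n)"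
    and t: "0 <= t"
  shows "dirichlet_trial k t"
proof -
  interpret D: l2form "lebesgue_on S" "H10 S" "grad_form S" by (rule D_form)
  note eE = l2form.orthonormal_trialD[OF P_form E]
  have eH: "e n i \<in> H1 UNIV" and eP: "pot (W n) (e n i) \<in> L2 lebesgue" if "i < k" for n i
    using eE(1)[OF that, of n] by (auto simp: domain_iff)
  have sH: "(comb k b (e n)) \<in> H1 UNIV" for b n
    using eH by (intro HU.Q.closed_sum HU.Q.closed(4)) auto
  have sP: "pot (W n) (comb k b (e n)) \<in> L2 lebesgue" for b n
  proof -
    have "pot (W n) (comb k b (e n)) = (\<Sum>i<k. fscale (b i) (pot (W n) (e n i)))"
      by (simp add: pot_def fun_eq_iff sum_fun_apply sum_distrib_left mult_ac)
    thus ?thesis using eP by (simp only:) (intro l2.closed_sum l2.closed(4); simp)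
  qed
  have energy: "energy UNIV (comb k b (e n)) <= t * (\<Sum>i<k. (cmod (b i))^2)"
    "nsq (pot (W n) (comb k b (e n))) <= t * (\<Sum>i<k. (cmod (b i))^2)" for b n
    using eE(4)[of n b] HU.Q.ip_pos[OF sH[of b n]] l2.ip_pos[OF sP[of n b]] unfolding form_sq by simp_all
  have g1: "energy UNIV (e n i) <= t" and p1: "nsq (pot (W n) (e n i)) <= t" if "i < k" for n i
    using energy[where b = "%j. if j = i then 1 else 0" and n = n] unfolding unit_coefficients[OF that] by simp_all
  have n1: "nsq (e n i) = 1" if "i < k" for n i using eE(3)[OF that that] by simp
  obtain R where R: "0 < R" "S \<subseteq> cball 0 R" "!!x. R < norm x ==> 2 <= r x" using domain(5) by blast

  have "\<forall>m::nat. \<exists>(N::nat) f. (\<forall>j<N. f j \<in> L2 lebesgue) & (\<forall>u\<in>H1 (UNIV :: 'a set).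
    nsq (%x. cplx (indicator (cball 0 R) x) * u x) \<le>
      1 / real (Suc m) * energy UNIV u + (\<Sum>j<N. (cmod (l2_inner lebesgue u (f j)))^2))"
    by (intro allI local_rellich) simp
  from choice[OF this] obtain N :: "nat => nat" where "\<forall>m::nat. \<exists>f. (\<forall>j<N m. f j \<in> L2 lebesgue) & (\<forall>u\<in>H1 (UNIV :: 'a set).
    nsq (%x. cplx (indicator (cball 0 R) x) * u x) \<le>
      1 / real (Suc m) * energy UNIV u + (\<Sum>j<N m. (cmod (l2_inner lebesgue u (f j)))^2))" ..
  from choice[OF this] obtain f :: "nat => nat => 'a => complex" where f: "!!m j. j < N m ==> f m j \<in> L2 lebesgue"
    and rellich: "!!m u. u \<in> H1 (UNIV :: 'a set) ==> nsq (%x. cplx (indicator (cball 0 R) x) * u x) \<le>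
      1 / real (Suc m) * energy UNIV u + (\<Sum>j<N m. (cmod (l2_inner lebesgue u (f m j)))^2)" by blast

  define g where "g n p = (if fst (prod_decode p) < k & snd (prod_decode (snd (prod_decode p))) < N (fst (prod_decode (snd (prod_decode p))))
    then l2_inner lebesgue (e n (fst (prod_decode p))) (f (fst (prod_decode (snd (prod_decode p)))) (snd (prod_decode (snd (prod_decode p))))) else 0)" for n p
  define B where "B p = (if fst (prod_decode p) < k & snd (prod_decode (snd (prod_decode p))) < N (fst (prod_decode (snd (prod_decode p))))
    then sqrt (nsq (f (fst (prod_decode (snd (prod_decode p)))) (snd (prod_decode (snd (prod_decode p)))))) else 0)" for p
  have "cmod (g n p) <= B p" for n p
    using l2.Cauchy_Schwarz[OF eE(2) f] n1 by (simp add: g_def B_def)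
  from bounded_diagonal_subseq[where g = g and B = B, OF this] obtain \<rho> where \<rho>: "strict_mono \<rho>" "!!p. convergent (%n. g (\<rho> n) p)" by blast
  define w where "w n i = e (\<rho> n) i" for n i
  have wL: "w n i \<in> L2 lebesgue" and wH: "w n i \<in> H1 UNIV" if "i < k" for n i
    using eE(2)[OF that] eH[OF that] by (auto simp: w_def)
  have conv: "convergent (%n. l2_inner lebesgue (w n i) (f m j))" if "i < k" "j < N m" for i m j
    using \<rho>(2)[of "prod_encode (i, prod_encode (m, j))"] that by (simp add: g_def w_def)
  have large: "\<forall>\<^sub>F n in sequentially. \<forall>x. s <= r x --> L <= W (\<rho> n) x" if "1 < s" for s L
    using eventually_subseq[OF \<rho>(1) W_large[OF that]] .

  have cauchy: "\<forall>\<epsilon>>0. \<exists>M. \<forall>n\<ge>M. \<forall>n'\<ge>M. nsq (w n i - w n' i) < \<epsilon>" if i: "i < k" for i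
  proof (intro allI impI)
    fix \<epsilon> :: real assume \<epsilon>: "0 < \<epsilon>"
    obtain m where "4 * t / (\<epsilon> / 4) < real (Suc m)" using reals_Archimedean2 less_Suc_eq of_nat_less_iff order_less_trans by (metis lessI)
    hence m: "1 / real (Suc m) * (4 * t) < \<epsilon> / 4" using \<epsilon> by (simp add: field_simps)
    \<comment> \<open>\<open>t + 1\<close> instead of \<open>t\<close> keeps \<open>L\<close> positive when \<open>t = 0\<close>.\<close>
    define L where "L = 16 * (t + 1) / \<epsilon>"
    have L: "0 < L" "2 * t / L < \<epsilon> / 8" using t \<epsilon> by (auto simp: L_def field_simps)
    have "\<forall>j. \<exists>l. j < N m --> (%n. l2_inner lebesgue (w n i) (f m j)) \<leadsto> l" using conv[OF i] unfolding convergent_def by blast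
    from choice[OF this] obtain l where l: "!!j. j < N m ==> (%n. l2_inner lebesgue (w n i) (f m j)) \<leadsto> l j" by blast
    define a where "a n = (\<Sum>j<N m. (cmod (l2_inner lebesgue (w n i) (f m j) - l j))^2)" for n
    have "a \<leadsto> (\<Sum>j<N m. (cmod (l j - l j))^2)" unfolding a_def by (intro tendsto_intros l) simp
    hence "\<forall>\<^sub>F n in sequentially. a n < \<epsilon> / 8" by (rule order_tendstoD(2)) (use \<epsilon> in simp)
    hence "\<forall>\<^sub>F n in sequentially. a n < \<epsilon> / 8 & (\<forall>x. 2 <= r x --> L <= W (\<rho> n) x)"
      using large[of 2 L] by (intro eventually_conj) auto
    then obtain M where M: "!!n. n \<ge> M ==> a n < \<epsilon> / 8" "!!n x. n \<ge> M ==> 2 <= r x ==> L <= W (\<rho> n) x"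
      unfolding eventually_sequentially by blast
    have "nsq (w n i - w n' i) < \<epsilon>" if n: "n \<ge> M" and n': "n' \<ge> M" for n n'
    proof -
      define d where "d = w n i - w n' i"
      have dH: "d \<in> H1 UNIV" unfolding d_def by (rule HU.Q.closed(3)[OF wH[OF i] wH[OF i]])
      have dL: "d \<in> L2 lebesgue" by (rule HU.QinH[OF dH])
      have grad: "energy UNIV d <= 4 * t"
        using HU.Q.parallelogram[OF wH[OF i, of n] wH[OF i, of n']] HU.Q.ip_pos[OF HU.Q.closed(2)[OF wH[OF i, of n] wH[OF i, of n']]]
          g1[OF i, of "\<rho> n"] g1[OF i, of "\<rho> n'"] by (simp add: d_def w_def)
      have "(\<Sum>j<N m. (cmod (l2_inner lebesgue d (f m j)))^2) <= (\<Sum>j<N m. 2 * (cmod (l2_inner lebesgue (w n i) (f m j) - l j))^2 + 2 * (cmod (l2_inner lebesgue (w n' i) (f m j) - l j))^2)"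
      proof (rule sum_mono)
        fix j assume "j \<in> {..<N m}"
        hence j: "j < N m" by simp
        define p where "p = l2_inner lebesgue (w n i) (f m j) - l j"
        define q where "q = l2_inner lebesgue (w n' i) (f m j) - l j"
        have "l2_inner lebesgue d (f m j) = p - q" unfolding d_def p_def q_def using l2.ip_diff[OF wL[OF i] wL[OF i] f[OF j]] by simp
        hence "(cmod (l2_inner lebesgue d (f m j)))^2 <= (cmod p + cmod q)^2" using norm_triangle_ineq4[of p q] by (intro power_mono) auto
        also have "\<dots> <= 2 * (cmod p)^2 + 2 * (cmod q)^2" using two_mult_le_squares[of "cmod p" "cmod q"] by (simp add: power2_sum)
        finally show "(cmod (l2_inner lebesgue d (f m j)))^2 <= 2 * (cmod (l2_inner lebesgue (w n i) (f m j) - l j))^2 + 2 * (cmod (l2_inner lebesgue (w n' i) (f m j) - l j))^2"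
          unfolding p_def q_def .
      qed
      also have "\<dots> = 2 * a n + 2 * a n'" by (simp add: a_def sum.distrib sum_distrib_left)
      finally have func: "(\<Sum>j<N m. (cmod (l2_inner lebesgue d (f m j)))^2) < \<epsilon> / 2" using M(1)[OF n] M(1)[OF n'] by linarith
      define P where "P A u = (%x. cplx (indicator A x) * u x)" for A and u :: "'a => complex"
      have PL: "P A u \<in> L2 lebesgue" if "A \<in> sets lebesgue" "u \<in> L2 lebesgue" for A u
        unfolding P_def by (rule L2_cut(1)[OF that(2,1)])
      have "1 / real (Suc m) * energy UNIV d <= 1 / real (Suc m) * (4 * t)" using grad by (intro mult_left_mono) auto
      hence near: "nsq (P (cball 0 R) d) < \<epsilon> / 4 + \<epsilon> / 2" using rellich[OF dH, of m] m func unfolding P_def by linarith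
      \<comment> \<open>The two tails are removed one after the other; \<open>z\<close> carries the first of them.\<close>
      define z where "z = (%x. if norm x <= R then P (cball 0 R) d x else cplx (sqrt 2) * w n i x)"
      have zL: "z \<in> L2 lebesgue"
      proof -
        have "z = P (cball 0 R) d + fscale (cplx (sqrt 2)) (P (- cball 0 R) (w n i))"
          by (auto simp: z_def P_def fun_eq_iff split: split_indicator)
        thus ?thesis by (simp only:) (intro l2.closed(2) L2_scale PL dL wL[OF i]; simp)
      qed
      have "nsq d <= nsq z + 2 * t / L"
      proof (rule tail_estimate[OF L(1) M(2)[OF n'] _ _ zL dL, of 2 "w n' i"])
        show "pot (W (\<rho> n')) (w n' i) \<in> L2 lebesgue" "nsq (pot (W (\<rho> n')) (w n' i)) <= t"
          unfolding w_def by (rule eP[OF i], rule p1[OF i])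
        fix x
        show "norm (d x) <= norm (z x)" if "r x < 2"
        proof -
          have "norm x <= R" using R(3)[of x] that by linarith
          thus ?thesis by (simp add: z_def P_def)
        qed
        show "(norm (d x))^2 <= (norm (z x))^2 + 2 * (norm (w n' i x))^2"
        proof (cases "norm x <= R")
          case False
          have "(norm (d x))^2 <= (norm (w n i x) + norm (w n' i x))^2"
            unfolding d_def fun_diff_def by (intro power_mono norm_triangle_ineq4) simp
          also have "\<dots> <= 2 * (norm (w n i x))^2 + 2 * (norm (w n' i x))^2"
            using two_mult_le_squares[of "norm (w n i x)" "norm (w n' i x)"] by (simp add: power2_sum)
          finally show ?thesis using False by (simp add: z_def norm_mult power_mult_distrib)
        qed (simp add: z_def P_def)
      qed simp_all
      moreover have "nsq z <= nsq (P (cball 0 R) d) + 2 * t / L"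
      proof (rule tail_estimate[OF L(1) M(2)[OF n] _ _ PL[OF _ dL] zL, of 2 "w n i"])
        show "pot (W (\<rho> n)) (w n i) \<in> L2 lebesgue" "nsq (pot (W (\<rho> n)) (w n i)) <= t"
          unfolding w_def by (rule eP[OF i], rule p1[OF i])
        fix x
        show "norm (z x) <= norm (P (cball 0 R) d x)" if "r x < 2"
        proof -
          have "norm x <= R" using R(3)[of x] that by linarith
          thus ?thesis by (simp add: z_def P_def)
        qed
        show "(norm (z x))^2 <= (norm (P (cball 0 R) d x))^2 + 2 * (norm (w n i x))^2"
          by (simp add: z_def norm_mult power_mult_distrib)
      qed simp_all
      ultimately show ?thesis using near L(2) unfolding d_def by linarith
    qed
    thus "\<exists>M. \<forall>n\<ge>M. \<forall>n'\<ge>M. nsq (w n i - w n' i) < \<epsilon>" by blast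
  qed
  have "\<forall>i. \<exists>u. i < k --> u \<in> L2 lebesgue & (%n. nsq (w n i - u)) \<leadsto> 0"
    using L2_complete[OF wL cauchy] by blast
  from choice[OF this] obtain u where uL: "!!i. i < k ==> u i \<in> L2 lebesgue"
    and lim: "!!i. i < k ==> (%n. nsq (w n i - u i)) \<leadsto> 0" by blast

  have limit: "(comb k b u) \<in> H1 UNIV"
    "energy UNIV (comb k b u) <= t * (\<Sum>i<k. (cmod (b i))^2)"
    "nsq (comb k b u) = (\<Sum>i<k. (cmod (b i))^2)" for b
  proof -
    let ?w = "%n. \<Sum>i<k. fscale (b i) (w n i)" and ?u = "\<Sum>i<k. fscale (b i) (u i)"
    have sw: "?w n \<in> L2 lebesgue" for n using wL by (intro l2.closed_sum L2_scale) simp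
    have su: "?u \<in> L2 lebesgue" using uL by (intro l2.closed_sum L2_scale) simp
    have le: "sqrt (nsq (?w n - ?u)) <= (\<Sum>i<k. cmod (b i) * sqrt (nsq (w n i - u i)))" for n
    proof -
      have "?w n - ?u = (\<Sum>i<k. fscale (b i) (w n i - u i))"
        unfolding sum_subtractf[symmetric] by (intro sum.cong refl) (simp add: fun_eq_iff algebra_simps)
      moreover have "sqrt (nsq (\<Sum>i<k. fscale (b i) (w n i - u i))) <= (\<Sum>i<k. sqrt (nsq (fscale (b i) (w n i - u i))))"
        using wL uL by (intro l2.triangle_sum L2_scale l2.closed(3)) auto
      moreover have "\<dots> = (\<Sum>i<k. cmod (b i) * sqrt (nsq (w n i - u i)))"
        using wL uL l2.sq_scale[OF l2.closed(3)[OF wL uL]] by (intro sum.cong refl) (simp add: real_sqrt_mult)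
      ultimately show ?thesis by simp
    qed
    have "(%n. \<Sum>i<k. cmod (b i) * sqrt (nsq (w n i - u i))) \<leadsto> (\<Sum>i<k. cmod (b i) * sqrt 0)"
      by (intro tendsto_sum tendsto_mult tendsto_const tendsto_real_sqrt lim) simp
    hence 0: "(%n. \<Sum>i<k. cmod (b i) * sqrt (nsq (w n i - u i))) \<leadsto> 0" by simp
    have pos: "0 <= nsq (?w n - ?u)" for n by (rule l2.ip_pos[OF l2.closed(3)[OF sw su]])
    have "(%n. sqrt (nsq (?w n - ?u))) \<leadsto> 0"
      by (rule tendsto_sandwich[OF always_eventually always_eventually tendsto_const 0]) (use le pos in auto)
    hence "(%n. (sqrt (nsq (?w n - ?u)))^2) \<leadsto> 0^2" by (rule tendsto_power)
    hence c: "(%n. nsq (?w n - ?u)) \<leadsto> 0" by (simp only: real_sqrt_pow2[OF pos]) simp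
    have "?w n \<in> H1 UNIV" "energy UNIV (?w n) <= t * (\<Sum>i<k. (cmod (b i))^2)" for n
      unfolding w_def by (rule sH, rule energy(1))
    from H1_weak_limit[OF this su c] show "?u \<in> H1 UNIV" "energy UNIV ?u <= t * (\<Sum>i<k. (cmod (b i))^2)" .
    have "nsq (?w n) = (\<Sum>i<k. (cmod (b i))^2)" for n unfolding w_def by (rule eE(5))
    with l2.tendsto_sq[OF sw su c] have "(%n. \<Sum>i<k. (cmod (b i))^2) \<leadsto> nsq ?u" by (simp only:)
    thus "nsq ?u = (\<Sum>i<k. (cmod (b i))^2)" by (rule LIMSEQ_unique) simp
  qed

  have vanish: "AE x in lebesgue. 1 < r x --> u i x = 0" if i: "i < k" for i
  proof -
    have "AE x in lebesgue. s <= r x --> u i x = 0" if s: "1 < s" for s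
    proof -
      define v where "v x = cplx (indicator {x. s <= r x} x) * u i x" for x
      have "closed {x. s <= r x}" by (intro closed_Collect_le continuous_on_const r_cont)
      hence vL: "v \<in> L2 lebesgue" unfolding v_def by (intro L2_cut(1) uL i) (simp add: borel_closed)
      have "nsq v <= 0 + \<epsilon>" if \<epsilon>: "0 < \<epsilon>" for \<epsilon>
      proof -
        define L where "L = 4 * (t + 1) / \<epsilon>"
        have L: "0 < L" "2 * t / L <= \<epsilon>" using t \<epsilon> by (auto simp: L_def field_simps)
        have "\<forall>\<^sub>F n in sequentially. nsq v <= 2 * nsq (w n i - u i) + 2 * t / L"
          using large[OF s, of L]
        proof eventually_elim
          fix n assume n: "\<forall>x. s <= r x --> L <= W (\<rho> n) x"
          define z where "z = fscale (cplx (sqrt 2)) (w n i - u i)"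
          have dL: "w n i - u i \<in> L2 lebesgue" by (rule l2.closed(3)[OF wL[OF i] uL[OF i]])
          have "nsq v <= nsq z + 2 * t / L"
          proof (rule tail_estimate[OF L(1) _ _ _ _ vL, of s "\<rho> n" "w n i"])
            show "pot (W (\<rho> n)) (w n i) \<in> L2 lebesgue" "nsq (pot (W (\<rho> n)) (w n i)) <= t"
              unfolding w_def by (rule eP[OF i], rule p1[OF i])
            show "z \<in> L2 lebesgue" unfolding z_def by (rule L2_scale[OF dL])
            fix x
            show "L <= W (\<rho> n) x" if "s <= r x" using n that by blast
            show "norm (v x) <= norm (z x)" if "r x < s" using that by (simp add: v_def)
            have "(norm (u i x))^2 <= (norm (w n i x - u i x) + norm (w n i x))^2"
              using norm_triangle_sub[of "u i x" "w n i x"] by (intro power_mono) (simp_all add: norm_minus_commute add.commute)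
            also have "\<dots> <= 2 * (norm (w n i x - u i x))^2 + 2 * (norm (w n i x))^2"
              using two_mult_le_squares[of "norm (w n i x - u i x)" "norm (w n i x)"] by (simp add: power2_sum)
            finally show "(norm (v x))^2 <= (norm (z x))^2 + 2 * (norm (w n i x))^2"
              by (auto simp: v_def z_def norm_mult power_mult_distrib split: split_indicator)
          qed
          also have "nsq z = 2 * nsq (w n i - u i)" unfolding z_def l2.sq_scale[OF dL] by simp
          finally show "nsq v <= 2 * nsq (w n i - u i) + 2 * t / L" .
        qed
        moreover have "(%n. 2 * nsq (w n i - u i) + 2 * t / L) \<leadsto> 2 * 0 + 2 * t / L"
          by (intro tendsto_add tendsto_mult tendsto_const lim[OF i])
        ultimately have "nsq v <= 2 * 0 + 2 * t / L"
          by (intro tendsto_lowerbound) auto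
        thus ?thesis using L(2) by linarith
      qed
      hence "nsq v <= 0" by (rule field_le_epsilon)
      hence "nsq v = 0" using l2.ip_pos[OF vL] by linarith
      hence "AE x in lebesgue. v x = 0" using l2_sq_0_iff[OF vL] by simp
      thus ?thesis by eventually_elim (auto simp: v_def)
    qed
    hence "AE x in lebesgue. 1 + 1 / real (Suc j) <= r x --> u i x = 0" for j by simp
    hence "AE x in lebesgue. \<forall>j. 1 + 1 / real (Suc j) <= r x --> u i x = 0" unfolding AE_all_countable by blast
    thus ?thesis
    proof eventually_elim
      fix x assume j: "\<forall>j. 1 + 1 / real (Suc j) <= r x --> u i x = 0"
      show "1 < r x --> u i x = 0"
      proof
        assume "1 < r x"
        then obtain j where "1 / real (Suc j) < r x - 1" using nat_approx_posE[of "r x - 1"] by auto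
        thus "u i x = 0" using j[rule_format, of j] by simp
      qed
    qed
  qed
  have H10: "(comb k b u) \<in> H10 S"
    "l2.sq (lebesgue_on S) (comb k b u) = nsq (comb k b u)" for b
  proof -
    have "AE x in lebesgue. \<forall>i\<in>{..<k}. 1 < r x --> u i x = 0"
      using vanish by (intro AE_finite_allI) auto
    hence ae: "AE x in lebesgue. x \<notin> {x. r x <= 1} --> (comb k b u) x = 0"
      by eventually_elim (simp add: sum_fun_apply)
    obtain v where "!!N. v N \<in> test_functions S" "(%N. h1sq UNIV (v N - (comb k b u))) \<leadsto> 0"
      using test_approximation[OF domain(1,3) _ limit(1) ae] domain(4) by blast
    from H10_of_test_limit[OF domain(1) limit(1) this]
    show "(comb k b u) \<in> H10 S"
      "l2.sq (lebesgue_on S) (comb k b u) = nsq (comb k b u)" .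
  qed
  have "u i \<in> H10 S" if "i < k" for i
    using H10(1)[of "%j. if j = i then 1 else 0"] unfolding unit_coefficients[OF that] .
  moreover have "D.Q.sq (comb k b u) <= t * l2.sq (lebesgue_on S) (comb k b u)" for b
    using H1_restrict(2)[OF domain(1) limit(1), of b] limit(2)[of b] unfolding H10(2) limit(3) by linarith
  moreover have "l2.sq (lebesgue_on S) (comb k b u) = 0 --> (\<forall>i<k. b i = 0)" for b
    unfolding H10(2) limit(3) by (simp add: sum_nonneg_eq_0_iff)
  ultimately show ?thesis unfolding D.trial_def by (intro exI[of _ u]) blast
qed

end

section \<open>Convergence of the eigenvalues\<close>

context confinement
begin

text \<open>If the eigenvalues stayed at or below some \<open>t < \<mu>\<close> along a subsequence, \<open>limit_trial\<close> would give a Dirichlet trial family at level \<open>t\<close>.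
  The last clause places \<open>W\<close> above the eigenvalue near infinity, as needed for the finite-rank bound at other scales.\<close>

theorem eigenvalue_convergence:
  assumes k: "1 <= k"
  shows "\<exists>\<mu> \<nu> R. lambda_k (lebesgue_on S) (dirichlet_laplacian S) k = ereal \<mu> & 0 < \<mu> & \<nu> \<leadsto> \<mu> &
    (\<forall>\<^sub>F n in sequentially. schroedinger_trial 1 (W n) k (\<nu> n) & (\<forall>t. schroedinger_trial 1 (W n) k t --> \<nu> n <= t) &
      \<nu> n < \<mu> + 2 & (\<forall>x. R < norm x --> \<mu> + 2 <= W n x))"
proof -
  obtain \<mu> e where \<mu>: "lambda_k (lebesgue_on S) (dirichlet_laplacian S) k = ereal \<mu>" "0 < \<mu>"
    and E: "l2form.orthonormal_trial (lebesgue_on S) (H10 S) (grad_form S) k \<mu> e" and least: "!!t. dirichlet_trial k t ==> \<mu> <= t"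
    using dirichlet_eigenvalue[OF k] by blast
  obtain R where R: "0 < R" "!!x. R < norm x ==> 2 <= r x" using domain(5) by blast
  define P where "P n v f \<longleftrightarrow> l2form.orthonormal_trial lebesgue (schroedinger_domain (W n)) (schroedinger_form 1 (W n)) k v f &
    (\<forall>t. schroedinger_trial 1 (W n) k t --> v <= t)" for n v f
  have up: "\<forall>\<^sub>F n in sequentially. schroedinger_trial 1 (W n) k t" if "\<mu> < t" for t
    by (rule upper_bound[OF E _ that]) (use \<mu> in simp)
  have up1: "\<forall>\<^sub>F n in sequentially. schroedinger_trial 1 (W n) k (\<mu> + 1)" by (rule up) simp
  have lg: "\<forall>\<^sub>F n in sequentially. \<forall>x. R < norm x --> \<mu> + 2 <= W n x"
    using W_large[of 2 "\<mu> + 2"] R(2) by (auto elim: eventually_mono)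
  have ev0: "\<forall>\<^sub>F n in sequentially. \<exists>v f. P n v f"
    using up1 lg
  proof eventually_elim
    fix n assume T: "schroedinger_trial 1 (W n) k (\<mu> + 1)" and n: "\<forall>x. R < norm x --> \<mu> + 2 <= W n x"
    interpret F: l2form lebesgue "schroedinger_domain (W n)" "schroedinger_form 1 (W n)" by (rule P_form)
    have c: "0 < \<mu> + 2" using \<mu> by simp
    have "\<exists>(N::nat) f. F.finite_rank_bound (\<mu> + 2) N f"
      unfolding F.finite_rank_bound_def
      by (rule schroedinger_rank_bound[OF W_measurable W_nonneg _ c, of 1 R]) (use n in simp_all)
    then obtain N :: nat and f where "F.finite_rank_bound (\<mu> + 2) N f" by blast
    from F.lambda_k_least_trial[OF this c T _ k] show "\<exists>v f. P n v f" unfolding P_def by auto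
  qed
  have "\<forall>n. \<exists>v. (\<exists>v f. P n v f) --> (\<exists>f. P n v f)" by blast
  from choice[OF this] obtain \<nu> where \<nu>: "!!n. \<exists>v f. P n v f ==> \<exists>f. P n (\<nu> n) f" by blast
  have ev: "\<forall>\<^sub>F n in sequentially. \<exists>f. P n (\<nu> n) f" by (rule eventually_mono[OF ev0 \<nu>])
  have trial: "schroedinger_trial 1 (W n) k v" if "P n v f" for n v f
    using l2form.trial_orthonormal[OF P_form] that unfolding P_def by blast
  have upper: "\<forall>\<^sub>F n in sequentially. \<nu> n <= t" if "\<mu> < t" for t
    using up[OF that] ev by eventually_elim (auto simp: P_def)
  have upper1: "\<forall>\<^sub>F n in sequentially. \<nu> n <= \<mu> + 1" by (rule upper) simp
  have lower: "\<forall>\<^sub>F n in sequentially. t < \<nu> n" if t: "t < \<mu>" for t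
  proof (rule ccontr)
    assume "\<not> (\<forall>\<^sub>F n in sequentially. t < \<nu> n)"
    hence "\<exists>\<^sub>F n in sequentially. \<not> t < \<nu> n" by (simp add: not_eventually)
    from frequently_eventually_frequently[OF this ev]
    have inf: "infinite {n. \<nu> n <= t & (\<exists>f. P n (\<nu> n) f)}"
      by (simp add: cofinite_eq_sequentially[symmetric] frequently_cofinite not_less)
    obtain q :: "nat => nat" where q: "strict_mono q" "!!n. q n \<in> {n. \<nu> n <= t & (\<exists>f. P n (\<nu> n) f)}"
      using infinite_enumerate[OF inf] by blast
    from q(2) have "\<forall>n. \<exists>f. P (q n) (\<nu> (q n)) f" by simp
    from choice[OF this] obtain f where f: "!!n. P (q n) (\<nu> (q n)) (f n)" by blast
    interpret L: confinement r "%n. W (q n)" by (rule subsequence[OF q(1)])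
    have "l2form.orthonormal_trial lebesgue (schroedinger_domain (W (q n))) (schroedinger_form 1 (W (q n))) k (max t 0) (f n)" for n
    proof -
      interpret F: l2form lebesgue "schroedinger_domain (W (q n))" "schroedinger_form 1 (W (q n))" by (rule P_form)
      have o: "F.orthonormal_trial k (\<nu> (q n)) (f n)" using f[of n] by (simp add: P_def)
      have "\<nu> (q n) * (\<Sum>i<k. (cmod (b i))^2) <= max t 0 * (\<Sum>i<k. (cmod (b i))^2)" for b
        using q(2)[of n] by (intro mult_right_mono sum_nonneg) auto
      thus ?thesis using o unfolding F.orthonormal_trial_def by (meson order_trans)
    qed
    from L.limit_trial[OF this] have "L.dirichlet_trial k (max t 0)" by simp
    hence "\<mu> <= max t 0" using least unfolding L.S_def S_def by blast
    thus False using t \<mu>(2) by simp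
  qed
  have "\<nu> \<leadsto> \<mu>"
  proof (rule order_tendstoI)
    fix a assume a: "\<mu> < a"
    hence "\<forall>\<^sub>F n in sequentially. \<nu> n <= (\<mu> + a) / 2" by (intro upper) simp
    moreover have "(\<mu> + a) / 2 < a" using a by simp
    ultimately show "\<forall>\<^sub>F n in sequentially. \<nu> n < a" by (elim eventually_mono) (rule le_less_trans)
  qed (rule lower)
  moreover have "\<forall>\<^sub>F n in sequentially. schroedinger_trial 1 (W n) k (\<nu> n) & (\<forall>t. schroedinger_trial 1 (W n) k t --> \<nu> n <= t) &
      \<nu> n < \<mu> + 2 & (\<forall>x. R < norm x --> \<mu> + 2 <= W n x)"
    using ev upper1 lg
  proof eventually_elim
    fix n assume f': "\<exists>f. P n (\<nu> n) f" and b: "\<nu> n <= \<mu> + 1" "\<forall>x. R < norm x --> \<mu> + 2 <= W n x"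
    from f' obtain f where f: "P n (\<nu> n) f" by (elim exE)
    have "\<forall>t. schroedinger_trial 1 (W n) k t --> \<nu> n <= t" using f unfolding P_def by (rule conjunct2)
    thus "schroedinger_trial 1 (W n) k (\<nu> n) & (\<forall>t. schroedinger_trial 1 (W n) k t --> \<nu> n <= t) &
      \<nu> n < \<mu> + 2 & (\<forall>x. R < norm x --> \<mu> + 2 <= W n x)" using trial[OF f] b by simp
  qed
  ultimately show ?thesis using \<mu> by blast
qed

end

theorem dilated_eigenvalue:
  fixes V W :: "'a::euclidean_space => real"
  assumes V: "V \<in> borel_measurable borel" "!!x. 0 <= V x" and h: "0 < h" and s: "0 < s" and c: "0 < c" and hc: "s^2 = c * h^2"
    and W: "!!x. W x = c * V (s *\<^sub>R x)"
    and T: "schroedinger_trial 1 W k v" and least: "!!t. schroedinger_trial 1 W k t ==> v <= t"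
    and m: "0 < m" "v < m" "!!x. R < norm x ==> m <= W x" and k: "1 <= k"
  shows "lambda_k lebesgue (schroedinger_op h V) k = ereal (v / c)"
proof -
  interpret F: l2form lebesgue "schroedinger_domain V" "schroedinger_form h V" by (rule schroedinger_l2form[OF V h])
  have Wm: "W \<in> borel_measurable borel"
  proof -
    have "(%x. c * V (s *\<^sub>R x)) \<in> borel_measurable borel" using V(1) by measurable
    thus ?thesis unfolding W[symmetric] .
  qed
  have W0: "0 <= W x" for x using V(2) c by (simp add: W)
  have VW: "V x = 1 / c * W ((1 / s) *\<^sub>R x)" for x using s c by (simp add: W)
  have T': "F.trial k (1 / c * v)"
    by (rule dil_trial[OF Wm W0 _ h _ _ _ VW T]) (use s c hc in \<open>auto simp: field_simps\<close>)
  have "\<exists>(N::nat) f. F.finite_rank_bound (m / c) N f"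
    unfolding F.finite_rank_bound_def
  proof (rule schroedinger_rank_bound[OF V h])
    fix x :: 'a assume "s * R < norm x"
    hence "R < norm ((1 / s) *\<^sub>R x)" using s by (simp add: field_simps)
    hence "m <= W ((1 / s) *\<^sub>R x)" by (rule m(3))
    thus "m / c <= V x" unfolding VW using c by (simp add: field_simps)
  qed (use m c in simp)
  then obtain N :: nat and f where f: "F.finite_rank_bound (m / c) N f" by blast
  have "0 < m / c" "1 / c * v < m / c" using m c by (simp_all add: field_simps)
  from F.lambda_k_least_trial[OF f this(1) T' this(2) k] obtain \<nu> e where \<nu>: "lambda_k lebesgue (schroedinger_op h V) k = ereal \<nu>"
    "F.orthonormal_trial k \<nu> e" "\<forall>t. F.trial k t --> \<nu> <= t" unfolding schroedinger_op_def by blast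
  have "schroedinger_trial 1 W k (c * \<nu>)"
    by (rule dil_trial[OF V h _ s c _ W F.trial_orthonormal[OF \<nu>(2)]]) (use hc in simp_all)
  hence "v <= c * \<nu>" by (rule least)
  hence "v / c <= \<nu>" using c by (simp add: field_simps)
  moreover have "\<nu> <= v / c" using \<nu>(3) T' by simp
  ultimately show ?thesis using \<nu>(1) by simp
qed

section \<open>The profile of the well\<close>

locale flat_profile =
  fixes V0 :: "real => real"
  assumes V0_cont: "continuous_on {0..} V0"
    and V0_nonneg: "\<forall>x\<ge>0. 0 <= V0 x"
    and V0_zero: "\<forall>x\<ge>0. V0 x = 0 \<longleftrightarrow> x = 0"
    and V0_liminf: "0 < Liminf at_top (%x. ereal (V0 x))"
    and V0_mono: "\<forall>n::nat. \<exists>\<epsilon>>0. strict_mono_on {0<..<\<epsilon>} (%x. V0 x / \<bar>x\<bar> ^ n)"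
begin

lemma V0_pos: "0 < x ==> 0 < V0 x" using V0_nonneg V0_zero by (metis less_eq_real_def less_irrefl)

lemma V0_0: "V0 0 = 0" using V0_zero by auto

lemma V0_bounded_below: assumes "0 < a" shows "\<exists>m>0. \<forall>x\<ge>a. m <= V0 x"
proof -
  obtain m where m: "0 < ereal m" "ereal m < Liminf at_top (%x. ereal (V0 x))" using ereal_dense2[OF V0_liminf] by blast
  have "\<forall>\<^sub>F x in at_top. ereal m < ereal (V0 x)" by (rule less_LiminfD[OF m(2)])
  then obtain X where X: "!!x. x \<ge> X ==> m < V0 x" by (auto simp: eventually_at_top_linorder)
  have "\<exists>z\<in>{a..max a X}. \<forall>x\<in>{a..max a X}. V0 z <= V0 x"
    by (intro continuous_attains_inf continuous_on_subset[OF V0_cont]) (use assms in auto)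
  then obtain z where z: "a <= z" "!!x. a <= x ==> x <= max a X ==> V0 z <= V0 x" by auto
  have "min m (V0 z) <= V0 x" if "a <= x" for x
    using X[of x] z(2)[OF that] by (cases "x <= max a X") (auto simp: min_le_iff_disj not_le less_imp_le)
  moreover have "0 < min m (V0 z)" using m(1) V0_pos[of z] z(1) assms by simp
  ultimately show ?thesis by blast
qed

lemma V0_increasing: "\<exists>\<epsilon>>0. \<forall>x y. 0 < x --> x < y --> y < \<epsilon> --> V0 x < V0 y"
  using V0_mono[rule_format, of 0] by (auto simp: strict_mono_on_def)

text \<open>The monotonicity of \<open>V0 x / x^n\<close>, read as a comparison of \<open>V0\<close> at two scales.\<close>

lemma V0_power: "\<exists>\<epsilon>>0. \<forall>x s. 0 < x --> x < \<epsilon> --> 0 < s --> s < 1 --> V0 (s * x) <= s ^ n * V0 x"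
proof -
  obtain \<epsilon> where \<epsilon>: "0 < \<epsilon>" "strict_mono_on {0<..<\<epsilon>} (%x. V0 x / \<bar>x\<bar> ^ n)" using V0_mono by blast
  have "V0 (s * x) <= s ^ n * V0 x" if "0 < x" "x < \<epsilon>" "0 < s" "s < 1" for x s
  proof -
    have l: "s * x < x" using that by simp
    hence "s * x < \<epsilon>" using that by linarith
    with l have "V0 (s * x) / \<bar>s * x\<bar> ^ n < V0 x / \<bar>x\<bar> ^ n" using that by (intro strict_mono_onD[OF \<epsilon>(2)]) auto
    thus ?thesis using that by (simp add: power_mult_distrib field_simps)
  qed
  thus ?thesis using \<epsilon>(1) by blast
qed

text \<open>A solution cannot be \<open>>= a\<close> for small \<open>h\<close>, because \<open>V0\<close> is bounded below there; on \<open>(0, a)\<close> the function \<open>d^2 V0 d\<close> is strictly increasing.\<close>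

lemma delta_small:
  assumes "0 < \<eta>"
  shows "\<exists>h0>0. \<forall>h. 0 < h --> h < h0 --> 0 < delta V0 h & delta V0 h < \<eta> & (delta V0 h)^2 * V0 (delta V0 h) = h^2"
proof -
  obtain \<epsilon> where \<epsilon>: "0 < \<epsilon>" "!!x y. 0 < x ==> x < y ==> y < \<epsilon> ==> V0 x < V0 y" using V0_increasing by blast
  define a where "a = min \<eta> \<epsilon>"
  have a: "0 < a" "a <= \<eta>" "a <= \<epsilon>" using assms \<epsilon> by (auto simp: a_def)
  obtain m where m: "0 < m" "!!x. a <= x ==> m <= V0 x" using V0_bounded_below[OF a(1)] by blast
  define h0 where "h0 = a * sqrt m"
  have h0: "0 < h0" "h0^2 = a^2 * m" using a m by (auto simp: h0_def power_mult_distrib)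
  have "0 < delta V0 h & delta V0 h < \<eta> & (delta V0 h)^2 * V0 (delta V0 h) = h^2" if h: "0 < h" "h < h0" for h
  proof -
    have hh: "h^2 < a^2 * m" unfolding h0(2)[symmetric] using h by (intro power_strict_mono) auto
    have small: "d < a" if d: "0 < d" "d^2 * V0 d = h^2" for d
    proof (rule ccontr)
      assume "\<not> d < a"
      hence "a^2 * m <= d^2 * V0 d" using a m by (intro mult_mono m(2) power_mono) auto
      thus False using d(2) hh by linarith
    qed
    have "\<exists>d\<ge>0. d <= a & d^2 * V0 d = h^2"
    proof (rule IVT')
      have "a^2 * m <= a^2 * V0 a" using m(2)[of a] by (intro mult_left_mono) auto
      thus "h^2 <= a^2 * V0 a" using hh by linarith
      show "continuous_on {0..a} (%d. d^2 * V0 d)" by (intro continuous_intros continuous_on_subset[OF V0_cont]) auto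
    qed (use a in auto)
    then obtain d where d: "0 <= d" "d^2 * V0 d = h^2" by blast
    have d0: "0 < d" using d h by (cases "d = 0") auto
    have lt: "x^2 * V0 x < y^2 * V0 y" if "0 < x" "x < y" "y < a" for x y
      using that \<epsilon>(2)[of x y] a V0_pos[of x] by (intro mult_strict_mono power_strict_mono) auto
    have uniq: "d' = d" if d': "0 < d'" "d'^2 * V0 d' = h^2" for d'
      using lt[of d d'] lt[of d' d] small[OF d'] small[OF d0 d(2)] d' d(2) d0 by (cases d d' rule: linorder_cases) auto
    have "delta V0 h = d" unfolding delta_def by (intro the_equality) (use d0 d(2) uniq in blast)+
    thus ?thesis using d0 d(2) small[OF d0 d(2)] a by auto
  qed
  thus ?thesis using h0(1) by blast
qed

lemma rescaled_small:
  assumes \<delta>: "!!n. 0 < \<delta> n" "\<delta> \<leadsto> 0" and s: "s < 1" "0 < \<epsilon>"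
  shows "\<forall>\<^sub>F n in sequentially. \<forall>a. 0 <= a --> a <= s --> V0 (\<delta> n * a) / V0 (\<delta> n) <= \<epsilon>"
proof -
  define z where "z = max s (1/2)"
  have z: "0 < z" "z < 1" "s <= z" using s by (auto simp: z_def)
  obtain N where N: "z ^ N < \<epsilon>" using real_arch_pow_inv[OF s(2) z(2)] by blast
  obtain \<eta> where \<eta>: "0 < \<eta>" "!!x a. 0 < x ==> x < \<eta> ==> 0 < a ==> a < 1 ==> V0 (a * x) <= a ^ N * V0 x" using V0_power by blast
  show ?thesis using order_tendstoD(2)[OF \<delta>(2) \<eta>(1)]
  proof (eventually_elim, intro allI impI)
    fix n a assume n: "\<delta> n < \<eta>" and a: "0 <= a" "a <= s"
    have p: "0 < V0 (\<delta> n)" by (rule V0_pos[OF \<delta>(1)])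
    show "V0 (\<delta> n * a) / V0 (\<delta> n) <= \<epsilon>"
    proof (cases "a = 0")
      case True thus ?thesis using s by (simp add: V0_0)
    next
      case False
      hence "V0 (a * \<delta> n) <= a ^ N * V0 (\<delta> n)" using a z by (intro \<eta>(2) \<delta>(1) n) auto
      also have "\<dots> <= \<epsilon> * V0 (\<delta> n)"
        using power_mono[of a z N] a z N p by (intro mult_right_mono) auto
      finally show ?thesis using p by (simp add: field_simps)
    qed
  qed
qed

text \<open>Where \<open>\<delta> a\<close> stays in the region of monotonicity the power bound applies; beyond, \<open>V0\<close> is bounded below while \<open>V0 \<delta>\<close> tends to \<open>0\<close>.\<close>

lemma rescaled_large:
  assumes \<delta>: "!!n. 0 < \<delta> n" "\<delta> \<leadsto> 0" and s: "1 < s"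
  shows "\<forall>\<^sub>F n in sequentially. \<forall>a. s <= a --> m <= V0 (\<delta> n * a) / V0 (\<delta> n)"
proof -
  obtain N where N: "m < s ^ N" using real_arch_pow[OF s] by blast
  obtain \<eta> where \<eta>: "0 < \<eta>" "!!x a. 0 < x ==> x < \<eta> ==> 0 < a ==> a < 1 ==> V0 (a * x) <= a ^ N * V0 x" using V0_power by blast
  obtain \<epsilon> where \<epsilon>: "0 < \<epsilon>" "!!x y. 0 < x ==> x < y ==> y < \<epsilon> ==> V0 x < V0 y" using V0_increasing by blast
  obtain c where c: "0 < c" "!!x. \<epsilon> <= x ==> c <= V0 x" using V0_bounded_below[OF \<epsilon>(1)] by blast
  have "(%n. V0 (\<delta> n)) \<leadsto> V0 0"
    by (rule continuous_on_tendsto_compose[OF V0_cont \<delta>(2)]) (use \<delta>(1) in \<open>auto simp: less_imp_le\<close>)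
  hence "(%n. m * V0 (\<delta> n)) \<leadsto> m * 0" by (intro tendsto_mult tendsto_const) (simp add: V0_0)
  hence "\<forall>\<^sub>F n in sequentially. m * V0 (\<delta> n) < c" by (rule order_tendstoD(2)) (use c in simp)
  moreover have "(%n. s * \<delta> n) \<leadsto> s * 0" by (intro tendsto_mult tendsto_const \<delta>(2))
  hence "\<forall>\<^sub>F n in sequentially. s * \<delta> n < \<eta>" by (rule order_tendstoD(2)) (use \<eta> in simp)
  ultimately show ?thesis
  proof (eventually_elim, intro allI impI)
    fix n a assume n: "m * V0 (\<delta> n) < c" "s * \<delta> n < \<eta>" and a: "s <= a"
    have p: "0 < V0 (\<delta> n)" by (rule V0_pos[OF \<delta>(1)])
    have sd: "s * \<delta> n <= \<delta> n * a" using \<delta>(1)[of n] a by (simp add: mult.commute)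
    have "m * V0 (\<delta> n) <= V0 (\<delta> n * a)"
    proof (cases "\<epsilon> <= \<delta> n * a")
      case True thus ?thesis using c(2)[OF True] n(1) by linarith
    next
      case False
      have "V0 (1 / s * (s * \<delta> n)) <= (1 / s) ^ N * V0 (s * \<delta> n)"
        by (rule \<eta>(2)) (use s \<delta>(1)[of n] n in auto)
      hence "s ^ N * V0 (\<delta> n) <= V0 (s * \<delta> n)" using s by (simp add: field_simps)
      moreover have "m * V0 (\<delta> n) <= s ^ N * V0 (\<delta> n)" using N p by (intro mult_right_mono) auto
      moreover have "V0 (s * \<delta> n) <= V0 (\<delta> n * a)"
        using \<epsilon>(2)[of "s * \<delta> n" "\<delta> n * a"] sd False s \<delta>(1)[of n] by (cases "s * \<delta> n = \<delta> n * a") (auto simp: mult.commute)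
      ultimately show ?thesis by linarith
    qed
    thus "m <= V0 (\<delta> n * a) / V0 (\<delta> n)" using p by (simp add: field_simps)
  qed
qed

end

section \<open>The gauge of the star domain\<close>

definition gauge_of :: "('a::euclidean_space => real) => 'a => real" where
  "gauge_of \<theta> x = norm x * \<theta> (sgn x)"

lemma gauge_facts:
  fixes \<theta> :: "'a::euclidean_space => real"
  assumes cont: "continuous_on (sphere 0 1) \<theta>" and pos: "\<forall>\<omega>\<in>sphere 0 1. 0 < \<theta> \<omega>"
  shows "continuous_on UNIV (gauge_of \<theta>)" "!!s x. 0 <= s ==> gauge_of \<theta> (s *\<^sub>R x) = s * gauge_of \<theta> x"
    "\<exists>R>0. \<forall>x. norm x <= R * gauge_of \<theta> x" "!!x. 0 <= gauge_of \<theta> x" "star_domain \<theta> = {x. gauge_of \<theta> x < 1}"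
proof -
  have sg: "sgn x \<in> sphere 0 1" if "x \<noteq> 0" for x :: 'a using that by (simp add: norm_sgn)
  have ne: "sphere (0::'a) 1 \<noteq> {}" using sg[of "SOME i. i \<in> Basis"] by (metis SOME_Basis empty_iff nonzero_Basis)
  obtain p where p: "p \<in> sphere 0 1" "!!\<omega>. \<omega> \<in> sphere 0 1 ==> \<theta> p <= \<theta> \<omega>"
    using continuous_attains_inf[OF compact_sphere ne cont] by blast
  obtain q where q: "!!\<omega>. \<omega> \<in> sphere 0 1 ==> \<theta> \<omega> <= \<theta> q"
    using continuous_attains_sup[OF compact_sphere ne cont] by blast
  have p0: "0 < \<theta> p" using pos p(1) by blast
  have g0: "gauge_of \<theta> 0 = 0" by (simp add: gauge_of_def)
  have up: "gauge_of \<theta> x <= \<theta> q * norm x" and low: "\<theta> p * norm x <= gauge_of \<theta> x" for x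
    using q[OF sg[of x]] p(2)[OF sg[of x]] by (cases "x = 0"; simp add: gauge_of_def mult.commute mult_right_mono)+
  show nn: "0 <= gauge_of \<theta> x" for x
    using low[of x] p0 by (meson mult_nonneg_nonneg norm_ge_zero order_trans less_imp_le)
  have "continuous_on (- {0}) (%x. norm x * \<theta> (sgn x))"
  proof (intro continuous_intros continuous_on_compose2[OF cont])
    show "sgn ` (- {0}) \<subseteq> sphere (0::'a) 1" using sg by blast
  qed auto
  hence "continuous_on (- {0}) (gauge_of \<theta>)" by (simp add: gauge_of_def[abs_def])
  hence "isCont (gauge_of \<theta>) x" if "x \<noteq> 0" for x
    using that by (simp add: continuous_on_eq_continuous_at open_Compl)
  moreover have "isCont (gauge_of \<theta>) 0"
  proof -
    have "((%x::'a. \<theta> q * norm x) \<longlongrightarrow> \<theta> q * norm (0::'a)) (at 0)" by (intro tendsto_intros)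
    hence z: "(%x. \<theta> q * norm x) \<midarrow>(0::'a)\<rightarrow> 0" by simp
    have "gauge_of \<theta> \<midarrow>0\<rightarrow> 0"
      by (rule tendsto_sandwich[OF always_eventually[OF allI] always_eventually[OF allI] tendsto_const z]) (rule nn, rule up)
    thus ?thesis by (simp add: isCont_def g0)
  qed
  ultimately show "continuous_on UNIV (gauge_of \<theta>)" by (metis continuous_at_imp_continuous_on)
  show "gauge_of \<theta> (s *\<^sub>R x) = s * gauge_of \<theta> x" if "0 <= s" for s x
  proof (cases "s = 0")
    case False
    hence "sgn s = 1" using that by simp
    thus ?thesis using that by (simp add: gauge_of_def sgn_scaleR)
  qed (simp add: gauge_of_def)
  have "norm x <= 1 / \<theta> p * gauge_of \<theta> x" for x using low[of x] p0 by (simp add: field_simps)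
  thus "\<exists>R>0. \<forall>x. norm x <= R * gauge_of \<theta> x" using p0 by (intro exI[of _ "1 / \<theta> p"]) simp
  have "x \<in> star_domain \<theta> \<longleftrightarrow> gauge_of \<theta> x < 1" for x
  proof (cases "x = 0")
    case False
    have "0 < \<theta> (sgn x)" using pos sg[OF False] by (rule bspec)
    thus ?thesis using False by (simp add: star_domain_def gauge_of_def pos_less_divide_eq)
  qed (simp add: star_domain_def g0)
  thus "star_domain \<theta> = {x. gauge_of \<theta> x < 1}" by blast
qed

section \<open>The semiclassical limit\<close>

text \<open>Along a sequence \<open>h \<rightarrow> 0\<close> the ratio equals \<open>\<nu>/\<mu>\<close>, the factor \<open>V0 \<delta> = h^2/\<delta>^2\<close> cancelling.\<close>

theorem theorem4p1:
  fixes V0 :: "real \<Rightarrow> real"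
    and \<theta> :: "'a::euclidean_space \<Rightarrow> real"
    and k :: nat
  assumes V0_cont: "continuous_on {0..} V0"
    and V0_nonneg: "\<forall>x\<ge>0. 0 \<le> V0 x"
    and V0_zero: "\<forall>x\<ge>0. V0 x = 0 \<longleftrightarrow> x = 0"
    and V0_liminf: "0 < Liminf at_top (\<lambda>x. ereal (V0 x))"
    and V0_flat: "\<forall>n::nat. V0 \<in> O[at 0 within {0..}](\<lambda>x. \<bar>x\<bar> ^ n)"
    and V0_mono: "\<forall>n::nat. \<exists>\<epsilon>>0. strict_mono_on {0<..<\<epsilon>} (\<lambda>x. V0 x / \<bar>x\<bar> ^ n)"
    and theta_cont: "continuous_on (sphere 0 1) \<theta>"
    and theta_pos: "\<forall>\<omega>\<in>sphere 0 1. 0 < \<theta> \<omega>"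
    and k: "1 \<le> k"
  shows "((\<lambda>h. lambda_k lebesgue (schroedinger_op h (potential V0 \<theta>)) k /
               (ereal (h\<^sup>2 / (delta V0 h)\<^sup>2) *
                lambda_k (lebesgue_on (star_domain \<theta>)) (dirichlet_laplacian (star_domain \<theta>)) k))
          \<longlongrightarrow> 1) (at_right 0)"
  unfolding tendsto_at_iff_sequentially comp_def
proof (intro allI impI)
  fix X :: "nat => real" assume X0: "\<forall>i. X i \<in> {0<..} - {0}" and Xlim: "X \<leadsto> 0"
  interpret V: flat_profile V0 by standard (rule V0_cont V0_nonneg V0_zero V0_liminf V0_mono)+
  note G = gauge_facts[OF theta_cont theta_pos]
  have Xpos: "0 < X i" for i using X0 by simp
  have good: "\<forall>\<^sub>F n in sequentially. 0 < delta V0 (X n) & delta V0 (X n) < \<eta> & (delta V0 (X n))^2 * V0 (delta V0 (X n)) = (X n)^2"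
    if \<eta>: "0 < \<eta>" for \<eta>
  proof -
    obtain h0 where h0: "0 < h0" "!!h. 0 < h ==> h < h0 ==> 0 < delta V0 h & delta V0 h < \<eta> & (delta V0 h)^2 * V0 (delta V0 h) = h^2"
      using V.delta_small[OF \<eta>] by blast
    show ?thesis using order_tendstoD(2)[OF Xlim h0(1)] by eventually_elim (use h0(2) Xpos in blast)
  qed
  obtain n0 where n0: "!!n. n \<ge> n0 ==> 0 < delta V0 (X n) & (delta V0 (X n))^2 * V0 (delta V0 (X n)) = (X n)^2"
    using good[of 1] unfolding eventually_sequentially by auto
  \<comment> \<open>The first terms are dropped, since the equation for \<open>\<delta>\<close> is only solved for small \<open>h\<close>.\<close>
  define h where "h n = X (n + n0)" for n
  define \<delta> where "\<delta> n = delta V0 (h n)" for n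
  have h: "0 < h n" for n by (simp add: h_def Xpos)
  have \<delta>: "0 < \<delta> n" "(\<delta> n)^2 * V0 (\<delta> n) = (h n)^2" for n using n0[of "n + n0"] by (simp_all add: \<delta>_def h_def)
  have \<delta>0: "\<delta> \<leadsto> 0"
  proof (rule order_tendstoI)
    fix a :: real assume "0 < a"
    from good[OF this] have "\<forall>\<^sub>F n in sequentially. delta V0 (X n) < a" by eventually_elim simp
    from eventually_all_ge_at_top[OF this] show "\<forall>\<^sub>F n in sequentially. \<delta> n < a"
      unfolding \<delta>_def h_def by eventually_elim simp
  next
    fix a :: real assume "a < 0"
    thus "\<forall>\<^sub>F n in sequentially. a < \<delta> n" using \<delta>(1) by (intro always_eventually allI) (rule less_trans)
  qed
  have p: "0 < V0 (\<delta> n)" for n by (rule V.V0_pos[OF \<delta>(1)])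
  define c where "c n = 1 / V0 (\<delta> n)" for n
  have c: "0 < c n" for n using p by (simp add: c_def)
  define W where "W n x = c n * potential V0 \<theta> (\<delta> n *\<^sub>R x)" for n and x :: 'a
  have pot_eq: "potential V0 \<theta> x = V0 (gauge_of \<theta> x)" for x by (simp add: potential_def gauge_of_def)
  have pc: "continuous_on UNIV (potential V0 \<theta>)"
    unfolding pot_eq[abs_def] by (rule continuous_on_compose2[OF V0_cont G(1)]) (use G(4) in auto)
  have pm: "potential V0 \<theta> \<in> borel_measurable borel" by (rule borel_measurable_continuous_onI[OF pc])
  have pn: "0 <= potential V0 \<theta> x" for x unfolding pot_eq using V0_nonneg G(4) by blast
  have W: "W n x = V0 (\<delta> n * gauge_of \<theta> x) / V0 (\<delta> n)" for n x
    using G(2)[of "\<delta> n" x] \<delta>(1)[of n] by (simp add: W_def c_def pot_eq)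
  interpret C: confinement "gauge_of \<theta>" W
  proof
    show "W n \<in> borel_measurable borel" for n unfolding W_def using pm by measurable
    show "0 <= W n x" for n x unfolding W_def using c[of n] pn by simp
    show "\<forall>\<^sub>F n in sequentially. \<forall>x. gauge_of \<theta> x <= s --> W n x <= \<epsilon>" if "s < 1" "0 < \<epsilon>" for s \<epsilon>
      using V.rescaled_small[OF \<delta>(1) \<delta>0 that] by eventually_elim (use G(4) W in auto)
    show "\<forall>\<^sub>F n in sequentially. \<forall>x. s <= gauge_of \<theta> x --> m <= W n x" if "1 < s" for s m
      using V.rescaled_large[OF \<delta>(1) \<delta>0 that] by eventually_elim (use W in auto)
  qed (rule G; assumption?)+
  have S: "C.S = star_domain \<theta>" unfolding C.S_def G(5) ..
  obtain \<mu> \<nu> R where \<mu>: "lambda_k (lebesgue_on (star_domain \<theta>)) (dirichlet_laplacian (star_domain \<theta>)) k = ereal \<mu>" "0 < \<mu>" "\<nu> \<leadsto> \<mu>"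
    and ev: "\<forall>\<^sub>F n in sequentially. schroedinger_trial 1 (W n) k (\<nu> n) & (\<forall>t. schroedinger_trial 1 (W n) k t --> \<nu> n <= t) &
      \<nu> n < \<mu> + 2 & (\<forall>x. R < norm x --> \<mu> + 2 <= W n x)"
    using C.eigenvalue_convergence[OF k] unfolding S by blast
  define q where "q a = lambda_k lebesgue (schroedinger_op a (potential V0 \<theta>)) k / (ereal (a^2 / (delta V0 a)^2) *
      lambda_k (lebesgue_on (star_domain \<theta>)) (dirichlet_laplacian (star_domain \<theta>)) k)" for a
  have "\<forall>\<^sub>F n in sequentially. ereal (\<nu> n / \<mu>) = q (h n)"
    using ev
  proof eventually_elim
    fix n assume n: "schroedinger_trial 1 (W n) k (\<nu> n) & (\<forall>t. schroedinger_trial 1 (W n) k t --> \<nu> n <= t) &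
      \<nu> n < \<mu> + 2 & (\<forall>x. R < norm x --> \<mu> + 2 <= W n x)"
    have hc: "(\<delta> n)^2 = c n * (h n)^2" using \<delta>(2)[of n] p[of n] by (simp add: c_def field_simps)
    have "lambda_k lebesgue (schroedinger_op (h n) (potential V0 \<theta>)) k = ereal (\<nu> n / c n)"
      by (rule dilated_eigenvalue[OF pm pn h \<delta>(1) c hc W_def, of k "\<nu> n" "\<mu> + 2" R]) (use n \<mu> k in auto)
    moreover have "(h n)^2 / (delta V0 (h n))^2 = V0 (\<delta> n)"
      using \<delta>[of n] unfolding \<delta>_def[symmetric] by (simp add: field_simps)
    ultimately show "ereal (\<nu> n / \<mu>) = q (h n)" using p[of n] \<mu> by (simp add: q_def c_def)
  qed
  moreover have "(%n. ereal (\<nu> n / \<mu>)) \<leadsto> ereal (\<mu> / \<mu>)" using \<mu> by (intro tendsto_intros) auto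
  ultimately have "(%n. q (h n)) \<leadsto> ereal (\<mu> / \<mu>)" by (rule Lim_transform_eventually[rotated])
  hence "(%n. q (X (n + n0))) \<leadsto> 1" using \<mu>(2) by (simp add: h_def one_ereal_def)
  hence "(%n. q (X n)) \<leadsto> 1" by (rule LIMSEQ_offset)
  thus "(%n. lambda_k lebesgue (schroedinger_op (X n) (potential V0 \<theta>)) k / (ereal ((X n)^2 / (delta V0 (X n))^2) *
      lambda_k (lebesgue_on (star_domain \<theta>)) (dirichlet_laplacian (star_domain \<theta>)) k)) \<leadsto> 1" unfolding q_def .
qed

end
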